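(* Let $\omega$ be an open strict interval of $\mathbb T$ and let $T>0$; let $\Omega_T$, $\Gamma_1$, $\Gamma_2$ be as defined in the context. A function $f_0\in H^2$ is in $\mathcal{NC}_{H^2}(\omega,T)$ if and only if there exists $g\in L^2(\mathbb T)$ such that (i) $f_0=P_+g$; (ii) $\operatorname{supp} g\subset \overline\omega$; (iii) $\sum_{n<0} |n|\, |\widehat g(n)|^2 < +\infty$; (iv) denoting by $G$ the harmonic extension of $\zeta\mapsto \zeta g(\zeta)$ to the exterior disk, the measure $\overline{G}\,d\zeta$ on $\Gamma_{1}\cup\Gamma_{2}$ is pseudo-Carleson for $A^2(\Omega_T)$, i.e. there is a constant $C>0$ such that for every polynomial $p\in\mathbb C[X]$, $$\left|\int_{\Gamma_{1}\cup\Gamma_{2}}\overline{G(\zeta)}\,p(\zeta)\,d\zeta\right|\le C\|p\|_{A^2(\Omega_{T})}.$$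
   Context: $\mathbb T$ is the complex unit circle, identified with $\mathbb R/2\pi\mathbb Z$ via $x\mapsto e^{ix}$. An open strict interval of $\mathbb T$ is an open arc $\{e^{ix}:a<x<b\}$ with $0<b-a<2\pi$; $\overline\omega$ is its closure, and $\zeta_1,\zeta_2$ its endpoints. Functions are complex valued; $f\in L^2(\mathbb T)$ is written $f(e^{ix})=\sum_{n\in\mathbb Z}\widehat f(n)e^{inx}$. The Riesz projector is $P_+f(e^{ix})=\sum_{n\ge 0}\widehat f(n)e^{inx}$, and $H^2=P_+L^2(\mathbb T)$. Geometry: $\Omega_T=\{z\in\mathbb C: 1<|z|<e^T,\ z/|z|\in\omega\}$. Fix $0<\eta_0<T$ and a nonempty open arc $\omega_0$ compactly contained in $\omega$, with the same center as $\omega$ and endpoints $\zeta_1',\zeta_2'$ ($\zeta_k'$ being the one on the side of $\zeta_k$), such that $\eta_0\pi/8\le|\zeta_k'-\zeta_k|\le\eta_0\pi/4$, $k=1,2$. $\Gamma_k$ is the segment $[\zeta_k,e^{\eta_0}\zeta_k']$; the parameters are such that $\Gamma_k\setminus\{\zeta_k\}\subset\Omega_T$. In the integral over $\Gamma_1\cup\Gamma_2$, the segments are oriented as consecutive parts of the boundary of the domain $\widetilde\Omega_T$ enclosed by $\omega$, $\Gamma_1$, $\Gamma_2$ and the arc joining $e^{\eta_0}\zeta_1'$ to $e^{\eta_0}\zeta_2'$ on $e^{\eta_0}\omega_0$: that is, $\int_{\Gamma_1\cup\Gamma_2}=\pm\big(\int_{[\zeta_2,e^{\eta_0}\zeta_2']}-\int_{[\zeta_1,e^{\eta_0}\zeta_1']}\big)$.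 The harmonic extension of $h\in L^2(\mathbb T)$ to $\{|z|>1\}$ is $\frac1{2\pi}\int_{\mathbb T}\frac{|z|^2-1}{|z-\zeta|^2}h(\zeta)\,|d\zeta|$ (the integral in (iv) is then absolutely convergent). $A^2(\Omega_T)$ is the Bergman space of holomorphic functions $f$ on $\Omega_T$ with $\|f\|^2_{A^2(\Omega_T)}=\int_{\Omega_T}|f|^2\,dA<\infty$ ($dA$ planar Lebesgue measure). Let $S(t)f(e^{ix})=\sum_{n}\widehat f(n)e^{-|n|t}e^{inx}$. $\mathcal{NC}_{H^2}(\omega,T)$ is the set of $f_0\in H^2$ for which there is $u\in L^2([0,T]\times\omega)$ with $S(T)f_0+\int_0^TS(T-s)P_+(\mathbf 1_\omega u(s,\cdot))\,ds=0$ ($\mathbf 1_\omega u$ being the extension of $u$ by $0$ outside $\omega$), i.e. such that the solution of $(\partial_t+|D|)f=P_+\mathbf 1_\omega u$, $f(0,\cdot)=f_0$, vanishes at time $T$, where $|D|f=\sum_n|n|\widehat f(n)e^{inx}$. (This set does not depend on $T>0$.) *)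

theory Defs
  imports "HOL-Complex_Analysis.Complex_Analysis" "HOL-Computational_Algebra.Polynomial"
begin

section \<open>Square integrable functions on the circle\<close>

text \<open>Arc length \<open>|d\<zeta>|\<close> on the unit circle, as a measure on the complex plane of total
  mass \<open>2\<pi>\<close>. Functions on the circle are functions \<open>complex \<Rightarrow> complex\<close>, and elements of
  \<open>L\<^sup>2\<close> of the circle are represented by functions: equality in \<open>L\<^sup>2\<close> is equality almost
  everywhere with respect to this measure.\<close>

definition circle_measure :: "complex measure" where
  "circle_measure = distr (restrict_space lborel {0..<2 * pi}) borel cis"

definition L2_space :: "'a measure \<Rightarrow> ('a \<Rightarrow> complex) set" where
  "L2_space M = {f \<in> borel_measurable M. integrable M (\<lambda>x. (cmod (f x))\<^sup>2)}"

definition fourier_coeff :: "(complex \<Rightarrow> complex) \<Rightarrow> int \<Rightarrow> complex" where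
  "fourier_coeff f n =
     complex_of_real (1 / (2 * pi)) * (\<integral>\<zeta>. f \<zeta> * \<zeta> powi (- n) \<partial>circle_measure)"

text \<open>\<open>F(e\<^sup>i\<^sup>x) = \<Sum>\<^sub>n c\<^sub>n e\<^sup>i\<^sup>n\<^sup>x\<close> with convergence in \<open>L\<^sup>2\<close>.\<close>

definition has_L2_fourier_series :: "(complex \<Rightarrow> complex) \<Rightarrow> (int \<Rightarrow> complex) \<Rightarrow> bool" where
  "has_L2_fourier_series F c \<longleftrightarrow>
     F \<in> L2_space circle_measure \<and>
     (\<lambda>N::nat. \<integral>\<zeta>. (cmod (F \<zeta> - (\<Sum>n = - int N..int N. c n * \<zeta> powi n)))\<^sup>2 \<partial>circle_measure)
       \<longlonglongrightarrow> 0"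

text \<open>The Riesz projector \<open>P\<^sub>+\<close>. The \<open>L\<^sup>2\<close> sum determines the function only up to a null set;
  \<open>SOME\<close> picks a representative.\<close>

definition riesz_proj :: "(complex \<Rightarrow> complex) \<Rightarrow> complex \<Rightarrow> complex" where
  "riesz_proj f =
     (SOME F. has_L2_fourier_series F (\<lambda>n. if 0 \<le> n then fourier_coeff f n else 0))"

definition hardy_H2 :: "(complex \<Rightarrow> complex) set" where
  "hardy_H2 = {f \<in> L2_space circle_measure.
     \<exists>h \<in> L2_space circle_measure. AE \<zeta> in circle_measure. f \<zeta> = riesz_proj h \<zeta>}"

definition ess_support :: "(complex \<Rightarrow> complex) \<Rightarrow> complex set" where
  "ess_support g = {\<zeta> \<in> sphere 0 1. \<forall>U. open U \<and> \<zeta> \<in> U \<longrightarrow>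
     \<not> (AE \<xi> in circle_measure. \<xi> \<in> U \<longrightarrow> g \<xi> = 0)}"

section \<open>The control problem\<close>

text \<open>\<open>S(t)\<close>, for \<open>t > 0\<close>: the series then converges absolutely for every \<open>f\<close> in \<open>L\<^sup>2\<close>, and
  its pointwise sum is the canonical representative of its \<open>L\<^sup>2\<close> sum. (\<open>S(0)\<close> is the
  identity of \<open>L\<^sup>2\<close>, which this pointwise sum need not represent.)\<close>

definition half_heat_semigroup :: "real \<Rightarrow> (complex \<Rightarrow> complex) \<Rightarrow> complex \<Rightarrow> complex" where
  "half_heat_semigroup t f \<zeta> =
     (\<Sum>\<^sub>\<infinity>n\<in>UNIV. fourier_coeff f n * complex_of_real (exp (- \<bar>real_of_int n\<bar> * t)) * \<zeta> powi n)"

text \<open>Initial data in \<open>H\<^sup>2\<close> that can be steered to \<open>0\<close> at time \<open>T\<close>. The \<open>L\<^sup>2\<close>-valued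
  integral of the Duhamel formula is computed pointwise in \<open>\<zeta>\<close>: its integrand is jointly
  measurable in \<open>(s, \<zeta>)\<close> with integrable \<open>L\<^sup>2\<close> norm, so for almost every \<open>\<zeta>\<close> the integral
  below converges absolutely and is the value of the Bochner integral. The time \<open>s = T\<close>, where
  \<open>S(0)\<close> occurs, and the times at which \<open>u(s, \<cdot>)\<close> is not in \<open>L\<^sup>2\<close> form a null set.\<close>

definition null_controllable_H2 :: "complex set \<Rightarrow> real \<Rightarrow> (complex \<Rightarrow> complex) set" where
  "null_controllable_H2 \<omega> T = {f0 \<in> hardy_H2.
     \<exists>u \<in> L2_space (restrict_space lborel {0..T} \<Otimes>\<^sub>M restrict_space circle_measure \<omega>).
       AE \<zeta> in circle_measure.
         half_heat_semigroup T f0 \<zeta> +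
         (LINT s:{0..T}|lebesgue.
            half_heat_semigroup (T - s)
              (riesz_proj (\<lambda>\<xi>. if \<xi> \<in> \<omega> then u (s, \<xi>) else 0)) \<zeta>) = 0}"

section \<open>Geometry, harmonic extension and Bergman norm\<close>

definition open_arc :: "real \<Rightarrow> real \<Rightarrow> complex set" where
  "open_arc a b = cis ` {a<..<b}"

definition Omega :: "complex set \<Rightarrow> real \<Rightarrow> complex set" where
  "Omega \<omega> T = {z. 1 < cmod z \<and> cmod z < exp T \<and> z / complex_of_real (cmod z) \<in> \<omega>}"

definition exterior_harmonic_ext :: "(complex \<Rightarrow> complex) \<Rightarrow> complex \<Rightarrow> complex" where
  "exterior_harmonic_ext h z =
     complex_of_real (1 / (2 * pi)) *
     (\<integral>\<zeta>. complex_of_real (((cmod z)\<^sup>2 - 1) / (cmod (z - \<zeta>))\<^sup>2) * h \<zeta> \<partial>circle_measure)"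

text \<open>The segment \<open>\<Gamma>\<close> from the point of angle \<open>\<theta>\<close> on the unit circle to the point of angle
  \<open>\<theta>'\<close> on the circle of radius \<open>e\<^sup>\<eta>\<close>.\<close>

definition Gamma_path :: "real \<Rightarrow> real \<Rightarrow> real \<Rightarrow> real \<Rightarrow> complex" where
  "Gamma_path \<eta> \<theta> \<theta>' = linepath (cis \<theta>) (complex_of_real (exp \<eta>) * cis \<theta>')"

text \<open>The integral over \<open>\<Gamma>\<^sub>1 \<union> \<Gamma>\<^sub>2\<close>, where \<open>\<Gamma>\<^sub>1\<close> starts at \<open>e\<^sup>i\<^sup>a\<close> and \<open>\<Gamma>\<^sub>2\<close> at \<open>e\<^sup>i\<^sup>b\<close>,
  \<open>a < b\<close>. Along the positively oriented boundary of the enclosed domain, \<open>\<Gamma>\<^sub>1\<close> is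
  traversed outwards and \<open>\<Gamma>\<^sub>2\<close> inwards.\<close>

definition Gamma_integral ::
    "real \<Rightarrow> real \<Rightarrow> real \<Rightarrow> real \<Rightarrow> real \<Rightarrow> (complex \<Rightarrow> complex) \<Rightarrow> complex" where
  "Gamma_integral \<eta> a a' b b' h =
     contour_integral (Gamma_path \<eta> a a') h - contour_integral (Gamma_path \<eta> b b') h"

definition bergman_norm :: "complex set \<Rightarrow> (complex \<Rightarrow> complex) \<Rightarrow> real" where
  "bergman_norm U f = sqrt (LINT z:U|lborel. (cmod (f z))\<^sup>2)"

text \<open>A complex measure enters only through the functional \<open>I\<close> of integration against it.\<close>

definition pseudo_carleson ::
    "complex set \<Rightarrow> ((complex \<Rightarrow> complex) \<Rightarrow> complex) \<Rightarrow> bool" where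
  "pseudo_carleson U I \<longleftrightarrow>
     (\<exists>C>0. \<forall>p :: complex poly. cmod (I (poly p)) \<le> C * bergman_norm U (poly p))"

end

theory Submission
  imports Defs
begin

text \<open>By duality \<open>f0\<close> is null controllable iff \<open>p \<mapsto> \<integral> p cnj f0\<close> (over the circle) is bounded by the \<open>L\<^sup>2\<close>
  norm of \<open>p (e\<^sup>s \<zeta>)\<close> over the control region, which is comparable to the Bergman norm of \<open>p\<close>. If
  \<open>f0 = P\<^sub>+ g\<close>, then \<open>\<integral> p cnj f0 = \<integral> p cnj g\<close>. If moreover \<open>g\<close> lives on \<open>closure \<omega>\<close>, Green's formula on the
  domain enclosed by \<open>\<omega>\<close>, the two segments and an arc turns \<open>\<i> \<integral> p cnj g\<close> into the integral of \<open>cnj G p\<close>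
  over the segments, up to the integral over a compact arc, where \<open>p\<close> is bounded pointwise by its
  Bergman norm, and an area integral of \<open>p\<close> times the conjugate of the derivative of the holomorphic
  part of \<open>G\<close>. Condition (iii) says that this derivative is square integrable. So for such a \<open>g\<close>,
  condition (iv) is equivalent to null controllability. Given a control, such a \<open>g\<close> is obtained as
  the jump across the circle of the Cauchy transform of the control.\<close>

section \<open>Square integrable functions\<close>

text \<open>The factor \<zeta> in \<zeta> g(\<zeta>) is there because d\<zeta> = \<i> \<zeta>
  |d\<zeta>| and |\<zeta>| = 1 on the circle: the boundary form cnj (\<zeta> g) p d\<zeta> is then
  \<i> p cnj g |d\<zeta>|, the pairing that decides controllability. The annulus comes from the heat
  weights: after multiplication by e^(nT), the n-th moment condition pairs the control with (e^s
  \<xi>)^n, 0 < s < T. Two obstacles shape the use of Green's formula. First, G has boundary values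
  only in the L2 sense, so the domain is cut off near \<omega> by arcs of circles centred at 0. On
  such an arc G is a dilate of its boundary function, and dilates converge in L2; all other
  estimates must be uniform in the cut-off. Second, a segment may leave the circle tangentially, so
  integrability of G along it needs an argument of its own. In the necessity part, (iii) holds
  because the negative coefficients of the density are moments of the control against (e^(-s)
  \<xi>)^k, and the L2 norm in time of e^(-ks) is of order k^(-1/2).\<close>

definition normsq :: "'a measure \<Rightarrow> ('a \<Rightarrow> complex) \<Rightarrow> real" where
  "normsq M f = (\<integral>x. (cmod (f x))\<^sup>2 \<partial>M)"

lemma normsq_nonneg [simp]: "0 \<le> normsq M f"
  by (simp add: normsq_def)

lemma L2_measurable [measurable_dest]: "f \<in> L2_space M \<Longrightarrow> f \<in> borel_measurable M"
  by (simp add: L2_space_def)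

lemma L2_integrable_sq: "f \<in> L2_space M \<Longrightarrow> integrable M (\<lambda>x. (cmod (f x))\<^sup>2)"
  by (simp add: L2_space_def)

lemma L2_spaceI:
  "f \<in> borel_measurable M \<Longrightarrow> integrable M (\<lambda>x. (cmod (f x))\<^sup>2) \<Longrightarrow> f \<in> L2_space M"
  by (simp add: L2_space_def)

lemma L2_nn_integral:
  "f \<in> L2_space M \<Longrightarrow> (\<integral>\<^sup>+x. ennreal ((cmod (f x))\<^sup>2) \<partial>M) = ennreal (normsq M f)"
  unfolding normsq_def by (rule nn_integral_eq_integral) (auto simp: L2_integrable_sq)

text \<open>Fatou and Tonelli arguments end in a bound on a nonnegative integral. Its finiteness is
  what makes \<open>normsq\<close> meaningful, since the Bochner integral of a non-integrable square
  is 0; so membership and bound are extracted together.\<close>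

lemma L2_space_nnI:
  assumes "f \<in> borel_measurable M" "(\<integral>\<^sup>+x. ennreal ((cmod (f x))\<^sup>2) \<partial>M) \<le> ennreal B" "0 \<le> B"
  shows "f \<in> L2_space M" "normsq M f \<le> B"
proof -
  have "(\<integral>\<^sup>+x. ennreal ((cmod (f x))\<^sup>2) \<partial>M) < \<infinity>"
    using assms(2) by (auto simp: le_less_trans)
  then have "integrable M (\<lambda>x. (cmod (f x))\<^sup>2)"
    using assms(1) by (intro integrableI_bounded) auto
  then show *: "f \<in> L2_space M" using assms(1) by (rule L2_spaceI[rotated])
  show "normsq M f \<le> B"
    using L2_nn_integral[OF *] assms(2,3) by simp
qed

lemma cmod_add_sq_le: "(cmod (a + b))\<^sup>2 \<le> 2 * (cmod a)\<^sup>2 + 2 * (cmod b)\<^sup>2"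
proof -
  have "(cmod (a + b))\<^sup>2 \<le> (cmod a + cmod b)\<^sup>2"
    by (intro power_mono norm_triangle_ineq) auto
  also have "\<dots> \<le> 2 * (cmod a)\<^sup>2 + 2 * (cmod b)\<^sup>2"
    using sum_squares_bound[of "cmod a" "cmod b"] by (simp add: power2_sum)
  finally show ?thesis .
qed

lemma L2_add:
  assumes "f \<in> L2_space M" "g \<in> L2_space M"
  shows "(\<lambda>x. f x + g x) \<in> L2_space M"
    and "normsq M (\<lambda>x. f x + g x) \<le> 2 * normsq M f + 2 * normsq M g"
proof -
  have [measurable]: "f \<in> borel_measurable M" "g \<in> borel_measurable M"
    using assms by (auto intro: L2_measurable)
  have i: "integrable M (\<lambda>x. 2 * (cmod (f x))\<^sup>2 + 2 * (cmod (g x))\<^sup>2)"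
    using assms by (intro Bochner_Integration.integrable_add integrable_mult_right L2_integrable_sq) auto
  have i2: "integrable M (\<lambda>x. (cmod (f x + g x))\<^sup>2)"
    by (rule Bochner_Integration.integrable_bound[OF i]) (auto simp: cmod_add_sq_le)
  then show "(\<lambda>x. f x + g x) \<in> L2_space M" by (intro L2_spaceI) auto
  have "normsq M (\<lambda>x. f x + g x) \<le> (\<integral>x. 2 * (cmod (f x))\<^sup>2 + 2 * (cmod (g x))\<^sup>2 \<partial>M)"
    unfolding normsq_def by (intro integral_mono i i2 cmod_add_sq_le)
  also have "\<dots> = 2 * normsq M f + 2 * normsq M g"
    unfolding normsq_def using assms by (simp add: L2_integrable_sq)
  finally show "normsq M (\<lambda>x. f x + g x) \<le> 2 * normsq M f + 2 * normsq M g" .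
qed

lemma L2_cmult:
  assumes "f \<in> L2_space M"
  shows "(\<lambda>x. c * f x) \<in> L2_space M" and "normsq M (\<lambda>x. c * f x) = (cmod c)\<^sup>2 * normsq M f"
proof -
  have [measurable]: "f \<in> borel_measurable M" using assms by (rule L2_measurable)
  show "(\<lambda>x. c * f x) \<in> L2_space M"
    using L2_integrable_sq[OF assms] by (intro L2_spaceI) (auto simp: norm_mult power_mult_distrib)
  show "normsq M (\<lambda>x. c * f x) = (cmod c)\<^sup>2 * normsq M f"
    by (simp add: normsq_def norm_mult power_mult_distrib)
qed

lemma normsq_uminus [simp]: "normsq M (\<lambda>x. - f x) = normsq M f"
  by (simp add: normsq_def)

lemma normsq_cnj [simp]: "normsq M (\<lambda>x. cnj (f x)) = normsq M f"
  by (simp add: normsq_def)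

lemma normsq_commute: "normsq M (\<lambda>x. f x - g x) = normsq M (\<lambda>x. g x - f x)"
  by (simp add: normsq_def norm_minus_commute)

lemma L2_uminus: "f \<in> L2_space M \<Longrightarrow> (\<lambda>x. - f x) \<in> L2_space M"
  using L2_cmult(1)[of f M "-1"] by simp

lemma L2_diff:
  assumes "f \<in> L2_space M" "g \<in> L2_space M"
  shows "(\<lambda>x. f x - g x) \<in> L2_space M"
    and "normsq M (\<lambda>x. f x - g x) \<le> 2 * normsq M f + 2 * normsq M g"
  using L2_add[OF assms(1) L2_uminus[OF assms(2)]] by simp_all

lemma L2_zero [simp]: "(\<lambda>x. 0) \<in> L2_space M"
  by (auto intro: L2_spaceI)

lemma L2_sum: "(\<And>i. i \<in> I \<Longrightarrow> f i \<in> L2_space M) \<Longrightarrow> (\<lambda>x. \<Sum>i\<in>I. f i x) \<in> L2_space M"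
  by (induction I rule: infinite_finite_induct) (auto intro: L2_add(1))

lemma borel_measurable_cnj [measurable (raw)]:
  "f \<in> borel_measurable M \<Longrightarrow> (\<lambda>x. cnj (f x)) \<in> borel_measurable M"
  by (rule measurable_compose[of f M borel cnj]) (auto intro!: borel_measurable_continuous_onI continuous_intros)

lemma L2_cnj: "f \<in> L2_space M \<Longrightarrow> (\<lambda>x. cnj (f x)) \<in> L2_space M"
  unfolding L2_space_def by auto

lemma L2_bounded_mult:
  assumes "f \<in> L2_space M" and [measurable]: "g \<in> borel_measurable M"
    and le: "AE x in M. cmod (g x) \<le> B"
  shows "(\<lambda>x. g x * f x) \<in> L2_space M" "normsq M (\<lambda>x. g x * f x) \<le> B\<^sup>2 * normsq M f"
proof -
  have [measurable]: "f \<in> borel_measurable M" using assms(1) by (rule L2_measurable)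
  have le: "AE x in M. (cmod (g x * f x))\<^sup>2 \<le> B\<^sup>2 * (cmod (f x))\<^sup>2"
    using le by eventually_elim (auto simp: norm_mult power_mult_distrib intro!: mult_right_mono power_mono)
  have i: "integrable M (\<lambda>x. B\<^sup>2 * (cmod (f x))\<^sup>2)"
    using L2_integrable_sq[OF assms(1)] by simp
  have i2: "integrable M (\<lambda>x. (cmod (g x * f x))\<^sup>2)"
    by (rule Bochner_Integration.integrable_bound[OF i]) (use le in auto)
  then show "(\<lambda>x. g x * f x) \<in> L2_space M" by (intro L2_spaceI) auto
  have "normsq M (\<lambda>x. g x * f x) \<le> (\<integral>x. B\<^sup>2 * (cmod (f x))\<^sup>2 \<partial>M)"
    unfolding normsq_def by (intro integral_mono_AE i i2 le)
  then show "normsq M (\<lambda>x. g x * f x) \<le> B\<^sup>2 * normsq M f" by (simp add: normsq_def)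
qed

section \<open>The Cauchy-Schwarz inequality in L2\<close>

lemma L2_Cauchy_Schwarz_real:
  assumes f: "f \<in> L2_space M" and g: "g \<in> L2_space M"
  shows "integrable M (\<lambda>x. cmod (f x) * cmod (g x))"
    and "(\<integral>x. cmod (f x) * cmod (g x) \<partial>M)\<^sup>2 \<le> normsq M f * normsq M g"
proof -
  have [measurable]: "f \<in> borel_measurable M" "g \<in> borel_measurable M"
    using assms by (auto intro: L2_measurable)
  have i: "integrable M (\<lambda>x. (cmod (f x))\<^sup>2 + (cmod (g x))\<^sup>2)"
    using assms by (intro Bochner_Integration.integrable_add L2_integrable_sq) auto
  show int: "integrable M (\<lambda>x. cmod (f x) * cmod (g x))"
  proof (rule Bochner_Integration.integrable_bound[OF i])
    show "AE x in M. norm (cmod (f x) * cmod (g x)) \<le> norm ((cmod (f x))\<^sup>2 + (cmod (g x))\<^sup>2)"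
    proof (intro AE_I2)
      fix x
      have "cmod (f x) * cmod (g x) \<le> 2 * cmod (f x) * cmod (g x)"
        by (simp add: mult_nonneg_nonneg)
      also have "\<dots> \<le> (cmod (f x))\<^sup>2 + (cmod (g x))\<^sup>2" by (rule sum_squares_bound)
      finally show "norm (cmod (f x) * cmod (g x)) \<le> norm ((cmod (f x))\<^sup>2 + (cmod (g x))\<^sup>2)"
        by simp
    qed
  qed auto
  let ?I = "\<integral>x. cmod (f x) * cmod (g x) \<partial>M"
  have "ennreal (?I\<^sup>2) = (\<integral>\<^sup>+x. ennreal (cmod (f x)) * ennreal (cmod (g x)) \<partial>M)\<^sup>2"
    by (simp flip: ennreal_mult add: nn_integral_eq_integral[OF int] ennreal_power)
  also have "\<dots> \<le> (\<integral>\<^sup>+x. ennreal (cmod (f x)) ^ 2 \<partial>M) * (\<integral>\<^sup>+x. ennreal (cmod (g x)) ^ 2 \<partial>M)"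
    by (rule Cauchy_Schwarz_nn_integral) auto
  also have "\<dots> = ennreal (normsq M f * normsq M g)"
    using L2_nn_integral[OF f] L2_nn_integral[OF g] by (simp add: ennreal_power ennreal_mult)
  finally show "?I\<^sup>2 \<le> normsq M f * normsq M g"
    by (simp add: ennreal_le_iff)
qed

lemma L2_mult_integrable:
  assumes f: "f \<in> L2_space M" and g: "g \<in> L2_space M"
  shows "integrable M (\<lambda>x. f x * g x)"
proof (rule Bochner_Integration.integrable_bound[OF L2_Cauchy_Schwarz_real(1)[OF f g]])
  show "(\<lambda>x. f x * g x) \<in> borel_measurable M"
    using assms by (auto intro!: borel_measurable_times L2_measurable)
qed (auto simp: norm_mult)

lemma L2_Cauchy_Schwarz:
  assumes f: "f \<in> L2_space M" and g: "g \<in> L2_space M"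
  shows "(cmod (\<integral>x. f x * g x \<partial>M))\<^sup>2 \<le> normsq M f * normsq M g"
proof -
  have "cmod (\<integral>x. f x * g x \<partial>M) \<le> (\<integral>x. cmod (f x) * cmod (g x) \<partial>M)"
    using integral_norm_bound[of M "\<lambda>x. f x * g x"] by (simp add: norm_mult)
  then have "(cmod (\<integral>x. f x * g x \<partial>M))\<^sup>2 \<le> (\<integral>x. cmod (f x) * cmod (g x) \<partial>M)\<^sup>2"
    by (intro power_mono) auto
  also note L2_Cauchy_Schwarz_real(2)[OF f g]
  finally show ?thesis .
qed

lemma L2_Cauchy_Schwarz_sqrt:
  assumes f: "f \<in> L2_space M" and g: "g \<in> L2_space M"
  shows "cmod (\<integral>x. f x * g x \<partial>M) \<le> sqrt (normsq M f) * sqrt (normsq M g)"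
  using L2_Cauchy_Schwarz[OF assms] by (simp add: real_le_rsqrt flip: real_sqrt_mult)

lemma L2_integrable:
  assumes "finite_measure M" "f \<in> L2_space M"
  shows "integrable M f"
proof -
  interpret finite_measure M by fact
  have "(\<lambda>x. 1) \<in> L2_space M" by (auto intro: L2_spaceI)
  from L2_mult_integrable[OF this assms(2)] show ?thesis by simp
qed

text \<open>Fatou's lemma for the squares. It gives membership of the limit and the norm bound at
  once, and serves wherever only pointwise convergence is at hand: in \<open>L2_complete\<close>,
  for power series as limits of partial sums, and for the vanishing of the density off the
  arc.\<close>

lemma L2_Fatou:
  assumes [measurable]: "\<And>n. f n \<in> borel_measurable M" "F \<in> borel_measurable M"
    and lim: "AE x in M. (\<lambda>n. f n x) \<longlonglongrightarrow> F x"
    and B: "eventually (\<lambda>n. f n \<in> L2_space M \<and> normsq M (f n) \<le> B) sequentially" and "0 \<le> B"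
  shows "F \<in> L2_space M" "normsq M F \<le> B"
proof -
  have "(\<integral>\<^sup>+x. ennreal ((cmod (F x))\<^sup>2) \<partial>M)
      = (\<integral>\<^sup>+x. liminf (\<lambda>n. ennreal ((cmod (f n x))\<^sup>2)) \<partial>M)"
  proof (intro nn_integral_cong_AE)
    show "AE x in M. ennreal ((cmod (F x))\<^sup>2) = liminf (\<lambda>n. ennreal ((cmod (f n x))\<^sup>2))"
      using lim
    proof eventually_elim
      case (elim x)
      then have "(\<lambda>n. ennreal ((cmod (f n x))\<^sup>2)) \<longlonglongrightarrow> ennreal ((cmod (F x))\<^sup>2)"
        by (intro tendsto_ennrealI tendsto_power tendsto_norm)
      then show ?case using lim_imp_Liminf sequentially_bot by metis
    qed
  qed
  also have "\<dots> \<le> liminf (\<lambda>n. \<integral>\<^sup>+x. ennreal ((cmod (f n x))\<^sup>2) \<partial>M)"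
    by (rule nn_integral_liminf) auto
  also have "\<dots> \<le> liminf (\<lambda>n::nat. ennreal B)"
  proof (rule Liminf_mono)
    show "\<forall>\<^sub>F n in sequentially. (\<integral>\<^sup>+ x. ennreal ((cmod (f n x))\<^sup>2) \<partial>M) \<le> ennreal B"
      using B by eventually_elim (auto simp: L2_nn_integral ennreal_leI)
  qed
  also have "\<dots> = ennreal B" by (simp add: Liminf_const)
  finally have le: "(\<integral>\<^sup>+x. ennreal ((cmod (F x))\<^sup>2) \<partial>M) \<le> ennreal B" .
  show "F \<in> L2_space M" "normsq M F \<le> B" using L2_space_nnI[OF _ le \<open>0 \<le> B\<close>] by auto
qed

section \<open>Completeness of L2\<close>

lemma LIMSEQ_I_le:
  fixes a :: "nat \<Rightarrow> real"
  assumes "\<And>e. 0 < e \<Longrightarrow> \<exists>K. \<forall>n\<ge>K. a n \<le> e" and "\<And>n. 0 \<le> a n"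
  shows "a \<longlonglongrightarrow> 0"
proof (rule LIMSEQ_I)
  fix e :: real assume "0 < e"
  then obtain K where "\<forall>n\<ge>K. a n \<le> e / 2" using assms(1)[of "e/2"] by auto
  then show "\<exists>K. \<forall>n\<ge>K. norm (a n - 0) < e"
    using assms(2) \<open>0 < e\<close> by (intro exI[of _ K]) (auto intro: le_less_trans)
qed

text \<open>Either \<open>d k \<le> (1/2)^k\<close>, or \<open>1 \<le> 2^k * d k\<close> and then
  \<open>d k \<le> 2^k * (d k)\<^sup>2\<close>. This turns weighted L2 control of increments into
  absolute summability at almost every point, also over a measure of infinite mass.\<close>

lemma sum_sq_weighted_bound:
  fixes d :: "nat \<Rightarrow> real"
  assumes "\<And>k. 0 \<le> d k" and s: "summable (\<lambda>k. 2 ^ k * (d k)\<^sup>2)"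
  shows "summable d"
proof (rule summable_comparison_test'[where N=0])
  show "summable (\<lambda>k. (1/2) ^ k + 2 ^ k * (d k)\<^sup>2)"
    by (intro summable_add s summable_geometric) auto
  fix k
  have "2 * ((1/2) ^ k) * (2 ^ k * d k) \<le> ((1/2) ^ k)\<^sup>2 + (2 ^ k * d k)\<^sup>2"
    by (rule sum_squares_bound)
  then have "2 ^ k * (2 * ((1/2) ^ k) * (2 ^ k * d k)) \<le> 2 ^ k * (((1/2) ^ k)\<^sup>2 * 1 + (2 ^ k * d k)\<^sup>2)"
    by simp
  have "d k \<le> (1/2) ^ k + 2 ^ k * (d k)\<^sup>2"
  proof (cases "d k \<le> (1/2)^k")
    case True
    moreover have "0 \<le> 2 ^ k * (d k)\<^sup>2" by simp
    ultimately show ?thesis by linarith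
  next
    case False
    then have "1 \<le> 2 ^ k * d k" by (simp add: field_simps power_one_over)
    then have "d k * 1 \<le> d k * (2 ^ k * d k)" using assms(1)[of k] by (intro mult_left_mono)
    then have "d k \<le> 2 ^ k * (d k)\<^sup>2" by (simp add: power2_eq_square mult_ac)
    moreover have "0 \<le> (1/2 :: real) ^ k" by simp
    ultimately show ?thesis by linarith
  qed
  then show "norm (d k) \<le> (1/2) ^ k + 2 ^ k * (d k)\<^sup>2" using assms(1) by simp
qed

theorem L2_complete:
  assumes f: "\<And>n. f n \<in> L2_space M"
    and Cauchy: "\<And>e. 0 < e \<Longrightarrow> \<exists>N. \<forall>m\<ge>N. \<forall>n\<ge>N. normsq M (\<lambda>x. f m x - f n x) \<le> e"
  shows "\<exists>F \<in> L2_space M. (\<lambda>n. normsq M (\<lambda>x. F x - f n x)) \<longlonglongrightarrow> 0"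
proof -
  have [measurable]: "f n \<in> borel_measurable M" for n using f by (rule L2_measurable)
  \<comment> \<open>The increments are to decay like \<open>(1/4)^k\<close>, so that the weight
    \<open>2^k\<close> still leaves a geometric series.\<close>
  have "\<forall>k. \<exists>N. \<forall>m\<ge>N. \<forall>n\<ge>N. normsq M (\<lambda>x. f m x - f n x) \<le> (1/4) ^ k"
    using Cauchy by simp
  then obtain N where N: "\<And>k m n. m \<ge> N k \<Longrightarrow> n \<ge> N k \<Longrightarrow> normsq M (\<lambda>x. f m x - f n x) \<le> (1/4) ^ k"
    by metis
  \<comment> \<open>A partial sum of the \<open>N j\<close> plus \<open>k\<close>: it is monotone,
    lies beyond \<open>N k\<close>, and is at least \<open>k\<close>, so it tends to
    infinity.\<close>
  define r where "r k = (\<Sum>j\<le>k. N j) + k" for k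
  have rN: "N k \<le> r k" for k unfolding r_def by (simp add: member_le_sum trans_le_add1)
  have r_mono: "mono r" unfolding r_def
    by (intro monoI add_mono sum_mono2) auto
  have rk: "k \<le> r k" for k by (simp add: r_def)
  define g where "g k = f (r k)" for k
  have gm [measurable]: "g k \<in> borel_measurable M" for k by (simp add: g_def)
  have gL: "g k \<in> L2_space M" for k by (simp add: g_def f)
  have step: "normsq M (\<lambda>x. g (Suc k) x - g k x) \<le> (1/4) ^ k" for k
    unfolding g_def using rN[of k] monoD[OF r_mono, of k "Suc k"] by (intro N) auto
  have "(\<integral>\<^sup>+x. (\<Sum>k. ennreal (2 ^ k * (cmod (g (Suc k) x - g k x))\<^sup>2)) \<partial>M)
      = (\<Sum>k. \<integral>\<^sup>+x. ennreal (2 ^ k * (cmod (g (Suc k) x - g k x))\<^sup>2) \<partial>M)"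
    by (rule nn_integral_suminf) measurable
  also have "\<dots> = (\<Sum>k. ennreal (2 ^ k * normsq M (\<lambda>x. g (Suc k) x - g k x)))"
    by (simp add: ennreal_mult nn_integral_cmult L2_nn_integral[OF L2_diff(1)] gL)
  also have "\<dots> \<le> (\<Sum>k. ennreal ((1/2) ^ k))"
  proof (intro suminf_le ennreal_leI)
    fix k
    have "2 ^ k * normsq M (\<lambda>x. g (Suc k) x - g k x) \<le> 2 ^ k * (1/4) ^ k"
      using step[of k] by (intro mult_left_mono) auto
    also have "\<dots> = (1/2) ^ k" by (simp flip: power_mult_distrib)
    finally show "2 ^ k * normsq M (\<lambda>x. g (Suc k) x - g k x) \<le> (1/2) ^ k" .
  qed auto
  also have "\<dots> = ennreal (\<Sum>k. (1/2) ^ k)"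
    by (intro suminf_ennreal2) (auto intro!: summable_geometric)
  also have "\<dots> < \<infinity>" by simp
  finally have "(\<integral>\<^sup>+x. (\<Sum>k. ennreal (2 ^ k * (cmod (g (Suc k) x - g k x))\<^sup>2)) \<partial>M) \<noteq> \<infinity>"
    by simp
  then have "AE x in M. (\<Sum>k. ennreal (2 ^ k * (cmod (g (Suc k) x - g k x))\<^sup>2)) \<noteq> \<infinity>"
    by (intro nn_integral_PInf_AE) auto
  then have conv: "AE x in M. convergent (\<lambda>k. g k x)"
  proof eventually_elim
    case (elim x)
    have "summable (\<lambda>k. 2 ^ k * (cmod (g (Suc k) x - g k x))\<^sup>2)"
    proof (rule summable_suminf_not_top)
      show "(\<Sum>k. ennreal (2 ^ k * (cmod (g (Suc k) x - g k x))\<^sup>2)) \<noteq> top"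
        using elim by (simp only: infinity_ennreal_def not_False_eq_True)
    qed simp
    then have "summable (\<lambda>k. cmod (g (Suc k) x - g k x))"
      by (rule sum_sq_weighted_bound[rotated]) (rule norm_ge_zero)
    then have "summable (\<lambda>k. g (Suc k) x - g k x)" by (rule summable_norm_cancel)
    then have "convergent (\<lambda>n. \<Sum>k<n. g (Suc k) x - g k x)" by (simp add: summable_iff_convergent)
    moreover have "(\<Sum>k<n. g (Suc k) x - g k x) = g n x - g 0 x" for n
      by (induction n) auto
    ultimately have "convergent (\<lambda>n. g n x - g 0 x)" by simp
    then have "convergent (\<lambda>n. (g n x - g 0 x) + g 0 x)" by (intro convergent_add convergent_const)
    then show ?case by simp
  qed
  define F where "F x = lim (\<lambda>k. g k x)" for x
  have [measurable]: "F \<in> borel_measurable M" unfolding F_def by (rule borel_measurable_lim_metric) simp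
  have lim: "AE x in M. (\<lambda>k. g k x) \<longlonglongrightarrow> F x"
    using conv by eventually_elim (simp add: F_def convergent_LIMSEQ_iff)
  \<comment> \<open>Fatou along the subsequence \<open>g k\<close> with \<open>n\<close> fixed: the
    Cauchy condition bounds all differences \<open>f n - g k\<close> with \<open>k\<close>
    large.\<close>
  have key: "(\<lambda>x. f n x - F x) \<in> L2_space M \<and> normsq M (\<lambda>x. f n x - F x) \<le> e"
    if e: "0 < e" and K: "\<forall>m\<ge>K. \<forall>n\<ge>K. normsq M (\<lambda>x. f m x - f n x) \<le> e" and n: "n \<ge> K" for n K e
  proof -
    have "eventually (\<lambda>k. (\<lambda>x. f n x - g k x) \<in> L2_space M \<and> normsq M (\<lambda>x. f n x - g k x) \<le> e) sequentially"
      using eventually_ge_at_top[of K]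
    proof eventually_elim
      case (elim k)
      then have "r k \<ge> K" using rk[of k] by linarith
      then show ?case using K n L2_diff(1)[OF f gL] by (auto simp: g_def)
    qed
    moreover have "AE x in M. (\<lambda>k. f n x - g k x) \<longlonglongrightarrow> f n x - F x"
      using lim by eventually_elim (intro tendsto_intros)
    ultimately show ?thesis
      by (intro conjI L2_Fatou[where f="\<lambda>k x. f n x - g k x" and F="\<lambda>x. f n x - F x" and B=e])
        (use e in simp_all)
  qed
  have FL: "F \<in> L2_space M"
  proof -
    from Cauchy[of 1] obtain K where "\<forall>m\<ge>K. \<forall>n\<ge>K. normsq M (\<lambda>x. f m x - f n x) \<le> 1" by auto
    from key[OF _ this, of K] have "(\<lambda>x. f K x - F x) \<in> L2_space M" by auto
    from L2_diff(1)[OF f[of K] this] show ?thesis by simp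
  qed
  have "\<exists>K. \<forall>n\<ge>K. normsq M (\<lambda>x. f n x - F x) \<le> e" if "0 < e" for e
  proof -
    obtain K where K: "\<forall>m\<ge>K. \<forall>n\<ge>K. normsq M (\<lambda>x. f m x - f n x) \<le> e"
      using Cauchy[OF \<open>0 < e\<close>] by (rule exE)
    show ?thesis
      by (intro exI[of _ K] allI impI) (rule conjunct2[OF key[OF \<open>0 < e\<close> K]])
  qed
  then have "(\<lambda>n. normsq M (\<lambda>x. F x - f n x)) \<longlonglongrightarrow> 0"
    by (subst normsq_commute) (rule LIMSEQ_I_le, auto)
  with FL show ?thesis by blast
qed

lemma L2_tendsto_integral:
  assumes f: "\<And>n. f n \<in> L2_space M" and F: "F \<in> L2_space M" and g: "g \<in> L2_space M"
    and lim: "(\<lambda>n. normsq M (\<lambda>x. F x - f n x)) \<longlonglongrightarrow> 0"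
  shows "(\<lambda>n. \<integral>x. f n x * g x \<partial>M) \<longlonglongrightarrow> (\<integral>x. F x * g x \<partial>M)"
proof -
  have "(\<lambda>n. sqrt (normsq M (\<lambda>x. F x - f n x)) * sqrt (normsq M g)) \<longlonglongrightarrow> sqrt 0 * sqrt (normsq M g)"
    by (intro tendsto_intros lim)
  then have "(\<lambda>n. sqrt (normsq M (\<lambda>x. F x - f n x)) * sqrt (normsq M g)) \<longlonglongrightarrow> 0" by simp
  moreover have "cmod ((\<integral>x. f n x * g x \<partial>M) - (\<integral>x. F x * g x \<partial>M))
      \<le> sqrt (normsq M (\<lambda>x. F x - f n x)) * sqrt (normsq M g)" for n
  proof -
    have "(\<integral>x. f n x * g x \<partial>M) - (\<integral>x. F x * g x \<partial>M) = - (\<integral>x. (F x - f n x) * g x \<partial>M)"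
      using L2_mult_integrable[OF f g] L2_mult_integrable[OF F g]
      by (simp add: ring_distribs)
    then show ?thesis using L2_Cauchy_Schwarz_sqrt[OF L2_diff(1)[OF F f[of n]] g] by simp
  qed
  ultimately have "(\<lambda>n. (\<integral>x. f n x * g x \<partial>M) - (\<integral>x. F x * g x \<partial>M)) \<longlonglongrightarrow> 0"
    by (rule Lim_null_comparison[OF always_eventually[OF allI], rotated])
  then show ?thesis by (rule LIM_zero_cancel)
qed

lemma normsq_eq_inner:
  assumes "f \<in> L2_space M"
  shows "complex_of_real (normsq M f) = (\<integral>x. f x * cnj (f x) \<partial>M)"
  by (simp only: normsq_def integral_complex_of_real[symmetric] complex_norm_square)

lemma normsq_diff_expand:
  assumes f: "f \<in> L2_space M" and g: "g \<in> L2_space M"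
  shows "normsq M (\<lambda>x. f x - g x) = normsq M f + normsq M g - 2 * Re (\<integral>x. f x * cnj (g x) \<partial>M)"
proof -
  have i: "integrable M (\<lambda>x. f x * cnj (g x))" by (intro L2_mult_integrable f L2_cnj g)
  have "(cmod (f x - g x))\<^sup>2 = (cmod (f x))\<^sup>2 + (cmod (g x))\<^sup>2 - 2 * Re (f x * cnj (g x))" for x
    unfolding cmod_power2 by (simp add: power2_eq_square algebra_simps)
  then have "normsq M (\<lambda>x. f x - g x)
      = (\<integral>x. (cmod (f x))\<^sup>2 + (cmod (g x))\<^sup>2 - 2 * Re (f x * cnj (g x)) \<partial>M)"
    by (simp add: normsq_def)
  also have "\<dots> = normsq M f + normsq M g - 2 * (\<integral>x. Re (f x * cnj (g x)) \<partial>M)"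
    using integrable_Re[OF i] L2_integrable_sq[OF f] L2_integrable_sq[OF g]
    by (simp add: normsq_def del: times_complex.simps)
  also have "(\<integral>x. Re (f x * cnj (g x)) \<partial>M) = Re (\<integral>x. f x * cnj (g x) \<partial>M)"
    by (rule integral_Re[OF i])
  finally show ?thesis .
qed

lemma normsq_eq_0_AE:
  assumes "f \<in> L2_space M" "normsq M f = 0"
  shows "AE x in M. f x = 0"
proof -
  have "AE x in M. (cmod (f x))\<^sup>2 = 0"
    using assms integral_nonneg_eq_0_iff_AE[of M "\<lambda>x. (cmod (f x))\<^sup>2"]
    by (auto simp: normsq_def L2_integrable_sq)
  then show ?thesis by simp
qed


section \<open>Fourier series on the circle\<close>

lemma borel_measurable_power_int [measurable (raw)]:
  fixes f :: "'a \<Rightarrow> complex"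
  assumes [measurable]: "f \<in> borel_measurable M"
  shows "(\<lambda>x. f x powi n) \<in> borel_measurable M"
  by (cases "n \<ge> 0") (simp_all add: power_int_def)

lemma borel_measurable_cis [measurable]: "cis \<in> borel_measurable borel"
  by (intro borel_measurable_continuous_onI continuous_intros)

lemma cis_powi_real: "cis x powi n = cis (of_int n * x)"
  by (cases n rule: int_cases4)
    (simp_all add: power_int_minus Complex.DeMoivre flip: cis_inverse)

lemma sets_circle_measure [simp, measurable_cong]: "sets circle_measure = sets borel"
  and space_circle_measure [simp]: "space circle_measure = UNIV"
  by (simp_all add: circle_measure_def)

lemma emeasure_lborel_shift:
  fixes t :: real
  assumes "S \<in> sets borel"
  shows "emeasure lborel ((\<lambda>x. t + x) -` S) = emeasure lborel S"
proof -
  have "emeasure lborel S = emeasure (distr lborel borel ((+) t)) S"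
    by (simp add: lborel_distr_plus)
  also have "\<dots> = emeasure lborel ((\<lambda>x. t + x) -` S)"
    using assms by (subst emeasure_distr) auto
  finally show ?thesis by simp
qed

text \<open>A multiple of the period moves \<open>c\<close> to a point \<open>c0\<close> of [0, p).
  The piece of the interval beyond \<open>p\<close> is then moved back by one period and fills [0,
  c0).\<close>

lemma periodic_emeasure_interval:
  fixes S :: "real set" and p c :: real
  assumes S: "S \<in> sets borel" and p: "0 < p" and per: "\<And>x. x + p \<in> S \<longleftrightarrow> x \<in> S"
  shows "emeasure lborel (S \<inter> {c..<c + p}) = emeasure lborel (S \<inter> {0..<p})"
proof -
  define k where "k = \<lfloor>c / p\<rfloor>"
  define c0 where "c0 = c - of_int k * p"
  have perk: "x + of_int k * p \<in> S \<longleftrightarrow> x \<in> S" for x and k :: int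
  proof (induction k rule: int_induct[where k=0])
    case (step1 i)
    then show ?case using per[of "x + of_int i * p"] by (simp add: algebra_simps)
  next
    case (step2 i)
    then show ?case using per[of "x + of_int (i - 1) * p"] by (simp add: algebra_simps)
  qed simp
  have c0: "0 \<le> c0" "c0 < p"
    using floor_divide_lower[OF p, of c] floor_divide_upper[OF p, of c]
    by (simp_all add: c0_def k_def algebra_simps)
  have "(\<lambda>x. of_int k * p + x) -` (S \<inter> {c..<c + p}) = S \<inter> {c0..<c0 + p}"
    using perk[of _ k] by (auto simp: c0_def add.commute)
  then have "emeasure lborel (S \<inter> {c..<c + p}) = emeasure lborel (S \<inter> {c0..<c0 + p})"
    using emeasure_lborel_shift[of "S \<inter> {c..<c + p}" "of_int k * p"] S by auto
  also have "S \<inter> {c0..<c0 + p} = (S \<inter> {c0..<p}) \<union> (S \<inter> {p..<p + c0})"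
    using c0 by auto
  also have "emeasure lborel \<dots> = emeasure lborel (S \<inter> {c0..<p}) + emeasure lborel (S \<inter> {p..<p + c0})"
    using S by (intro plus_emeasure[symmetric]) auto
  also have "(\<lambda>x. p + x) -` (S \<inter> {p..<p + c0}) = S \<inter> {0..<c0}"
    using per by (auto simp: add.commute)
  then have "emeasure lborel (S \<inter> {p..<p + c0}) = emeasure lborel (S \<inter> {0..<c0})"
    using emeasure_lborel_shift[of "S \<inter> {p..<p + c0}" p] S by auto
  also have "emeasure lborel (S \<inter> {c0..<p}) + emeasure lborel (S \<inter> {0..<c0})
      = emeasure lborel ((S \<inter> {c0..<p}) \<union> (S \<inter> {0..<c0}))"
    using S by (intro plus_emeasure) auto
  also have "(S \<inter> {c0..<p}) \<union> (S \<inter> {0..<c0}) = S \<inter> {0..<p}"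
    using c0 by auto
  finally show ?thesis .
qed

text \<open>Freedom in the choice of the cut point: integrals over the circle are later computed on
  an interval starting at \<open>a\<close>, so that the arc is not cut, or on one centred at a
  singularity.\<close>

lemma circle_measure_eq:
  "circle_measure = distr (restrict_space lborel {c..<c + 2 * pi}) borel cis"
proof (rule measure_eqI)
  fix A assume "A \<in> sets circle_measure"
  then have A [measurable]: "A \<in> sets borel" by simp
  have [measurable]: "cis -` A \<in> sets borel"
    using measurable_sets[OF borel_measurable_cis A] by simp
  have *: "emeasure (distr (restrict_space lborel {d..<d + 2 * pi}) borel cis) A
      = emeasure lborel (cis -` A \<inter> {d..<d + 2 * pi})" for d
    by (subst emeasure_distr)
      (auto simp: measurable_restrict_space1 space_restrict_space emeasure_restrict_space Int_commute)
  have "emeasure lborel (cis -` A \<inter> {c..<c + 2 * pi}) = emeasure lborel (cis -` A \<inter> {0..<2 * pi})"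
    by (rule periodic_emeasure_interval) (auto simp: cis_mult[symmetric])
  then show "emeasure circle_measure A
      = emeasure (distr (restrict_space lborel {c..<c + 2 * pi}) borel cis) A"
    using *[of c] *[of 0] by (simp add: circle_measure_def)
qed simp

lemma emeasure_circle: "emeasure circle_measure UNIV = ennreal (2 * pi)"
  by (simp add: circle_measure_def emeasure_distr measurable_restrict_space1
      space_restrict_space emeasure_restrict_space)

lemma finite_circle: "finite_measure circle_measure"
  by (intro finite_measureI) (simp add: emeasure_circle)

interpretation circle: finite_measure circle_measure by (rule finite_circle)

lemma circle_integral:
  fixes f :: "complex \<Rightarrow> 'b::{banach, second_countable_topology}"
  assumes [measurable]: "f \<in> borel_measurable borel"
  shows "(\<integral>\<zeta>. f \<zeta> \<partial>circle_measure) = (LINT x:{c..<c + 2 * pi}|lborel. f (cis x))"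
  by (subst circle_measure_eq[of c])
    (simp add: integral_distr measurable_restrict_space1 integral_restrict_space set_lebesgue_integral_def)

lemma circle_nn_integral:
  assumes [measurable]: "f \<in> borel_measurable borel"
  shows "(\<integral>\<^sup>+\<zeta>. f \<zeta> \<partial>circle_measure) = (\<integral>\<^sup>+x. f (cis x) * indicator {c..<c + 2 * pi} x \<partial>lborel)"
  by (subst circle_measure_eq[of c])
    (simp add: nn_integral_distr measurable_restrict_space1 nn_integral_restrict_space)

lemma circle_AE_iff:
  assumes [measurable]: "Measurable.pred borel P"
  shows "(AE \<zeta> in circle_measure. P \<zeta>) \<longleftrightarrow> (AE x in lborel. x \<in> {c..<c + 2 * pi} \<longrightarrow> P (cis x))"
  by (subst circle_measure_eq[of c])
    (simp add: AE_distr_iff measurable_restrict_space1 AE_restrict_space_iff)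

lemma AE_circle_norm: "AE \<zeta> in circle_measure. cmod \<zeta> = 1"
  by (subst circle_AE_iff[where c=0]) auto

lemma integrable_circle_bounded:
  assumes "f \<in> borel_measurable borel" "\<And>\<zeta>. cmod \<zeta> = 1 \<Longrightarrow> norm (f \<zeta>) \<le> B"
  shows "integrable circle_measure (f :: complex \<Rightarrow> 'b::{banach, second_countable_topology})"
  using assms AE_circle_norm by (intro circle.integrable_const_bound[where B=B]) auto

lemma norm_power_int_circle [simp]: "cmod \<zeta> = 1 \<Longrightarrow> cmod (\<zeta> powi n) = 1"
  by (simp add: norm_power_int)

lemma integral_circle_powi:
  "(\<integral>\<zeta>. \<zeta> powi n \<partial>circle_measure) = (if n = 0 then complex_of_real (2 * pi) else 0)"
proof (cases "n = 0")
  case True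
  then show ?thesis
    by (simp add: measure_def emeasure_circle scaleR_conv_of_real)
next
  case False
  let ?F = "\<lambda>x::real. cis (of_int n * x) / (\<i> * of_int n)"
  have der: "(?F has_vector_derivative cis x powi n) (at x within {0..2 * pi})" for x
  proof -
    have "((\<lambda>z. exp (\<i> * of_int n * z) / (\<i> * of_int n)) has_field_derivative
        exp (\<i> * of_int n * of_real x)) (at (of_real x))"
      using False by (auto intro!: derivative_eq_intros)
    then have "(?F has_vector_derivative cis (of_int n * x)) (at x within {0..2 * pi})"
      using has_vector_derivative_real_field by (fastforce simp: cis_conv_exp mult_ac)
    then show ?thesis by (simp only: cis_powi_real)
  qed
  have "(\<integral>\<zeta>. \<zeta> powi n \<partial>circle_measure) = (LINT x:{0..<0 + 2 * pi}|lborel. cis x powi n)"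
    by (rule circle_integral) simp
  also have "\<dots> = (\<integral>x. indicator {0..2 * pi} x *\<^sub>R (cis x powi n) \<partial>lborel)"
  proof -
    have "AE x in lborel. x \<noteq> 2 * pi" by (rule AE_lborel_singleton)
    then show ?thesis unfolding set_lebesgue_integral_def
      by (intro integral_cong_AE) (auto simp: indicator_def)
  qed
  also have "\<dots> = ?F (2 * pi) - ?F 0"
    by (rule integral_FTC_Icc) (auto intro!: der continuous_intros)
  also have "\<dots> = 0"
    using cis_multiple_2pi[of "of_int n"] by (simp add: mult_ac)
  finally show ?thesis using False by simp
qed

lemma cnj_powi_circle:
  assumes "cmod \<zeta> = 1"
  shows "cnj (\<zeta> powi n) = \<zeta> powi (- n)"
proof -
  have "\<zeta> * cnj \<zeta> = 1" using assms complex_norm_square[of \<zeta>] by simp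
  then have "cnj \<zeta> = inverse \<zeta>" by (metis inverse_unique)
  then show ?thesis by (simp add: power_int_minus power_int_inverse)
qed

lemma powi_L2 [simp]: "(\<lambda>\<zeta>. \<zeta> powi n) \<in> L2_space circle_measure"
  by (intro L2_spaceI integrable_circle_bounded[where B=1]) auto

lemma trig_L2: "(\<lambda>\<zeta>. \<Sum>n\<in>A. c n * \<zeta> powi n) \<in> L2_space circle_measure"
  by (intro L2_sum L2_cmult) simp

lemma L2_circle_integrable: "f \<in> L2_space circle_measure \<Longrightarrow> integrable circle_measure f"
  by (rule L2_integrable[OF finite_circle])

lemma integrable_mult_powi:
  assumes "integrable circle_measure f"
  shows "integrable circle_measure (\<lambda>\<zeta>. f \<zeta> * \<zeta> powi n)"
proof (rule Bochner_Integration.integrable_bound[OF assms])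
  show "(\<lambda>\<zeta>. f \<zeta> * \<zeta> powi n) \<in> borel_measurable circle_measure"
    using assms by measurable
  show "AE \<zeta> in circle_measure. norm (f \<zeta> * \<zeta> powi n) \<le> norm (f \<zeta>)"
    using AE_circle_norm by eventually_elim (simp add: norm_mult)
qed

lemma integral_mult_powi:
  "(\<integral>\<zeta>. f \<zeta> * \<zeta> powi n \<partial>circle_measure) = complex_of_real (2 * pi) * fourier_coeff f (- n)"
  by (simp add: fourier_coeff_def)

lemma fourier_coeff_add:
  "integrable circle_measure f \<Longrightarrow> integrable circle_measure g \<Longrightarrow>
    fourier_coeff (\<lambda>\<zeta>. f \<zeta> + g \<zeta>) n = fourier_coeff f n + fourier_coeff g n"
  by (simp add: fourier_coeff_def ring_distribs integrable_mult_powi)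

lemma fourier_coeff_cmult: "fourier_coeff (\<lambda>\<zeta>. c * f \<zeta>) n = c * fourier_coeff f n"
  by (simp add: fourier_coeff_def mult.assoc)

lemma fourier_coeff_diff:
  "integrable circle_measure f \<Longrightarrow> integrable circle_measure g \<Longrightarrow>
    fourier_coeff (\<lambda>\<zeta>. f \<zeta> - g \<zeta>) n = fourier_coeff f n - fourier_coeff g n"
  by (simp add: fourier_coeff_def ring_distribs integrable_mult_powi)

lemma fourier_coeff_sum:
  "(\<And>i. i \<in> I \<Longrightarrow> integrable circle_measure (f i)) \<Longrightarrow>
    fourier_coeff (\<lambda>\<zeta>. \<Sum>i\<in>I. f i \<zeta>) n = (\<Sum>i\<in>I. fourier_coeff (f i) n)"
proof (induction I rule: infinite_finite_induct)
  case (insert x F)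
  then show ?case by (simp add: fourier_coeff_add)
qed (auto simp: fourier_coeff_def)

lemma fourier_coeff_cong_AE:
  assumes [measurable]: "f \<in> borel_measurable circle_measure" "g \<in> borel_measurable circle_measure"
    and "AE \<zeta> in circle_measure. f \<zeta> = g \<zeta>"
  shows "fourier_coeff f n = fourier_coeff g n"
proof -
  have "(\<integral>\<zeta>. f \<zeta> * \<zeta> powi (- n) \<partial>circle_measure) = (\<integral>\<zeta>. g \<zeta> * \<zeta> powi (- n) \<partial>circle_measure)"
    using assms(3) by (intro integral_cong_AE) (measurable, auto)
  then show ?thesis by (simp add: fourier_coeff_def)
qed

lemma fourier_coeff_shift:
  assumes [measurable]: "f \<in> borel_measurable circle_measure"
  shows "fourier_coeff (\<lambda>\<zeta>. f \<zeta> * \<zeta> powi m) n = fourier_coeff f (n - m)"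
proof -
  have "(\<integral>\<zeta>. f \<zeta> * \<zeta> powi m * \<zeta> powi (- n) \<partial>circle_measure)
      = (\<integral>\<zeta>. f \<zeta> * \<zeta> powi (m - n) \<partial>circle_measure)"
  proof (rule integral_cong_AE)
    show "AE \<zeta> in circle_measure. f \<zeta> * \<zeta> powi m * \<zeta> powi - n = f \<zeta> * \<zeta> powi (m - n)"
      using AE_circle_norm
    proof eventually_elim
      case (elim \<zeta>)
      then have "\<zeta> \<noteq> 0" by auto
      then show ?case by (simp add: power_int_diff power_int_minus field_simps)
    qed
  qed measurable
  then show ?thesis by (simp add: fourier_coeff_def)
qed

lemma fourier_coeff_powi: "fourier_coeff (\<lambda>\<zeta>. \<zeta> powi m) n = (if n = m then 1 else 0)"
  using fourier_coeff_shift[of "\<lambda>\<zeta>. 1" m n] integral_circle_powi[of "m - n"]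
  by (auto simp: fourier_coeff_def)

lemma fourier_coeff_trig:
  assumes "finite A"
  shows "fourier_coeff (\<lambda>\<zeta>. \<Sum>n\<in>A. c n * \<zeta> powi n) m = (if m \<in> A then c m else 0)"
proof -
  have "fourier_coeff (\<lambda>\<zeta>. \<Sum>n\<in>A. c n * \<zeta> powi n) m = (\<Sum>n\<in>A. fourier_coeff (\<lambda>\<zeta>. c n * \<zeta> powi n) m)"
    by (intro fourier_coeff_sum L2_circle_integrable L2_cmult) simp
  also have "\<dots> = (\<Sum>n\<in>A. if m = n then c n else 0)"
    by (intro sum.cong) (simp_all add: fourier_coeff_cmult fourier_coeff_powi)
  finally show ?thesis using assms by simp
qed

section \<open>Bessel's inequality and the Riesz-Fischer theorem\<close>

lemma inner_trig:
  assumes f: "f \<in> L2_space circle_measure"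
  shows "(\<integral>\<zeta>. f \<zeta> * cnj (\<Sum>n\<in>A. c n * \<zeta> powi n) \<partial>circle_measure)
    = complex_of_real (2 * pi) * (\<Sum>n\<in>A. cnj (c n) * fourier_coeff f n)"
proof -
  have [measurable]: "f \<in> borel_measurable circle_measure" using f by (rule L2_measurable)
  have i: "integrable circle_measure (\<lambda>\<zeta>. f \<zeta> * \<zeta> powi n)" for n
    by (intro integrable_mult_powi L2_circle_integrable f)
  have "(\<integral>\<zeta>. f \<zeta> * cnj (\<Sum>n\<in>A. c n * \<zeta> powi n) \<partial>circle_measure)
      = (\<integral>\<zeta>. (\<Sum>n\<in>A. cnj (c n) * (f \<zeta> * \<zeta> powi (- n))) \<partial>circle_measure)"
  proof (rule integral_cong_AE)
    show "AE \<zeta> in circle_measure. f \<zeta> * cnj (\<Sum>n\<in>A. c n * \<zeta> powi n)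
        = (\<Sum>n\<in>A. cnj (c n) * (f \<zeta> * \<zeta> powi (- n)))"
      using AE_circle_norm
      by eventually_elim (simp add: cnj_powi_circle sum_distrib_left mult_ac del: complex_cnj_power_int)
  qed measurable
  also have "\<dots> = (\<Sum>n\<in>A. cnj (c n) * (\<integral>\<zeta>. f \<zeta> * \<zeta> powi (- n) \<partial>circle_measure))"
    using i by simp
  finally show ?thesis by (simp add: integral_mult_powi sum_distrib_left mult_ac)
qed

lemma normsq_trig:
  assumes "finite A"
  shows "normsq circle_measure (\<lambda>\<zeta>. \<Sum>n\<in>A. c n * \<zeta> powi n) = 2 * pi * (\<Sum>n\<in>A. (cmod (c n))\<^sup>2)"
proof -
  have "complex_of_real (normsq circle_measure (\<lambda>\<zeta>. \<Sum>n\<in>A. c n * \<zeta> powi n))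
      = complex_of_real (2 * pi) * (\<Sum>n\<in>A. cnj (c n) * fourier_coeff (\<lambda>\<zeta>. \<Sum>n\<in>A. c n * \<zeta> powi n) n)"
    by (simp only: normsq_eq_inner[OF trig_L2] inner_trig[OF trig_L2])
  also have "(\<Sum>n\<in>A. cnj (c n) * fourier_coeff (\<lambda>\<zeta>. \<Sum>n\<in>A. c n * \<zeta> powi n) n)
      = complex_of_real (\<Sum>n\<in>A. (cmod (c n))\<^sup>2)"
    unfolding of_real_sum
    by (intro sum.cong) (simp_all only: fourier_coeff_trig[OF assms] complex_norm_square mult.commute if_True)
  finally show ?thesis by (simp only: of_real_mult[symmetric] of_real_eq_iff)
qed

text \<open>Pythagoras with the exact defect: its nonnegativity gives Bessel's inequality, and its
  limit gives Parseval's identity.\<close>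

lemma normsq_diff_partial_sum:
  assumes f: "f \<in> L2_space circle_measure" and A: "finite A"
  shows "normsq circle_measure (\<lambda>\<zeta>. f \<zeta> - (\<Sum>n\<in>A. fourier_coeff f n * \<zeta> powi n))
    = normsq circle_measure f - 2 * pi * (\<Sum>n\<in>A. (cmod (fourier_coeff f n))\<^sup>2)"
proof -
  have "(\<Sum>n\<in>A. cnj (fourier_coeff f n) * fourier_coeff f n)
      = complex_of_real (\<Sum>n\<in>A. (cmod (fourier_coeff f n))\<^sup>2)"
    unfolding of_real_sum by (intro sum.cong) (simp_all only: complex_norm_square mult.commute)
  then show ?thesis
    by (simp only: normsq_diff_expand[OF f trig_L2] normsq_trig[OF A] inner_trig[OF f] Re_complex_of_real
        flip: of_real_mult)
qed

lemma Bessel: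
  assumes "f \<in> L2_space circle_measure" "finite A"
  shows "2 * pi * (\<Sum>n\<in>A. (cmod (fourier_coeff f n))\<^sup>2) \<le> normsq circle_measure f"
  using normsq_diff_partial_sum[OF assms]
    normsq_nonneg[of circle_measure "\<lambda>\<zeta>. f \<zeta> - (\<Sum>n\<in>A. fourier_coeff f n * \<zeta> powi n)"] by linarith

lemma fourier_coeff_sq_summable:
  assumes f: "f \<in> L2_space circle_measure"
  shows "(\<lambda>n. (cmod (fourier_coeff f n))\<^sup>2) summable_on UNIV"
proof (rule nonneg_bdd_above_summable_on)
  show "bdd_above (sum (\<lambda>n. (cmod (fourier_coeff f n))\<^sup>2) ` {F. F \<subseteq> UNIV \<and> finite F})"
  proof (rule bdd_aboveI2)
    fix A :: "int set" assume "A \<in> {F. F \<subseteq> UNIV \<and> finite F}"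
    then show "(\<Sum>n\<in>A. (cmod (fourier_coeff f n))\<^sup>2) \<le> normsq circle_measure f / (2 * pi)"
      using Bessel[OF f, of A] by (simp add: pos_le_divide_eq mult.commute)
  qed
qed simp

text \<open>Links unordered sums over the integers with the symmetric partial sums in
  \<open>has_L2_fourier_series\<close>.\<close>

lemma filterlim_int_intervals:
  "filterlim (\<lambda>N::nat. {- int N..int N}) (finite_subsets_at_top UNIV) sequentially"
unfolding filterlim_finite_subsets_at_top
proof (intro allI impI)
  fix X :: "int set" assume X: "finite X \<and> X \<subseteq> UNIV"
  define b where "b = Max (abs ` X)"
  have b: "\<bar>x\<bar> \<le> b" if "x \<in> X" for x
    using X that unfolding b_def by (intro Max_ge) auto
  show "\<forall>\<^sub>F N in sequentially. finite {- int N..int N} \<and> X \<subseteq> {- int N..int N} \<and> {- int N..int N} \<subseteq> UNIV"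
    using eventually_ge_at_top[of "nat b"]
  proof eventually_elim
    case (elim N)
    then show ?case using b by fastforce
  qed
qed

lemma has_sum_int_tendsto:
  "(f has_sum S) (UNIV :: int set) \<Longrightarrow> (\<lambda>N. \<Sum>n=-int N..int N. f n) \<longlonglongrightarrow> S"
  unfolding has_sum_def by (rule filterlim_compose[OF _ filterlim_int_intervals])

lemma fourier_coeff_L2_series:
  assumes "has_L2_fourier_series F c"
  shows "fourier_coeff F n = c n"
proof -
  have F: "F \<in> L2_space circle_measure" using assms by (simp add: has_L2_fourier_series_def)
  define f where "f N = (\<lambda>\<zeta>. \<Sum>n=-int N..int N. c n * \<zeta> powi n)" for N
  have f: "f N \<in> L2_space circle_measure" for N unfolding f_def by (rule trig_L2)
  have "(\<lambda>N. normsq circle_measure (\<lambda>\<zeta>. F \<zeta> - f N \<zeta>)) \<longlonglongrightarrow> 0"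
    using assms by (simp add: has_L2_fourier_series_def normsq_def f_def)
  from L2_tendsto_integral[OF f F powi_L2 this, of "-n"]
  have "(\<lambda>N. fourier_coeff (f N) n) \<longlonglongrightarrow> fourier_coeff F n"
    unfolding fourier_coeff_def by (intro tendsto_intros)
  moreover have "(\<lambda>N. fourier_coeff (f N) n) \<longlonglongrightarrow> c n"
  proof (rule tendsto_eventually)
    show "\<forall>\<^sub>F N in sequentially. fourier_coeff (f N) n = c n"
      using eventually_ge_at_top[of "nat \<bar>n\<bar>"]
      by eventually_elim (auto simp: f_def fourier_coeff_trig)
  qed
  ultimately show ?thesis by (rule LIMSEQ_unique)
qed

lemma Riesz_Fischer:
  assumes "(\<lambda>n. (cmod (c n))\<^sup>2) summable_on UNIV"
  shows "\<exists>F. has_L2_fourier_series F c"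
proof -
  define f where "f N = (\<lambda>\<zeta>. \<Sum>n=-int N..int N. c n * \<zeta> powi n)" for N
  have f: "f N \<in> L2_space circle_measure" for N unfolding f_def by (rule trig_L2)
  define S where "S N = (\<Sum>n=-int N..int N. (cmod (c n))\<^sup>2)" for N
  have "convergent S" using has_sum_int_tendsto[OF has_sum_infsum[OF assms]] unfolding S_def
    by (rule convergentI)
  then have S: "Cauchy S" by (rule convergent_Cauchy)
  have diff: "normsq circle_measure (\<lambda>\<zeta>. f m \<zeta> - f n \<zeta>) = 2 * pi * (S m - S n)" if "n \<le> m" for m n
  proof -
    have sub: "{- int n..int n} \<subseteq> {- int m..int m}" using that by auto
    have "(\<lambda>\<zeta>. f m \<zeta> - f n \<zeta>) = (\<lambda>\<zeta>. \<Sum>k\<in>{- int m..int m} - {- int n..int n}. c k * \<zeta> powi k)"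
      unfolding f_def by (subst sum_diff[OF _ sub]) auto
    then have "normsq circle_measure (\<lambda>\<zeta>. f m \<zeta> - f n \<zeta>)
        = 2 * pi * (\<Sum>k\<in>{- int m..int m} - {- int n..int n}. (cmod (c k))\<^sup>2)"
      by (simp only: normsq_trig[OF finite_Diff[OF finite_atLeastAtMost_int]])
    then show ?thesis
      by (simp only: S_def sum_diff[OF finite_atLeastAtMost_int sub])
  qed
  have "\<exists>F \<in> L2_space circle_measure. (\<lambda>n. normsq circle_measure (\<lambda>x. F x - f n x)) \<longlonglongrightarrow> 0"
  proof (rule L2_complete[OF f])
    fix e :: real assume "0 < e"
    then have "0 < e / (2 * pi)" by simp
    then obtain N where N: "\<And>m n. m \<ge> N \<Longrightarrow> n \<ge> N \<Longrightarrow> norm (S m - S n) < e / (2 * pi)"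
      using CauchyD[OF S] by blast
    have *: "normsq circle_measure (\<lambda>\<zeta>. f m \<zeta> - f n \<zeta>) \<le> e" if "N \<le> n" "n \<le> m" for m n
    proof -
      have "S m - S n \<le> e / (2 * pi)" using N[of m n] that by (simp add: abs_less_iff)
      then show ?thesis by (simp add: diff[OF that(2)] field_simps)
    qed
    have "normsq circle_measure (\<lambda>\<zeta>. f m \<zeta> - f n \<zeta>) \<le> e" if "N \<le> n" "N \<le> m" for m n
      using *[of n m] *[of m n] that linorder_linear[of m n]
      unfolding normsq_commute[of circle_measure "f n" "f m"] by blast
    then show "\<exists>N. \<forall>m\<ge>N. \<forall>n\<ge>N. normsq circle_measure (\<lambda>x. f m x - f n x) \<le> e" by blast
  qed
  then obtain F where "F \<in> L2_space circle_measure"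
    "(\<lambda>n. normsq circle_measure (\<lambda>x. F x - f n x)) \<longlonglongrightarrow> 0" by blast
  then show ?thesis
    unfolding has_L2_fourier_series_def normsq_def f_def by blast
qed

section \<open>Uniqueness of Fourier coefficients\<close>

lemma integral_mult_real_polynomial:
  fixes q :: "complex \<Rightarrow> real"
  assumes "real_polynomial_function q" "integrable circle_measure f" "\<And>n. fourier_coeff f n = 0"
  shows "integrable circle_measure (\<lambda>\<zeta>. f \<zeta> * of_real (q \<zeta>)) \<and>
    (\<forall>n. fourier_coeff (\<lambda>\<zeta>. f \<zeta> * of_real (q \<zeta>)) n = 0)"
  using assms
\<comment> \<open>\<open>f\<close> is generalised because the product case applies the hypothesis
  for \<open>q\<close> to \<open>f\<close> times \<open>p\<close>, which again has vanishing
  coefficients.\<close>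
proof (induction arbitrary: f rule: real_polynomial_function.induct)
  case (linear q)
  then interpret q: bounded_linear q by simp
  have [measurable]: "f \<in> borel_measurable circle_measure" using linear by auto
  have [measurable]: "q \<in> borel_measurable borel"
    by (intro borel_measurable_continuous_onI continuous_on_subset[OF linear_continuous_on] linear) auto
  \<comment> \<open>A real linear form is \<alpha> \<zeta> + \<beta> cnj \<zeta>, and cnj \<zeta> =
    1 / \<zeta> on the circle; so multiplication by it only shifts Fourier coefficients.\<close>
  define \<alpha> \<beta> :: complex where "\<alpha> = (of_real (q 1) - \<i> * of_real (q \<i>)) / 2" and "\<beta> = (of_real (q 1) + \<i> * of_real (q \<i>)) / 2"
  have q: "of_real (q \<zeta>) = \<alpha> * \<zeta> + \<beta> * cnj \<zeta>" for \<zeta>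
  proof -
    have "q \<zeta> = q (Re \<zeta> *\<^sub>R 1 + Im \<zeta> *\<^sub>R \<i>)"
      using complex_eq[of \<zeta>] by (simp add: scaleR_conv_of_real mult.commute)
    also have "\<dots> = Re \<zeta> * q 1 + Im \<zeta> * q \<i>"
      by (simp only: q.add q.scaleR real_scaleR_def)
    finally show ?thesis by (simp add: \<alpha>_def \<beta>_def complex_eq_iff field_simps)
  qed
  let ?g = "\<lambda>\<zeta>. \<alpha> * (f \<zeta> * \<zeta> powi 1) + \<beta> * (f \<zeta> * \<zeta> powi (-1))"
  have ae: "AE \<zeta> in circle_measure. f \<zeta> * of_real (q \<zeta>) = ?g \<zeta>"
    using AE_circle_norm
  proof eventually_elim
    case (elim \<zeta>)
    have "cnj \<zeta> = \<zeta> powi (-1)" using cnj_powi_circle[OF elim, of 1] by simp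
    then show ?case by (simp add: q algebra_simps)
  qed
  have i: "integrable circle_measure (\<lambda>\<zeta>. f \<zeta> * \<zeta> powi k)" for k
    using linear by (intro integrable_mult_powi) auto
  have ig: "integrable circle_measure ?g"
    by (intro Bochner_Integration.integrable_add integrable_mult_right i)
  have "integrable circle_measure (\<lambda>\<zeta>. f \<zeta> * of_real (q \<zeta>))"
    by (rule integrable_cong_AE_imp[OF ig]) (use ae in auto)
  moreover have "fourier_coeff (\<lambda>\<zeta>. f \<zeta> * of_real (q \<zeta>)) n = 0" for n
  proof -
    have "fourier_coeff (\<lambda>\<zeta>. f \<zeta> * of_real (q \<zeta>)) n = fourier_coeff ?g n"
      by (rule fourier_coeff_cong_AE[OF _ _ ae]) measurable
    also have "\<dots> = \<alpha> * fourier_coeff f (n - 1) + \<beta> * fourier_coeff f (n - (-1))"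
      by (simp only: fourier_coeff_add[OF integrable_mult_right[OF i] integrable_mult_right[OF i]]
          fourier_coeff_cmult fourier_coeff_shift[OF \<open>f \<in> borel_measurable circle_measure\<close>])
    finally show ?thesis using linear by simp
  qed
  ultimately show ?case by blast
next
  case (const c)
  have "fourier_coeff (\<lambda>\<zeta>. of_real c * f \<zeta>) n = 0" for n
    using const by (simp only: fourier_coeff_cmult mult_zero_right)
  then show ?case using const by (simp add: mult.commute)
next
  case (add p q)
  from add.IH(1)[OF add.prems] add.IH(2)[OF add.prems] show ?case
    by (simp add: ring_distribs fourier_coeff_add)
next
  case (mult p q)
  from mult.IH(1)[OF mult.prems] have "integrable circle_measure (\<lambda>\<zeta>. f \<zeta> * of_real (p \<zeta>))"
    "\<And>n. fourier_coeff (\<lambda>\<zeta>. f \<zeta> * of_real (p \<zeta>)) n = 0" by auto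
  from mult.IH(2)[OF this] show ?case by (simp add: mult.assoc)
qed

text \<open>Stone-Weierstrass on the circle: a polynomial within \<open>e\<close> of \<phi>
  integrates to 0 against \<open>f\<close>, so the integral with \<phi> is at most \<open>e\<close>
  times the L1 norm of \<open>f\<close>.\<close>

lemma integral_mult_continuous_eq_0:
  fixes \<phi> :: "complex \<Rightarrow> real"
  assumes f: "integrable circle_measure f" and 0: "\<And>n. fourier_coeff f n = 0"
    and \<phi>: "continuous_on UNIV \<phi>"
  shows "(\<integral>\<zeta>. f \<zeta> * of_real (\<phi> \<zeta>) \<partial>circle_measure) = 0"
proof -
  have [measurable]: "f \<in> borel_measurable circle_measure" using f by auto
  have \<phi>m [measurable]: "\<phi> \<in> borel_measurable borel" by (rule borel_measurable_continuous_onI[OF \<phi>])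
  have "compact (sphere 0 1 :: complex set)" by simp
  then obtain B where B: "\<And>\<zeta>. \<zeta> \<in> sphere 0 1 \<Longrightarrow> norm (\<phi> \<zeta>) \<le> B"
    using compact_continuous_image[of "sphere 0 1" \<phi>] continuous_on_subset[OF \<phi>]
    by (metis bounded_iff compact_imp_bounded image_eqI top_greatest)
  have iphi: "integrable circle_measure (\<lambda>\<zeta>. f \<zeta> * of_real (\<phi> \<zeta>))"
  proof (rule Bochner_Integration.integrable_bound)
    show "integrable circle_measure (\<lambda>\<zeta>. B * norm (f \<zeta>))" using f by simp
    show "AE \<zeta> in circle_measure. norm (f \<zeta> * of_real (\<phi> \<zeta>)) \<le> norm (B * norm (f \<zeta>))"
      using AE_circle_norm
    proof eventually_elim
      case (elim \<zeta>)
      then have "\<bar>\<phi> \<zeta>\<bar> \<le> \<bar>B\<bar>" using B[of \<zeta>] by simp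
      then show ?case by (simp add: norm_mult abs_mult mult.commute mult_right_mono)
    qed
  qed measurable
  let ?I = "\<integral>\<zeta>. f \<zeta> * of_real (\<phi> \<zeta>) \<partial>circle_measure"
  have le: "cmod ?I \<le> e * (\<integral>\<zeta>. norm (f \<zeta>) \<partial>circle_measure)" if e: "0 < e" for e
  proof -
    obtain q where q: "real_polynomial_function q" "\<And>\<zeta>. \<zeta> \<in> sphere 0 1 \<Longrightarrow> \<bar>\<phi> \<zeta> - q \<zeta>\<bar> < e"
      by (rule Stone_Weierstrass_real_polynomial_function
          [OF compact_sphere[of 0 1] continuous_on_subset[OF \<phi> subset_UNIV] e]) blast
    have iq: "integrable circle_measure (\<lambda>\<zeta>. f \<zeta> * of_real (q \<zeta>))"
      and cq: "fourier_coeff (\<lambda>\<zeta>. f \<zeta> * of_real (q \<zeta>)) 0 = 0"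
      using integral_mult_real_polynomial[OF q(1) f 0] by auto
    from cq have "(\<integral>\<zeta>. f \<zeta> * of_real (q \<zeta>) \<partial>circle_measure) = 0"
      by (simp add: fourier_coeff_def)
    then have "?I = (\<integral>\<zeta>. f \<zeta> * of_real (\<phi> \<zeta>) - f \<zeta> * of_real (q \<zeta>) \<partial>circle_measure)"
      using iphi iq by simp
    also have "cmod \<dots> \<le> (\<integral>\<zeta>. norm (f \<zeta> * of_real (\<phi> \<zeta>) - f \<zeta> * of_real (q \<zeta>)) \<partial>circle_measure)"
      by (rule integral_norm_bound)
    also have "\<dots> \<le> (\<integral>\<zeta>. e * norm (f \<zeta>) \<partial>circle_measure)"
    proof (rule integral_mono_AE)
      show "integrable circle_measure (\<lambda>\<zeta>. norm (f \<zeta> * of_real (\<phi> \<zeta>) - f \<zeta> * of_real (q \<zeta>)))"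
        using iphi iq by simp
      show "integrable circle_measure (\<lambda>\<zeta>. e * norm (f \<zeta>))" using f by simp
      show "AE \<zeta> in circle_measure. norm (f \<zeta> * of_real (\<phi> \<zeta>) - f \<zeta> * of_real (q \<zeta>)) \<le> e * norm (f \<zeta>)"
        using AE_circle_norm
      proof eventually_elim
        case (elim \<zeta>)
        have "f \<zeta> * of_real (\<phi> \<zeta>) - f \<zeta> * of_real (q \<zeta>) = f \<zeta> * of_real (\<phi> \<zeta> - q \<zeta>)"
          by (simp add: algebra_simps)
        then show ?case using q(2)[of \<zeta>] elim
          by (simp add: norm_mult mult.commute[of e] mult_left_mono del: of_real_diff)
      qed
    qed
    finally show ?thesis by simp
  qed
  have "(\<lambda>k. inverse (real (Suc k)) * (\<integral>\<zeta>. norm (f \<zeta>) \<partial>circle_measure)) \<longlonglongrightarrow> 0 * (\<integral>\<zeta>. norm (f \<zeta>) \<partial>circle_measure)"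
    by (intro tendsto_intros LIMSEQ_inverse_real_of_nat)
  then have "cmod ?I \<le> 0 * (\<integral>\<zeta>. norm (f \<zeta>) \<partial>circle_measure)"
    by (rule LIMSEQ_le_const) (auto intro!: exI[of _ 0] le)
  then show ?thesis by simp
qed

lemma set_integral_open_eq_0:
  assumes f: "integrable circle_measure f" and 0: "\<And>n. fourier_coeff f n = 0" and U: "open U"
  shows "set_lebesgue_integral circle_measure U f = 0"
proof (cases "U = UNIV")
  \<comment> \<open>\<open>infdist\<close> to the empty complement is 0 by convention, so the
    approximation used in the other case would break down for the whole plane.\<close>
  case True
  then show ?thesis using 0[of 0] by (simp add: set_lebesgue_integral_def fourier_coeff_def)
next
  case False
  have [measurable]: "f \<in> borel_measurable circle_measure" "U \<in> sets borel" using f U by auto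
  \<comment> \<open>Continuous functions tending to the indicator of \<open>U\<close>, since the
    distance to the closed complement is positive exactly on \<open>U\<close>.\<close>
  define \<phi> where "\<phi> k x = min 1 (real k * infdist x (- U))" for k and x :: complex
  have cont: "continuous_on UNIV (\<phi> k)" for k
    unfolding \<phi>_def by (intro continuous_intros)
  have [measurable]: "\<phi> k \<in> borel_measurable borel" for k by (rule borel_measurable_continuous_onI[OF cont])
  have lim: "(\<lambda>k. \<phi> k x) \<longlonglongrightarrow> indicator U x" for x
  proof (cases "x \<in> U")
    case True
    have cl: "closed (- U)" using U by (rule closed_Compl)
    have "infdist x (- U) > 0"
      using in_closed_iff_infdist_zero[OF cl] infdist_nonneg[of x "- U"] True False
      by (metis ComplD Compl_UNIV_eq double_compl less_eq_real_def)
    then obtain K :: nat where K: "1 < real K * infdist x (- U)"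
      using reals_Archimedean3 by blast
    have "\<phi> k x = 1" if "k \<ge> K" for k
    proof -
      have "real K * infdist x (- U) \<le> real k * infdist x (- U)"
        using that \<open>infdist x (- U) > 0\<close> by (intro mult_right_mono) auto
      with K show ?thesis unfolding \<phi>_def by simp
    qed
    then have "\<forall>\<^sub>F k in sequentially. \<phi> k x = indicator U x"
      using True eventually_sequentially by auto
    then show ?thesis by (rule tendsto_eventually)
  next
    case False
    then show ?thesis by (simp add: \<phi>_def)
  qed
  have "(\<lambda>k. \<integral>\<zeta>. f \<zeta> * of_real (\<phi> k \<zeta>) \<partial>circle_measure) \<longlonglongrightarrow> (\<integral>\<zeta>. f \<zeta> * of_real (indicator U \<zeta>) \<partial>circle_measure)"
  proof (rule integral_dominated_convergence[where w="\<lambda>\<zeta>. norm (f \<zeta>)"])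
    show "AE \<zeta> in circle_measure. (\<lambda>k. f \<zeta> * of_real (\<phi> k \<zeta>)) \<longlonglongrightarrow> f \<zeta> * of_real (indicator U \<zeta>)"
      by (intro AE_I2 tendsto_intros lim)
    show "AE \<zeta> in circle_measure. norm (f \<zeta> * of_real (\<phi> k \<zeta>)) \<le> norm (f \<zeta>)" for k
    proof (intro AE_I2)
      fix \<zeta>
      have "\<bar>\<phi> k \<zeta>\<bar> \<le> 1" using infdist_nonneg[of \<zeta> "- U"] by (simp add: \<phi>_def)
      then show "norm (f \<zeta> * of_real (\<phi> k \<zeta>)) \<le> norm (f \<zeta>)"
        using mult_left_mono[of "\<bar>\<phi> k \<zeta>\<bar>" 1 "norm (f \<zeta>)"] by (simp add: norm_mult)
    qed
    show "integrable circle_measure (\<lambda>\<zeta>. norm (f \<zeta>))" using f by simp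
  qed measurable
  moreover have "(\<integral>\<zeta>. f \<zeta> * of_real (\<phi> k \<zeta>) \<partial>circle_measure) = 0" for k
    by (rule integral_mult_continuous_eq_0[OF f 0 cont])
  ultimately have "(\<integral>\<zeta>. f \<zeta> * of_real (indicator U \<zeta>) \<partial>circle_measure) = 0"
    by (simp add: LIMSEQ_const_iff)
  then show ?thesis
    by (simp add: set_lebesgue_integral_def scaleR_conv_of_real mult.commute)
qed

text \<open>Stated for integrable functions because the Duhamel integral enters later as an
  integrable function of \<zeta>. Vanishing of the integral over open sets extends to all Borel
  sets, as open sets form a generator stable under intersection.\<close>

theorem fourier_coeff_unique:
  assumes f: "integrable circle_measure f" and 0: "\<And>n. fourier_coeff f n = 0"
  shows "AE \<zeta> in circle_measure. f \<zeta> = 0"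
proof (rule circle.density_zero[OF f])
  have [measurable]: "f \<in> borel_measurable circle_measure" using f by auto
  fix A assume "A \<in> sets circle_measure"
  then have "A \<in> sigma_sets UNIV {S. open S}" by (simp add: borel_def)
  have "Int_stable {S :: complex set. open S}" "{S :: complex set. open S} \<subseteq> Pow UNIV"
    by (auto simp: Int_stable_def)
  from this \<open>A \<in> sigma_sets UNIV {S. open S}\<close>
  show "set_lebesgue_integral circle_measure A f = 0"
  proof (induction rule: sigma_sets_induct_disjoint)
    case (basic A)
    then show ?case using set_integral_open_eq_0[OF f 0] by simp
  next
    case empty
    show ?case by (simp add: set_lebesgue_integral_def)
  next
    case (compl A)
    have A: "A \<in> sets borel" using compl.hyps by (simp add: borel_def)
    have "set_lebesgue_integral circle_measure UNIV f
        = set_lebesgue_integral circle_measure A f + set_lebesgue_integral circle_measure (UNIV - A) f"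
      using set_integral_Un[of A "UNIV - A" circle_measure f] A f
      by (simp add: set_integrable_def integrable_mult_indicator)
    then show ?case using compl.IH set_integral_open_eq_0[OF f 0, of UNIV] by simp
  next
    case (union A)
    have A: "A i \<in> sets circle_measure" for i using union.hyps by (auto simp: borel_def)
    have "set_lebesgue_integral circle_measure (\<Union>i. A i) f = (\<Sum>i. set_lebesgue_integral circle_measure (A i) f)"
    proof (rule lebesgue_integral_countable_add)
      show "set_integrable circle_measure (\<Union> (range A)) f"
        unfolding set_integrable_def by (rule integrable_mult_indicator[OF _ f]) (use A in auto)
      show "A i \<inter> A j = {}" if "i \<noteq> j" for i j
        using union.hyps that by (auto simp: disjoint_family_on_def)
    qed (rule A)
    then show ?case using union.IH by simp
  qed
qed

text \<open>Riesz-Fischer builds some function with the coefficients of \<open>f\<close>; uniqueness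
  identifies it with \<open>f\<close> almost everywhere.\<close>

lemma has_L2_fourier_series:
  assumes f: "f \<in> L2_space circle_measure"
  shows "has_L2_fourier_series f (fourier_coeff f)"
proof -
  obtain F where F: "has_L2_fourier_series F (fourier_coeff f)"
    using Riesz_Fischer[OF fourier_coeff_sq_summable[OF f]] by blast
  then have FL: "F \<in> L2_space circle_measure" by (simp add: has_L2_fourier_series_def)
  have "AE \<zeta> in circle_measure. F \<zeta> - f \<zeta> = 0"
    using fourier_coeff_L2_series[OF F] f FL
    by (intro fourier_coeff_unique) (simp_all add: fourier_coeff_diff L2_circle_integrable)
  then have ae: "AE \<zeta> in circle_measure. F \<zeta> = f \<zeta>" by simp
  have [measurable]: "F \<in> borel_measurable circle_measure" "f \<in> borel_measurable circle_measure"
    using f FL by (auto intro: L2_measurable)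
  have "(\<integral>\<zeta>. (cmod (F \<zeta> - (\<Sum>n = - int N..int N. fourier_coeff f n * \<zeta> powi n)))\<^sup>2 \<partial>circle_measure)
      = (\<integral>\<zeta>. (cmod (f \<zeta> - (\<Sum>n = - int N..int N. fourier_coeff f n * \<zeta> powi n)))\<^sup>2 \<partial>circle_measure)" for N
    using ae by (intro integral_cong_AE) (measurable, auto)
  then show ?thesis using F f by (simp add: has_L2_fourier_series_def)
qed

text \<open>The choice by \<open>SOME\<close> is harmless: Riesz-Fischer provides a candidate, and
  the Fourier coefficients do not depend on which one is taken.\<close>

lemma riesz_proj:
  assumes f: "f \<in> L2_space circle_measure"
  shows "riesz_proj f \<in> L2_space circle_measure"
    and "fourier_coeff (riesz_proj f) n = (if 0 \<le> n then fourier_coeff f n else 0)"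
proof -
  have "(\<lambda>n. (cmod (if 0 \<le> n then fourier_coeff f n else 0))\<^sup>2) summable_on (UNIV :: int set)"
    by (rule summable_on_comparison_test[OF fourier_coeff_sq_summable[OF f]]) auto
  from Riesz_Fischer[OF this]
  have *: "has_L2_fourier_series (riesz_proj f) (\<lambda>n. if 0 \<le> n then fourier_coeff f n else 0)"
    unfolding riesz_proj_def by (rule someI_ex)
  then show "riesz_proj f \<in> L2_space circle_measure" by (simp add: has_L2_fourier_series_def)
  show "fourier_coeff (riesz_proj f) n = (if 0 \<le> n then fourier_coeff f n else 0)"
    by (rule fourier_coeff_L2_series[OF *])
qed

lemma Parseval:
  assumes f: "f \<in> L2_space circle_measure"
  shows "normsq circle_measure f = 2 * pi * (\<Sum>\<^sub>\<infinity>n. (cmod (fourier_coeff f n))\<^sup>2)"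
proof -
  have "(\<lambda>N. normsq circle_measure f - 2 * pi * (\<Sum>n=-int N..int N. (cmod (fourier_coeff f n))\<^sup>2)) \<longlonglongrightarrow> 0"
    using has_L2_fourier_series[OF f] normsq_diff_partial_sum[OF f]
    by (simp add: has_L2_fourier_series_def normsq_def)
  moreover have "(\<lambda>N. normsq circle_measure f - 2 * pi * (\<Sum>n=-int N..int N. (cmod (fourier_coeff f n))\<^sup>2))
      \<longlonglongrightarrow> normsq circle_measure f - 2 * pi * (\<Sum>\<^sub>\<infinity>n. (cmod (fourier_coeff f n))\<^sup>2)"
    by (intro tendsto_intros has_sum_int_tendsto has_sum_infsum fourier_coeff_sq_summable f)
  ultimately have "0 = normsq circle_measure f - 2 * pi * (\<Sum>\<^sub>\<infinity>n. (cmod (fourier_coeff f n))\<^sup>2)"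
    by (rule LIMSEQ_unique)
  then show ?thesis by simp
qed


section \<open>Controllability as a moment problem\<close>

text \<open>The control lives on a product with the restricted circle measure, while Fourier
  coefficients need the whole circle. Viewing the former as a restriction of the full product allows
  the control to be extended by 0.\<close>

lemma pair_restrict_space_right:
  assumes "sigma_finite_measure M1" "sigma_finite_measure M2" and B: "B \<in> sets M2"
  shows "M1 \<Otimes>\<^sub>M restrict_space M2 B = restrict_space (M1 \<Otimes>\<^sub>M M2) (space M1 \<times> B)"
proof (rule pair_measure_eqI)
  interpret M2: sigma_finite_measure M2 by fact
  show "sigma_finite_measure M1" by fact
  show "sigma_finite_measure (restrict_space M2 B)"
    by (rule sigma_finite_measure_restrict_space[OF assms(2) B])
  have BS: "B \<subseteq> space M2" using B by (rule sets.sets_into_space)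
  have sp: "space M1 \<times> B \<inter> space (M1 \<Otimes>\<^sub>M M2) \<in> sets (M1 \<Otimes>\<^sub>M M2)"
    using B by (auto intro!: sets.Int pair_measureI)
  have BM: "space M1 \<times> B \<in> sets (M1 \<Otimes>\<^sub>M M2)" using B by (auto intro!: pair_measureI)
  show "sets (M1 \<Otimes>\<^sub>M restrict_space M2 B) = sets (restrict_space (M1 \<Otimes>\<^sub>M M2) (space M1 \<times> B))"
  proof (rule antisym)
    show "sets (M1 \<Otimes>\<^sub>M restrict_space M2 B) \<subseteq> sets (restrict_space (M1 \<Otimes>\<^sub>M M2) (space M1 \<times> B))"
    proof (rule sets_pair_in_sets)
      fix X Y assume "X \<in> sets M1" "Y \<in> sets (restrict_space M2 B)"
      then have "X \<times> Y \<in> sets (M1 \<Otimes>\<^sub>M M2)" "X \<times> Y \<subseteq> space M1 \<times> B"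
        using sets.sets_into_space[of X M1] B by (auto simp: sets_restrict_space_iff)
      then show "X \<times> Y \<in> sets (restrict_space (M1 \<Otimes>\<^sub>M M2) (space M1 \<times> B))"
        using sp by (simp add: sets_restrict_space_iff)
    qed
    have "(\<lambda>x. (fst x, snd x)) \<in> measurable (M1 \<Otimes>\<^sub>M restrict_space M2 B) (M1 \<Otimes>\<^sub>M M2)"
      by (intro measurable_Pair measurable_fst measurable_compose[OF measurable_snd]
          measurable_restrict_space1 measurable_ident_sets[OF refl])
    then have m: "(\<lambda>x. x) \<in> measurable (M1 \<Otimes>\<^sub>M restrict_space M2 B) (M1 \<Otimes>\<^sub>M M2)" by simp
    show "sets (restrict_space (M1 \<Otimes>\<^sub>M M2) (space M1 \<times> B)) \<subseteq> sets (M1 \<Otimes>\<^sub>M restrict_space M2 B)"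
    proof
      fix X assume "X \<in> sets (restrict_space (M1 \<Otimes>\<^sub>M M2) (space M1 \<times> B))"
      then have X: "X \<in> sets (M1 \<Otimes>\<^sub>M M2)" "X \<subseteq> space M1 \<times> B"
        using sp by (auto simp: sets_restrict_space_iff)
      have "(\<lambda>x. x) -` X \<inter> space (M1 \<Otimes>\<^sub>M restrict_space M2 B) = X"
        using X(2) BS by (auto simp: space_pair_measure space_restrict_space)
      then show "X \<in> sets (M1 \<Otimes>\<^sub>M restrict_space M2 B)"
        using measurable_sets[OF m X(1)] by simp
    qed
  qed
  fix X Y assume "X \<in> sets M1" "Y \<in> sets (restrict_space M2 B)"
  then have X: "X \<in> sets M1" and Y: "Y \<in> sets M2" "Y \<subseteq> B"
    using B by (auto simp: sets_restrict_space_iff)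
  have "emeasure (restrict_space (M1 \<Otimes>\<^sub>M M2) (space M1 \<times> B)) (X \<times> Y) = emeasure (M1 \<Otimes>\<^sub>M M2) (X \<times> Y)"
    using sets.sets_into_space[OF X] Y by (intro emeasure_restrict_space[OF sp]) auto
  also have "\<dots> = emeasure M1 X * emeasure M2 Y" by (rule M2.emeasure_pair_measure_Times[OF X Y(1)])
  finally show "emeasure M1 X * emeasure (restrict_space M2 B) Y
      = emeasure (restrict_space (M1 \<Otimes>\<^sub>M M2) (space M1 \<times> B)) (X \<times> Y)"
    using Y B by (simp add: emeasure_restrict_space)
qed

section \<open>Functions of time and angle\<close>

abbreviation time_measure :: "real \<Rightarrow> real measure" where
  "time_measure T \<equiv> restrict_space lborel {0..T}"

lemma finite_time_measure: "finite_measure (time_measure T)"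
  by (intro finite_measureI) (simp add: space_restrict_space emeasure_restrict_space emeasure_lborel_Icc_eq)

lemma sigma_finite_time [simp]: "sigma_finite_measure (time_measure T)"
  and sigma_finite_circle [simp]: "sigma_finite_measure circle_measure"
  using finite_time_measure finite_circle by (auto simp: finite_measure_def)

lemma pair_sigma_finite_time_circle: "pair_sigma_finite (time_measure T) circle_measure"
  by (simp add: pair_sigma_finite_def)

interpretation tc: pair_sigma_finite "time_measure T" circle_measure for T
  by (rule pair_sigma_finite_time_circle)

lemma finite_time_circle: "finite_measure (time_measure T \<Otimes>\<^sub>M circle_measure)"
  by (intro finite_measureI)
    (simp add: space_pair_measure space_restrict_space circle.emeasure_pair_measure_Times sets_restrict_space_iff
      emeasure_restrict_space emeasure_lborel_Icc_eq emeasure_circle ennreal_mult_eq_top_iff)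

lemma space_time_circle [simp]: "space (time_measure T \<Otimes>\<^sub>M circle_measure) = {0..T} \<times> UNIV"
  by (simp add: space_pair_measure space_restrict_space)

lemma AE_time_circle_norm: "AE x in time_measure T \<Otimes>\<^sub>M circle_measure. cmod (snd x) = 1"
proof (rule tc.AE_pair_measure)
  show "{x \<in> space (time_measure T \<Otimes>\<^sub>M circle_measure). cmod (snd x) = 1}
      \<in> sets (time_measure T \<Otimes>\<^sub>M circle_measure)"
    by measurable
qed (simp add: AE_circle_norm)

lemma AE_time_less: "AE s in time_measure T. s < T"
proof -
  have "AE s in lborel. s \<noteq> T" by (rule AE_lborel_singleton)
  then show ?thesis by (auto simp: AE_restrict_space_iff elim!: eventually_mono)
qed

abbreviation control_measure :: "complex set \<Rightarrow> real \<Rightarrow> (real \<times> complex) measure" where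
  "control_measure \<omega> T \<equiv> time_measure T \<Otimes>\<^sub>M restrict_space circle_measure \<omega>"

lemma control_measure_eq:
  "\<omega> \<in> sets borel \<Longrightarrow>
    control_measure \<omega> T = restrict_space (time_measure T \<Otimes>\<^sub>M circle_measure) ({0..T} \<times> \<omega>)"
  by (subst pair_restrict_space_right) (simp_all add: space_restrict_space)

lemma times_sets_time_circle:
  assumes "\<omega> \<in> sets borel"
  shows "{0..T} \<times> \<omega> \<in> sets (time_measure T \<Otimes>\<^sub>M circle_measure)"
proof -
  have "{0..T} \<in> sets (time_measure T)" by (simp add: sets_restrict_space_iff)
  then show ?thesis using assms by (intro pair_measureI) auto
qed

definition zero_ext :: "complex set \<Rightarrow> (real \<times> complex \<Rightarrow> complex) \<Rightarrow> real \<times> complex \<Rightarrow> complex" where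
  "zero_ext \<omega> u x = (if snd x \<in> \<omega> then u x else 0)"

lemma
  assumes \<omega>: "\<omega> \<in> sets borel" and u: "u \<in> L2_space (control_measure \<omega> T)"
  shows zero_ext_L2: "zero_ext \<omega> u \<in> L2_space (time_measure T \<Otimes>\<^sub>M circle_measure)"
    and zero_ext_integral:
      "(\<integral>x. zero_ext \<omega> u x * w x \<partial>(time_measure T \<Otimes>\<^sub>M circle_measure)) = (\<integral>x. u x * w x \<partial>control_measure \<omega> T)"
proof -
  let ?M = "time_measure T \<Otimes>\<^sub>M circle_measure" and ?A = "{0..T} \<times> \<omega>"
  have A: "?A \<inter> space ?M \<in> sets ?M" using times_sets_time_circle[OF \<omega>] by (simp add: Times_Int_Times)
  have um: "u \<in> borel_measurable (restrict_space ?M ?A)"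
    and ui: "integrable (restrict_space ?M ?A) (\<lambda>x. (cmod (u x))\<^sup>2)"
    using u by (simp_all add: control_measure_eq[OF \<omega>] L2_space_def)
  have "(\<lambda>x. indicator ?A x *\<^sub>R u x) \<in> borel_measurable ?M"
    using um A by (simp add: borel_measurable_restrict_space_iff)
  moreover have "indicator ?A x *\<^sub>R u x = zero_ext \<omega> u x" if "x \<in> space ?M" for x
    using that by (auto simp: zero_ext_def split: prod.splits)
  ultimately have m: "zero_ext \<omega> u \<in> borel_measurable ?M"
    using measurable_cong[of ?M "\<lambda>x. indicator ?A x *\<^sub>R u x" "zero_ext \<omega> u" borel] by blast
  have "integrable ?M (\<lambda>x. indicator ?A x *\<^sub>R (cmod (u x))\<^sup>2)"
    using ui A by (simp add: integrable_restrict_space)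
  also have "?this \<longleftrightarrow> integrable ?M (\<lambda>x. (cmod (zero_ext \<omega> u x))\<^sup>2)"
    by (rule Bochner_Integration.integrable_cong) (auto simp: zero_ext_def)
  finally show "zero_ext \<omega> u \<in> L2_space ?M" using m by (intro L2_spaceI)
  have "(\<integral>x. u x * w x \<partial>control_measure \<omega> T) = (\<integral>x. indicator ?A x *\<^sub>R (u x * w x) \<partial>?M)"
    using A by (simp add: control_measure_eq[OF \<omega>] integral_restrict_space)
  also have "\<dots> = (\<integral>x. zero_ext \<omega> u x * w x \<partial>?M)"
    by (rule Bochner_Integration.integral_cong) (auto simp: zero_ext_def)
  finally show "(\<integral>x. zero_ext \<omega> u x * w x \<partial>?M) = (\<integral>x. u x * w x \<partial>control_measure \<omega> T)" by simp
qed

text \<open>Tonelli. On a null set of times a section may fail to be square integrable, so later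
  statements about sections hold for almost every time only.\<close>

lemma L2_sections:
  assumes v: "v \<in> L2_space (time_measure T \<Otimes>\<^sub>M circle_measure)"
  shows "AE s in time_measure T. (\<lambda>\<xi>. v (s, \<xi>)) \<in> L2_space circle_measure"
    and "(\<integral>\<^sup>+s. ennreal (normsq circle_measure (\<lambda>\<xi>. v (s, \<xi>))) \<partial>time_measure T)
      = ennreal (normsq (time_measure T \<Otimes>\<^sub>M circle_measure) v)"
proof -
  have [measurable]: "v \<in> borel_measurable (time_measure T \<Otimes>\<^sub>M circle_measure)"
    using v by (rule L2_measurable)
  have i: "integrable (time_measure T \<Otimes>\<^sub>M circle_measure) (\<lambda>x. (cmod (v x))\<^sup>2)"
    using v by (rule L2_integrable_sq)
  have "AE s in time_measure T. integrable circle_measure (\<lambda>\<xi>. (cmod (v (s, \<xi>)))\<^sup>2)"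
    using tc.AE_integrable_fst'[OF i] by simp
  moreover have "(\<lambda>\<xi>. v (s, \<xi>)) \<in> borel_measurable circle_measure" if "s \<in> space (time_measure T)" for s
    using that by measurable
  ultimately show ae: "AE s in time_measure T. (\<lambda>\<xi>. v (s, \<xi>)) \<in> L2_space circle_measure"
    by (auto simp: L2_space_def AE_space)
  have "ennreal (normsq (time_measure T \<Otimes>\<^sub>M circle_measure) v)
      = (\<integral>\<^sup>+s. \<integral>\<^sup>+\<xi>. ennreal ((cmod (v (s, \<xi>)))\<^sup>2) \<partial>circle_measure \<partial>time_measure T)"
    unfolding L2_nn_integral[OF v, symmetric]
    by (rule circle.nn_integral_fst[symmetric]) measurable
  also have "\<dots> = (\<integral>\<^sup>+s. ennreal (normsq circle_measure (\<lambda>\<xi>. v (s, \<xi>))) \<partial>time_measure T)"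
    using ae by (intro nn_integral_cong_AE) (auto simp: L2_nn_integral)
  finally show "(\<integral>\<^sup>+s. ennreal (normsq circle_measure (\<lambda>\<xi>. v (s, \<xi>))) \<partial>time_measure T)
      = ennreal (normsq (time_measure T \<Otimes>\<^sub>M circle_measure) v)" by simp
qed

lemma measurable_fourier_coeff_section [measurable (raw)]:
  assumes [measurable]: "v \<in> borel_measurable (M \<Otimes>\<^sub>M circle_measure)"
  shows "(\<lambda>s. fourier_coeff (\<lambda>\<xi>. v (s, \<xi>)) n) \<in> borel_measurable M"
  unfolding fourier_coeff_def by measurable

lemma AE_cong_eq: "AE x in M. P x \<longleftrightarrow> Q x \<Longrightarrow> (AE x in M. P x) \<longleftrightarrow> (AE x in M. Q x)"
  by (auto elim: AE_mp intro: AE_I2)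

lemma fourier_coeff_bound:
  assumes f: "f \<in> L2_space circle_measure"
  shows "cmod (fourier_coeff f n) \<le> sqrt (normsq circle_measure f)"
proof -
  have "1 * (cmod (fourier_coeff f n))\<^sup>2 \<le> 2 * pi * (cmod (fourier_coeff f n))\<^sup>2"
    using pi_gt3 by (intro mult_right_mono) auto
  also have "\<dots> \<le> normsq circle_measure f" using Bessel[OF f, of "{n}"] by simp
  finally show ?thesis by (intro real_le_rsqrt) simp
qed

lemma power_L2: "(\<lambda>\<zeta>. \<zeta> ^ n) \<in> L2_space circle_measure"
  using powi_L2[of "int n"] by simp

text \<open>Absolute summability bounds the partial sums uniformly on the circle, so their
  coefficients pass to the limit by dominated convergence; each fixed coefficient is eventually
  constant in \<open>N\<close>.\<close>

lemma fourier_coeff_power_series: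
  assumes c: "summable (\<lambda>n. cmod (c n))"
  shows "integrable circle_measure (\<lambda>\<zeta>. \<Sum>n. c n * \<zeta> ^ n)"
    and "fourier_coeff (\<lambda>\<zeta>. \<Sum>n. c n * \<zeta> ^ n) m = (if 0 \<le> m then c (nat m) else 0)"
proof -
  have lim: "(\<lambda>N. \<Sum>n<N. c n * \<zeta> ^ n) \<longlonglongrightarrow> (\<Sum>n. c n * \<zeta> ^ n)"
    and bd: "cmod (\<Sum>n<N. c n * \<zeta> ^ n) \<le> (\<Sum>n. cmod (c n))" if "cmod \<zeta> = 1" for \<zeta> N
  proof -
    have "summable (\<lambda>n. cmod (c n * \<zeta> ^ n))" using that c by (simp add: norm_mult norm_power)
    then have "summable (\<lambda>n. c n * \<zeta> ^ n)" by (rule summable_norm_cancel)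
    then show "(\<lambda>N. \<Sum>n<N. c n * \<zeta> ^ n) \<longlonglongrightarrow> (\<Sum>n. c n * \<zeta> ^ n)" by (rule summable_LIMSEQ)
    have "cmod (\<Sum>n<N. c n * \<zeta> ^ n) \<le> (\<Sum>n<N. cmod (c n * \<zeta> ^ n))" by (rule norm_sum)
    also have "\<dots> = (\<Sum>n<N. cmod (c n))" using that by (simp add: norm_mult norm_power)
    also have "\<dots> \<le> (\<Sum>n. cmod (c n))" using c by (intro sum_le_suminf) auto
    finally show "cmod (\<Sum>n<N. c n * \<zeta> ^ n) \<le> (\<Sum>n. cmod (c n))" .
  qed
  have *: "(\<lambda>N. \<integral>\<zeta>. (\<Sum>n<N. c n * \<zeta> ^ n) * \<zeta> powi k \<partial>circle_measure)
      \<longlonglongrightarrow> (\<integral>\<zeta>. (\<Sum>n. c n * \<zeta> ^ n) * \<zeta> powi k \<partial>circle_measure)" for k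
  proof (rule integral_dominated_convergence[where w="\<lambda>_. \<Sum>n. cmod (c n)"])
    show "AE \<zeta> in circle_measure. (\<lambda>N. (\<Sum>n<N. c n * \<zeta> ^ n) * \<zeta> powi k) \<longlonglongrightarrow> (\<Sum>n. c n * \<zeta> ^ n) * \<zeta> powi k"
      using AE_circle_norm by eventually_elim (intro tendsto_intros lim)
    show "AE \<zeta> in circle_measure. norm ((\<Sum>n<N. c n * \<zeta> ^ n) * \<zeta> powi k) \<le> (\<Sum>n. cmod (c n))" for N
      using AE_circle_norm by eventually_elim (use bd in \<open>simp add: norm_mult\<close>)
  qed auto
  have int: "integrable circle_measure (\<lambda>\<zeta>. \<Sum>n<N. c n * \<zeta> ^ n)" for N
    by (intro integrable_circle_bounded[where B="\<Sum>n. cmod (c n)"] bd) auto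
  show "integrable circle_measure (\<lambda>\<zeta>. \<Sum>n. c n * \<zeta> ^ n)"
  proof (intro integrable_circle_bounded)
    show "norm (\<Sum>n. c n * \<zeta> ^ n) \<le> (\<Sum>n. cmod (c n))" if "cmod \<zeta> = 1" for \<zeta>
      using lim[OF that] bd[OF that] by (intro tendsto_upperbound[OF tendsto_norm[OF lim[OF that]]]) auto
  qed auto
  have "(\<lambda>N. fourier_coeff (\<lambda>\<zeta>. \<Sum>n<N. c n * \<zeta> ^ n) m) \<longlonglongrightarrow> fourier_coeff (\<lambda>\<zeta>. \<Sum>n. c n * \<zeta> ^ n) m"
    unfolding fourier_coeff_def by (intro tendsto_intros *)
  moreover have "(\<lambda>N. fourier_coeff (\<lambda>\<zeta>. \<Sum>n<N. c n * \<zeta> ^ n) m) \<longlonglongrightarrow> (if 0 \<le> m then c (nat m) else 0)"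
  proof (rule tendsto_eventually)
    show "\<forall>\<^sub>F N in sequentially. fourier_coeff (\<lambda>\<zeta>. \<Sum>n<N. c n * \<zeta> ^ n) m = (if 0 \<le> m then c (nat m) else 0)"
      using eventually_gt_at_top[of "nat m"]
    proof eventually_elim
      case (elim N)
      have "fourier_coeff (\<lambda>\<zeta>. \<Sum>n<N. c n * \<zeta> ^ n) m = (\<Sum>n<N. fourier_coeff (\<lambda>\<zeta>. c n * \<zeta> powi int n) m)"
        by (subst fourier_coeff_sum[symmetric]) (auto intro!: L2_circle_integrable L2_cmult power_L2)
      also have "\<dots> = (\<Sum>n<N. if m = int n then c n else 0)"
        by (intro sum.cong) (auto simp: fourier_coeff_cmult fourier_coeff_powi simp del: power_int_of_nat)
      also have "\<dots> = (if 0 \<le> m then c (nat m) else 0)"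
      proof (cases "0 \<le> m")
        case True
        then have "(\<Sum>n<N. if m = int n then c n else 0) = (\<Sum>n<N. if n = nat m then c n else 0)"
          by (intro sum.cong) auto
        then show ?thesis using elim True by simp
      next
        case False
        then show ?thesis by (intro trans[OF sum.neutral]) auto
      qed
      finally show ?case .
    qed
  qed
  ultimately show "fourier_coeff (\<lambda>\<zeta>. \<Sum>n. c n * \<zeta> ^ n) m = (if 0 \<le> m then c (nat m) else 0)"
    by (rule LIMSEQ_unique)
qed

lemma summable_exp_decay:
  assumes "\<And>n. cmod (c n) \<le> B" "0 < t"
  shows "summable (\<lambda>n. cmod (c n * complex_of_real (exp (- (real n * t)))))"
proof (rule summable_comparison_test'[where N=0])
  show "summable (\<lambda>n. B * exp (- t) ^ n)" using assms(2) by (intro summable_mult summable_geometric) auto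
  show "norm (cmod (c n * complex_of_real (exp (- (real n * t))))) \<le> B * exp (- t) ^ n" for n
    using assms(1)[of n] by (simp add: norm_mult mult_right_mono flip: exp_of_nat_mult)
qed

text \<open>Without negative frequencies the unordered sum over the integers becomes a power series
  in \<zeta>, whose measurability and coefficients are accessible.\<close>

lemma half_heat_semigroup_analytic:
  assumes neg: "\<And>n. n < 0 \<Longrightarrow> fourier_coeff f n = 0" and B: "\<And>n. cmod (fourier_coeff f n) \<le> B"
    and t: "0 < t" and \<zeta>: "cmod \<zeta> = 1"
  shows "half_heat_semigroup t f \<zeta> = (\<Sum>n. fourier_coeff f (int n) * complex_of_real (exp (- (real n * t))) * \<zeta> ^ n)"
proof -
  let ?g = "\<lambda>n. fourier_coeff f n * complex_of_real (exp (- \<bar>real_of_int n\<bar> * t)) * \<zeta> powi n"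
  have s: "summable (\<lambda>n. norm (?g (int n)))"
    using summable_exp_decay[of "\<lambda>n. fourier_coeff f (int n)" B t] B t \<zeta>
    by (simp add: norm_mult norm_power)
  have "half_heat_semigroup t f \<zeta> = infsum ?g (range int)"
    unfolding half_heat_semigroup_def
  proof (rule infsum_cong_neutral)
    fix n :: int assume "n \<in> UNIV - range int"
    then have "n < 0" by (metis DiffD2 rangeI nonneg_int_cases not_less)
    then show "?g n = 0" using neg by simp
  qed auto
  also have "\<dots> = infsum (?g \<circ> int) UNIV" by (rule infsum_reindex) simp
  also have "\<dots> = (\<Sum>n. ?g (int n))"
    using norm_summable_imp_has_sum[OF s summable_sums[OF summable_norm_cancel[OF s]]]
    by (simp add: infsumI o_def)
  finally show ?thesis by simp
qed

text \<open>\<open>riesz_proj\<close> picks its representative separately at each time, so the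
  Duhamel integrand is only almost everywhere equal to a Borel function of the time. For the
  completed measure that is enough.\<close>

lemma measurable_completion_AE:
  fixes f g :: "'a \<Rightarrow> 'b::topological_space"
  assumes g: "g \<in> borel_measurable M" and ae: "AE x in M. f x = g x"
  shows "f \<in> borel_measurable (completion M)"
proof (rule measurableI)
  fix A :: "'b set" assume A: "A \<in> sets borel"
  have 1: "Measurable.pred (completion M) (\<lambda>x. f x \<noteq> g x)"
    using ae by (intro sets_completion_AE) auto
  have 2: "Measurable.pred (completion M) (\<lambda>x. f x \<noteq> g x \<and> f x \<in> A)"
    using ae by (intro sets_completion_AE) auto
  have [measurable]: "g \<in> borel_measurable (completion M)" using g by (rule measurable_completion)
  have 3: "Measurable.pred (completion M) (\<lambda>x. g x \<in> A)" using A by measurable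
  have "Measurable.pred (completion M) (\<lambda>x. (g x \<in> A \<and> \<not> f x \<noteq> g x) \<or> (f x \<noteq> g x \<and> f x \<in> A))"
    using 1 2 3 by measurable
  also have "(\<lambda>x. (g x \<in> A \<and> \<not> f x \<noteq> g x) \<or> (f x \<noteq> g x \<and> f x \<in> A)) = (\<lambda>x. f x \<in> A)" by auto
  finally show "f -` A \<inter> space (completion M) \<in> sets (completion M)"
    by (simp add: pred_def vimage_def Int_def conj_commute)
qed simp

lemma set_integral_lebesgue_time:
  fixes f g :: "real \<Rightarrow> complex"
  assumes g: "g \<in> borel_measurable (time_measure T)" and ae: "AE s in time_measure T. f s = g s"
  shows "(LINT s:{0..T}|lebesgue. f s) = (\<integral>s. g s \<partial>time_measure T)"
proof -
  have g': "(\<lambda>s. indicator {0..T} s *\<^sub>R g s) \<in> borel_measurable lborel"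
    using g by (simp add: borel_measurable_restrict_space_iff)
  have ae': "AE s in lborel. indicator {0..T} s *\<^sub>R f s = indicator {0..T} s *\<^sub>R g s"
    using ae by (auto simp: AE_restrict_space_iff indicator_def elim!: eventually_mono)
  have "(LINT s:{0..T}|lebesgue. f s) = (\<integral>s. indicator {0..T} s *\<^sub>R g s \<partial>lebesgue)"
    unfolding set_lebesgue_integral_def
    by (rule integral_cong_AE)
      (use ae' g' in \<open>auto intro: measurable_completion_AE[OF g'] measurable_completion AE_completion\<close>)
  also have "\<dots> = (\<integral>s. indicator {0..T} s *\<^sub>R g s \<partial>lborel)" by (rule integral_completion[OF g'])
  also have "\<dots> = (\<integral>s. g s \<partial>time_measure T)" by (simp add: integral_restrict_space)
  finally show ?thesis .
qed

section \<open>Duhamel's formula in Fourier coefficients\<close>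

context
  fixes T :: real and v :: "real \<times> complex \<Rightarrow> complex"
  assumes T: "0 < T" and v: "v \<in> L2_space (time_measure T \<Otimes>\<^sub>M circle_measure)"
begin

text \<open>The n-th coefficient of the Duhamel integrand at time \<open>s\<close>. At
  \<open>s = T\<close> the heat factor gives no decay, so it is replaced by 0; this changes a null
  set of times.\<close>

private definition "w n s = fourier_coeff (\<lambda>\<xi>. v (s, \<xi>)) (int n) *
  (if s < T then complex_of_real (exp (- (real n * (T - s)))) else 0)"

text \<open>A jointly Borel version of the Duhamel integrand in (s, \<zeta>).\<close>

private definition "Q x = (\<Sum>n. w n (fst x) * snd x ^ n)"

private lemma v_meas: "v \<in> borel_measurable (time_measure T \<Otimes>\<^sub>M circle_measure)"
  using v by (rule L2_measurable)

private lemma w_meas: "w n \<in> borel_measurable (time_measure T)"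
proof -
  note [measurable] = v_meas
  have "(\<lambda>s. if s < T then complex_of_real (exp (- (real n * (T - s)))) else 0) \<in> borel_measurable (time_measure T)"
    by (rule measurable_restrict_space1) measurable
  then show ?thesis unfolding w_def by measurable
qed

private lemma Q_meas: "Q \<in> borel_measurable (time_measure T \<Otimes>\<^sub>M circle_measure)"
  unfolding Q_def using w_meas by measurable

private lemma w_summable:
  assumes "(\<lambda>\<xi>. v (s, \<xi>)) \<in> L2_space circle_measure"
  shows "summable (\<lambda>n. cmod (w n s))"
proof (cases "s < T")
  case True
  then show ?thesis
    using summable_exp_decay[OF fourier_coeff_bound[OF assms], of "T - s" int] by (simp add: w_def)
qed (simp add: w_def)

text \<open>The heat factors are at most 1, so by Bessel every partial sum has, at almost every
  time, norm at most that of the section of \<open>v\<close>. Fatou passes to the full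
  series.\<close>

private lemma Q_L2: "Q \<in> L2_space (time_measure T \<Otimes>\<^sub>M circle_measure)"
proof -
  note [measurable] = v_meas w_meas Q_meas
  let ?M = "time_measure T \<Otimes>\<^sub>M circle_measure"
  define q where "q N x = (\<Sum>n<N. w n (fst x) * snd x ^ n)" for N :: nat and x
  have [measurable]: "q N \<in> borel_measurable ?M" for N unfolding q_def by measurable
  have le: "(\<integral>\<^sup>+x. ennreal ((cmod (q N x))\<^sup>2) \<partial>?M) \<le> ennreal (normsq ?M v)" for N
  proof -
    have "(\<integral>\<^sup>+x. ennreal ((cmod (q N x))\<^sup>2) \<partial>?M)
        = (\<integral>\<^sup>+s. \<integral>\<^sup>+\<xi>. ennreal ((cmod (q N (s, \<xi>)))\<^sup>2) \<partial>circle_measure \<partial>time_measure T)"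
      by (rule circle.nn_integral_fst[symmetric]) measurable
    also have "\<dots> \<le> (\<integral>\<^sup>+s. ennreal (normsq circle_measure (\<lambda>\<xi>. v (s, \<xi>))) \<partial>time_measure T)"
    proof (rule nn_integral_mono_AE)
      show "AE s in time_measure T. (\<integral>\<^sup>+\<xi>. ennreal ((cmod (q N (s, \<xi>)))\<^sup>2) \<partial>circle_measure)
          \<le> ennreal (normsq circle_measure (\<lambda>\<xi>. v (s, \<xi>)))"
        using L2_sections(1)[OF v]
      proof eventually_elim
        case (elim s)
        define c where "c k = w (nat k) s" for k :: int
        have qc: "q N (s, \<xi>) = (\<Sum>k\<in>int ` {..<N}. c k * \<xi> powi k)" for \<xi>
          by (simp add: q_def c_def sum.reindex)
        have "(\<integral>\<^sup>+\<xi>. ennreal ((cmod (q N (s, \<xi>)))\<^sup>2) \<partial>circle_measure)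
            = ennreal (2 * pi * (\<Sum>k\<in>int ` {..<N}. (cmod (c k))\<^sup>2))"
          unfolding qc L2_nn_integral[OF trig_L2] by (subst normsq_trig) auto
        also have "2 * pi * (\<Sum>k\<in>int ` {..<N}. (cmod (c k))\<^sup>2)
            \<le> 2 * pi * (\<Sum>k\<in>int ` {..<N}. (cmod (fourier_coeff (\<lambda>\<xi>. v (s, \<xi>)) k))\<^sup>2)"
        proof (intro mult_left_mono sum_mono power_mono)
          fix k assume k: "k \<in> int ` {..<N}"
          show "cmod (c k) \<le> cmod (fourier_coeff (\<lambda>\<xi>. v (s, \<xi>)) k)"
            using k by (auto simp: c_def w_def norm_mult intro!: mult_left_le)
        qed auto
        also have "\<dots> \<le> normsq circle_measure (\<lambda>\<xi>. v (s, \<xi>))" by (rule Bessel[OF elim]) simp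
        finally show ?case by (simp add: ennreal_leI)
      qed
    qed
    finally show ?thesis by (simp add: L2_sections(2)[OF v])
  qed
  have lim: "AE x in ?M. (\<lambda>N. q N x) \<longlonglongrightarrow> Q x"
  proof -
    have "AE s in time_measure T. AE \<xi> in circle_measure. Cauchy (\<lambda>N. q N (s, \<xi>))"
      using L2_sections(1)[OF v]
    proof eventually_elim
      case (elim s)
      show ?case using AE_circle_norm
      proof eventually_elim
        case (elim \<xi>)
        then have "summable (\<lambda>n. cmod (w n s * \<xi> ^ n))"
          using w_summable[OF \<open>(\<lambda>\<xi>. v (s, \<xi>)) \<in> L2_space circle_measure\<close>] by (simp add: norm_mult norm_power)
        from summable_LIMSEQ[OF summable_norm_cancel[OF this]] show ?case
          unfolding q_def fst_conv snd_conv by (rule LIMSEQ_imp_Cauchy)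
      qed
    qed
    then have "AE x in ?M. Cauchy (\<lambda>N. q N x)"
      by (intro tc.AE_pair_measure) measurable
    then show ?thesis
    proof eventually_elim
      case (elim x)
      then have "summable (\<lambda>n. w n (fst x) * snd x ^ n)"
        by (simp add: summable_iff_convergent q_def Cauchy_convergent_iff)
      from summable_LIMSEQ[OF this] show ?case by (simp add: q_def Q_def)
    qed
  qed
  show ?thesis
    by (rule L2_Fatou(1)[OF _ _ lim, where B="normsq ?M v"])
      (use L2_space_nnI[OF _ le] in auto)
qed

private lemma E_meas:
  "(\<lambda>x. (complex_of_real (exp (fst x)) * snd x) ^ n) \<in> borel_measurable (time_measure T \<Otimes>\<^sub>M circle_measure)"
proof -
  have "(\<lambda>s. complex_of_real (exp s)) \<in> borel_measurable (time_measure T)"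
    by (rule measurable_restrict_space1) measurable
  from measurable_compose[OF measurable_fst this] show ?thesis by measurable
qed

private definition "R \<zeta> = (\<integral>s. Q (s, \<zeta>) \<partial>time_measure T)"

private lemma R_integrable: "integrable circle_measure R"
  unfolding R_def
  by (rule tc.integrable_snd) (simp add: L2_integrable[OF finite_time_circle Q_L2])

private lemma R_coeff:
  "fourier_coeff R m = (if 0 \<le> m then \<integral>s. w (nat m) s \<partial>time_measure T else 0)"
proof -
  note [measurable] = w_meas Q_meas
  let ?M = "time_measure T \<Otimes>\<^sub>M circle_measure"
  have "integrable ?M (\<lambda>x. Q x * snd x powi (- m))"
  proof (rule Bochner_Integration.integrable_bound[OF L2_integrable[OF finite_time_circle Q_L2]])
    show "AE x in ?M. norm (Q x * snd x powi (- m)) \<le> norm (Q x)"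
      using AE_time_circle_norm by eventually_elim (simp add: norm_mult)
  qed measurable
  then have i: "integrable ?M (\<lambda>(s, \<zeta>). Q (s, \<zeta>) * \<zeta> powi (- m))"
    by (simp add: case_prod_unfold)
  have "complex_of_real (2 * pi) * fourier_coeff R m
      = (\<integral>\<zeta>. (\<integral>s. Q (s, \<zeta>) * \<zeta> powi (- m) \<partial>time_measure T) \<partial>circle_measure)"
    unfolding R_def by (simp add: fourier_coeff_def)
  also have "\<dots> = (\<integral>s. (\<integral>\<zeta>. Q (s, \<zeta>) * \<zeta> powi (- m) \<partial>circle_measure) \<partial>time_measure T)"
    by (rule tc.Fubini_integral[OF i])
  also have "\<dots> = (\<integral>s. complex_of_real (2 * pi) * (if 0 \<le> m then w (nat m) s else 0) \<partial>time_measure T)"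
  proof (rule integral_cong_AE)
    show "AE s in time_measure T. (\<integral>\<zeta>. Q (s, \<zeta>) * \<zeta> powi (- m) \<partial>circle_measure)
        = complex_of_real (2 * pi) * (if 0 \<le> m then w (nat m) s else 0)"
      using L2_sections(1)[OF v]
    proof eventually_elim
      case (elim s)
      have "(\<integral>\<zeta>. Q (s, \<zeta>) * \<zeta> powi (- m) \<partial>circle_measure)
          = complex_of_real (2 * pi) * fourier_coeff (\<lambda>\<zeta>. \<Sum>n. w n s * \<zeta> ^ n) m"
        unfolding integral_mult_powi Q_def by simp
      then show ?case
        by (simp only: fourier_coeff_power_series(2)[OF w_summable[OF elim]])
    qed
    show "(\<lambda>s. complex_of_real (2 * pi) * (if 0 \<le> m then w (nat m) s else 0)) \<in> borel_measurable (time_measure T)"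
      by (cases "0 \<le> m") simp_all
  qed measurable
  also have "\<dots> = complex_of_real (2 * pi) * (if 0 \<le> m then \<integral>s. w (nat m) s \<partial>time_measure T else 0)"
    by (cases "0 \<le> m") simp_all
  finally show ?thesis by simp
qed

private lemma duhamel_eq:
  "AE \<zeta> in circle_measure. (LINT s:{0..T}|lebesgue.
      half_heat_semigroup (T - s) (riesz_proj (\<lambda>\<xi>. v (s, \<xi>))) \<zeta>) = R \<zeta>"
  using AE_circle_norm
proof eventually_elim
  case (elim \<zeta>)
  show ?case unfolding R_def
  proof (rule set_integral_lebesgue_time)
    show "(\<lambda>s. Q (s, \<zeta>)) \<in> borel_measurable (time_measure T)" using Q_meas by measurable
    show "AE s in time_measure T. half_heat_semigroup (T - s) (riesz_proj (\<lambda>\<xi>. v (s, \<xi>))) \<zeta> = Q (s, \<zeta>)"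
      using AE_time_less L2_sections(1)[OF v]
    proof eventually_elim
      case s: (elim s)
      show ?case
        using s riesz_proj(2)[OF s(2)]
        by (subst half_heat_semigroup_analytic[OF _ fourier_coeff_bound[OF riesz_proj(1)[OF s(2)]] _ elim])
          (auto simp: Q_def w_def)
    qed
  qed
qed

text \<open>Both terms have nonnegative frequencies only, so their sum vanishes almost everywhere
  iff every coefficient does. Multiplying the n-th one by \<open>exp (n T)\<close> turns the heat
  factor \<open>exp (- n (T - s))\<close> into \<open>exp (n s)\<close>; hence the powers of
  \<open>exp s * \<xi>\<close>.\<close>

lemma duhamel_vanishes_iff:
  assumes f: "f \<in> L2_space circle_measure" and neg: "\<And>n. n < 0 \<Longrightarrow> fourier_coeff f n = 0"
  shows "(AE \<zeta> in circle_measure. half_heat_semigroup T f \<zeta> + (LINT s:{0..T}|lebesgue.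
      half_heat_semigroup (T - s) (riesz_proj (\<lambda>\<xi>. v (s, \<xi>))) \<zeta>) = 0) \<longleftrightarrow>
    (\<forall>n. complex_of_real (2 * pi) * fourier_coeff f (int n) =
      - (\<integral>x. v x * cnj ((complex_of_real (exp (fst x)) * snd x) ^ n) \<partial>(time_measure T \<Otimes>\<^sub>M circle_measure)))"
proof -
  note [measurable] = v_meas w_meas E_meas
  let ?M = "time_measure T \<Otimes>\<^sub>M circle_measure"
  define c where "c n = fourier_coeff f (int n) * complex_of_real (exp (- (real n * T)))" for n
  define F where "F \<zeta> = (\<Sum>n. c n * \<zeta> ^ n)" for \<zeta>
  have sc: "summable (\<lambda>n. cmod (c n))"
    unfolding c_def by (rule summable_exp_decay[OF fourier_coeff_bound[OF f] T])
  have F: "integrable circle_measure F" "\<And>m. fourier_coeff F m = (if 0 \<le> m then c (nat m) else 0)"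
    unfolding F_def by (rule fourier_coeff_power_series[OF sc])+
  have [measurable]: "F \<in> borel_measurable circle_measure" "R \<in> borel_measurable circle_measure"
    using F(1) R_integrable by auto
  have "AE \<zeta> in circle_measure. half_heat_semigroup T f \<zeta> = F \<zeta>"
    using AE_circle_norm
    by eventually_elim
      (simp add: half_heat_semigroup_analytic[OF neg fourier_coeff_bound[OF f] T] F_def c_def)
  then have "AE \<zeta> in circle_measure. (half_heat_semigroup T f \<zeta> + (LINT s:{0..T}|lebesgue.
      half_heat_semigroup (T - s) (riesz_proj (\<lambda>\<xi>. v (s, \<xi>))) \<zeta>) = 0) \<longleftrightarrow> (F \<zeta> + R \<zeta> = 0)"
    using duhamel_eq by eventually_elim simp
  then have "(AE \<zeta> in circle_measure. half_heat_semigroup T f \<zeta> + (LINT s:{0..T}|lebesgue.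
      half_heat_semigroup (T - s) (riesz_proj (\<lambda>\<xi>. v (s, \<xi>))) \<zeta>) = 0)
    \<longleftrightarrow> (AE \<zeta> in circle_measure. F \<zeta> + R \<zeta> = 0)"
    by (rule AE_cong_eq)
  also have "\<dots> \<longleftrightarrow> (\<forall>m. fourier_coeff (\<lambda>\<zeta>. F \<zeta> + R \<zeta>) m = 0)"
  proof
    assume "AE \<zeta> in circle_measure. F \<zeta> + R \<zeta> = 0"
    then have "fourier_coeff (\<lambda>\<zeta>. F \<zeta> + R \<zeta>) m = fourier_coeff (\<lambda>\<zeta>. 0) m" for m
      by (intro fourier_coeff_cong_AE) measurable
    then show "\<forall>m. fourier_coeff (\<lambda>\<zeta>. F \<zeta> + R \<zeta>) m = 0" by (simp add: fourier_coeff_def)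
  next
    assume "\<forall>m. fourier_coeff (\<lambda>\<zeta>. F \<zeta> + R \<zeta>) m = 0"
    then show "AE \<zeta> in circle_measure. F \<zeta> + R \<zeta> = 0"
      by (intro fourier_coeff_unique Bochner_Integration.integrable_add F R_integrable) auto
  qed
  also have "\<dots> \<longleftrightarrow> (\<forall>m. (if 0 \<le> m then c (nat m) + (\<integral>s. w (nat m) s \<partial>time_measure T) else 0) = 0)"
    by (simp add: fourier_coeff_add[OF F(1) R_integrable] F(2) R_coeff)
  also have "\<dots> \<longleftrightarrow> (\<forall>n. c n + (\<integral>s. w n s \<partial>time_measure T) = 0)"
    by (metis nat_int of_nat_0_le_iff)
  also have "\<dots> \<longleftrightarrow> (\<forall>n. complex_of_real (2 * pi) * fourier_coeff f (int n) =
      - (\<integral>x. v x * cnj ((complex_of_real (exp (fst x)) * snd x) ^ n) \<partial>?M))"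
  proof (intro iff_allI)
    fix n
    have "(\<lambda>x. cnj ((complex_of_real (exp (fst x)) * snd x) ^ n) * v x) \<in> L2_space ?M"
    proof (rule L2_bounded_mult(1)[OF v])
      show "(\<lambda>x. cnj ((complex_of_real (exp (fst x)) * snd x) ^ n)) \<in> borel_measurable ?M"
        by measurable
      show "AE x in ?M. cmod (cnj ((complex_of_real (exp (fst x)) * snd x) ^ n)) \<le> exp T ^ n"
        using AE_time_circle_norm AE_space[of ?M]
        by eventually_elim (auto simp: norm_mult norm_power intro!: power_mono)
    qed
    then have i: "integrable ?M (\<lambda>x. v x * cnj ((complex_of_real (exp (fst x)) * snd x) ^ n))"
      using L2_integrable[OF finite_time_circle] by (simp add: mult.commute)
    have "(\<integral>x. v x * cnj ((complex_of_real (exp (fst x)) * snd x) ^ n) \<partial>?M)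
        = (\<integral>s. (\<integral>\<xi>. v (s, \<xi>) * cnj ((complex_of_real (exp s) * \<xi>) ^ n) \<partial>circle_measure) \<partial>time_measure T)"
      using tc.integral_fst'[OF i] by simp
    also have "\<dots> = (\<integral>s. complex_of_real (2 * pi) * (complex_of_real (exp (real n * T)) * w n s) \<partial>time_measure T)"
    proof (rule integral_cong_AE)
      show "AE s in time_measure T. (\<integral>\<xi>. v (s, \<xi>) * cnj ((complex_of_real (exp s) * \<xi>) ^ n) \<partial>circle_measure)
          = complex_of_real (2 * pi) * (complex_of_real (exp (real n * T)) * w n s)"
        using AE_time_less AE_space[of "time_measure T"]
      proof eventually_elim
        case (elim s)
        define g where "g \<xi> = v (s, \<xi>)" for \<xi>
        have [measurable]: "g \<in> borel_measurable borel"
          using elim(2) measurable_Pair2[OF v_meas elim(2)] by (simp add: g_def[abs_def] cong: measurable_cong_sets)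
        have "(\<integral>\<xi>. g \<xi> * cnj ((complex_of_real (exp s) * \<xi>) ^ n) \<partial>circle_measure)
            = (\<integral>\<xi>. complex_of_real (exp (real n * s)) * (g \<xi> * \<xi> powi (- int n)) \<partial>circle_measure)"
        proof (rule integral_cong_AE)
          show "AE \<xi> in circle_measure. g \<xi> * cnj ((complex_of_real (exp s) * \<xi>) ^ n)
              = complex_of_real (exp (real n * s)) * (g \<xi> * \<xi> powi (- int n))"
            using AE_circle_norm
          proof eventually_elim
            case (elim \<xi>)
            have "cnj (\<xi> ^ n) = \<xi> powi (- int n)" using cnj_powi_circle[OF elim, of "int n"] by simp
            then show ?case
              by (simp add: power_mult_distrib exp_of_nat_mult)
          qed
        qed measurable
        also have "\<dots> = complex_of_real (2 * pi) * (complex_of_real (exp (real n * s)) * fourier_coeff g (int n))"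
          using integral_mult_powi[of g "- int n"] by simp
        \<comment> \<open>The growing weight is expressed through the decaying one in
          \<open>w\<close>. The factor \<open>exp (n T)\<close> does not depend on \<open>s\<close>
          and cancels against the one hidden in \<open>c n\<close>.\<close>
        also have "exp (real n * s) = exp (real n * T) * exp (- (real n * (T - s)))"
          by (simp flip: exp_add add: algebra_simps)
        finally show ?case using elim by (simp add: w_def g_def)
      qed
    qed measurable
    also have "\<dots> = complex_of_real (2 * pi) * (complex_of_real (exp (real n * T)) * (\<integral>s. w n s \<partial>time_measure T))"
      by simp
    finally have I: "(\<integral>x. v x * cnj ((complex_of_real (exp (fst x)) * snd x) ^ n) \<partial>?M)
      = complex_of_real (2 * pi) * (complex_of_real (exp (real n * T)) * (\<integral>s. w n s \<partial>time_measure T))" .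
    have "fourier_coeff f (int n) = complex_of_real (exp (real n * T)) * c n"
      by (simp add: c_def exp_minus)
    then show "(c n + (\<integral>s. w n s \<partial>time_measure T) = 0) \<longleftrightarrow> (complex_of_real (2 * pi) * fourier_coeff f (int n) =
      - (\<integral>x. v x * cnj ((complex_of_real (exp (fst x)) * snd x) ^ n) \<partial>?M))"
      unfolding I by (simp add: eq_neg_iff_add_eq_0 flip: distrib_left)
  qed
  finally show ?thesis .
qed

end


section \<open>Duality between controls and polynomials\<close>

lemma normsq_add_expand:
  assumes f: "f \<in> L2_space M" and g: "g \<in> L2_space M"
  shows "normsq M (\<lambda>x. f x + g x) = normsq M f + normsq M g + 2 * Re (\<integral>x. f x * cnj (g x) \<partial>M)"
  using normsq_diff_expand[OF f L2_uminus[OF g]] by simp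

lemma L2_inner_cnj:
  "(\<integral>x. f x * cnj (g x) \<partial>M) = cnj (\<integral>x. g x * cnj (f x) \<partial>M)"
  using Bochner_Integration.integral_cnj[of M "\<lambda>x. g x * cnj (f x)"] by (simp add: mult.commute)

text \<open>Riesz representation on the (not necessarily closed) range of a linear map \<open>P\<close>: a sequence
  minimising \<open>\<parallel>P p\<parallel>\<^sup>2 - 2 Re (L p)\<close> is Cauchy, and its limit represents \<open>L\<close>.\<close>

theorem Riesz_representation:
  fixes P :: "complex poly \<Rightarrow> 'a \<Rightarrow> complex" and L :: "complex poly \<Rightarrow> complex"
  assumes P: "\<And>p. P p \<in> L2_space M"
    and P_add: "\<And>p q x. P (p + q) x = P p x + P q x" and P_smult: "\<And>c p x. P (smult c p) x = c * P p x"
    and L_add: "\<And>p q. L (p + q) = L p + L q" and L_smult: "\<And>c p. L (smult c p) = c * L p"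
    and bound: "\<And>p. cmod (L p) \<le> C * sqrt (normsq M (P p))"
  shows "\<exists>v \<in> L2_space M. \<forall>p. L p = (\<integral>x. P p x * v x \<partial>M)"
proof -
  define J where "J p = normsq M (P p) - 2 * Re (L p)" for p
  \<comment> \<open>The boundedness of \<open>L\<close> enters here, through 2 C x \<le> C^2 +
    x^2.\<close>
  have J_lower: "- C\<^sup>2 \<le> J p" for p
  proof -
    have "2 * Re (L p) \<le> 2 * cmod (L p)" using complex_Re_le_cmod[of "L p"] by simp
    also have "\<dots> \<le> 2 * C * sqrt (normsq M (P p))" using bound[of p] by simp
    also have "\<dots> \<le> C\<^sup>2 + (sqrt (normsq M (P p)))\<^sup>2" by (rule sum_squares_bound)
    finally show ?thesis by (simp add: J_def)
  qed
  have bdd: "bdd_below (range J)" using J_lower by (intro bdd_belowI[where m="- C\<^sup>2"]) auto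
  define m where "m = (INF p. J p)"
  have m_le: "m \<le> J p" for p unfolding m_def by (rule cINF_lower[OF bdd]) simp
  have "\<exists>p. J p < m + inverse (real (Suc k))" for k
    using cINF_less_iff[OF _ bdd, of "m + inverse (real (Suc k))"] unfolding m_def by simp
  then obtain p where p: "\<And>k. J (p k) < m + inverse (real (Suc k))" by metis
  \<comment> \<open>Variation of \<open>J\<close> at \<open>r\<close> in the direction of
    \<open>q\<close>: the linear part measures how far \<open>cnj (P r)\<close> is from representing
    \<open>L\<close> on \<open>q\<close>.\<close>
  have JX: "J (r + smult c q) = J r + (cmod c)\<^sup>2 * normsq M (P q)
      + 2 * Re (c * ((\<integral>x. P q x * cnj (P r x) \<partial>M) - L q))" for r q c
  proof -
    have "normsq M (P (r + smult c q)) = normsq M (\<lambda>x. c * P q x + P r x)"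
      by (simp add: P_add P_smult fun_eq_iff[symmetric] add.commute normsq_def)
    also have "\<dots> = (cmod c)\<^sup>2 * normsq M (P q) + normsq M (P r) + 2 * Re (c * (\<integral>x. P q x * cnj (P r x) \<partial>M))"
      using normsq_add_expand[OF L2_cmult(1)[OF P, of c q] P[of r]] L2_cmult(2)[OF P, of c q]
      by (simp add: mult.assoc)
    finally show ?thesis by (simp add: J_def L_add L_smult right_diff_distrib)
  qed
  \<comment> \<open>Parallelogram law: the midpoint of \<open>r\<close> and \<open>q\<close> cannot
    fall below the infimum \<open>m\<close>.\<close>
  have par: "normsq M (\<lambda>x. P r x - P q x) \<le> 2 * (J r - m) + 2 * (J q - m)" for r q
  proof -
    let ?I = "Re (\<integral>x. P r x * cnj (P q x) \<partial>M)"
    let ?h = "smult (1/2) (r + q)"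
    have "normsq M (P ?h) = normsq M (\<lambda>x. (1/2) * (P r x + P q x))"
      by (simp add: P_add P_smult normsq_def)
    also have "\<dots> = (cmod (1/2))\<^sup>2 * normsq M (\<lambda>x. P r x + P q x)"
      by (rule L2_cmult(2)) (rule L2_add(1)[OF P P])
    also have "\<dots> = (normsq M (P r) + normsq M (P q) + 2 * ?I) / 4"
      by (simp add: normsq_add_expand[OF P P] power2_eq_square norm_divide)
    finally have "normsq M (P ?h) = (normsq M (P r) + normsq M (P q) + 2 * ?I) / 4" .
    moreover have "Re (L ?h) = (Re (L r) + Re (L q)) / 2" by (simp add: L_add L_smult)
    ultimately have "4 * J ?h = normsq M (P r) + normsq M (P q) + 2 * ?I - 4 * Re (L r) - 4 * Re (L q)"
      by (simp add: J_def field_simps)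
    moreover have "4 * m \<le> 4 * J ?h" using m_le[of ?h] by simp
    ultimately show ?thesis
      unfolding normsq_diff_expand[OF P P] J_def by simp
  qed
  define d where "d k = inverse (real (Suc k))" for k
  note p = p[folded d_def]
  have inv0: "(\<lambda>k. d k) \<longlonglongrightarrow> 0" unfolding d_def by (rule LIMSEQ_inverse_real_of_nat)
  have inv_le: "d k \<le> d N" if "N \<le> k" for k N
    using that unfolding d_def by (simp add: le_imp_inverse_le)
  have "\<exists>F \<in> L2_space M. (\<lambda>n. normsq M (\<lambda>x. F x - P (p n) x)) \<longlonglongrightarrow> 0"
  proof (rule L2_complete[OF P])
    fix e :: real assume "0 < e"
    then obtain N where N: "d N < e / 4" using reals_Archimedean[of "e / 4"] unfolding d_def by auto
    have "normsq M (\<lambda>x. P (p j) x - P (p k) x) \<le> e" if "N \<le> j" "N \<le> k" for j k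
    proof -
      have "J (p j) - m \<le> e / 4" "J (p k) - m \<le> e / 4"
        using p[of j] p[of k] inv_le[OF that(1)] inv_le[OF that(2)] N by linarith+
      then have "2 * (J (p j) - m) + 2 * (J (p k) - m) \<le> 2 * (e / 4) + 2 * (e / 4)"
        by (intro add_mono mult_left_mono) auto
      also have "\<dots> = e" by simp
      finally have "2 * (J (p j) - m) + 2 * (J (p k) - m) \<le> e" .
      with par[of "p j" "p k"] show ?thesis by (rule order_trans)
    qed
    then show "\<exists>N. \<forall>m\<ge>N. \<forall>n\<ge>N. normsq M (\<lambda>x. P (p m) x - P (p n) x) \<le> e" by blast
  qed
  then obtain F where F: "F \<in> L2_space M" and lim: "(\<lambda>n. normsq M (\<lambda>x. F x - P (p n) x)) \<longlonglongrightarrow> 0"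
    by (rule bexE)
  have "L q = (\<integral>x. P q x * cnj (F x) \<partial>M)" for q
  proof -
    define D where "D k = (\<integral>x. P q x * cnj (P (p k) x) \<partial>M) - L q" for k
    define N where "N = normsq M (P q)"
    have N: "0 \<le> N" by (simp add: N_def)
    have D_le: "(cmod (D k))\<^sup>2 \<le> (N + 1) * d k" for k
    proof -
      \<comment> \<open>The optimal step would be 1 / N; \<open>N + 1\<close> also covers
        \<open>N = 0\<close>. With \<open>t * N \<le> 1\<close> the quadratic term eats at most half
        of the linear gain.\<close>
      define t where "t = 1 / (N + 1)"
      have t: "0 < t" "t * N \<le> 1" using N by (auto simp: t_def field_simps)
      let ?c = "complex_of_real (- t) * cnj (D k)"
      have "m \<le> J (p k + smult ?c q)" by (rule m_le)
      also have "\<dots> = J (p k) + (t * cmod (D k))\<^sup>2 * N + 2 * Re (?c * D k)"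
        unfolding JX N_def[symmetric] D_def[symmetric] using t(1) by (simp add: norm_mult)
      also have "?c * D k = complex_of_real (- (t * (cmod (D k))\<^sup>2))"
        using complex_norm_square[of "D k"] by (simp add: mult_ac)
      finally have "m \<le> J (p k) + (t * N) * (t * (cmod (D k))\<^sup>2) - 2 * (t * (cmod (D k))\<^sup>2)"
        by (simp add: power_mult_distrib power2_eq_square algebra_simps)
      moreover have "(t * N) * (t * (cmod (D k))\<^sup>2) \<le> 1 * (t * (cmod (D k))\<^sup>2)"
        using t by (intro mult_right_mono) auto
      ultimately have "t * (cmod (D k))\<^sup>2 \<le> d k" using p[of k] by linarith
      then show ?thesis using N by (simp add: t_def field_simps)
    qed
    have "(\<lambda>k. (N + 1) * d k) \<longlonglongrightarrow> (N + 1) * 0" by (intro tendsto_intros inv0)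
    then have "(\<lambda>k. (N + 1) * d k) \<longlonglongrightarrow> 0" by simp
    then have "(\<lambda>k. (cmod (D k))\<^sup>2) \<longlonglongrightarrow> 0"
      by (rule Lim_null_comparison[OF always_eventually[OF allI], rotated]) (simp add: D_le)
    from tendsto_real_sqrt[OF this] have "D \<longlonglongrightarrow> 0" by (simp add: tendsto_norm_zero_iff)
    moreover have "D \<longlonglongrightarrow> (\<integral>x. P q x * cnj (F x) \<partial>M) - L q"
    proof -
      have "(\<lambda>k. \<integral>x. P (p k) x * cnj (P q x) \<partial>M) \<longlonglongrightarrow> (\<integral>x. F x * cnj (P q x) \<partial>M)"
        by (rule L2_tendsto_integral[OF P F L2_cnj[OF P] lim])
      from tendsto_cnj[OF this] have "(\<lambda>k. \<integral>x. P q x * cnj (P (p k) x) \<partial>M) \<longlonglongrightarrow> (\<integral>x. P q x * cnj (F x) \<partial>M)"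
        by (simp only: L2_inner_cnj[of M "P q"])
      then show ?thesis unfolding D_def by (intro tendsto_intros)
    qed
    ultimately show ?thesis using LIMSEQ_unique by fastforce
  qed
  then show ?thesis using L2_cnj[OF F] by (intro bexI[of _ "\<lambda>x. cnj (F x)"]) auto
qed

lemma hardy_coeff:
  assumes "f \<in> hardy_H2"
  shows "f \<in> L2_space circle_measure" and "n < 0 \<Longrightarrow> fourier_coeff f n = 0"
proof -
  show f: "f \<in> L2_space circle_measure" using assms by (simp add: hardy_H2_def)
  from assms obtain h where h: "h \<in> L2_space circle_measure" "AE \<zeta> in circle_measure. f \<zeta> = riesz_proj h \<zeta>"
    by (auto simp: hardy_H2_def)
  have "fourier_coeff f n = fourier_coeff (riesz_proj h) n"
    by (rule fourier_coeff_cong_AE[OF L2_measurable[OF f] L2_measurable[OF riesz_proj(1)[OF h(1)]] h(2)])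
  then show "n < 0 \<Longrightarrow> fourier_coeff f n = 0" by (simp add: riesz_proj(2)[OF h(1)])
qed

lemma null_controllable_iff_moments:
  assumes f: "f \<in> hardy_H2" and T: "0 < T" and \<omega>: "\<omega> \<in> sets borel"
  shows "f \<in> null_controllable_H2 \<omega> T \<longleftrightarrow> (\<exists>u \<in> L2_space (control_measure \<omega> T).
    \<forall>n. complex_of_real (2 * pi) * fourier_coeff f (int n) =
      - (\<integral>x. u x * cnj ((complex_of_real (exp (fst x)) * snd x) ^ n) \<partial>control_measure \<omega> T))"
proof -
  have "(AE \<zeta> in circle_measure. half_heat_semigroup T f \<zeta> + (LINT s:{0..T}|lebesgue.
      half_heat_semigroup (T - s) (riesz_proj (\<lambda>\<xi>. if \<xi> \<in> \<omega> then u (s, \<xi>) else 0)) \<zeta>) = 0) \<longleftrightarrow>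
    (\<forall>n. complex_of_real (2 * pi) * fourier_coeff f (int n) =
      - (\<integral>x. u x * cnj ((complex_of_real (exp (fst x)) * snd x) ^ n) \<partial>control_measure \<omega> T))"
    if u: "u \<in> L2_space (control_measure \<omega> T)" for u
    using duhamel_vanishes_iff[OF T zero_ext_L2[OF \<omega> u] hardy_coeff[OF f]]
    by (simp only: zero_ext_integral[OF \<omega> u]) (simp add: zero_ext_def)
  then show ?thesis using f by (auto simp: null_controllable_H2_def)
qed

text \<open>Polar coordinates with logarithmic radius: for an arc \<omega>, the control region is
  mapped onto \<open>Omega \<omega> T\<close> up to null sets.\<close>

definition exp_coord :: "real \<times> complex \<Rightarrow> complex" where
  "exp_coord x = complex_of_real (exp (fst x)) * snd x"

lemma AE_control:
  assumes \<omega>: "\<omega> \<in> sets borel"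
  shows "AE x in control_measure \<omega> T. cmod (snd x) = 1 \<and> 0 \<le> fst x \<and> fst x \<le> T \<and> snd x \<in> \<omega>"
proof -
  have A: "{0..T} \<times> \<omega> \<inter> space (time_measure T \<Otimes>\<^sub>M circle_measure) \<in> sets (time_measure T \<Otimes>\<^sub>M circle_measure)"
    using times_sets_time_circle[OF \<omega>] by (simp add: Times_Int_Times)
  show ?thesis
    unfolding control_measure_eq[OF \<omega>] AE_restrict_space_iff[OF A]
    using AE_time_circle_norm[of T] by eventually_elim auto
qed

lemma exp_coord_measurable [measurable]:
  assumes "\<omega> \<in> sets borel"
  shows "exp_coord \<in> borel_measurable (control_measure \<omega> T)"
proof -
  have 1: "(\<lambda>s. complex_of_real (exp s)) \<in> borel_measurable (time_measure T)"
    by (rule measurable_restrict_space1) measurable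
  have 2: "(\<lambda>\<xi>. \<xi>) \<in> borel_measurable (restrict_space circle_measure \<omega>)"
    by (rule measurable_restrict_space1) measurable
  show ?thesis unfolding exp_coord_def[abs_def]
    by (rule borel_measurable_times[OF measurable_compose[OF measurable_fst 1] measurable_compose[OF measurable_snd 2]])
qed

lemma poly_measurable [measurable]: "poly p \<in> borel_measurable (borel :: complex measure)"
  by (intro borel_measurable_continuous_onI continuous_intros)

lemma finite_control_measure:
  assumes \<omega>: "\<omega> \<in> sets borel"
  shows "finite_measure (control_measure \<omega> T)"
  unfolding control_measure_eq[OF \<omega>]
  using times_sets_time_circle[OF \<omega>]
  by (intro finite_measure_restrict_space finite_time_circle) auto

lemma poly_exp_coord_L2:
  assumes \<omega>: "\<omega> \<in> sets borel"
  shows "(\<lambda>x. poly p (exp_coord x)) \<in> L2_space (control_measure \<omega> T)"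
proof -
  interpret finite_measure "control_measure \<omega> T" by (rule finite_control_measure[OF \<omega>])
  have "compact (cball (0::complex) (exp T))" by simp
  then have "bounded (poly p ` cball 0 (exp T))"
    by (intro compact_imp_bounded compact_continuous_image continuous_intros)
  then obtain B where "\<forall>z\<in>cball 0 (exp T). cmod (poly p z) \<le> B"
    by (auto simp: bounded_iff)
  then have B: "\<And>z. cmod z \<le> exp T \<Longrightarrow> cmod (poly p z) \<le> B" by auto
  have m: "(\<lambda>x. poly p (exp_coord x)) \<in> borel_measurable (control_measure \<omega> T)"
    using measurable_compose[OF exp_coord_measurable[OF \<omega>] poly_measurable] .
  have "AE x in control_measure \<omega> T. cmod (poly p (exp_coord x)) \<le> B"
    using AE_control[OF \<omega>] by eventually_elim (auto intro!: B simp: exp_coord_def norm_mult)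
  then have "AE x in control_measure \<omega> T. norm ((cmod (poly p (exp_coord x)))\<^sup>2) \<le> B\<^sup>2"
    by eventually_elim (simp add: power_mono)
  then have "integrable (control_measure \<omega> T) (\<lambda>x. (cmod (poly p (exp_coord x)))\<^sup>2)"
    by (rule integrable_const_bound) (intro borel_measurable_power measurable_compose[OF m borel_measurable_norm])
  then show ?thesis by (rule L2_spaceI[OF m])
qed

text \<open>Only coefficients of nonnegative index of \<open>f\<close> are seen by a polynomial.
  Functions with the same Riesz projection thus have the same pairing, which is how
  \<open>f0\<close> will be replaced by \<open>g\<close>.\<close>

lemma integral_poly_cnj:
  assumes f: "f \<in> L2_space circle_measure"
  shows "(\<integral>\<zeta>. poly p \<zeta> * cnj (f \<zeta>) \<partial>circle_measure)
    = complex_of_real (2 * pi) * (\<Sum>n\<le>degree p. coeff p n * cnj (fourier_coeff f (int n)))"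
proof -
  have eq: "poly p \<zeta> = (\<Sum>k\<in>int ` {..degree p}. coeff p (nat k) * \<zeta> powi k)" for \<zeta>
    by (simp add: poly_altdef sum.reindex)
  have "(\<integral>\<zeta>. poly p \<zeta> * cnj (f \<zeta>) \<partial>circle_measure) = cnj (\<integral>\<zeta>. f \<zeta> * cnj (poly p \<zeta>) \<partial>circle_measure)"
    by (rule L2_inner_cnj)
  also have "\<dots> = complex_of_real (2 * pi) * (\<Sum>k\<in>int ` {..degree p}. coeff p (nat k) * cnj (fourier_coeff f k))"
    unfolding eq inner_trig[OF f] by simp
  finally show ?thesis by (simp add: sum.reindex)
qed

lemma poly_circle_L2: "(\<lambda>\<zeta>. poly p \<zeta>) \<in> L2_space circle_measure"
  unfolding poly_altdef by (intro L2_sum L2_cmult power_L2)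

text \<open>In one direction, Cauchy-Schwarz against the control. In the other,
  \<open>Riesz_representation\<close> applied to the polynomials on the control region yields
  \<open>v\<close>; the control is \<open>- cnj v\<close>, and monomials recover the moment
  equations.\<close>

theorem null_controllable_iff_bounded:
  assumes f: "f \<in> hardy_H2" and T: "0 < T" and \<omega>: "\<omega> \<in> sets borel"
  shows "f \<in> null_controllable_H2 \<omega> T \<longleftrightarrow>
    (\<exists>C. \<forall>p. cmod (\<integral>\<zeta>. poly p \<zeta> * cnj (f \<zeta>) \<partial>circle_measure)
      \<le> C * sqrt (normsq (control_measure \<omega> T) (\<lambda>x. poly p (exp_coord x))))"
proof
  let ?M = "control_measure \<omega> T"
  note fL = hardy_coeff(1)[OF f]
  have EL: "(\<lambda>x. exp_coord x ^ n) \<in> L2_space ?M" for n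
    using poly_exp_coord_L2[OF \<omega>, of "monom 1 n" T] by (simp add: poly_monom)
  {
    assume "f \<in> null_controllable_H2 \<omega> T"
    then obtain u where u: "u \<in> L2_space ?M" and
      mom: "\<And>n. complex_of_real (2 * pi) * fourier_coeff f (int n) = - (\<integral>x. u x * cnj (exp_coord x ^ n) \<partial>?M)"
      unfolding null_controllable_iff_moments[OF f T \<omega>] exp_coord_def[symmetric] by (elim bexE) blast
    have "(\<integral>\<zeta>. poly p \<zeta> * cnj (f \<zeta>) \<partial>circle_measure) = - (\<integral>x. poly p (exp_coord x) * cnj (u x) \<partial>?M)" for p
    proof -
      have "(\<integral>\<zeta>. poly p \<zeta> * cnj (f \<zeta>) \<partial>circle_measure)
          = (\<Sum>n\<le>degree p. coeff p n * cnj (complex_of_real (2 * pi) * fourier_coeff f (int n)))"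
        unfolding integral_poly_cnj[OF fL] by (simp add: sum_distrib_left mult_ac)
      also have "\<dots> = - (\<Sum>n\<le>degree p. coeff p n * (\<integral>x. exp_coord x ^ n * cnj (u x) \<partial>?M))"
        by (simp only: mom complex_cnj_minus L2_inner_cnj[symmetric] mult_minus_right sum_negf)
      also have "(\<Sum>n\<le>degree p. coeff p n * (\<integral>x. exp_coord x ^ n * cnj (u x) \<partial>?M))
          = (\<integral>x. (\<Sum>n\<le>degree p. coeff p n * (exp_coord x ^ n * cnj (u x))) \<partial>?M)"
        using L2_mult_integrable[OF EL L2_cnj[OF u]] by simp
      finally show ?thesis by (simp add: poly_altdef sum_distrib_right mult.assoc)
    qed
    then show "\<exists>C. \<forall>p. cmod (\<integral>\<zeta>. poly p \<zeta> * cnj (f \<zeta>) \<partial>circle_measure)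
        \<le> C * sqrt (normsq ?M (\<lambda>x. poly p (exp_coord x)))"
      using L2_Cauchy_Schwarz_sqrt[OF poly_exp_coord_L2[OF \<omega>] L2_cnj[OF u]]
      by (intro exI[of _ "sqrt (normsq ?M u)"]) (simp add: mult.commute)
  next
    assume "\<exists>C. \<forall>p. cmod (\<integral>\<zeta>. poly p \<zeta> * cnj (f \<zeta>) \<partial>circle_measure)
      \<le> C * sqrt (normsq ?M (\<lambda>x. poly p (exp_coord x)))"
    then obtain C where C: "\<And>p. cmod (\<integral>\<zeta>. poly p \<zeta> * cnj (f \<zeta>) \<partial>circle_measure)
      \<le> C * sqrt (normsq ?M (\<lambda>x. poly p (exp_coord x)))" by blast
    have i: "integrable circle_measure (\<lambda>\<zeta>. poly p \<zeta> * cnj (f \<zeta>))" for p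
      by (intro L2_mult_integrable poly_circle_L2 L2_cnj fL)
    have "\<exists>v \<in> L2_space ?M. \<forall>p. (\<integral>\<zeta>. poly p \<zeta> * cnj (f \<zeta>) \<partial>circle_measure) = (\<integral>x. poly p (exp_coord x) * v x \<partial>?M)"
      by (rule Riesz_representation[OF poly_exp_coord_L2[OF \<omega>] _ _ _ _ C])
        (simp_all add: ring_distribs i mult.assoc)
    then obtain v where v: "v \<in> L2_space ?M" and
      rep: "\<And>p. (\<integral>\<zeta>. poly p \<zeta> * cnj (f \<zeta>) \<partial>circle_measure) = (\<integral>x. poly p (exp_coord x) * v x \<partial>?M)" by blast
    have "complex_of_real (2 * pi) * fourier_coeff f (int n)
        = - (\<integral>x. - cnj (v x) * cnj (exp_coord x ^ n) \<partial>?M)" for n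
    proof -
      have "(\<Sum>k\<le>degree (monom (1::complex) n). coeff (monom 1 n) k * cnj (fourier_coeff f (int k))) = cnj (fourier_coeff f (int n))"
      proof -
        have "(\<Sum>k\<le>n. coeff (monom (1::complex) n) k * cnj (fourier_coeff f (int k)))
            = (\<Sum>k\<le>n. if k = n then cnj (fourier_coeff f (int k)) else 0)"
          by (intro sum.cong) auto
        then show ?thesis by (simp add: degree_monom_eq)
      qed
      then have "complex_of_real (2 * pi) * cnj (fourier_coeff f (int n)) = (\<integral>x. exp_coord x ^ n * v x \<partial>?M)"
        using rep[of "monom 1 n"] unfolding integral_poly_cnj[OF fL] by (simp only: poly_monom mult_1_left)
      then have "cnj (complex_of_real (2 * pi) * cnj (fourier_coeff f (int n))) = (\<integral>x. cnj (exp_coord x ^ n * v x) \<partial>?M)"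
        unfolding Bochner_Integration.integral_cnj by (rule arg_cong)
      then show ?thesis by (simp add: mult.commute)
    qed
    then show "f \<in> null_controllable_H2 \<omega> T"
      unfolding null_controllable_iff_moments[OF f T \<omega>] exp_coord_def[symmetric]
      by (intro bexI[of _ "\<lambda>x. - cnj (v x)"] allI L2_uminus[OF L2_cnj[OF v]])
  }
qed


section \<open>Polar coordinates\<close>

text \<open>The change of variables takes place in \<open>real^2\<close>, with matrices as
  derivatives, and Tonelli on pairs of reals. This identification and \<open>lborel_vec2_eq\<close>
  link both with Lebesgue measure on \<open>complex\<close>.\<close>

lemma lborel_complex_eq:
  "(lborel :: complex measure) = distr (lborel :: (real^2) measure) borel (\<lambda>v. Complex (v $ 1) (v $ 2))"
proof (rule lborel_eqI)
  fix l u :: complex assume le: "\<And>b. b \<in> Basis \<Longrightarrow> l \<bullet> b \<le> u \<bullet> b"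
  then have le': "Re l \<le> Re u" "Im l \<le> Im u" using le[of 1] le[of \<i>] by simp_all
  have m: "(\<lambda>v::real^2. Complex (v $ 1) (v $ 2)) \<in> borel_measurable borel"
    unfolding complex_eq by (intro borel_measurable_continuous_onI continuous_intros)
  have eq: "(\<lambda>v::real^2. Complex (v $ 1) (v $ 2)) -` box l u = box (vector [Re l, Im l]) (vector [Re u, Im u])"
    by (auto simp: mem_box_cart forall_2 in_box_complex_iff)
  have "emeasure lborel (box (vector [Re l, Im l] :: real^2) (vector [Re u, Im u]))
      = (\<Prod>b\<in>Basis. (vector [Re u, Im u] - vector [Re l, Im l] :: real^2) \<bullet> b)"
    using le' forall_2[of "\<lambda>i. (vector [Re l, Im l] :: real^2) $ i \<le> (vector [Re u, Im u] :: real^2) $ i"]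
    by (intro emeasure_lborel_box) (auto simp: Basis_vec_def inner_axis)
  also have "\<dots> = (\<Prod>b\<in>Basis. (u - l) \<bullet> b)"
    by (simp add: Basis_vec_def Basis_complex_def UNIV_2 inner_axis axis_eq_axis mult.commute)
  finally show "emeasure (distr (lborel :: (real^2) measure) borel (\<lambda>v. Complex (v $ 1) (v $ 2))) (box l u)
      = (\<Prod>b\<in>Basis. (u - l) \<bullet> b)"
    using m by (simp add: emeasure_distr eq)
qed simp

lemma vector_2_axis: "(vector [x, y] :: real^2) = x *\<^sub>R axis 1 1 + y *\<^sub>R axis 2 1"
  by (simp add: vec_eq_iff forall_2 axis_def)

lemma measurable_vec2:
  "(\<lambda>x::real \<times> real. vector [fst x, snd x] :: real^2) \<in> borel_measurable (lborel \<Otimes>\<^sub>M lborel)"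
  unfolding vector_2_axis by measurable

lemma lborel_vec2_eq:
  "(lborel :: (real^2) measure) = distr (lborel \<Otimes>\<^sub>M lborel) borel (\<lambda>x. vector [fst x, snd x])"
proof (rule lborel_eqI)
  fix l u :: "real^2" assume L: "\<And>b. b \<in> Basis \<Longrightarrow> l \<bullet> b \<le> u \<bullet> b"
  have le: "l $ 1 \<le> u $ 1" "l $ 2 \<le> u $ 2"
    using L[of "axis 1 1"] L[of "axis 2 1"] by (simp_all add: inner_axis axis_in_Basis_iff)
  note m = measurable_vec2
  have eq: "(\<lambda>x::real \<times> real. vector [fst x, snd x] :: real^2) -` box l u = {l $ 1<..<u $ 1} \<times> {l $ 2<..<u $ 2}"
    by (auto simp: mem_box_cart forall_2)
  have "emeasure (lborel \<Otimes>\<^sub>M lborel) ({l $ 1<..<u $ 1} \<times> {l $ 2<..<u $ 2})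
      = ennreal (u $ 1 - l $ 1) * ennreal (u $ 2 - l $ 2)"
    using le by (simp add: lborel.emeasure_pair_measure_Times)
  also have "\<dots> = (\<Prod>b\<in>Basis. (u - l) \<bullet> b)"
    using le by (simp add: Basis_vec_def UNIV_2 inner_axis axis_eq_axis ennreal_mult mult.commute)
  finally show "emeasure (distr (lborel \<Otimes>\<^sub>M lborel) borel (\<lambda>x. vector [fst x, snd x])) (box l u)
      = (\<Prod>b\<in>Basis. (u - l) \<bullet> b)"
    using m by (simp add: emeasure_distr eq space_pair_measure)
qed simp

lemma nn_integral_vec2:
  fixes f :: "real^2 \<Rightarrow> ennreal"
  assumes "f \<in> borel_measurable borel"
  shows "(\<integral>\<^sup>+v. f v \<partial>lborel) = (\<integral>\<^sup>+x. f (vector [fst x, snd x]) \<partial>(lborel \<Otimes>\<^sub>M lborel))"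
  by (subst lborel_vec2_eq) (simp add: nn_integral_distr measurable_vec2 assms)

lemma measurable_complex2: "(\<lambda>v::real^2. Complex (v $ 1) (v $ 2)) \<in> borel_measurable borel"
  unfolding complex_eq by (intro borel_measurable_continuous_onI continuous_intros)

lemma cis_eq_imp_eq:
  assumes "cis x = cis y" "\<bar>x - y\<bar> < 2 * pi"
  shows "x = y"
proof -
  have "cis (x - y) = 1" using assms(1) by (simp add: cis_divide[symmetric])
  then have "cos (x - y) = 1" by (metis cis.sel(1) one_complex.sel(1))
  then obtain n :: int where n: "x - y = of_int n * 2 * pi" by (auto simp: cos_one_2pi_int)
  then have "\<bar>of_int n :: real\<bar> * (2 * pi) < 1 * (2 * pi)" using assms(2) by (simp add: abs_mult)
  then have "\<bar>of_int n :: real\<bar> < 1" using pi_gt_zero mult_less_cancel_right_pos[of "2 * pi"] by (simp del: mult_less_cancel_right)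
  then have "n = 0" by linarith
  with n show ?thesis by simp
qed

lemma exp_cis_inj:
  assumes "complex_of_real (exp s) * cis x = complex_of_real (exp s') * cis x'" "\<bar>x - x'\<bar> < 2 * pi"
  shows "s = s' \<and> x = x'"
proof -
  have "cmod (complex_of_real (exp s) * cis x) = cmod (complex_of_real (exp s') * cis x')"
    using assms(1) by simp
  then have "s = s'" by (simp add: norm_mult)
  with assms have "cis x = cis x'" by simp
  with assms(2) \<open>s = s'\<close> show ?thesis using cis_eq_imp_eq by blast
qed

text \<open>The first coordinate is the logarithm of the modulus, so the sector is the image of a
  rectangle under the exponential and the area element is \<open>exp (2 s)\<close>.\<close>

definition polar_sector :: "real \<Rightarrow> real \<Rightarrow> real \<Rightarrow> real \<Rightarrow> complex set" where
  "polar_sector s1 s2 a b = (\<lambda>x. complex_of_real (exp (fst x)) * cis (snd x)) ` ({s1<..<s2} \<times> {a<..<b})"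

text \<open>An open set is a countable union of compact boxes, and continuous images of these are
  compact.\<close>

lemma open_image_borel:
  fixes f :: "'a::euclidean_space \<Rightarrow> 'b::t2_space"
  assumes "open S" "continuous_on S f"
  shows "f ` S \<in> sets borel"
proof -
  obtain D where D: "countable D" "D \<subseteq> Pow S" "\<And>X. X \<in> D \<Longrightarrow> \<exists>a b. X = cbox a b" "\<Union>D = S"
    using open_countable_Union_open_cbox[OF assms(1)] by metis
  have "f ` S = (\<Union>X\<in>D. f ` X)" using D(4) by auto
  also have "\<dots> \<in> sets borel"
  proof (rule sets.countable_UN'[OF D(1)])
    show "(\<lambda>X. f ` X) ` D \<subseteq> sets borel"
    proof clarify
      fix X assume X: "X \<in> D"
      then have "compact X" using D(3) compact_cbox by blast
      moreover have "continuous_on X f" using X D(2) by (intro continuous_on_subset[OF assms(2)]) auto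
      ultimately show "f ` X \<in> sets borel" by (intro borel_compact compact_continuous_image)
    qed
  qed
  finally show ?thesis .
qed

lemma polar_sector_borel [measurable]: "polar_sector s1 s2 a b \<in> sets borel"
  unfolding polar_sector_def by (intro open_image_borel open_Times open_greaterThanLessThan continuous_intros)

lemma open_arc_borel [measurable]: "open_arc a b \<in> sets borel"
  unfolding open_arc_def by (intro open_image_borel open_greaterThanLessThan continuous_intros)

text \<open>Change of variables for the exponential written in \<open>real^2\<close>; its Jacobian
  determinant is the squared modulus \<open>exp (2 s)\<close>. It is injective because the angle
  runs over an open interval of length at most 2 \<pi>.\<close>

lemma emeasure_polar_sector:
  assumes ab: "b - a \<le> 2 * pi" and A: "A \<in> sets borel"
  shows "emeasure lborel (A \<inter> polar_sector s1 s2 a b) =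
    (\<integral>\<^sup>+x. ennreal (exp (2 * fst x)) * indicator A (complex_of_real (exp (fst x)) * cis (snd x))
        * indicator ({s1<..<s2} \<times> {a<..<b}) x \<partial>(lborel \<Otimes>\<^sub>M lborel))"
proof -
  define c where "c v = Complex (v $ 1) (v $ 2)" for v :: "real^2"
  define g :: "real^2 \<Rightarrow> real^2" where
    "g v = (exp (v $ 1) * cos (v $ 2)) *\<^sub>R axis 1 1 + (exp (v $ 1) * sin (v $ 2)) *\<^sub>R axis 2 1" for v
  define g' :: "real^2 \<Rightarrow> real^2 \<Rightarrow> real^2" where
    "g' v h = (exp (v $ 1) * (cos (v $ 2) * h $ 1 - sin (v $ 2) * h $ 2)) *\<^sub>R axis 1 1
      + (exp (v $ 1) * (sin (v $ 2) * h $ 1 + cos (v $ 2) * h $ 2)) *\<^sub>R axis 2 1" for v h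
  have cg: "c (g v) = complex_of_real (exp (v $ 1)) * cis (v $ 2)" for v
    by (simp add: c_def g_def axis_def complex_eq_iff)
  have c_inj: "c v = c w \<Longrightarrow> v = w" for v w
    by (simp add: c_def vec_eq_iff forall_2)
  have cm [measurable]: "c \<in> borel_measurable borel" unfolding c_def by (rule measurable_complex2)
  have [measurable]: "(\<lambda>v. c (g v)) \<in> borel_measurable borel"
    unfolding cg by (intro borel_measurable_continuous_onI continuous_intros)
  define S where "S = {v :: real^2. v $ 1 \<in> {s1<..<s2} \<and> v $ 2 \<in> {a<..<b} \<and> c (g v) \<in> A}"
  have S_eq: "S = box (vector [s1, a]) (vector [s2, b]) \<inter> (\<lambda>v. c (g v)) -` A"
    by (auto simp: S_def mem_box_cart forall_2)
  have S_borel: "S \<in> sets borel"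
    unfolding S_eq using A measurable_sets[of "\<lambda>v. c (g v)" borel borel A] by auto
  have der: "(g has_derivative g' v) (at v within X)" for v X
  proof -
    have 1: "((\<lambda>v::real^2. v $ i) has_derivative (\<lambda>h. h $ i)) (at v within X)" for i
      by (rule bounded_linear_imp_has_derivative[OF bounded_linear_vec_nth])
    show ?thesis unfolding g_def g'_def
      by (rule derivative_eq_intros 1 refl)+ (simp add: algebra_simps)
  qed
  have det: "\<bar>det (matrix (g' v))\<bar> = exp (2 * v $ 1)" for v
  proof -
    have "det (matrix (g' v)) = exp (v $ 1) * exp (v $ 1) * (cos (v $ 2) * cos (v $ 2))
        + exp (v $ 1) * exp (v $ 1) * (sin (v $ 2) * sin (v $ 2))"
      by (simp add: det_2 matrix_def g'_def axis_def)
    also have "\<dots> = exp (v $ 1) * exp (v $ 1) * (cos (v $ 2) * cos (v $ 2) + sin (v $ 2) * sin (v $ 2))"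
      by (simp only: distrib_left)
    also have "cos (v $ 2) * cos (v $ 2) + sin (v $ 2) * sin (v $ 2) = 1"
      using sin_cos_squared_add2[of "v $ 2"] by (simp add: power2_eq_square)
    finally show ?thesis by (simp add: exp_add[symmetric])
  qed
  have inj: "inj_on g S"
  proof (rule inj_onI)
    fix v w assume vw: "v \<in> S" "w \<in> S" "g v = g w"
    then have "c (g v) = c (g w)" by simp
    then have "v $ 1 = w $ 1 \<and> v $ 2 = w $ 2"
      unfolding cg using vw(1,2) ab by (intro exp_cis_inj) (auto simp: S_def)
    then show "v = w" by (simp add: vec_eq_iff forall_2)
  qed
  have img: "c -` (A \<inter> polar_sector s1 s2 a b) = g ` S"
  proof
    show "g ` S \<subseteq> c -` (A \<inter> polar_sector s1 s2 a b)"
      by (force simp: S_def cg polar_sector_def)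
    show "c -` (A \<inter> polar_sector s1 s2 a b) \<subseteq> g ` S"
    proof
      fix v assume v: "v \<in> c -` (A \<inter> polar_sector s1 s2 a b)"
      then obtain s x where sx: "s \<in> {s1<..<s2}" "x \<in> {a<..<b}" "c v = complex_of_real (exp s) * cis x"
        by (auto simp: polar_sector_def)
      then have "c v = c (g (vector [s, x]))" by (simp add: cg)
      then have "v = g (vector [s, x])" by (rule c_inj)
      moreover have "vector [s, x] \<in> S" using v sx by (simp add: S_def cg)
      ultimately show "v \<in> g ` S" by blast
    qed
  qed
  have Sl: "S \<in> sets lebesgue" using S_borel by auto
  \<comment> \<open>Integrability is inherited from the closed rectangle, where the Jacobian is
    continuous.\<close>
  have "(\<lambda>v::real^2. exp (2 * v $ 1)) absolutely_integrable_on cbox (vector [s1, a]) (vector [s2, b])"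
    by (intro absolutely_integrable_continuous continuous_intros)
  then have "(\<lambda>v. exp (2 * v $ 1)) absolutely_integrable_on S"
    by (rule set_integrable_subset[OF _ Sl]) (use box_subset_cbox in \<open>auto simp: S_eq\<close>)
  then have int: "(\<lambda>v. \<bar>det (matrix (g' v))\<bar>) integrable_on S"
    unfolding det by (rule set_lebesgue_integral_eq_integral(1))
  define m where "m = integral S (\<lambda>v. \<bar>det (matrix (g' v))\<bar>)"
  have hi: "((\<lambda>v. \<bar>det (matrix (g' v))\<bar>) has_integral m) S"
    unfolding m_def using int by (rule integrable_integral)
  have gm: "g ` S \<in> lmeasurable" "measure lebesgue (g ` S) = m"
    using has_measure_differentiable_image[OF Sl der inj, of m] hi by auto
  have As: "A \<inter> polar_sector s1 s2 a b \<in> sets borel" using A by (auto intro: polar_sector_borel)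
  then have gS: "g ` S \<in> sets borel"
    using measurable_sets[OF cm As] unfolding img by simp
  have "emeasure lborel (A \<inter> polar_sector s1 s2 a b) = emeasure lborel (c -` (A \<inter> polar_sector s1 s2 a b))"
    using As unfolding lborel_complex_eq c_def[abs_def] by (subst emeasure_distr) (auto simp: measurable_complex2)
  also have "\<dots> = emeasure lborel (g ` S)" by (simp only: img)
  also have "\<dots> = emeasure lebesgue (g ` S)" using gS by (simp add: emeasure_completion)
  also have "\<dots> = ennreal m"
    using gm emeasure_eq_ennreal_measure[of lebesgue "g ` S"] by (auto simp: fmeasurable_def)
  also have "\<dots> = (\<integral>\<^sup>+v. ennreal (exp (2 * v $ 1)) * indicator S v \<partial>lborel)"
    using nn_integral_has_integral_lebesgue'[OF _ hi] by (simp add: det)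
  also have "\<dots> = (\<integral>\<^sup>+x. ennreal (exp (2 * fst x)) * indicator S (vector [fst x, snd x]) \<partial>(lborel \<Otimes>\<^sub>M lborel))"
    by (subst nn_integral_vec2) (use S_borel in \<open>auto intro!: borel_measurable_times measurable_compose[OF _ measurable_ennreal] borel_measurable_continuous_onI continuous_intros\<close>)
  also have "\<dots> = (\<integral>\<^sup>+x. ennreal (exp (2 * fst x)) * indicator A (complex_of_real (exp (fst x)) * cis (snd x))
        * indicator ({s1<..<s2} \<times> {a<..<b}) x \<partial>(lborel \<Otimes>\<^sub>M lborel))"
    by (intro nn_integral_cong) (auto simp: S_def cg indicator_def)
  finally show ?thesis .
qed

text \<open>\<open>emeasure_polar_sector\<close> says that Lebesgue measure on the sector is the
  image of a weighted measure on the rectangle. The integrals agree because the measures do.\<close>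

lemma nn_integral_polar_sector:
  fixes f :: "complex \<Rightarrow> ennreal"
  assumes ab: "b - a \<le> 2 * pi" and f: "f \<in> borel_measurable borel"
  shows "(\<integral>\<^sup>+z. f z * indicator (polar_sector s1 s2 a b) z \<partial>lborel) =
    (\<integral>\<^sup>+s. (\<integral>\<^sup>+x. ennreal (exp (2 * s)) * f (complex_of_real (exp s) * cis x)
        * indicator {a<..<b} x \<partial>lborel) * indicator {s1<..<s2} s \<partial>lborel)"
proof -
  let ?P = "lborel \<Otimes>\<^sub>M lborel :: (real \<times> real) measure"
  let ?g = "\<lambda>x::real \<times> real. complex_of_real (exp (fst x)) * cis (snd x)"
  let ?w = "\<lambda>x::real \<times> real. ennreal (exp (2 * fst x)) * indicator ({s1<..<s2} \<times> {a<..<b}) x"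
  note [measurable] = f
  have R [measurable]: "{s1<..<s2} \<times> {a<..<b} \<in> sets ?P" by (intro pair_measureI) auto
  have w [measurable]: "?w \<in> borel_measurable ?P" by measurable
  have g [measurable]: "?g \<in> borel_measurable ?P" by measurable
  have "density lborel (indicator (polar_sector s1 s2 a b)) = distr (density ?P ?w) borel ?g"
  proof (rule measure_eqI)
    fix A assume "A \<in> sets (density lborel (indicator (polar_sector s1 s2 a b)))"
    then have A [measurable]: "A \<in> sets borel" by simp
    have "emeasure (density lborel (indicator (polar_sector s1 s2 a b))) A = emeasure lborel (A \<inter> polar_sector s1 s2 a b)"
    proof -
      have "emeasure (density lborel (indicator (polar_sector s1 s2 a b))) A
          = (\<integral>\<^sup>+z. indicator (polar_sector s1 s2 a b) z * indicator A z \<partial>lborel)"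
        by (rule emeasure_density) auto
      also have "\<dots> = (\<integral>\<^sup>+z. indicator (A \<inter> polar_sector s1 s2 a b) z \<partial>lborel)"
        by (intro nn_integral_cong) (auto simp: indicator_def)
      finally show ?thesis by simp
    qed
    also have "\<dots> = (\<integral>\<^sup>+x. ?w x * indicator (?g -` A \<inter> space (density ?P ?w)) x \<partial>?P)"
      unfolding emeasure_polar_sector[OF ab A]
      by (intro nn_integral_cong) (auto simp: indicator_def space_pair_measure)
    also have "\<dots> = emeasure (distr (density ?P ?w) borel ?g) A"
      using measurable_sets[OF g A] by (subst emeasure_distr) (auto simp: emeasure_density)
    finally show "emeasure (density lborel (indicator (polar_sector s1 s2 a b))) A
      = emeasure (distr (density ?P ?w) borel ?g) A" .
  qed simp
  then have "(\<integral>\<^sup>+z. f z \<partial>density lborel (indicator (polar_sector s1 s2 a b))) = (\<integral>\<^sup>+z. f z \<partial>distr (density ?P ?w) borel ?g)"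
    by simp
  then have "(\<integral>\<^sup>+z. f z * indicator (polar_sector s1 s2 a b) z \<partial>lborel) = (\<integral>\<^sup>+x. ?w x * f (?g x) \<partial>?P)"
    by (simp add: nn_integral_density nn_integral_distr mult.commute)
  also have "\<dots> = (\<integral>\<^sup>+s. \<integral>\<^sup>+x. ?w (s, x) * f (?g (s, x)) \<partial>lborel \<partial>lborel)"
    by (rule lborel.nn_integral_fst[symmetric]) measurable
  also have "\<dots> = (\<integral>\<^sup>+s. (\<integral>\<^sup>+x. ennreal (exp (2 * s)) * f (complex_of_real (exp s) * cis x)
        * indicator {a<..<b} x \<partial>lborel) * indicator {s1<..<s2} s \<partial>lborel)"
  proof (rule nn_integral_cong)
    fix s :: real
    show "(\<integral>\<^sup>+x. ?w (s, x) * f (?g (s, x)) \<partial>lborel) = (\<integral>\<^sup>+x. ennreal (exp (2 * s)) * f (complex_of_real (exp s) * cis x)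
        * indicator {a<..<b} x \<partial>lborel) * indicator {s1<..<s2} s"
      by (cases "s \<in> {s1<..<s2}") (auto simp: indicator_times mult_ac)
  qed
  finally show ?thesis .
qed

lemma Omega_eq_polar_sector: "Omega (open_arc a b) T = polar_sector 0 T a b"
proof
  show "Omega (open_arc a b) T \<subseteq> polar_sector 0 T a b"
  proof
    fix z assume z: "z \<in> Omega (open_arc a b) T"
    then obtain x where x: "x \<in> {a<..<b}" "z / complex_of_real (cmod z) = cis x" and n: "1 < cmod z" "cmod z < exp T"
      by (auto simp: Omega_def open_arc_def)
    have "cmod z > 0" using n by linarith
    then have "exp (ln (cmod z)) = cmod z" by simp
    moreover have "z = complex_of_real (cmod z) * cis x"
      using x(2) \<open>cmod z > 0\<close> by (simp add: divide_eq_eq mult.commute)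
    ultimately have "z = complex_of_real (exp (ln (cmod z))) * cis x" by simp
    moreover have "0 < ln (cmod z)" using n by (intro ln_gt_zero)
    moreover have "ln (cmod z) < T" using n \<open>cmod z > 0\<close> ln_less_cancel_iff[of "cmod z" "exp T"] by simp
    ultimately show "z \<in> polar_sector 0 T a b"
      using x(1) unfolding polar_sector_def by (intro image_eqI[of _ _ "(ln (cmod z), x)"]) auto
  qed
  show "polar_sector 0 T a b \<subseteq> Omega (open_arc a b) T"
    by (auto simp: polar_sector_def Omega_def open_arc_def norm_mult)
qed

text \<open>The exponential is injective on the open rectangle of logarithmic coordinates, so the
  open mapping theorem applies.\<close>

lemma open_Omega:
  assumes ab: "b - a \<le> 2 * pi"
  shows "open (Omega (open_arc a b) T)"
proof -
  have "exp ` box (Complex 0 a) (Complex T b) = polar_sector 0 T a b"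
    unfolding polar_sector_def
  proof (intro equalityI subsetI)
    fix z assume "z \<in> exp ` box (Complex 0 a) (Complex T b)"
    then obtain w where w: "w \<in> box (Complex 0 a) (Complex T b)" "z = exp w" by blast
    then show "z \<in> (\<lambda>x. complex_of_real (exp (fst x)) * cis (snd x)) ` ({0<..<T} \<times> {a<..<b})"
      by (intro image_eqI[of _ _ "(Re w, Im w)"]) (auto simp: exp_eq_polar in_box_complex_iff)
  next
    fix z assume "z \<in> (\<lambda>x. complex_of_real (exp (fst x)) * cis (snd x)) ` ({0<..<T} \<times> {a<..<b})"
    then obtain s x where "s \<in> {0<..<T}" "x \<in> {a<..<b}" "z = complex_of_real (exp s) * cis x" by auto
    then show "z \<in> exp ` box (Complex 0 a) (Complex T b)"
      by (intro image_eqI[of _ _ "Complex s x"]) (auto simp: exp_eq_polar in_box_complex_iff)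
  qed
  moreover have "inj_on exp (box (Complex 0 a) (Complex T b))"
  proof (rule inj_onI)
    fix v w assume vw: "v \<in> box (Complex 0 a) (Complex T b)" "w \<in> box (Complex 0 a) (Complex T b)" "exp v = exp w"
    then have "Re v = Re w \<and> Im v = Im w"
      using ab by (intro exp_cis_inj) (auto simp: exp_eq_polar in_box_complex_iff)
    then show "v = w" by (simp add: complex_eq_iff)
  qed
  then have "open (exp ` box (Complex 0 a) (Complex T b))"
    by (intro open_mapping_thm3 holomorphic_intros) auto
  ultimately show ?thesis by (simp add: Omega_eq_polar_sector)
qed

text \<open>Cutting the circle at \<open>a\<close> makes the arc correspond to the interval (a, b);
  the end times 0 and \<open>T\<close> are null.\<close>

lemma nn_integral_control:
  fixes f :: "complex \<Rightarrow> ennreal"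
  assumes ab: "b - a < 2 * pi" and f: "f \<in> borel_measurable borel"
  shows "(\<integral>\<^sup>+x. f (exp_coord x) \<partial>control_measure (open_arc a b) T) =
    (\<integral>\<^sup>+s. (\<integral>\<^sup>+x. f (complex_of_real (exp s) * cis x) * indicator {a<..<b} x \<partial>lborel) * indicator {0<..<T} s \<partial>lborel)"
proof -
  note [measurable] = f
  let ?C = "restrict_space circle_measure (open_arc a b)"
  have "sigma_finite_measure ?C" by (intro sigma_finite_measure_restrict_space) auto
  then interpret C: sigma_finite_measure ?C .
  have arc: "cis x \<in> open_arc a b \<longleftrightarrow> x \<in> {a<..<b}" if "x \<in> {a..<a + 2 * pi}" for x
    using that ab cis_eq_imp_eq[of x] by (fastforce simp: open_arc_def)
  have "(\<integral>\<^sup>+x. f (exp_coord x) \<partial>control_measure (open_arc a b) T)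
      = (\<integral>\<^sup>+s. \<integral>\<^sup>+\<xi>. f (exp_coord (s, \<xi>)) \<partial>?C \<partial>time_measure T)"
    by (rule C.nn_integral_fst[symmetric]) (rule measurable_compose[OF exp_coord_measurable f], simp)
  also have "\<dots> = (\<integral>\<^sup>+s. (\<integral>\<^sup>+x. f (complex_of_real (exp s) * cis x) * indicator {a<..<b} x \<partial>lborel) \<partial>time_measure T)"
  proof (rule nn_integral_cong)
    fix s :: real
    have "(\<integral>\<^sup>+\<xi>. f (exp_coord (s, \<xi>)) \<partial>?C) = (\<integral>\<^sup>+\<xi>. f (complex_of_real (exp s) * \<xi>) * indicator (open_arc a b) \<xi> \<partial>circle_measure)"
      by (simp add: nn_integral_restrict_space exp_coord_def)
    also have "\<dots> = (\<integral>\<^sup>+x. f (complex_of_real (exp s) * cis x) * indicator (open_arc a b) (cis x) * indicator {a..<a + 2 * pi} x \<partial>lborel)"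
      by (rule circle_nn_integral) measurable
    also have "\<dots> = (\<integral>\<^sup>+x. f (complex_of_real (exp s) * cis x) * indicator {a<..<b} x \<partial>lborel)"
      using arc ab by (intro nn_integral_cong) (fastforce simp: indicator_def)
    finally show "(\<integral>\<^sup>+\<xi>. f (exp_coord (s, \<xi>)) \<partial>?C) = (\<integral>\<^sup>+x. f (complex_of_real (exp s) * cis x) * indicator {a<..<b} x \<partial>lborel)" .
  qed
  also have "\<dots> = (\<integral>\<^sup>+s. (\<integral>\<^sup>+x. f (complex_of_real (exp s) * cis x) * indicator {a<..<b} x \<partial>lborel) * indicator {0..T} s \<partial>lborel)"
    by (simp add: nn_integral_restrict_space)
  also have "\<dots> = (\<integral>\<^sup>+s. (\<integral>\<^sup>+x. f (complex_of_real (exp s) * cis x) * indicator {a<..<b} x \<partial>lborel) * indicator {0<..<T} s \<partial>lborel)"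
  proof (rule nn_integral_cong_AE)
    have "AE s in lborel. s \<noteq> 0 \<and> s \<noteq> T"
      using AE_lborel_singleton[of 0] AE_lborel_singleton[of T] by eventually_elim simp
    then show "AE s in lborel. (\<integral>\<^sup>+x. f (complex_of_real (exp s) * cis x) * indicator {a<..<b} x \<partial>lborel) * indicator {0..T} s
      = (\<integral>\<^sup>+x. f (complex_of_real (exp s) * cis x) * indicator {a<..<b} x \<partial>lborel) * indicator {0<..<T} s"
      by eventually_elim (auto simp: indicator_def)
  qed
  finally show ?thesis .
qed

lemma Omega_finite_measure: "emeasure lborel (Omega \<omega> T) < \<infinity>"
proof -
  have "emeasure lborel (Omega \<omega> T) \<le> emeasure lborel (cball (0::complex) (exp T))"
    by (intro emeasure_mono) (auto simp: Omega_def)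
  also have "\<dots> < \<infinity>" by (rule emeasure_bounded_finite) simp
  finally show ?thesis .
qed

lemma bergman_norm_nonneg [simp]: "0 \<le> bergman_norm U f"
  unfolding bergman_norm_def set_lebesgue_integral_def by (simp add: integral_nonneg_AE)

text \<open>A polynomial is bounded on the bounded set \<open>Omega\<close>, so the integral in
  \<open>bergman_norm\<close> is a genuine one and not the default value 0.\<close>

lemma bergman_norm_nn:
  assumes "\<omega> \<in> sets borel" and Om: "Omega \<omega> T \<in> sets borel"
  shows "ennreal ((bergman_norm (Omega \<omega> T) (poly p))\<^sup>2) = (\<integral>\<^sup>+z. ennreal ((cmod (poly p z))\<^sup>2) * indicator (Omega \<omega> T) z \<partial>lborel)"
proof -
  have "bounded (poly p ` cball 0 (exp T))"
    by (intro compact_imp_bounded compact_continuous_image continuous_intros) auto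
  then obtain B where B: "\<forall>z\<in>cball 0 (exp T). cmod (poly p z) \<le> B"
    by (auto simp: bounded_iff)
  have int: "integrable lborel (\<lambda>z. indicator (Omega \<omega> T) z *\<^sub>R (cmod (poly p z))\<^sup>2)"
  proof (rule integrableI_bounded_set_indicator[where B="B\<^sup>2"])
    show "emeasure lborel (Omega \<omega> T) < \<infinity>" by (rule Omega_finite_measure)
    show "AE z in lborel. z \<in> Omega \<omega> T \<longrightarrow> norm ((cmod (poly p z))\<^sup>2) \<le> B\<^sup>2"
      using B by (auto simp: Omega_def intro!: power_mono AE_I2)
  qed (use Om in auto)
  have "(bergman_norm (Omega \<omega> T) (poly p))\<^sup>2 = (\<integral>z. indicator (Omega \<omega> T) z *\<^sub>R (cmod (poly p z))\<^sup>2 \<partial>lborel)"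
    unfolding bergman_norm_def set_lebesgue_integral_def by (simp add: integral_nonneg_AE)
  then have "ennreal ((bergman_norm (Omega \<omega> T) (poly p))\<^sup>2) = (\<integral>\<^sup>+z. ennreal (indicator (Omega \<omega> T) z *\<^sub>R (cmod (poly p z))\<^sup>2) \<partial>lborel)"
    using nn_integral_eq_integral[OF int] by simp
  also have "\<dots> = (\<integral>\<^sup>+z. ennreal ((cmod (poly p z))\<^sup>2) * indicator (Omega \<omega> T) z \<partial>lborel)"
    by (intro nn_integral_cong) (auto simp: indicator_def)
  finally show ?thesis .
qed

lemma Omega_open_arc_borel [measurable]: "Omega (open_arc a b) T \<in> sets borel"
  by (simp add: Omega_eq_polar_sector)

text \<open>In polar coordinates the two integrals differ only by the area element
  \<open>exp (2 s)\<close>, which lies between 1 and \<open>exp (2 T)\<close>.\<close>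

lemma bergman_norm_control:
  assumes ab: "b - a < 2 * pi"
  shows "normsq (control_measure (open_arc a b) T) (\<lambda>x. poly p (exp_coord x))
      \<le> (bergman_norm (Omega (open_arc a b) T) (poly p))\<^sup>2" (is "?N \<le> ?B")
    and "(bergman_norm (Omega (open_arc a b) T) (poly p))\<^sup>2
      \<le> exp (2 * T) * normsq (control_measure (open_arc a b) T) (\<lambda>x. poly p (exp_coord x))"
proof -
  define f where "f z = ennreal ((cmod (poly p z))\<^sup>2)" for z
  have [measurable]: "f \<in> borel_measurable borel" unfolding f_def by measurable
  define I where "I s = (\<integral>\<^sup>+x. f (complex_of_real (exp s) * cis x) * indicator {a<..<b} x \<partial>lborel)" for s
  have N: "ennreal ?N = (\<integral>\<^sup>+s. I s * indicator {0<..<T} s \<partial>lborel)"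
    using nn_integral_control[OF ab, of f T] L2_nn_integral[OF poly_exp_coord_L2[OF open_arc_borel]]
    by (simp add: f_def I_def)
  have B: "ennreal ?B = (\<integral>\<^sup>+s. (ennreal (exp (2 * s)) * I s) * indicator {0<..<T} s \<partial>lborel)"
    unfolding bergman_norm_nn[OF open_arc_borel Omega_open_arc_borel]
    using nn_integral_polar_sector[of b a f 0 T] ab
    by (simp add: Omega_eq_polar_sector f_def I_def mult.assoc nn_integral_cmult)
  have "ennreal ?N \<le> ennreal ?B"
    unfolding N B
  proof (intro nn_integral_mono)
    fix s :: real
    have "1 * I s \<le> ennreal (exp (2 * s)) * I s" if "0 < s"
      using that by (intro mult_right_mono) (auto simp: ennreal_1[symmetric] simp del: ennreal_1 intro!: ennreal_leI)
    then show "I s * indicator {0<..<T} s \<le> ennreal (exp (2 * s)) * I s * indicator {0<..<T} s"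
      by (auto simp: indicator_def)
  qed
  then show "?N \<le> ?B" by simp
  have [measurable]: "I \<in> borel_measurable borel" unfolding I_def by measurable
  have "ennreal ?B \<le> (\<integral>\<^sup>+s. ennreal (exp (2 * T)) * (I s * indicator {0<..<T} s) \<partial>lborel)"
    unfolding B
  proof (intro nn_integral_mono)
    fix s :: real
    have "ennreal (exp (2 * s)) * I s \<le> ennreal (exp (2 * T)) * I s" if "s < T"
      using that by (intro mult_right_mono ennreal_leI) auto
    then show "ennreal (exp (2 * s)) * I s * indicator {0<..<T} s \<le> ennreal (exp (2 * T)) * (I s * indicator {0<..<T} s)"
      by (auto simp: indicator_def)
  qed
  also have "\<dots> = ennreal (exp (2 * T) * ?N)"
    by (simp add: nn_integral_cmult N[symmetric] ennreal_mult)
  finally show "?B \<le> exp (2 * T) * ?N" by simp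
qed

section \<open>Point evaluations are bounded by the Bergman norm\<close>

lemma poly_circle_mean:
  "2 * pi * (cmod (poly q 0))\<^sup>2 \<le> normsq circle_measure (poly q)"
proof -
  have "poly q = (\<lambda>\<zeta>. \<Sum>k\<in>int ` {..degree q}. coeff q (nat k) * \<zeta> powi k)"
    by (simp add: fun_eq_iff poly_altdef sum.reindex)
  then have "fourier_coeff (poly q) 0
      = fourier_coeff (\<lambda>\<zeta>. \<Sum>k\<in>int ` {..degree q}. coeff q (nat k) * \<zeta> powi k) 0"
    by (rule arg_cong)
  also have "\<dots> = poly q 0"
    by (subst fourier_coeff_trig) (auto simp: poly_0_coeff_0 image_iff)
  finally have "fourier_coeff (poly q) 0 = poly q 0" .
  then show ?thesis using Bessel[OF poly_circle_L2[of q], of "{0}"] by simp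
qed

text \<open>The value at the centre is dominated by the mean square over each circle; integrate over
  radii between \<delta>/2 and \<delta>. On this annulus the logarithmic radius runs through an
  interval of length \<open>ln 2\<close> and the area element is at least
  \<open>(\<delta> / 2)\<^sup>2\<close>.\<close>

lemma poly_point_estimate:
  assumes U: "U \<in> sets borel" and ball: "ball z0 \<delta> \<subseteq> U" and \<delta>: "0 < \<delta>"
  shows "ennreal (2 * pi * (cmod (poly p z0))\<^sup>2 * ((\<delta> / 2)\<^sup>2 * ln 2))
    \<le> (\<integral>\<^sup>+z. ennreal ((cmod (poly p z))\<^sup>2) * indicator U z \<partial>lborel)"
proof -
  define f where "f z = ennreal ((cmod (poly p z))\<^sup>2)" for z
  have [measurable]: "f \<in> borel_measurable borel" unfolding f_def by measurable
  let ?S = "polar_sector (ln (\<delta> / 2)) (ln \<delta>) 0 (2 * pi)"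
  have circ: "ennreal (2 * pi * (cmod (poly p z0))\<^sup>2) \<le> (\<integral>\<^sup>+x. f (z0 + complex_of_real (exp s) * cis x) * indicator {0<..<2 * pi} x \<partial>lborel)" for s
  proof -
    \<comment> \<open>The circle of radius \<open>exp s\<close> about \<open>z0\<close> is pulled
      back to the unit circle, so that Bessel for the coefficient of index 0 applies.\<close>
    define q where "q = pcompose p [:z0, complex_of_real (exp s):]"
    have q: "poly q \<zeta> = poly p (z0 + complex_of_real (exp s) * \<zeta>)" for \<zeta>
      by (simp add: q_def poly_pcompose mult.commute)
    have "ennreal (2 * pi * (cmod (poly p z0))\<^sup>2) \<le> ennreal (normsq circle_measure (poly q))"
      using poly_circle_mean[of q] by (simp add: q ennreal_leI)
    also have "\<dots> = (\<integral>\<^sup>+\<zeta>. f (z0 + complex_of_real (exp s) * \<zeta>) \<partial>circle_measure)"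
      using L2_nn_integral[OF poly_circle_L2[of q]] by (simp add: f_def flip: q)
    also have "\<dots> = (\<integral>\<^sup>+x. f (z0 + complex_of_real (exp s) * cis x) * indicator {0..<0 + 2 * pi} x \<partial>lborel)"
      by (rule circle_nn_integral) measurable
    also have "\<dots> = (\<integral>\<^sup>+x. f (z0 + complex_of_real (exp s) * cis x) * indicator {0<..<2 * pi} x \<partial>lborel)"
    proof (rule nn_integral_cong_AE)
      have "AE s in lborel. s \<noteq> (0::real)" by (rule AE_lborel_singleton)
      then show "AE x in lborel. f (z0 + complex_of_real (exp s) * cis x) * indicator {0..<0 + 2 * pi} x
          = f (z0 + complex_of_real (exp s) * cis x) * indicator {0<..<2 * pi} x"
        by eventually_elim (auto simp: indicator_def)
    qed
    finally show ?thesis .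
  qed
  have "ennreal (2 * pi * (cmod (poly p z0))\<^sup>2 * ((\<delta> / 2)\<^sup>2 * ln 2))
      = (\<integral>\<^sup>+s. ennreal ((\<delta> / 2)\<^sup>2) * ennreal (2 * pi * (cmod (poly p z0))\<^sup>2) * indicator {ln (\<delta> / 2)<..<ln \<delta>} s \<partial>lborel)"
  proof -
    have "ln \<delta> - ln (\<delta> / 2) = ln 2" using \<delta> by (simp add: ln_div)
    then have "emeasure lborel {ln (\<delta> / 2)<..<ln \<delta>} = ennreal (ln 2)" using \<delta> by simp
    then show ?thesis
      by (subst nn_integral_cmult_indicator) (simp_all add: ennreal_mult[symmetric] mult_ac)
  qed
  also have "\<dots> \<le> (\<integral>\<^sup>+s. (\<integral>\<^sup>+x. ennreal (exp (2 * s)) * f (z0 + complex_of_real (exp s) * cis x)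
        * indicator {0<..<2 * pi} x \<partial>lborel) * indicator {ln (\<delta> / 2)<..<ln \<delta>} s \<partial>lborel)"
  proof (rule nn_integral_mono)
    fix s :: real
    have "ennreal ((\<delta> / 2)\<^sup>2) * ennreal (2 * pi * (cmod (poly p z0))\<^sup>2)
        \<le> (\<integral>\<^sup>+x. ennreal (exp (2 * s)) * f (z0 + complex_of_real (exp s) * cis x) * indicator {0<..<2 * pi} x \<partial>lborel)"
      if s: "ln (\<delta> / 2) < s"
    proof -
      have "\<delta> / 2 \<le> exp s" using s \<delta> by (metis exp_ln exp_le_cancel_iff half_gt_zero less_imp_le)
      then have "(\<delta> / 2)\<^sup>2 \<le> (exp s)\<^sup>2" using \<delta> by (intro power_mono) auto
      also have "(exp s)\<^sup>2 = exp (2 * s)" by (simp add: exp_double)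
      finally have "ennreal ((\<delta> / 2)\<^sup>2) * ennreal (2 * pi * (cmod (poly p z0))\<^sup>2)
          \<le> ennreal (exp (2 * s)) * (\<integral>\<^sup>+x. f (z0 + complex_of_real (exp s) * cis x) * indicator {0<..<2 * pi} x \<partial>lborel)"
        by (intro mult_mono circ ennreal_leI) auto
      then show ?thesis by (simp add: nn_integral_cmult mult.assoc)
    qed
    then show "ennreal ((\<delta> / 2)\<^sup>2) * ennreal (2 * pi * (cmod (poly p z0))\<^sup>2) * indicator {ln (\<delta> / 2)<..<ln \<delta>} s
        \<le> (\<integral>\<^sup>+x. ennreal (exp (2 * s)) * f (z0 + complex_of_real (exp s) * cis x) * indicator {0<..<2 * pi} x \<partial>lborel)
          * indicator {ln (\<delta> / 2)<..<ln \<delta>} s"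
      by (auto simp: indicator_def)
  qed
  also have "\<dots> = (\<integral>\<^sup>+w. f (z0 + w) * indicator ?S w \<partial>lborel)"
    by (rule nn_integral_polar_sector[symmetric]) auto
  also have "\<dots> \<le> (\<integral>\<^sup>+w. f (z0 + w) * indicator U (z0 + w) \<partial>lborel)"
  proof (intro nn_integral_mono mult_left_mono)
    fix w :: complex
    have "z0 + w \<in> U" if "w \<in> ?S"
    proof -
      from that have "cmod w < \<delta>"
        using \<delta> by (auto simp: polar_sector_def norm_mult) (metis exp_less_cancel_iff exp_ln)
      then show ?thesis using ball by (auto simp: dist_norm)
    qed
    then show "indicator ?S w \<le> (indicator U (z0 + w) :: ennreal)" by (auto simp: indicator_def)
  qed simp
  also have "\<dots> = (\<integral>\<^sup>+z. f z * indicator U z \<partial>distr lborel borel ((+) z0))"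
    using U by (subst nn_integral_distr) auto
  also have "distr lborel borel ((+) z0) = lborel" by (rule lborel_distr_plus)
  finally show ?thesis by (simp add: f_def)
qed

lemma bergman_point_estimate:
  assumes ab: "b - a \<le> 2 * pi" and K: "compact K" "K \<subseteq> Omega (open_arc a b) T"
  shows "\<exists>C\<ge>0. \<forall>p. \<forall>z\<in>K. cmod (poly p z) \<le> C * bergman_norm (Omega (open_arc a b) T) (poly p)"
proof -
  let ?U = "Omega (open_arc a b) T"
  obtain \<delta> where \<delta>: "0 < \<delta>" "(\<Union>z\<in>K. ball z \<delta>) \<subseteq> ?U"
    using compact_subset_open_imp_ball_epsilon_subset[OF K(1) open_Omega[OF ab] K(2)] by blast
  define k where "k = 2 * pi * ((\<delta> / 2)\<^sup>2 * ln 2)"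
  have k: "0 < k" using \<delta>(1) by (simp add: k_def)
  have "cmod (poly p z) \<le> sqrt (1 / k) * bergman_norm ?U (poly p)" if "z \<in> K" for p z
  proof -
    have "ennreal (2 * pi * (cmod (poly p z))\<^sup>2 * ((\<delta> / 2)\<^sup>2 * ln 2)) \<le> ennreal ((bergman_norm ?U (poly p))\<^sup>2)"
      unfolding bergman_norm_nn[OF open_arc_borel Omega_open_arc_borel]
      using \<delta> that by (intro poly_point_estimate) auto
    then have "k * (cmod (poly p z))\<^sup>2 \<le> (bergman_norm ?U (poly p))\<^sup>2" by (simp add: k_def mult_ac)
    then have "(cmod (poly p z))\<^sup>2 \<le> 1 / k * (bergman_norm ?U (poly p))\<^sup>2" using k by (simp add: field_simps)
    then have "cmod (poly p z) \<le> sqrt (1 / k * (bergman_norm ?U (poly p))\<^sup>2)" by (rule real_le_rsqrt)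
    then show ?thesis
      by (simp only: real_sqrt_mult real_sqrt_abs abs_of_nonneg[OF bergman_norm_nonneg])
  qed
  then show ?thesis using k by (intro exI[of _ "sqrt (1 / k)"]) auto
qed


section \<open>The harmonic extension\<close>

text \<open>\<open>pow_sum c (1 / z)\<close> is the part of the extension that is holomorphic outside the disk,
  \<open>cnj (pow_sum d (1 / z))\<close> the antiholomorphic part.\<close>

definition pow_sum :: "(nat \<Rightarrow> complex) \<Rightarrow> complex \<Rightarrow> complex" where
  "pow_sum c w = (\<Sum>n. c n * w ^ n)"

definition ext_hol :: "(complex \<Rightarrow> complex) \<Rightarrow> nat \<Rightarrow> complex" where
  "ext_hol h k = fourier_coeff h (- int k)"

text \<open>Conjugated so that the antiholomorphic part is the conjugate of a power series in
  \<open>1 / z\<close>. The constant term is counted in \<open>ext_hol\<close> alone.\<close>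

definition ext_anti :: "(complex \<Rightarrow> complex) \<Rightarrow> nat \<Rightarrow> complex" where
  "ext_anti h k = (if k = 0 then 0 else cnj (fourier_coeff h (int k)))"

lemma summable_pow_sum:
  assumes "\<And>n. cmod (c n) \<le> B" "cmod w < 1"
  shows "summable (\<lambda>n. cmod (c n * w ^ n))"
proof (rule summable_comparison_test'[where N=0])
  show "summable (\<lambda>n. B * cmod w ^ n)" using assms(2) by (intro summable_mult summable_geometric) auto
  show "norm (cmod (c n * w ^ n)) \<le> B * cmod w ^ n" for n
    using assms(1)[of n] by (simp add: norm_mult norm_power mult_right_mono)
qed

lemma pow_sum_holomorphic:
  assumes B: "\<And>n. cmod (c n) \<le> B"
  shows "pow_sum c holomorphic_on ball 0 1"
proof (rule power_series_holomorphic[where a=c])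
  fix w :: complex assume "w \<in> ball 0 1"
  then have "summable (\<lambda>n. c n * w ^ n)"
    using summable_norm_cancel[OF summable_pow_sum[OF B, of w]] by simp
  then show "(\<lambda>n. c n * (w - 0) ^ n) sums pow_sum c w"
    by (simp add: pow_sum_def summable_sums)
qed

lemma ext_bounds:
  assumes h: "h \<in> L2_space circle_measure"
  shows "cmod (ext_hol h n) \<le> sqrt (normsq circle_measure h)"
    and "cmod (ext_anti h n) \<le> sqrt (normsq circle_measure h)"
  using fourier_coeff_bound[OF h] by (auto simp: ext_hol_def ext_anti_def)

text \<open>From \<zeta> cnj \<zeta> = 1 one has z cnj z - 1 = z cnj (z - \<zeta>) + cnj \<zeta> (z
  - \<zeta>); divide by the squared modulus of z - \<zeta>.\<close>

lemma Poisson_kernel_split: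
  assumes "cmod \<zeta> = 1" "1 < cmod z"
  shows "complex_of_real (((cmod z)\<^sup>2 - 1) / (cmod (z - \<zeta>))\<^sup>2) = z / (z - \<zeta>) + cnj (\<zeta> / (z - \<zeta>))"
proof -
  have nz: "z - \<zeta> \<noteq> 0" "cnj z - cnj \<zeta> \<noteq> 0" using assms by (auto simp flip: complex_cnj_diff)
  have 1: "\<zeta> * cnj \<zeta> = 1" using assms(1) complex_norm_square[of \<zeta>] by simp
  have "complex_of_real (((cmod z)\<^sup>2 - 1) / (cmod (z - \<zeta>))\<^sup>2) = (z * cnj z - 1) / ((z - \<zeta>) * cnj (z - \<zeta>))"
    by (simp only: of_real_divide of_real_diff of_real_1 complex_norm_square)
  also have "\<dots> = z / (z - \<zeta>) + cnj (\<zeta> / (z - \<zeta>))"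
    using nz 1 by (simp add: divide_simps) (simp add: algebra_simps)
  finally show ?thesis .
qed

text \<open>Both summands of the split kernel are geometric series in \<zeta> / z. The second one
  starts at k = 1, whence the case distinction.\<close>

lemma Poisson_kernel_sums:
  assumes "cmod \<zeta> = 1" "1 < cmod z"
  shows "(\<lambda>k. \<zeta> ^ k * (1 / z) ^ k + (if k = 0 then 0 else cnj (\<zeta> ^ k * (1 / z) ^ k)))
    sums complex_of_real (((cmod z)\<^sup>2 - 1) / (cmod (z - \<zeta>))\<^sup>2)"
proof -
  have z: "z \<noteq> 0" "z \<noteq> \<zeta>" using assms by auto
  have "0 < cmod z" using assms by linarith
  then have lt: "cmod (\<zeta> / z) < 1" using assms by (simp add: norm_divide pos_divide_less_eq)
  have "(\<lambda>k. (\<zeta> / z) ^ k) sums (1 / (1 - \<zeta> / z))" by (rule geometric_sums[OF lt])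
  also have "1 / (1 - \<zeta> / z) = z / (z - \<zeta>)" using z by (simp add: divide_simps)
  finally have s1: "(\<lambda>k. \<zeta> ^ k * (1 / z) ^ k) sums (z / (z - \<zeta>))" by (simp add: power_divide)
  have "(\<lambda>k. if k = 0 then \<zeta> ^ k * (1 / z) ^ k else 0) sums (\<Sum>k\<in>{0}. \<zeta> ^ k * (1 / z) ^ k)"
    using sums_If_finite_set[of "{0::nat}" "\<lambda>k. \<zeta> ^ k * (1 / z) ^ k"] by simp
  from sums_diff[OF s1 this]
  have "(\<lambda>k. \<zeta> ^ k * (1 / z) ^ k - (if k = 0 then \<zeta> ^ k * (1 / z) ^ k else 0)) sums (z / (z - \<zeta>) - 1)" by simp
  also have "(\<lambda>k. \<zeta> ^ k * (1 / z) ^ k - (if k = 0 then \<zeta> ^ k * (1 / z) ^ k else 0))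
      = (\<lambda>k. if k = 0 then 0 else \<zeta> ^ k * (1 / z) ^ k)" by auto
  also have "z / (z - \<zeta>) - 1 = \<zeta> / (z - \<zeta>)" using z by (simp add: divide_simps)
  finally have "(\<lambda>k. cnj (if k = 0 then 0 else \<zeta> ^ k * (1 / z) ^ k)) sums cnj (\<zeta> / (z - \<zeta>))"
    by (simp only: sums_cnj)
  from sums_add[OF s1 this]
  have "(\<lambda>k. \<zeta> ^ k * (1 / z) ^ k + cnj (if k = 0 then 0 else \<zeta> ^ k * (1 / z) ^ k))
    sums (z / (z - \<zeta>) + cnj (\<zeta> / (z - \<zeta>)))" .
  also have "(\<lambda>k. \<zeta> ^ k * (1 / z) ^ k + cnj (if k = 0 then 0 else \<zeta> ^ k * (1 / z) ^ k))
      = (\<lambda>k. \<zeta> ^ k * (1 / z) ^ k + (if k = 0 then 0 else cnj (\<zeta> ^ k * (1 / z) ^ k)))" by auto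
  finally show ?thesis unfolding Poisson_kernel_split[OF assms] .
qed

text \<open>Integration of the kernel expansion term by term; the k-th term is at most
  \<open>2 * q^k\<close> with q = 1 / |z| < 1, which gives an integrable majorant.\<close>

theorem exterior_harmonic_ext_eq:
  assumes h: "h \<in> L2_space circle_measure" and z: "1 < cmod z"
  shows "exterior_harmonic_ext h z = pow_sum (ext_hol h) (1 / z) + cnj (pow_sum (ext_anti h) (1 / z))"
proof -
  note hi = L2_circle_integrable[OF h]
  have [measurable]: "h \<in> borel_measurable circle_measure" using h by (rule L2_measurable)
  define e where "e k \<zeta> = \<zeta> ^ k * (1 / z) ^ k + (if k = 0 then 0 else cnj (\<zeta> ^ k * (1 / z) ^ k))" for k \<zeta>
  have [measurable]: "e k \<in> borel_measurable borel" for k unfolding e_def by (cases "k = 0") auto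
  define q where "q = 1 / cmod z"
  have "0 < cmod z" using z by linarith
  then have q: "0 \<le> q" "q < 1" using z by (auto simp: q_def pos_divide_less_eq)
  have e_le: "cmod (e k \<zeta>) \<le> 2 * q ^ k" if "cmod \<zeta> = 1" for k \<zeta>
  proof -
    define X where "X = \<zeta> ^ k * (1 / z) ^ k"
    have "cmod X = q ^ k" using that by (simp add: X_def q_def norm_mult norm_power norm_divide)
    moreover have "cmod (X + cnj X) \<le> cmod X + cmod X" using norm_triangle_ineq[of X "cnj X"] by simp
    ultimately show ?thesis using q unfolding e_def X_def[symmetric] by (auto simp del: complex_add_cnj)
  qed
  have qs: "(\<lambda>k. 2 * q ^ k) sums (2 * (1 / (1 - q)))" using q by (intro sums_mult geometric_sums) auto
  have "(\<lambda>N. \<integral>\<zeta>. (\<Sum>k<N. e k \<zeta>) * h \<zeta> \<partial>circle_measure)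
      \<longlonglongrightarrow> (\<integral>\<zeta>. complex_of_real (((cmod z)\<^sup>2 - 1) / (cmod (z - \<zeta>))\<^sup>2) * h \<zeta> \<partial>circle_measure)"
  proof (rule integral_dominated_convergence[where w="\<lambda>\<zeta>. 2 * (1 / (1 - q)) * norm (h \<zeta>)"])
    show "integrable circle_measure (\<lambda>\<zeta>. 2 * (1 / (1 - q)) * norm (h \<zeta>))" using hi by simp
    show "AE \<zeta> in circle_measure. (\<lambda>N. (\<Sum>k<N. e k \<zeta>) * h \<zeta>)
        \<longlonglongrightarrow> complex_of_real (((cmod z)\<^sup>2 - 1) / (cmod (z - \<zeta>))\<^sup>2) * h \<zeta>"
      using AE_circle_norm
    proof eventually_elim
      case (elim \<zeta>)
      from Poisson_kernel_sums[OF elim z] show ?case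
        unfolding e_def sums_def by (intro tendsto_mult tendsto_const)
    qed
    show "AE \<zeta> in circle_measure. norm ((\<Sum>k<N. e k \<zeta>) * h \<zeta>) \<le> 2 * (1 / (1 - q)) * norm (h \<zeta>)" for N
      using AE_circle_norm
    proof eventually_elim
      case (elim \<zeta>)
      have "cmod (\<Sum>k<N. e k \<zeta>) \<le> (\<Sum>k<N. 2 * q ^ k)"
        by (rule order_trans[OF norm_sum sum_mono]) (rule e_le[OF elim])
      also have "\<dots> \<le> (\<Sum>k. 2 * q ^ k)" using q by (intro sum_le_suminf sums_summable[OF qs]) auto
      also have "\<dots> = 2 * (1 / (1 - q))" using qs by (simp add: sums_iff)
      finally show ?case unfolding norm_mult by (rule mult_right_mono) simp
    qed
  qed measurable
  then have lim1: "(\<lambda>N. complex_of_real (1 / (2 * pi)) * (\<integral>\<zeta>. (\<Sum>k<N. e k \<zeta>) * h \<zeta> \<partial>circle_measure)) \<longlonglongrightarrow> exterior_harmonic_ext h z"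
    unfolding exterior_harmonic_ext_def by (intro tendsto_intros)
  have int: "integrable circle_measure (\<lambda>\<zeta>. e k \<zeta> * h \<zeta>)" for k
  proof (rule Bochner_Integration.integrable_bound)
    show "integrable circle_measure (\<lambda>\<zeta>. (2 * q ^ k) * h \<zeta>)" using hi by simp
    show "AE \<zeta> in circle_measure. norm (e k \<zeta> * h \<zeta>) \<le> norm ((2 * q ^ k) * h \<zeta>)"
      using AE_circle_norm
    proof eventually_elim
      case (elim \<zeta>)
      have "cmod (e k \<zeta>) * cmod (h \<zeta>) \<le> (2 * q ^ k) * cmod (h \<zeta>)" by (rule mult_right_mono[OF e_le[OF elim]]) simp
      then show ?case using q by (simp add: norm_mult norm_power)
    qed
  qed measurable
  have tm: "complex_of_real (1 / (2 * pi)) * (\<integral>\<zeta>. e k \<zeta> * h \<zeta> \<partial>circle_measure)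
      = ext_hol h k * (1 / z) ^ k + cnj (ext_anti h k * (1 / z) ^ k)" for k
  proof -
    have "(\<integral>\<zeta>. e k \<zeta> * h \<zeta> \<partial>circle_measure)
        = (\<integral>\<zeta>. (1 / z) ^ k * (h \<zeta> * \<zeta> powi int k) + (if k = 0 then 0 else cnj ((1 / z) ^ k)) * (h \<zeta> * \<zeta> powi (- int k)) \<partial>circle_measure)"
    proof (rule integral_cong_AE)
      show "AE \<zeta> in circle_measure. e k \<zeta> * h \<zeta> = (1 / z) ^ k * (h \<zeta> * \<zeta> powi int k)
          + (if k = 0 then 0 else cnj ((1 / z) ^ k)) * (h \<zeta> * \<zeta> powi (- int k))"
        using AE_circle_norm
      proof eventually_elim
        case (elim \<zeta>)
        have "cnj (\<zeta> ^ k) = \<zeta> powi (- int k)" using cnj_powi_circle[OF elim, of "int k"] by simp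
        then show ?case unfolding e_def complex_cnj_mult by (simp add: algebra_simps)
      qed
    qed measurable
    also have "\<dots> = (1 / z) ^ k * (\<integral>\<zeta>. h \<zeta> * \<zeta> powi int k \<partial>circle_measure)
        + (if k = 0 then 0 else cnj ((1 / z) ^ k)) * (\<integral>\<zeta>. h \<zeta> * \<zeta> powi (- int k) \<partial>circle_measure)"
      using integrable_mult_powi[OF hi] by (subst Bochner_Integration.integral_add) (auto simp del: power_int_of_nat)
    also have "\<dots> = complex_of_real (2 * pi) * (ext_hol h k * (1 / z) ^ k + cnj (ext_anti h k * (1 / z) ^ k))"
      unfolding integral_mult_powi by (simp add: ext_hol_def ext_anti_def algebra_simps)
    finally show ?thesis by simp
  qed
  have "complex_of_real (1 / (2 * pi)) * (\<integral>\<zeta>. (\<Sum>k<N. e k \<zeta>) * h \<zeta> \<partial>circle_measure)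
      = (\<Sum>k<N. ext_hol h k * (1 / z) ^ k + cnj (ext_anti h k * (1 / z) ^ k))" for N
    unfolding tm[symmetric] using int by (simp add: sum_distrib_right sum_distrib_left)
  with lim1 have sums1: "(\<lambda>k. ext_hol h k * (1 / z) ^ k + cnj (ext_anti h k * (1 / z) ^ k)) sums exterior_harmonic_ext h z"
    by (simp add: sums_def)
  have z1: "cmod (1 / z) < 1" using q(2) by (simp add: norm_divide q_def)
  have "(\<lambda>k. ext_hol h k * (1 / z) ^ k) sums pow_sum (ext_hol h) (1 / z)"
    unfolding pow_sum_def
    by (rule summable_sums[OF summable_norm_cancel[OF summable_pow_sum[OF ext_bounds(1)[OF h] z1]]])
  moreover have "(\<lambda>k. ext_anti h k * (1 / z) ^ k) sums pow_sum (ext_anti h) (1 / z)"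
    unfolding pow_sum_def
    by (rule summable_sums[OF summable_norm_cancel[OF summable_pow_sum[OF ext_bounds(2)[OF h] z1]]])
  ultimately have "(\<lambda>k. ext_hol h k * (1 / z) ^ k + cnj (ext_anti h k * (1 / z) ^ k)) sums
      (pow_sum (ext_hol h) (1 / z) + cnj (pow_sum (ext_anti h) (1 / z)))"
    by (intro sums_add) (simp_all only: sums_cnj)
  with sums1 show ?thesis by (rule sums_unique2)
qed

lemma fourier_coeff_cnj:
  assumes [measurable]: "f \<in> borel_measurable circle_measure"
  shows "fourier_coeff (\<lambda>\<zeta>. cnj (f \<zeta>)) n = cnj (fourier_coeff f (- n))"
proof -
  have "(\<integral>\<zeta>. cnj (f \<zeta>) * \<zeta> powi (- n) \<partial>circle_measure) = (\<integral>\<zeta>. cnj (f \<zeta> * \<zeta> powi n) \<partial>circle_measure)"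
  proof (rule integral_cong_AE)
    show "AE \<zeta> in circle_measure. cnj (f \<zeta>) * \<zeta> powi - n = cnj (f \<zeta> * \<zeta> powi n)"
      using AE_circle_norm by eventually_elim (simp add: cnj_powi_circle del: complex_cnj_power_int)
  qed measurable
  also have "\<dots> = cnj (\<integral>\<zeta>. f \<zeta> * \<zeta> powi n \<partial>circle_measure)" by (rule Bochner_Integration.integral_cnj)
  finally show ?thesis by (simp add: fourier_coeff_def)
qed

section \<open>The extension on circles close to the boundary\<close>

lemma pow_sum_bounded_on_circle:
  assumes "summable (\<lambda>n. cmod (c n))"
  shows "pow_sum c \<in> L2_space circle_measure"
proof (intro L2_spaceI integrable_circle_bounded)
  show [measurable]: "pow_sum c \<in> borel_measurable circle_measure" unfolding pow_sum_def by measurable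
  show "(\<lambda>x. (cmod (pow_sum c x))\<^sup>2) \<in> borel_measurable borel" by measurable
  fix \<zeta> :: complex assume \<zeta>: "cmod \<zeta> = 1"
  have "cmod (pow_sum c \<zeta>) \<le> (\<Sum>n. cmod (c n * \<zeta> ^ n))"
    unfolding pow_sum_def using assms \<zeta> by (intro summable_norm) (simp add: norm_mult norm_power)
  then have "cmod (pow_sum c \<zeta>) \<le> (\<Sum>n. cmod (c n))" using \<zeta> by (simp add: norm_mult norm_power)
  then show "norm ((cmod (pow_sum c \<zeta>))\<^sup>2) \<le> (\<Sum>n. cmod (c n))\<^sup>2" by (simp add: power_mono)
qed

text \<open>Fatou along the partial sums; the area estimate asks for this direction of Parseval's
  identity.\<close>

lemma normsq_pow_sum_le:
  assumes c: "summable (\<lambda>n. cmod (c n))" and c2: "summable (\<lambda>n. (cmod (c n))\<^sup>2)"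
  shows "normsq circle_measure (pow_sum c) \<le> 2 * pi * (\<Sum>n. (cmod (c n))\<^sup>2)"
proof -
  define f where "f N \<zeta> = (\<Sum>k\<in>int ` {..<N}. c (nat k) * \<zeta> powi k)" for N :: nat and \<zeta>
  have f: "f N \<in> L2_space circle_measure" for N unfolding f_def by (rule trig_L2)
  have fe: "f N \<zeta> = (\<Sum>n<N. c n * \<zeta> ^ n)" for N \<zeta> by (simp add: f_def sum.reindex)
  have "AE \<zeta> in circle_measure. (\<lambda>N. f N \<zeta>) \<longlonglongrightarrow> pow_sum c \<zeta>"
    using AE_circle_norm
  proof eventually_elim
    case (elim \<zeta>)
    then have "summable (\<lambda>n. cmod (c n * \<zeta> ^ n))" using c by (simp add: norm_mult norm_power)
    from summable_LIMSEQ[OF summable_norm_cancel[OF this]] show ?case by (simp add: fe pow_sum_def)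
  qed
  moreover have "normsq circle_measure (f N) \<le> 2 * pi * (\<Sum>n. (cmod (c n))\<^sup>2)" for N
  proof -
    have "normsq circle_measure (f N) = 2 * pi * (\<Sum>k\<in>int ` {..<N}. (cmod (c (nat k)))\<^sup>2)"
      unfolding f_def by (rule normsq_trig) simp
    also have "(\<Sum>k\<in>int ` {..<N}. (cmod (c (nat k)))\<^sup>2) = (\<Sum>n<N. (cmod (c n))\<^sup>2)" by (simp add: sum.reindex)
    also have "\<dots> \<le> (\<Sum>n. (cmod (c n))\<^sup>2)" using c2 by (intro sum_le_suminf) auto
    finally show ?thesis by simp
  qed
  ultimately show ?thesis
    using f L2_measurable[OF f] L2_measurable[OF pow_sum_bounded_on_circle[OF c]] suminf_nonneg[OF c2]
    by (intro L2_Fatou(2)[where f=f]) (auto intro!: always_eventually)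
qed

text \<open>The extension on the circle of radius \<open>exp r\<close>, seen as a function on the
  unit circle. The series form shows the Fourier multiplier \<open>exp (- |n| r)\<close>; the
  conjugates come from 1 / z = \<open>exp (- r)\<close> cnj \<zeta>.\<close>

definition dilate :: "(complex \<Rightarrow> complex) \<Rightarrow> real \<Rightarrow> complex \<Rightarrow> complex" where
  "dilate h r \<zeta> = pow_sum (\<lambda>k. cnj (ext_anti h k) * complex_of_real (exp (- (real k * r)))) \<zeta>
    + cnj (pow_sum (\<lambda>k. cnj (ext_hol h k) * complex_of_real (exp (- (real k * r)))) \<zeta>)"

lemma pow_sum_cnj: "cnj (pow_sum c w) = pow_sum (\<lambda>n. cnj (c n)) (cnj w)" if "summable (\<lambda>n. c n * w ^ n)"
proof -
  have "(\<lambda>n. cnj (c n * w ^ n)) sums cnj (pow_sum c w)"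
    unfolding pow_sum_def sums_cnj using that by (rule summable_sums)
  then show ?thesis by (simp add: pow_sum_def sums_iff)
qed

lemma exterior_harmonic_ext_dilate:
  assumes h: "h \<in> L2_space circle_measure" and r: "0 < r" and \<zeta>: "cmod \<zeta> = 1"
  shows "exterior_harmonic_ext h (complex_of_real (exp r) * \<zeta>) = dilate h r \<zeta>"
proof -
  let ?z = "complex_of_real (exp r) * \<zeta>"
  have z: "1 < cmod ?z" using r \<zeta> by (simp add: norm_mult)
  have "\<zeta> * cnj \<zeta> = 1" using \<zeta> complex_norm_square[of \<zeta>] by simp
  then have "cnj \<zeta> = inverse \<zeta>" by (metis inverse_unique)
  then have iz: "1 / ?z = complex_of_real (exp (- r)) * cnj \<zeta>"
    by (simp add: exp_minus divide_inverse)
  have z1: "cmod (1 / ?z) < 1" unfolding iz using r \<zeta> by (simp add: norm_mult)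
  have s: "summable (\<lambda>n. c n * (1 / ?z) ^ n)" if "\<And>n. cmod (c n) \<le> B" for c B
    by (rule summable_norm_cancel[OF summable_pow_sum[OF that z1]])
  have e: "complex_of_real (exp (- r)) ^ n = complex_of_real (exp (- (real n * r)))" for n
    by (simp flip: of_real_power exp_of_nat_mult)
  have 1: "pow_sum (ext_hol h) (1 / ?z)
      = cnj (pow_sum (\<lambda>k. cnj (ext_hol h k) * complex_of_real (exp (- (real k * r)))) \<zeta>)"
  proof -
    have "cnj (pow_sum (ext_hol h) (1 / ?z)) = pow_sum (\<lambda>n. cnj (ext_hol h n)) (cnj (1 / ?z))"
      by (rule pow_sum_cnj[OF s[OF ext_bounds(1)[OF h]]])
    also have "\<dots> = pow_sum (\<lambda>k. cnj (ext_hol h k) * complex_of_real (exp (- (real k * r)))) \<zeta>"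
      unfolding iz by (simp add: pow_sum_def power_mult_distrib e mult.assoc)
    finally show ?thesis by (metis complex_cnj_cnj)
  qed
  have "cnj (pow_sum (ext_anti h) (1 / ?z)) = pow_sum (\<lambda>n. cnj (ext_anti h n)) (cnj (1 / ?z))"
    by (rule pow_sum_cnj[OF s[OF ext_bounds(2)[OF h]]])
  also have "\<dots> = pow_sum (\<lambda>k. cnj (ext_anti h k) * complex_of_real (exp (- (real k * r)))) \<zeta>"
    unfolding iz by (simp add: pow_sum_def power_mult_distrib e mult.assoc)
  finally show ?thesis
    unfolding exterior_harmonic_ext_eq[OF h z] dilate_def 1 by simp
qed

lemma
  assumes h: "h \<in> L2_space circle_measure" and r: "0 < r"
  shows dilate_L2: "dilate h r \<in> L2_space circle_measure"
    and dilate_coeff: "fourier_coeff (dilate h r) n = fourier_coeff h n * complex_of_real (exp (- (\<bar>real_of_int n\<bar> * r)))"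
proof -
  let ?u = "\<lambda>k. cnj (ext_anti h k) * complex_of_real (exp (- (real k * r)))"
  let ?v = "\<lambda>k. cnj (ext_hol h k) * complex_of_real (exp (- (real k * r)))"
  have su: "summable (\<lambda>k. cmod (?u k))"
    by (rule summable_exp_decay[OF _ r, where B="sqrt (normsq circle_measure h)"])
      (simp only: complex_mod_cnj ext_bounds(2)[OF h])
  have sv: "summable (\<lambda>k. cmod (?v k))"
    by (rule summable_exp_decay[OF _ r, where B="sqrt (normsq circle_measure h)"])
      (simp only: complex_mod_cnj ext_bounds(1)[OF h])
  have uL: "pow_sum ?u \<in> L2_space circle_measure" and vL: "pow_sum ?v \<in> L2_space circle_measure"
    by (intro pow_sum_bounded_on_circle su sv)+
  show "dilate h r \<in> L2_space circle_measure"
    unfolding dilate_def[abs_def] by (rule L2_add(1)[OF uL L2_cnj[OF vL]])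
  have "fourier_coeff (dilate h r) n = fourier_coeff (pow_sum ?u) n + cnj (fourier_coeff (pow_sum ?v) (- n))"
    unfolding dilate_def[abs_def]
    by (subst fourier_coeff_add[OF L2_circle_integrable[OF uL] L2_circle_integrable[OF L2_cnj[OF vL]]])
      (simp add: fourier_coeff_cnj[OF L2_measurable[OF vL]])
  also have "\<dots> = (if 0 \<le> n then ?u (nat n) else 0) + cnj (if 0 \<le> - n then ?v (nat (- n)) else 0)"
    unfolding pow_sum_def[abs_def] fourier_coeff_power_series(2)[OF su] fourier_coeff_power_series(2)[OF sv] ..
  also have "\<dots> = fourier_coeff h n * complex_of_real (exp (- (\<bar>real_of_int n\<bar> * r)))"
    by (cases n "0::int" rule: linorder_cases) (auto simp: ext_anti_def ext_hol_def)
  finally show "fourier_coeff (dilate h r) n = fourier_coeff h n * complex_of_real (exp (- (\<bar>real_of_int n\<bar> * r)))" .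
qed

text \<open>Dominated convergence for unordered sums: a finite set carries all but e/2 of the sum of
  \<open>a\<close>, and on it finitely many factors tend to 0.\<close>

lemma infsum_mult_tendsto_0:
  fixes a :: "'i \<Rightarrow> real" and t :: "nat \<Rightarrow> 'i \<Rightarrow> real"
  assumes a: "a summable_on UNIV" "\<And>i. 0 \<le> a i" and t: "\<And>k i. 0 \<le> t k i" "\<And>k i. t k i \<le> 1"
    and lim: "\<And>i. (\<lambda>k. t k i) \<longlonglongrightarrow> 0"
  shows "(\<lambda>k. \<Sum>\<^sub>\<infinity>i. a i * t k i) \<longlonglongrightarrow> 0"
proof (rule LIMSEQ_I_le)
  have le: "a i * t k i \<le> a i" for k i using mult_left_mono[OF t(2) a(2)] by simp
  have s: "(\<lambda>i. a i * t k i) summable_on A" for k A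
    by (rule summable_on_comparison_test[OF summable_on_subset_banach[OF a(1)]]) (use le a(2) t(1) in auto)
  fix e :: real assume "0 < e"
  have "((\<lambda>F. sum a F) \<longlongrightarrow> infsum a UNIV) (finite_subsets_at_top UNIV)"
    using has_sum_infsum[OF a(1)] by (simp add: has_sum_def)
  from tendstoD[OF this half_gt_zero[OF \<open>0 < e\<close>]]
  obtain F where F: "finite F" "dist (sum a F) (infsum a UNIV) < e / 2"
    by (auto simp: eventually_finite_subsets_at_top)
  have "infsum a UNIV = infsum a (F \<union> - F)" by simp
  also have "\<dots> = infsum a F + infsum a (- F)"
    by (rule infsum_Un_disjoint) (auto intro: summable_on_subset_banach[OF a(1)])
  finally have tail: "infsum a (- F) < e / 2" using F by (simp add: dist_real_def)
  have "(\<lambda>k. \<Sum>i\<in>F. a i * t k i) \<longlonglongrightarrow> (\<Sum>i\<in>F. a i * 0)" by (intro tendsto_intros lim)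
  then have "\<forall>\<^sub>F k in sequentially. (\<Sum>i\<in>F. a i * t k i) < e / 2"
    using \<open>0 < e\<close> by (intro order_tendstoD) auto
  then obtain K where K: "\<And>k. k \<ge> K \<Longrightarrow> (\<Sum>i\<in>F. a i * t k i) < e / 2"
    by (auto simp: eventually_sequentially)
  have "(\<Sum>\<^sub>\<infinity>i. a i * t k i) \<le> e" if "k \<ge> K" for k
  proof -
    have "(\<Sum>\<^sub>\<infinity>i. a i * t k i) = (\<Sum>\<^sub>\<infinity>i\<in>F \<union> - F. a i * t k i)" by simp
    also have "\<dots> = (\<Sum>i\<in>F. a i * t k i) + (\<Sum>\<^sub>\<infinity>i\<in>- F. a i * t k i)"
      using F(1) by (subst infsum_Un_disjoint) (auto intro: s)
    also have "(\<Sum>\<^sub>\<infinity>i\<in>- F. a i * t k i) \<le> infsum a (- F)"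
      by (intro infsum_mono s summable_on_subset_banach[OF a(1)] le) auto
    finally show ?thesis using K[OF that] tail by linarith
  qed
  then show "\<exists>K. \<forall>k\<ge>K. (\<Sum>\<^sub>\<infinity>i. a i * t k i) \<le> e" by blast
next
  show "0 \<le> (\<Sum>\<^sub>\<infinity>i. a i * t k i)" for k by (rule infsum_nonneg) (simp add: a(2) t(1))
qed

text \<open>By Parseval the error sums the squared coefficients with weights (1 - exp (- |n| r))^2,
  which are at most 1 and tend to 0 for each n.\<close>

theorem dilate_tendsto:
  assumes h: "h \<in> L2_space circle_measure" and r: "\<And>k. 0 < r k" "r \<longlonglongrightarrow> 0"
  shows "(\<lambda>k. normsq circle_measure (\<lambda>\<zeta>. h \<zeta> - dilate h (r k) \<zeta>)) \<longlonglongrightarrow> 0"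
proof -
  define t where "t k n = (1 - exp (- (\<bar>real_of_int n\<bar> * r k)))\<^sup>2" for k n
  have eq: "normsq circle_measure (\<lambda>\<zeta>. h \<zeta> - dilate h (r k) \<zeta>)
      = 2 * pi * (\<Sum>\<^sub>\<infinity>n. (cmod (fourier_coeff h n))\<^sup>2 * t k n)" for k
  proof -
    have "fourier_coeff (\<lambda>\<zeta>. h \<zeta> - dilate h (r k) \<zeta>) n = fourier_coeff h n * complex_of_real (1 - exp (- (\<bar>real_of_int n\<bar> * r k)))" for n
      by (subst fourier_coeff_diff[OF L2_circle_integrable[OF h] L2_circle_integrable[OF dilate_L2[OF h r(1)]]])
        (simp add: dilate_coeff[OF h r(1)] algebra_simps)
    then have "(cmod (fourier_coeff (\<lambda>\<zeta>. h \<zeta> - dilate h (r k) \<zeta>) n))\<^sup>2 = (cmod (fourier_coeff h n))\<^sup>2 * t k n" for n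
      by (simp add: norm_mult power_mult_distrib t_def del: of_real_diff)
    then show ?thesis by (simp add: Parseval[OF L2_diff(1)[OF h dilate_L2[OF h r(1)]]])
  qed
  have "(\<lambda>k. \<Sum>\<^sub>\<infinity>n. (cmod (fourier_coeff h n))\<^sup>2 * t k n) \<longlonglongrightarrow> 0"
  proof (rule infsum_mult_tendsto_0)
    show "(\<lambda>n. (cmod (fourier_coeff h n))\<^sup>2) summable_on UNIV" by (rule fourier_coeff_sq_summable[OF h])
    show "t k n \<le> 1" for k n
      using r(1)[of k] by (auto simp: t_def intro!: power_le_one)
    have "(\<lambda>k. (1 - exp (- (\<bar>real_of_int n\<bar> * r k)))\<^sup>2) \<longlonglongrightarrow> (1 - exp (- (\<bar>real_of_int n\<bar> * 0)))\<^sup>2" for n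
      by (intro tendsto_intros r(2))
    then show "(\<lambda>k. t k n) \<longlonglongrightarrow> 0" for n by (simp add: t_def)
  qed (auto simp: t_def)
  from tendsto_mult[OF tendsto_const this, of "2 * pi"] show ?thesis by (simp add: eq)
qed


section \<open>Integrability along the segments\<close>

text \<open>cos 1 is at least 1/2, so sin x is at least x/2 on [0, 1]. Beyond 1, sin t is at least
  sin 1, hence at least 1/2, while t/4 stays below 1/2.\<close>

lemma sin_ge_quarter:
  assumes "0 \<le> t" "t \<le> pi / 2"
  shows "t / 4 \<le> sin t"
proof -
  have c1: "1 / 2 \<le> cos (1::real)"
    using cos_monotone_0_pi_le[of 1 "pi / 3"] pi_gt3 by (simp add: cos_60)
  have small: "x / 2 \<le> sin x" if x: "0 < x" "x \<le> 1" for x :: real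
  proof -
    obtain y where y: "0 < y" "y < x" "sin x - sin 0 = (x - 0) * cos y"
      using MVT2[of 0 x sin cos] x DERIV_sin by blast
    have "cos 1 \<le> cos y" using y x pi_gt3 by (intro cos_monotone_0_pi_le) auto
    then have "x * (1 / 2) \<le> x * cos y" using c1 x by (intro mult_left_mono) auto
    then show ?thesis using y by simp
  qed
  consider "t = 0" | "0 < t" "t \<le> 1" | "1 < t" using assms by linarith
  then show ?thesis
  proof cases
    case 2
    then show ?thesis using small[of t] by simp
  next
    case 3
    have "sin 1 \<le> sin t" using 3 assms pi_gt3 by (intro sin_monotone_2pi_le) auto
    then show ?thesis using small[of 1] assms pi_less_4 by simp
  qed simp
qed

lemma cmod_cis_minus_1:
  assumes "\<bar>y\<bar> \<le> pi"
  shows "\<bar>y\<bar> / 4 \<le> cmod (cis y - 1)"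
proof -
  have "\<bar>y\<bar> / 2 / 4 \<le> sin (\<bar>y\<bar> / 2)" using assms by (intro sin_ge_quarter) auto
  also have "sin (\<bar>y\<bar> / 2) \<le> \<bar>sin (y / 2)\<bar>" by (auto simp: abs_if)
  also have "cmod (cis y - 1) = 2 * \<bar>sin (y / 2)\<bar>"
  proof -
    have "(cmod (cis y - 1))\<^sup>2 = 2 - 2 * cos y"
      using sin_cos_squared_add[of y] unfolding cmod_power2 by (simp add: power2_eq_square algebra_simps)
    also have "\<dots> = (2 * \<bar>sin (y / 2)\<bar>)\<^sup>2"
      using cos_double_sin[of "y / 2"] by (simp add: power_mult_distrib)
    finally show ?thesis by (rule power2_eq_imp_eq) auto
  qed
  ultimately show ?thesis by simp
qed

lemma nn_integral_abs_powr_finite: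
  fixes a R :: real
  assumes a: "0 < a" "a < 1" and R: "0 \<le> R"
  shows "(\<integral>\<^sup>+u. ennreal (\<bar>u\<bar> powr (- a)) * indicator {-R..R} u \<partial>lborel) < \<infinity>"
proof -
  have 1: "(\<integral>\<^sup>+u. ennreal (u powr (- a)) * indicator {0..R} u \<partial>lborel) = ennreal (R powr (- a + 1) / (- a + 1))"
    using nn_integral_has_integral_lebesgue'[OF _ has_integral_powr_from_0[of "- a" R]] a R by simp
  have 2: "(\<integral>\<^sup>+u. ennreal ((- u) powr (- a)) * indicator {0..R} (- u) \<partial>lborel)
      = (\<integral>\<^sup>+u. ennreal (u powr (- a)) * indicator {0..R} u \<partial>lborel)"
    using nn_integral_real_affine[of "\<lambda>u. ennreal (u powr (- a)) * indicator {0..R} u" "-1" 0] by simp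
  have "(\<integral>\<^sup>+u. ennreal (\<bar>u\<bar> powr (- a)) * indicator {-R..R} u \<partial>lborel)
      \<le> (\<integral>\<^sup>+u. ennreal (u powr (- a)) * indicator {0..R} u + ennreal ((- u) powr (- a)) * indicator {0..R} (- u) \<partial>lborel)"
    by (intro nn_integral_mono) (auto simp: indicator_def abs_if)
  also have "\<dots> = ennreal (R powr (- a + 1) / (- a + 1)) + ennreal (R powr (- a + 1) / (- a + 1))"
    unfolding 1[symmetric] by (subst nn_integral_add) (auto simp: 2)
  also have "\<dots> < \<infinity>" by simp
  finally show ?thesis .
qed

text \<open>The exponent -1/2 is that of the square of |\<xi> - cis \<theta>|^(-1/4), the weight
  which the kernel estimate leaves on the circle. Cutting opposite to \<theta> makes chord and arc
  comparable.\<close>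

lemma circle_singularity_finite:
  "(\<integral>\<^sup>+\<xi>. ennreal (cmod (\<xi> - cis \<theta>) powr (- 1/2)) \<partial>circle_measure) < \<infinity>"
proof -
  have "(\<integral>\<^sup>+\<xi>. ennreal (cmod (\<xi> - cis \<theta>) powr (- 1/2)) \<partial>circle_measure)
      = (\<integral>\<^sup>+x. ennreal (cmod (cis x - cis \<theta>) powr (- 1/2)) * indicator {\<theta> - pi..<\<theta> - pi + 2 * pi} x \<partial>lborel)"
    by (rule circle_nn_integral) measurable
  also have "\<dots> = (\<integral>\<^sup>+y. ennreal (cmod (cis (\<theta> + 1 * y) - cis \<theta>) powr (- 1/2)) * indicator {\<theta> - pi..<\<theta> - pi + 2 * pi} (\<theta> + 1 * y) \<partial>lborel)"
    by (subst nn_integral_real_affine[where c=1 and t=\<theta>]) auto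
  also have "\<dots> \<le> (\<integral>\<^sup>+y. 2 * (ennreal (\<bar>y\<bar> powr (- (1/2))) * indicator {-pi..pi} y) \<partial>lborel)"
  proof (rule nn_integral_mono)
    fix y :: real
    have "cmod (cis (\<theta> + y) - cis \<theta>) powr (- 1/2) \<le> 2 * \<bar>y\<bar> powr (- (1/2))" if y: "\<bar>y\<bar> \<le> pi"
    proof (cases "y = 0")
      case False
      have "cmod (cis (\<theta> + y) - cis \<theta>) = cmod (cis \<theta> * (cis y - 1))"
        by (simp add: right_diff_distrib cis_mult)
      also have "\<dots> = cmod (cis y - 1)" by (simp add: norm_mult)
      finally have e: "cmod (cis (\<theta> + y) - cis \<theta>) = cmod (cis y - 1)" .
      have "cmod (cis y - 1) powr (- 1/2) \<le> (\<bar>y\<bar> / 4) powr (- 1/2)"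
        using False cmod_cis_minus_1[OF y] by (intro powr_mono2') auto
      also have "\<dots> = 2 * \<bar>y\<bar> powr (- (1/2))"
      proof -
        have 4: "(4::real) powr - (1/2) = 1 / 2"
          by (simp only: powr_minus powr_half_sqrt zero_le_numeral) simp
        have "(\<bar>y\<bar> / 4) powr - (1/2) = \<bar>y\<bar> powr - (1/2) / 4 powr - (1/2)"
          by (rule powr_divide)
        moreover have "(- 1 / 2 :: real) = - (1 / 2)" by simp
        ultimately show ?thesis by (simp only: 4) simp
      qed
      finally show ?thesis using e by simp
    qed simp
    then show "ennreal (cmod (cis (\<theta> + 1 * y) - cis \<theta>) powr (- 1/2)) * indicator {\<theta> - pi..<\<theta> - pi + 2 * pi} (\<theta> + 1 * y)
        \<le> 2 * (ennreal (\<bar>y\<bar> powr (- (1/2))) * indicator {-pi..pi} y)"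
      by (auto simp: indicator_def ennreal_mult[symmetric] abs_le_iff simp flip: ennreal_numeral intro!: ennreal_leI)
  qed
  also have "\<dots> = 2 * (\<integral>\<^sup>+y. ennreal (\<bar>y\<bar> powr (- (1/2))) * indicator {-pi..pi} y \<partial>lborel)"
    by (rule nn_integral_cmult) measurable
  also have "\<dots> < \<infinity>"
    using nn_integral_abs_powr_finite[of "1/2" pi] by (simp add: ennreal_mult_less_top)
  finally show ?thesis .
qed

text \<open>Interpolates between two lower bounds of a distance \<open>D\<close>. The power 7/8 < 1
  is integrable along the segment; the power 1/8, applied to a multiple of
  \<open>(cmod e)\<^sup>2\<close>, gives |e|^(-1/4), which is square integrable on the
  circle.\<close>

lemma inverse_le_powr_powr:
  fixes D \<kappa> y :: real
  assumes "0 < \<kappa>" "\<kappa> \<le> D" "0 < y" "y \<le> D"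
  shows "1 / D \<le> \<kappa> powr (- 1/8) * y powr (- 7/8)"
proof -
  have D: "0 < D" using assms by linarith
  have "1 / D = D powr (- 1/8) * D powr (- 7/8)"
    using D by (simp add: powr_add[symmetric] powr_minus_divide)
  also have "\<dots> \<le> \<kappa> powr (- 1/8) * y powr (- 7/8)"
    using assms D by (intro mult_mono powr_mono2') auto
  finally show ?thesis .
qed

text \<open>The segment may touch the circle tangentially, so \<open>|z| - 1\<close> is not comparable to the distance
  to the end point. What survives is that the distance from \<open>1 + s d\<close> to a point \<open>1 + e\<close> of the
  circle is at least \<open>|e|\<^sup>2 / 2\<close>, because \<open>Re e = - |e|\<^sup>2 / 2\<close>, and at least
  \<open>|s Im d - Im e|\<close>.\<close>

lemma segment_outside:
  assumes d: "0 \<le> Re d" "Im d \<noteq> 0" and s: "0 < s"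
  shows "1 < cmod (1 + of_real s * d)"
proof -
  have "d \<noteq> 0" using d by auto
  then have "0 < s\<^sup>2 * (cmod d)\<^sup>2" using s by simp
  moreover have "0 \<le> 2 * s * Re d" using s d by simp
  moreover have "(cmod (1 + of_real s * d))\<^sup>2 = 1 + 2 * s * Re d + s\<^sup>2 * (cmod d)\<^sup>2"
    unfolding cmod_power2 by (simp add: power2_eq_square algebra_simps)
  ultimately have "1\<^sup>2 < (cmod (1 + of_real s * d))\<^sup>2" by simp
  then show ?thesis by (rule power2_less_imp_less) simp
qed

text \<open>The numerator is at most 2 + |d| times the distance \<open>D\<close> from z to \<xi>,
  because |z| - |\<xi>| is at most \<open>D\<close>. The kernel is then at most (2 + |d|) / D, and
  the two lower bounds of \<open>D\<close> are interpolated; the excluded \<open>s\<close> is the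
  zero of the second one.\<close>

lemma Poisson_kernel_segment_bound:
  fixes d \<xi> :: complex and s :: real
  assumes d: "0 \<le> Re d" "Im d \<noteq> 0" and s: "0 < s" "s \<le> 1" and \<xi>: "cmod \<xi> = 1" "\<xi> \<noteq> cis \<theta>"
    and s': "s \<noteq> Im (\<xi> / cis \<theta>) / Im d"
  shows "1 < cmod (cis \<theta> * (1 + of_real s * d))"
    and "((cmod (cis \<theta> * (1 + of_real s * d)))\<^sup>2 - 1) / (cmod (cis \<theta> * (1 + of_real s * d) - \<xi>))\<^sup>2
      \<le> (2 + cmod d) * 2 powr (1/8) * \<bar>Im d\<bar> powr (- 7/8) * cmod (\<xi> - cis \<theta>) powr (- 1/4)
        * \<bar>s - Im (\<xi> / cis \<theta>) / Im d\<bar> powr (- 7/8)"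
proof -
  define z where "z = cis \<theta> * (1 + of_real s * d)"
  define e where "e = \<xi> / cis \<theta> - 1"
  have \<xi>e: "\<xi> = cis \<theta> * (1 + e)" by (simp add: e_def field_simps)
  have ne: "cmod (1 + e) = 1" using \<xi>(1) by (simp add: e_def norm_divide)
  have ce: "cmod e = cmod (\<xi> - cis \<theta>)"
  proof -
    have "\<xi> - cis \<theta> = cis \<theta> * e" by (simp add: \<xi>e algebra_simps)
    then show ?thesis by (simp add: norm_mult)
  qed
  have "(cmod (1 + e))\<^sup>2 = 1 + 2 * Re e + (cmod e)\<^sup>2"
    unfolding cmod_power2 by (simp add: power2_eq_square algebra_simps)
  then have Re_e: "Re e = - ((cmod e)\<^sup>2 / 2)" using ne by simp
  show z1: "1 < cmod (cis \<theta> * (1 + of_real s * d))"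
    using segment_outside[OF d s(1)] by (simp add: norm_mult)
  define D where "D = cmod (z - \<xi>)"
  have zx: "z - \<xi> = cis \<theta> * (of_real s * d - e)" by (simp add: z_def \<xi>e algebra_simps)
  have D: "D = cmod (of_real s * d - e)" by (simp add: D_def zx norm_mult)
  have "\<bar>Re (of_real s * d - e)\<bar> \<le> D" unfolding D by (rule abs_Re_le_cmod)
  moreover have "(cmod e)\<^sup>2 / 2 \<le> Re (of_real s * d - e)" using Re_e s d by simp
  ultimately have k: "(cmod e)\<^sup>2 / 2 \<le> D" by linarith
  have "\<bar>Im (of_real s * d - e)\<bar> \<le> D" unfolding D by (rule abs_Im_le_cmod)
  moreover have "Im (of_real s * d - e) = Im d * (s - Im (\<xi> / cis \<theta>) / Im d)"
    using d by (simp add: e_def right_diff_distrib)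
  ultimately have y: "\<bar>Im d\<bar> * \<bar>s - Im (\<xi> / cis \<theta>) / Im d\<bar> \<le> D" by (simp add: abs_mult)
  have e0: "0 < cmod e" using \<xi>(2) ce by simp
  then have D0: "0 < D" using k by (smt (verit) zero_less_power half_gt_zero)
  have "(cmod z)\<^sup>2 - 1 = (cmod z - cmod \<xi>) * (cmod z + cmod \<xi>)"
    using \<xi>(1) by (simp add: power2_eq_square algebra_simps)
  also have "\<dots> \<le> D * (2 + cmod d)"
  proof (rule mult_mono)
    show "cmod z - cmod \<xi> \<le> D" unfolding D_def by (rule norm_triangle_ineq2)
    have "cmod z \<le> 1 + s * cmod d"
      unfolding z_def using norm_triangle_ineq[of 1 "of_real s * d"] s by (simp add: norm_mult)
    also have "s * cmod d \<le> cmod d" using s by (simp add: mult_left_le_one_le)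
    finally show "cmod z + cmod \<xi> \<le> 2 + cmod d" using \<xi>(1) by simp
  qed (use D0 in auto)
  finally have "((cmod z)\<^sup>2 - 1) / D\<^sup>2 \<le> D * (2 + cmod d) / D\<^sup>2" by (intro divide_right_mono) auto
  also have "\<dots> = (2 + cmod d) * (1 / D)" using D0 by (simp add: power2_eq_square)
  also have "\<dots> \<le> (2 + cmod d) * (((cmod e)\<^sup>2 / 2) powr (- 1/8) * (\<bar>Im d\<bar> * \<bar>s - Im (\<xi> / cis \<theta>) / Im d\<bar>) powr (- 7/8))"
    using k y e0 d s' by (intro mult_left_mono inverse_le_powr_powr) auto
  also have "((cmod e)\<^sup>2 / 2) powr (- 1/8) = 2 powr (1/8) * cmod e powr (- 1/4)"
  proof -
    have "((cmod e)\<^sup>2 / 2) powr (- 1/8) = ((cmod e)\<^sup>2) powr (- 1/8) / 2 powr (- 1/8)"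
      by (rule powr_divide)
    also have "((cmod e)\<^sup>2) powr (- 1/8) = cmod e powr (- 1/4)"
      unfolding power2_eq_square powr_mult powr_add[symmetric] by simp
    also have "cmod e powr (- 1/4) / 2 powr (- 1/8) = 2 powr (1/8) * cmod e powr (- 1/4)"
      by (simp add: powr_minus_divide)
    finally show ?thesis .
  qed
  also have "(\<bar>Im d\<bar> * \<bar>s - Im (\<xi> / cis \<theta>) / Im d\<bar>) powr (- 7/8)
      = \<bar>Im d\<bar> powr (- 7/8) * \<bar>s - Im (\<xi> / cis \<theta>) / Im d\<bar> powr (- 7/8)" by (rule powr_mult)
  finally show "((cmod (cis \<theta> * (1 + of_real s * d)))\<^sup>2 - 1) / (cmod (cis \<theta> * (1 + of_real s * d) - \<xi>))\<^sup>2
      \<le> (2 + cmod d) * 2 powr (1/8) * \<bar>Im d\<bar> powr (- 7/8) * cmod (\<xi> - cis \<theta>) powr (- 1/4)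
        * \<bar>s - Im (\<xi> / cis \<theta>) / Im d\<bar> powr (- 7/8)"
    unfolding z_def[symmetric] D_def[symmetric] ce by (simp add: mult_ac)
qed

lemma AE_circle_neq: "AE \<xi> in circle_measure. \<xi> \<noteq> cis \<theta>"
proof -
  have "AE x in lborel. x \<noteq> \<theta>" by (rule AE_lborel_singleton)
  then have "AE x in lborel. x \<in> {\<theta> - pi..<\<theta> - pi + 2 * pi} \<longrightarrow> cis x \<noteq> cis \<theta>"
  proof eventually_elim
    case (elim x)
    show ?case
    proof (intro impI notI)
      assume x: "x \<in> {\<theta> - pi..<\<theta> - pi + 2 * pi}" "cis x = cis \<theta>"
      then have "x = \<theta>" using pi_gt_zero by (intro cis_eq_imp_eq) (auto simp: abs_less_iff)
      then show False using elim by simp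
    qed
  qed
  then show ?thesis by (subst circle_AE_iff[where c="\<theta> - pi"]) auto
qed

text \<open>As \<open>h\<close> is only in L2, the kernel is integrated along the segment before it
  meets \<open>h\<close>. What remains is a multiple of |\<xi> - cis \<theta>|^(-1/4), a square
  integrable function on the circle.\<close>

theorem exterior_harmonic_ext_segment_integrable:
  assumes h: "h \<in> L2_space circle_measure" and d: "0 \<le> Re d" "Im d \<noteq> 0"
  shows "set_integrable lborel {0<..1} (\<lambda>s. exterior_harmonic_ext h (cis \<theta> * (1 + of_real s * d)))"
proof -
  have hm [measurable]: "h \<in> borel_measurable borel" using L2_measurable[OF h] by (simp cong: measurable_cong_sets)
  define z where "z s = cis \<theta> * (1 + of_real s * d)" for s :: real
  have [measurable]: "z \<in> borel_measurable borel" unfolding z_def by measurable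
  define P where "P s \<xi> = ((cmod (z s))\<^sup>2 - 1) / (cmod (z s - \<xi>))\<^sup>2" for s \<xi>
  have [measurable]: "(\<lambda>x. P (fst x) (snd x)) \<in> borel_measurable (lborel \<Otimes>\<^sub>M circle_measure)"
    unfolding P_def by measurable
  have Pm2 [measurable]: "P s \<in> borel_measurable borel" for s unfolding P_def by measurable
  interpret lc: pair_sigma_finite "lborel :: real measure" circle_measure
    by (simp add: pair_sigma_finite_def lborel.sigma_finite_measure_axioms)
  define K where "K = (2 + cmod d) * 2 powr (1/8) * \<bar>Im d\<bar> powr (- 7/8)"
  have K: "0 \<le> K" by (simp add: K_def)
  define \<tau> where "\<tau> \<xi> = Im (\<xi> / cis \<theta>) / Im d" for \<xi>
  define I where "I = (\<integral>\<^sup>+u. ennreal (\<bar>u\<bar> powr (- (7/8))) * indicator {-1..1} u \<partial>lborel)"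
  have I: "I < \<infinity>" unfolding I_def by (rule nn_integral_abs_powr_finite) auto
  have inner: "(\<integral>\<^sup>+s. ennreal (P s \<xi>) * indicator {0<..1} s \<partial>lborel) \<le> ennreal (K * cmod (\<xi> - cis \<theta>) powr (- 1/4)) * (1 + I)"
    if \<xi>: "cmod \<xi> = 1" "\<xi> \<noteq> cis \<theta>" for \<xi>
  proof -
    have "AE s in lborel. s \<noteq> \<tau> \<xi>" by (rule AE_lborel_singleton)
    then have "(\<integral>\<^sup>+s. ennreal (P s \<xi>) * indicator {0<..1} s \<partial>lborel)
        \<le> (\<integral>\<^sup>+s. ennreal (K * cmod (\<xi> - cis \<theta>) powr (- 1/4)) * (indicator {0..1} s + ennreal (\<bar>s - \<tau> \<xi>\<bar> powr (- (7/8))) * indicator {-1..1} (s - \<tau> \<xi>)) \<partial>lborel)"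
    proof (intro nn_integral_mono_AE, eventually_elim)
      case (elim s)
      show ?case
      proof (cases "s \<in> {0<..1}")
        case True
        have "P s \<xi> \<le> K * cmod (\<xi> - cis \<theta>) powr (- 1/4) * \<bar>s - \<tau> \<xi>\<bar> powr (- (7/8))"
          using Poisson_kernel_segment_bound(2)[OF d _ _ \<xi>, of s] True elim
          unfolding P_def z_def K_def \<tau>_def by simp
        also have "\<dots> \<le> K * cmod (\<xi> - cis \<theta>) powr (- 1/4) * (1 + \<bar>s - \<tau> \<xi>\<bar> powr (- (7/8)) * indicator {-1..1} (s - \<tau> \<xi>))"
        \<comment> \<open>At distance more than 1 from \<tau> \<xi> the singular factor is at most
          1. Confining the singularity to a window of fixed length makes the integral bound
          independent of \<tau> \<xi>.\<close>
        proof (intro mult_left_mono mult_nonneg_nonneg K)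
          have "\<bar>s - \<tau> \<xi>\<bar> powr (- (7/8)) \<le> 1 powr (- (7/8))" if "\<not> \<bar>s - \<tau> \<xi>\<bar> \<le> 1"
            using that by (intro powr_mono2') auto
          then show "\<bar>s - \<tau> \<xi>\<bar> powr (- (7/8)) \<le> 1 + \<bar>s - \<tau> \<xi>\<bar> powr (- (7/8)) * indicator {-1..1} (s - \<tau> \<xi>)"
            by (auto simp: indicator_def abs_le_iff)
        qed auto
        finally have "ennreal (P s \<xi>) \<le> ennreal (K * cmod (\<xi> - cis \<theta>) powr (- 1/4) * (1 + \<bar>s - \<tau> \<xi>\<bar> powr (- (7/8)) * indicator {-1..1} (s - \<tau> \<xi>)))"
          by (rule ennreal_leI)
        also have "\<dots> = ennreal (K * cmod (\<xi> - cis \<theta>) powr (- 1/4)) * (1 + ennreal (\<bar>s - \<tau> \<xi>\<bar> powr (- (7/8))) * indicator {-1..1} (s - \<tau> \<xi>))"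
          using K by (auto simp: ennreal_mult ennreal_plus indicator_def)
        finally show ?thesis using True by simp
      qed simp
    qed
    also have "\<dots> = ennreal (K * cmod (\<xi> - cis \<theta>) powr (- 1/4)) * (1 + (\<integral>\<^sup>+s. ennreal (\<bar>s - \<tau> \<xi>\<bar> powr (- (7/8))) * indicator {-1..1} (s - \<tau> \<xi>) \<partial>lborel))"
      by (simp add: nn_integral_cmult nn_integral_add)
    also have "(\<integral>\<^sup>+s. ennreal (\<bar>s - \<tau> \<xi>\<bar> powr (- (7/8))) * indicator {-1..1} (s - \<tau> \<xi>) \<partial>lborel) = I"
      unfolding I_def using nn_integral_real_affine[of "\<lambda>u. ennreal (\<bar>u\<bar> powr (- (7/8))) * indicator {-1..1} u" 1 "- \<tau> \<xi>"]
      by simp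
    finally show ?thesis .
  qed
  define C where "C = ennreal (1 / (2 * pi)) * (ennreal K * (1 + I))"
  have C: "C < \<infinity>" using I by (simp add: C_def ennreal_mult_less_top)
  have "(\<integral>\<^sup>+s. ennreal (norm (indicator {0<..1} s *\<^sub>R exterior_harmonic_ext h (z s))) \<partial>lborel)
      \<le> (\<integral>\<^sup>+s. \<integral>\<^sup>+\<xi>. ennreal (1 / (2 * pi)) * (ennreal (P s \<xi>) * indicator {0<..1} s * ennreal (norm (h \<xi>))) \<partial>circle_measure \<partial>lborel)"
  proof (rule nn_integral_mono)
    fix s :: real
    show "ennreal (norm (indicator {0<..1} s *\<^sub>R exterior_harmonic_ext h (z s)))
      \<le> (\<integral>\<^sup>+\<xi>. ennreal (1 / (2 * pi)) * (ennreal (P s \<xi>) * indicator {0<..1} s * ennreal (norm (h \<xi>))) \<partial>circle_measure)"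
    proof (cases "s \<in> {0<..1}")
      case True
      have "1 < cmod (z s)"
        using segment_outside[OF d, of s] True by (simp add: z_def norm_mult)
      then have P0: "0 \<le> P s \<xi>" for \<xi> unfolding P_def by (intro divide_nonneg_nonneg) (auto simp: one_le_power)
      have "ennreal (norm (exterior_harmonic_ext h (z s)))
          = ennreal (1 / (2 * pi)) * ennreal (norm (\<integral>\<xi>. complex_of_real (P s \<xi>) * h \<xi> \<partial>circle_measure))"
      proof -
        have "norm (exterior_harmonic_ext h (z s)) = 1 / (2 * pi) * norm (\<integral>\<xi>. complex_of_real (P s \<xi>) * h \<xi> \<partial>circle_measure)"
          unfolding exterior_harmonic_ext_def P_def[symmetric] norm_mult norm_of_real by simp
        moreover have "ennreal (1 / (2 * pi) * N) = ennreal (1 / (2 * pi)) * ennreal N" if "0 \<le> N" for N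
          by (rule ennreal_mult) (use that in auto)
        ultimately show ?thesis by (simp only: norm_ge_zero)
      qed
      also have "\<dots> \<le> ennreal (1 / (2 * pi)) * (\<integral>\<^sup>+\<xi>. ennreal (norm (complex_of_real (P s \<xi>) * h \<xi>)) \<partial>circle_measure)"
      proof (rule mult_left_mono)
        show "ennreal (norm (\<integral>\<xi>. complex_of_real (P s \<xi>) * h \<xi> \<partial>circle_measure))
          \<le> (\<integral>\<^sup>+\<xi>. ennreal (norm (complex_of_real (P s \<xi>) * h \<xi>)) \<partial>circle_measure)"
        proof (cases "integrable circle_measure (\<lambda>\<xi>. complex_of_real (P s \<xi>) * h \<xi>)")
          case True
          then show ?thesis by (rule integral_norm_bound_ennreal)
        next
          \<comment> \<open>The integral of a non-integrable function is 0, so the bound is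
            trivial.\<close>
          case False
          then show ?thesis by (simp add: not_integrable_integral_eq)
        qed
      qed simp
      also have "\<dots> = (\<integral>\<^sup>+\<xi>. ennreal (1 / (2 * pi)) * (ennreal (P s \<xi>) * ennreal (norm (h \<xi>))) \<partial>circle_measure)"
        using P0 by (subst nn_integral_cmult) (auto simp: norm_mult ennreal_mult)
      finally show ?thesis using True by simp
    qed simp
  qed
  also have "\<dots> = (\<integral>\<^sup>+\<xi>. \<integral>\<^sup>+s. ennreal (1 / (2 * pi)) * (ennreal (P s \<xi>) * indicator {0<..1} s * ennreal (norm (h \<xi>))) \<partial>lborel \<partial>circle_measure)"
    by (rule lc.Fubini'[symmetric]) (simp add: case_prod_unfold)
  also have "\<dots> \<le> (\<integral>\<^sup>+\<xi>. C * ennreal ((cmod (h \<xi>))\<^sup>2 + cmod (\<xi> - cis \<theta>) powr (- 1/2)) \<partial>circle_measure)"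
  proof (rule nn_integral_mono_AE)
    show "AE \<xi> in circle_measure. (\<integral>\<^sup>+s. ennreal (1 / (2 * pi)) * (ennreal (P s \<xi>) * indicator {0<..1} s * ennreal (norm (h \<xi>))) \<partial>lborel)
        \<le> C * ennreal ((cmod (h \<xi>))\<^sup>2 + cmod (\<xi> - cis \<theta>) powr (- 1/2))"
      using AE_circle_norm AE_circle_neq[of \<theta>]
    proof eventually_elim
      case (elim \<xi>)
      have Pm: "(\<lambda>s. P s \<xi>) \<in> borel_measurable borel" unfolding P_def by measurable
      define q where "q = cmod (\<xi> - cis \<theta>) powr (- 1/4)"
      have q: "0 \<le> q" "q\<^sup>2 = cmod (\<xi> - cis \<theta>) powr (- 1/2)"
        by (simp_all add: q_def powr_add[symmetric] power2_eq_square)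
      \<comment> \<open>In place of Cauchy-Schwarz on the circle: the product is dominated by the
        sum of two integrable squares.\<close>
      have "q * cmod (h \<xi>) \<le> 2 * cmod (h \<xi>) * q" using q by simp
      also have "\<dots> \<le> (cmod (h \<xi>))\<^sup>2 + q\<^sup>2" by (rule sum_squares_bound)
      finally have qh: "q * cmod (h \<xi>) \<le> (cmod (h \<xi>))\<^sup>2 + cmod (\<xi> - cis \<theta>) powr (- 1/2)" by (simp only: q)
      have "(\<integral>\<^sup>+s. ennreal (1 / (2 * pi)) * (ennreal (P s \<xi>) * indicator {0<..1} s * ennreal (norm (h \<xi>))) \<partial>lborel)
          = ennreal (1 / (2 * pi)) * ((\<integral>\<^sup>+s. ennreal (P s \<xi>) * indicator {0<..1} s \<partial>lborel) * ennreal (norm (h \<xi>)))"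
        using Pm by (subst nn_integral_cmult, measurable) (subst nn_integral_multc, auto)
      also have "\<dots> \<le> ennreal (1 / (2 * pi)) * ((ennreal (K * q) * (1 + I)) * ennreal (norm (h \<xi>)))"
        unfolding q_def by (intro mult_left_mono mult_right_mono inner elim) auto
      also have "\<dots> = C * ennreal (q * cmod (h \<xi>))"
        using K q by (simp add: C_def ennreal_mult mult_ac)
      also have "\<dots> \<le> C * ennreal ((cmod (h \<xi>))\<^sup>2 + cmod (\<xi> - cis \<theta>) powr (- 1/2))"
        by (intro mult_left_mono ennreal_leI qh) auto
      finally show ?case .
    qed
  qed
  also have "\<dots> = C * (ennreal (normsq circle_measure h) + (\<integral>\<^sup>+\<xi>. ennreal (cmod (\<xi> - cis \<theta>) powr (- 1/2)) \<partial>circle_measure))"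
    by (simp add: nn_integral_cmult nn_integral_add ennreal_plus L2_nn_integral[OF h])
  also have "\<dots> < \<infinity>"
    using C circle_singularity_finite[of \<theta>] by (simp add: ennreal_mult_less_top)
  finally have fin: "(\<integral>\<^sup>+s. ennreal (norm (indicator {0<..1} s *\<^sub>R exterior_harmonic_ext h (z s))) \<partial>lborel) < \<infinity>" .
  have "(\<lambda>s. exterior_harmonic_ext h (z s)) \<in> borel_measurable borel"
    unfolding exterior_harmonic_ext_def by measurable
  then show ?thesis
    using fin unfolding set_integrable_def z_def[symmetric] by (intro integrableI_bounded) auto
qed


section \<open>Green's formula\<close>

text \<open>Proved by differentiating in \<open>s\<close> the integral over the segment from \<open>W1 s\<close> to \<open>W2 s\<close>: only the
  antiholomorphic factor \<open>cnj A\<close> contributes to the area term \<open>E\<close>.\<close>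

lemma Green_homotopy:
  fixes A H B :: "complex \<Rightarrow> complex" and W1 W2 V1 V2 :: "real \<Rightarrow> complex"
  assumes S: "open S" "convex S" and hol: "A holomorphic_on S" "H holomorphic_on S" "B holomorphic_on S"
    and d1: "\<And>s. s \<in> {\<epsilon>..1} \<Longrightarrow> (W1 has_vector_derivative V1 s) (at s within {\<epsilon>..1})"
    and d2: "\<And>s. s \<in> {\<epsilon>..1} \<Longrightarrow> (W2 has_vector_derivative V2 s) (at s within {\<epsilon>..1})"
    and c: "continuous_on {\<epsilon>..1} V1" "continuous_on {\<epsilon>..1} V2"
    and W: "\<And>s. s \<in> {\<epsilon>..1} \<Longrightarrow> W1 s \<in> S" "\<And>s. s \<in> {\<epsilon>..1} \<Longrightarrow> W2 s \<in> S" and \<epsilon>: "\<epsilon> \<le> 1"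
  defines "F \<equiv> \<lambda>w. (cnj (A w) + H w) * B w"
    and "\<Phi> \<equiv> \<lambda>s t. W1 s + of_real t * (W2 s - W1 s)"
    and "\<Psi> \<equiv> \<lambda>s t. V1 s + of_real t * (V2 s - V1 s)"
  defines "K \<equiv> \<lambda>s. integral {0..1} (\<lambda>t. F (\<Phi> s t) * (W2 s - W1 s))"
    and "E \<equiv> \<lambda>s. integral {0..1} (\<lambda>t. cnj (deriv A (\<Phi> s t)) * B (\<Phi> s t)
        * (cnj (\<Psi> s t) * (W2 s - W1 s) - cnj (W2 s - W1 s) * \<Psi> s t))"
  shows "((\<lambda>s. F (W2 s) * V2 s - F (W1 s) * V1 s + E s) has_integral (K 1 - K \<epsilon>)) {\<epsilon>..1}"
proof -
  let ?U = "{\<epsilon>..1}"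
  have cW: "continuous_on ?U W1" "continuous_on ?U W2"
    by (rule continuous_on_vector_derivative[OF d1] continuous_on_vector_derivative[OF d2], simp)+
  have \<Phi>S: "\<Phi> s t \<in> S" if "s \<in> ?U" "t \<in> {0..1}" for s t
  proof -
    have "\<Phi> s t = (1 - t) *\<^sub>R W1 s + t *\<^sub>R W2 s" by (simp add: \<Phi>_def scaleR_conv_of_real algebra_simps)
    then show ?thesis using W that convexD[OF S(2), of "W1 s" "W2 s" "1 - t" t] by simp
  qed
  define H2 where "H2 = (\<lambda>w. H w * B w)"
  have H2: "H2 holomorphic_on S" unfolding H2_def by (intro holomorphic_intros hol)
  have cA: "continuous_on S A" "continuous_on S B" "continuous_on S H2"
    using hol H2 by (auto intro: holomorphic_on_imp_continuous_on)
  have cD: "continuous_on S (deriv A)" "continuous_on S (deriv B)" "continuous_on S (deriv H2)"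
    using hol H2 S(1) by (auto intro!: holomorphic_on_imp_continuous_on holomorphic_deriv)
  have F: "F w = cnj (A w) * B w + H2 w" for w by (simp add: F_def H2_def algebra_simps)
  have der: "(f has_field_derivative deriv f w) (at w)" if "f holomorphic_on S" "w \<in> S" for f w
    using holomorphic_derivI[OF that(1) S(1) that(2)] .
  \<comment> \<open>The real differential of \<open>F\<close> at \<open>w\<close>. Its first summand
    is conjugate linear in \<open>v\<close>, the other two are complex linear.\<close>
  define DF where "DF w v = cnj (deriv A w * v) * B w + cnj (A w) * (deriv B w * v) + deriv H2 w * v" for w v
  have F_der: "((\<lambda>x. F (f x)) has_vector_derivative DF (f x) v) (at x within X)"
    if "(f has_vector_derivative v) (at x within X)" "f x \<in> S" for f :: "real \<Rightarrow> complex" and v x X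
  proof -
    have chain: "((\<lambda>x. g (f x)) has_vector_derivative deriv g (f x) * v) (at x within X)"
      if "g holomorphic_on S" for g
      using field_vector_diff_chain_within[OF \<open>(f has_vector_derivative v) (at x within X)\<close>
          has_field_derivative_at_within[OF der[OF that \<open>f x \<in> S\<close>]]]
      by (simp add: o_def mult.commute)
    have A': "((\<lambda>x. cnj (A (f x))) has_vector_derivative cnj (deriv A (f x) * v)) (at x within X)"
      using chain[OF hol(1)] by (rule has_vector_derivative_cnj)
    show ?thesis unfolding F DF_def
      by (rule has_vector_derivative_eq_rhs, rule has_vector_derivative_add[OF has_vector_derivative_mult[OF A' chain[OF hol(3)]] chain[OF H2]]) simp
  qed
  have \<Phi>_s: "((\<lambda>s. \<Phi> s t) has_vector_derivative \<Psi> s t) (at s within ?U)" if "s \<in> ?U" for s t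
    unfolding \<Phi>_def \<Psi>_def
    using d1[OF that] d2[OF that] by (auto intro!: derivative_eq_intros)
  have \<Phi>_t: "((\<lambda>t. \<Phi> s t) has_vector_derivative (W2 s - W1 s)) (at t within X)" for s t X
    unfolding \<Phi>_def by (auto intro!: derivative_eq_intros)
  have \<Psi>_t: "((\<lambda>t. \<Psi> s t) has_vector_derivative (V2 s - V1 s)) (at t within X)" for s t X
    unfolding \<Psi>_def by (auto intro!: derivative_eq_intros)
  \<comment> \<open>The s-derivative of the integrand of \<open>K\<close>.\<close>
  define fx where "fx s t = DF (\<Phi> s t) (\<Psi> s t) * (W2 s - W1 s) + F (\<Phi> s t) * (V2 s - V1 s)" for s t
  have c\<Phi>: "continuous_on (?U \<times> {0..1}) (\<lambda>x. \<Phi> (fst x) (snd x))"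
    "continuous_on (?U \<times> {0..1}) (\<lambda>x. \<Psi> (fst x) (snd x))"
    unfolding \<Phi>_def \<Psi>_def
    by (intro continuous_intros continuous_on_compose2[OF cW(1)] continuous_on_compose2[OF cW(2)]
        continuous_on_compose2[OF c(1)] continuous_on_compose2[OF c(2)]; auto)+
  have cS: "continuous_on (?U \<times> {0..1}) (\<lambda>x. f (\<Phi> (fst x) (snd x)))" if "continuous_on S f" for f :: "complex \<Rightarrow> complex"
    by (rule continuous_on_compose2[OF that c\<Phi>(1)]) (use \<Phi>S in auto)
  have cfst: "continuous_on (?U \<times> {0..1::real}) (\<lambda>x. f (fst x))" if "continuous_on ?U f" for f :: "real \<Rightarrow> complex"
    by (rule continuous_on_compose2[OF that]) (auto intro!: continuous_intros)
  have cF: "continuous_on (?U \<times> {0..1}) (\<lambda>x. F (\<Phi> (fst x) (snd x)))"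
    unfolding F by (intro continuous_intros cS cA)
  have cfx: "continuous_on (?U \<times> {0..1}) (\<lambda>x. fx (fst x) (snd x))"
    unfolding fx_def DF_def
    by (intro continuous_intros cS cA cD cF c\<Phi> cfst cW c)
  have sec: "continuous_on {0..1} (\<lambda>t. f (s, t))" if "continuous_on (?U \<times> {0..1}) f" "s \<in> ?U"
    for f :: "real \<times> real \<Rightarrow> complex" and s
    by (rule continuous_on_compose2[OF that(1)]) (use that(2) in \<open>auto intro!: continuous_intros\<close>)
  have K_der: "(K has_vector_derivative integral {0..1} (fx s)) (at s within ?U)" if s: "s \<in> ?U" for s
  proof -
    have 1: "((\<lambda>s. F (\<Phi> s t) * (W2 s - W1 s)) has_vector_derivative fx s t) (at s within ?U)"
      if st: "s \<in> ?U" "t \<in> {0..1}" for s t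
    proof -
      have "((\<lambda>s. W2 s - W1 s) has_vector_derivative V2 s - V1 s) (at s within ?U)"
        by (intro has_vector_derivative_diff d1 d2 st)
      from has_vector_derivative_mult[OF F_der[OF \<Phi>_s[OF st(1)] \<Phi>S[OF st]] this]
      show ?thesis by (simp add: fx_def add.commute)
    qed
    have 2: "(\<lambda>t. F (\<Phi> s t) * (W2 s - W1 s)) integrable_on {0..1}" if "s \<in> ?U" for s
      using sec[OF cF that] by (intro integrable_continuous_interval continuous_intros) simp
    have 3: "continuous_on (?U \<times> {0..1}) (\<lambda>(s, t). fx s t)"
      using cfx by (simp add: case_prod_unfold)
    have 4: "convex ?U" by simp
    show ?thesis
      unfolding K_def
      by (rule leibniz_rule_vector_derivative[where a="0::real" and b=1, unfolded box_real(2), OF 1 2 3 s 4])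
  qed
  have fx_eq: "integral {0..1} (fx s) = F (W2 s) * V2 s - F (W1 s) * V1 s + E s" if s: "s \<in> ?U" for s
  proof -
    define e where "e t = cnj (deriv A (\<Phi> s t)) * B (\<Phi> s t)
        * (cnj (\<Psi> s t) * (W2 s - W1 s) - cnj (W2 s - W1 s) * \<Psi> s t)" for t
    \<comment> \<open>The derivatives of \<open>\<Phi>\<close> in s and t are
      \<open>\<Psi> s t\<close> and \<open>W2 s - W1 s\<close>. In comparing the s-derivative of
      \<open>F (\<Phi> s t) * (W2 s - W1 s)\<close> with the t-derivative of
      \<open>F (\<Phi> s t) * \<Psi> s t\<close>, the complex linear part of \<open>DF\<close> and
      the mixed derivatives cancel; the conjugate linear part leaves \<open>e\<close>.\<close>
    have ft: "((\<lambda>t. F (\<Phi> s t) * \<Psi> s t) has_vector_derivative fx s t - e t) (at t within {0..1})"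
      if "t \<in> {0..1}" for t
    proof -
      from has_vector_derivative_mult[OF F_der[OF \<Phi>_t \<Phi>S[OF s that]] \<Psi>_t]
      have "((\<lambda>t. F (\<Phi> s t) * \<Psi> s t) has_vector_derivative
          F (\<Phi> s t) * (V2 s - V1 s) + DF (\<Phi> s t) (W2 s - W1 s) * \<Psi> s t) (at t within {0..1})" .
      moreover have "F (\<Phi> s t) * (V2 s - V1 s) + DF (\<Phi> s t) (W2 s - W1 s) * \<Psi> s t = fx s t - e t"
        unfolding fx_def e_def DF_def complex_cnj_mult by algebra
      ultimately show ?thesis by simp
    qed
    have "((\<lambda>t. fx s t - e t) has_integral (F (\<Phi> s 1) * \<Psi> s 1 - F (\<Phi> s 0) * \<Psi> s 0)) {0..1}"
      by (rule fundamental_theorem_of_calculus) (auto intro: ft)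
    then have "((\<lambda>t. fx s t - e t) has_integral (F (W2 s) * V2 s - F (W1 s) * V1 s)) {0..1}"
      by (simp add: \<Phi>_def \<Psi>_def)
    moreover have "(e has_integral E s) {0..1}"
    proof -
      have "continuous_on (?U \<times> {0..1}) (\<lambda>x. cnj (deriv A (\<Phi> (fst x) (snd x))) * B (\<Phi> (fst x) (snd x))
        * (cnj (\<Psi> (fst x) (snd x)) * (W2 (fst x) - W1 (fst x)) - cnj (W2 (fst x) - W1 (fst x)) * \<Psi> (fst x) (snd x)))"
        by (intro continuous_intros cS cA cD c\<Phi> cfst cW)
      from sec[OF this s] have "e integrable_on {0..1}"
        unfolding e_def by (intro integrable_continuous_interval) simp
      then show ?thesis unfolding E_def e_def by (rule integrable_integral)
    qed
    ultimately have "((\<lambda>t. (fx s t - e t) + e t) has_integral (F (W2 s) * V2 s - F (W1 s) * V1 s + E s)) {0..1}"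
      by (rule has_integral_add)
    then show ?thesis by (simp add: integral_unique)
  qed
  show ?thesis
    by (rule fundamental_theorem_of_calculus[OF \<epsilon>]) (use K_der fx_eq in auto)
qed


section \<open>The area term\<close>

text \<open>Passes from the gauge integrals of \<open>Green_homotopy\<close> to nonnegative Lebesgue
  integrals, where Tonelli and substitution apply.\<close>

lemma norm_integral_le_nn:
  fixes f :: "real \<Rightarrow> complex"
  assumes "continuous_on {p..q} f"
  shows "ennreal (norm (integral {p..q} f)) \<le> (\<integral>\<^sup>+x. ennreal (norm (f x)) * indicator {p..q} x \<partial>lborel)"
proof -
  have i: "set_integrable lborel {p..q} f" by (rule borel_integrable_atLeastAtMost'[OF assms])
  have "ennreal (norm (integral {p..q} f)) = ennreal (norm (\<integral>x. indicator {p..q} x *\<^sub>R f x \<partial>lborel))"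
    using set_borel_integral_eq_integral(2)[OF i] by (simp add: set_lebesgue_integral_def)
  also have "\<dots> \<le> (\<integral>\<^sup>+x. ennreal (norm (indicator {p..q} x *\<^sub>R f x)) \<partial>lborel)"
    using i unfolding set_integrable_def by (rule integral_norm_bound_ennreal)
  also have "\<dots> = (\<integral>\<^sup>+x. ennreal (norm (f x)) * indicator {p..q} x \<partial>lborel)"
    by (intro nn_integral_cong) (auto simp: indicator_def)
  finally show ?thesis .
qed

text \<open>The derivative of \<open>pow_sum c (exp (- w))\<close>, that is, of the holomorphic part
  of the extension in the coordinate w = log z.\<close>

definition dlog :: "(nat \<Rightarrow> complex) \<Rightarrow> complex \<Rightarrow> complex" where
  "dlog c w = - pow_sum (\<lambda>n. of_nat n * c n) (exp (- w))"

lemma summable_of_nat_mult: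
  assumes B: "\<And>n. cmod (c n) \<le> B" and z: "cmod z < 1"
  shows "summable (\<lambda>n. of_nat n * c n * z ^ n)"
    and "(\<Sum>n. of_nat n * c n * z ^ n) = z * (\<Sum>n. diffs c n * z ^ n)"
proof -
  have "summable (\<lambda>n. diffs c n * z ^ n)"
    by (rule termdiff_converges[OF z]) (rule summable_norm_cancel[OF summable_pow_sum[OF B]])
  from diffs_equiv[OF this]
  have "(\<lambda>n. z * (of_nat n * c n * z ^ (n - Suc 0))) sums (z * (\<Sum>n. diffs c n * z ^ n))" by (rule sums_mult)
  moreover have "z * (of_nat n * c n * z ^ (n - Suc 0)) = of_nat n * c n * z ^ n" for n
    by (cases n) auto
  ultimately have "(\<lambda>n. of_nat n * c n * z ^ n) sums (z * (\<Sum>n. diffs c n * z ^ n))" by simp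
  then show "summable (\<lambda>n. of_nat n * c n * z ^ n)"
    "(\<Sum>n. of_nat n * c n * z ^ n) = z * (\<Sum>n. diffs c n * z ^ n)" by (simp_all add: sums_iff)
qed

lemma pow_sum_exp_has_derivative:
  assumes B: "\<And>n. cmod (c n) \<le> B" and w: "0 < Re w"
  shows "((\<lambda>w. pow_sum c (exp (- w))) has_field_derivative dlog c w) (at w)"
proof -
  have lt: "cmod (exp (- w)) < 1" using w by simp
  have "(pow_sum c has_field_derivative (\<Sum>n. diffs c n * exp (- w) ^ n)) (at (exp (- w)))"
    unfolding pow_sum_def[abs_def]
    by (rule termdiffs_strong'[OF summable_norm_cancel[OF summable_pow_sum[OF B]] lt])
  moreover have "((\<lambda>w. exp (- w)) has_field_derivative - exp (- w)) (at w)"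
    by (auto intro!: derivative_eq_intros)
  ultimately have "((\<lambda>w. pow_sum c (exp (- w))) has_field_derivative (\<Sum>n. diffs c n * exp (- w) ^ n) * - exp (- w)) (at w)"
    by (rule DERIV_chain2)
  then show ?thesis
    unfolding dlog_def pow_sum_def summable_of_nat_mult(2)[OF B lt] by (simp add: mult.commute)
qed

lemma pow_sum_exp_holomorphic:
  assumes B: "\<And>n. cmod (c n) \<le> B"
  shows "(\<lambda>w. pow_sum c (exp (- w))) holomorphic_on {w. 0 < Re w}"
proof (rule holomorphic_onI)
  fix w assume "w \<in> {w. 0 < Re w}"
  then have "((\<lambda>w. pow_sum c (exp (- w))) has_field_derivative dlog c w) (at w)"
    using pow_sum_exp_has_derivative[of c B w] B by simp
  then show "(\<lambda>w. pow_sum c (exp (- w))) field_differentiable at w within {w. 0 < Re w}"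
    unfolding field_differentiable_def by (blast intro: has_field_derivative_at_within)
qed

lemma deriv_pow_sum_exp:
  assumes B: "\<And>n. cmod (c n) \<le> B" and w: "0 < Re w"
  shows "deriv (\<lambda>w. pow_sum c (exp (- w))) w = dlog c w"
  by (rule DERIV_imp_deriv[OF pow_sum_exp_has_derivative[OF B w]])

lemma dlog_measurable [measurable]: "dlog c \<in> borel_measurable borel"
proof -
  have [measurable]: "pow_sum d \<in> borel_measurable borel" for d unfolding pow_sum_def by measurable
  show ?thesis unfolding dlog_def[abs_def] by measurable
qed

abbreviation cart :: "real \<Rightarrow> real \<Rightarrow> complex" where
  "cart \<sigma> x \<equiv> of_real \<sigma> + \<i> * of_real x"

lemma exp_cart: "exp (cart \<sigma> x) = of_real (exp \<sigma>) * cis x"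
  by (simp add: exp_add cis_conv_exp exp_of_real)

text \<open>On a vertical line the function is, up to conjugation, a trigonometric series with
  coefficients of modulus n |c_n| exp (- n \<sigma>). The slice is enlarged to a full period and
  Parseval's inequality applied.\<close>

lemma dlog_slice:
  assumes ab: "b - a \<le> 2 * pi" and B: "\<And>n. cmod (c n) \<le> B" and \<sigma>: "0 < \<sigma>"
  shows "(\<integral>\<^sup>+x. ennreal ((cmod (dlog c (cart \<sigma> x)))\<^sup>2) * indicator {a<..<b} x \<partial>lborel)
    \<le> (\<Sum>n. ennreal (2 * pi * ((real n)\<^sup>2 * (cmod (c n))\<^sup>2 * exp (- (2 * real n * \<sigma>)))))"
proof -
  \<comment> \<open>The coefficients are conjugated because \<open>exp (- w)\<close> turns clockwise
    as the imaginary part grows.\<close>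
  define v where "v n = of_nat n * cnj (c n) * complex_of_real (exp (- (real n * \<sigma>)))" for n
  have e1: "cmod (complex_of_real (exp (- \<sigma>))) < 1" using \<sigma> by simp
  have sv: "summable (\<lambda>n. cmod (v n))"
  proof -
    have "summable (\<lambda>n. real n * B * exp (- \<sigma>) ^ n)"
    proof -
      have "summable (\<lambda>n. of_nat n * complex_of_real B * complex_of_real (exp (- \<sigma>)) ^ n)"
        by (rule summable_of_nat_mult(1)[where B="\<bar>B\<bar>", OF _ e1]) simp
      moreover have "of_nat n * complex_of_real B * complex_of_real (exp (- \<sigma>)) ^ n
          = complex_of_real (real n * B * exp (- \<sigma>) ^ n)" for n by simp
      ultimately show ?thesis by (simp only: summable_of_real_iff)
    qed
    then show ?thesis
    proof (rule summable_comparison_test'[where N=0])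
      fix n
      show "norm (cmod (v n)) \<le> real n * B * exp (- \<sigma>) ^ n"
      proof -
        have "exp (- \<sigma>) ^ n = exp (- (real n * \<sigma>))" by (simp flip: exp_of_nat_mult)
        then show ?thesis using B[of n]
          by (simp add: v_def norm_mult) (intro mult_right_mono mult_left_mono, auto)
      qed
    qed
  qed
  have val: "cmod (dlog c (cart \<sigma> x)) = cmod (pow_sum v (cis x))" for x
  proof -
    have ex: "exp (- cart \<sigma> x) = complex_of_real (exp (- \<sigma>)) * cis (- x)"
      using exp_cart[of "- \<sigma>" "- x"] by simp
    have lt: "cmod (exp (- cart \<sigma> x)) < 1" unfolding ex using \<sigma> by (simp add: norm_mult)
    have "cnj (pow_sum (\<lambda>n. of_nat n * c n) (exp (- cart \<sigma> x)))
        = pow_sum (\<lambda>n. cnj (of_nat n * c n)) (cnj (exp (- cart \<sigma> x)))"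
      by (rule pow_sum_cnj[OF summable_of_nat_mult(1)[OF B lt]])
    also have "\<dots> = pow_sum v (cis x)"
      unfolding ex by (simp add: pow_sum_def v_def power_mult_distrib cis_cnj mult_ac exp_of_nat_mult[symmetric] flip: of_real_power)
    finally show ?thesis unfolding dlog_def norm_minus_cancel by (metis complex_mod_cnj)
  qed
  have vsq: "(cmod (v n))\<^sup>2 = (real n)\<^sup>2 * (cmod (c n))\<^sup>2 * exp (- (2 * real n * \<sigma>))" for n
    by (simp add: v_def norm_mult power_mult_distrib mult.assoc flip: exp_double)
  have sv2: "summable (\<lambda>n. (cmod (v n))\<^sup>2)"
  proof (rule summable_comparison_test'[where N=0])
    show "summable (\<lambda>n. suminf (\<lambda>n. cmod (v n)) * cmod (v n))" by (intro summable_mult sv)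
    fix n
    have "cmod (v n) \<le> suminf (\<lambda>n. cmod (v n))"
      using sum_le_suminf[OF sv, of "{n}"] by simp
    then show "norm ((cmod (v n))\<^sup>2) \<le> suminf (\<lambda>n. cmod (v n)) * cmod (v n)"
      by (simp add: power2_eq_square mult_right_mono)
  qed
  have "(\<integral>\<^sup>+x. ennreal ((cmod (dlog c (cart \<sigma> x)))\<^sup>2) * indicator {a<..<b} x \<partial>lborel)
      \<le> (\<integral>\<^sup>+x. ennreal ((cmod (pow_sum v (cis x)))\<^sup>2) * indicator {a..<a + 2 * pi} x \<partial>lborel)"
    using ab by (intro nn_integral_mono) (auto simp: val indicator_def)
  also have "\<dots> = (\<integral>\<^sup>+\<zeta>. ennreal ((cmod (pow_sum v \<zeta>))\<^sup>2) \<partial>circle_measure)"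
    by (rule circle_nn_integral[symmetric]) (unfold pow_sum_def, measurable)
  also have "\<dots> = ennreal (normsq circle_measure (pow_sum v))"
    by (rule L2_nn_integral[OF pow_sum_bounded_on_circle[OF sv]])
  also have "\<dots> \<le> ennreal (2 * pi * (\<Sum>n. (cmod (v n))\<^sup>2))"
    by (intro ennreal_leI normsq_pow_sum_le sv sv2)
  also have "2 * pi * (\<Sum>n. (cmod (v n))\<^sup>2) = (\<Sum>n. 2 * pi * (cmod (v n))\<^sup>2)"
    by (rule suminf_mult[OF sv2, symmetric])
  also have "ennreal \<dots> = (\<Sum>n. ennreal (2 * pi * (cmod (v n))\<^sup>2))"
    by (rule suminf_ennreal2[symmetric]) (auto intro: summable_mult sv2)
  finally show ?thesis by (simp only: vsq)
qed

lemma nn_integral_exp_decay: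
  assumes "0 < k" "X \<subseteq> {0..T}"
  shows "(\<integral>\<^sup>+\<sigma>. ennreal (exp (- (k * \<sigma>))) * indicator X \<sigma> \<partial>lborel) \<le> ennreal (1 / k)"
proof (cases "0 \<le> T")
  case True
  have "(\<integral>\<^sup>+\<sigma>. ennreal (exp (- (k * \<sigma>))) * indicator X \<sigma> \<partial>lborel)
      \<le> (\<integral>\<^sup>+\<sigma>. ennreal (exp (- (k * \<sigma>))) * indicator {0..T} \<sigma> \<partial>lborel)"
    using assms(2) by (intro nn_integral_mono) (auto simp: indicator_def)
  also have "\<dots> = ennreal (- exp (- (k * T)) / k - (- exp (- (k * 0)) / k))"
    using assms True
    by (intro nn_integral_FTC_Icc) (auto intro!: derivative_eq_intros simp: has_real_derivative_iff_has_vector_derivative[symmetric])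
  also have "\<dots> \<le> ennreal (1 / k)" using assms by (intro ennreal_leI) (simp add: field_simps)
  finally show ?thesis .
next
  case False
  with assms(2) have "X = {}" by auto
  then show ?thesis by simp
qed

text \<open>Integrating exp (- 2 n \<sigma>) in \<sigma> gains 1 / (2 n), which turns the weight n^2
  of a derivative into the weight n of condition (iii), and 2 \<pi> into \<pi>.\<close>

lemma dlog_area:
  assumes ab: "b - a \<le> 2 * pi" and B: "\<And>n. cmod (c n) \<le> B"
    and s: "summable (\<lambda>n. real n * (cmod (c n))\<^sup>2)"
  shows "(\<integral>\<^sup>+\<sigma>. (\<integral>\<^sup>+x. ennreal ((cmod (dlog c (cart \<sigma> x)))\<^sup>2) * indicator {a<..<b} x \<partial>lborel) * indicator {0<..<T} \<sigma> \<partial>lborel)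
    \<le> ennreal (pi * (\<Sum>n. real n * (cmod (c n))\<^sup>2))"
proof -
  let ?q = "\<lambda>n. 2 * pi * ((real n)\<^sup>2 * (cmod (c n))\<^sup>2)"
  have "(\<integral>\<^sup>+\<sigma>. (\<integral>\<^sup>+x. ennreal ((cmod (dlog c (cart \<sigma> x)))\<^sup>2) * indicator {a<..<b} x \<partial>lborel) * indicator {0<..<T} \<sigma> \<partial>lborel)
      \<le> (\<integral>\<^sup>+\<sigma>. (\<Sum>n. ennreal (?q n) * (ennreal (exp (- (2 * real n * \<sigma>))) * indicator {0<..<T} \<sigma>)) \<partial>lborel)"
  proof (rule nn_integral_mono)
    fix \<sigma> :: real
    show "(\<integral>\<^sup>+x. ennreal ((cmod (dlog c (cart \<sigma> x)))\<^sup>2) * indicator {a<..<b} x \<partial>lborel) * indicator {0<..<T} \<sigma>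
      \<le> (\<Sum>n. ennreal (?q n) * (ennreal (exp (- (2 * real n * \<sigma>))) * indicator {0<..<T} \<sigma>))"
    proof (cases "\<sigma> \<in> {0<..<T}")
      case True
      then have \<sigma>: "0 < \<sigma>" and i: "indicator {0<..<T} \<sigma> = (1::ennreal)" by simp_all
      have e: "ennreal (2 * pi * ((real n)\<^sup>2 * (cmod (c n))\<^sup>2 * exp (- (2 * real n * \<sigma>))))
          = ennreal (?q n) * ennreal (exp (- (2 * real n * \<sigma>)))" for n
        by (subst ennreal_mult[symmetric]) (auto simp only: mult.assoc zero_le_power2 exp_ge_zero mult_nonneg_nonneg pi_ge_zero zero_le_numeral)
      show ?thesis
        using dlog_slice[where c=c, OF ab B \<sigma>] unfolding e i mult_1_right .
    qed simp
  qed
  also have "\<dots> = (\<Sum>n. ennreal (?q n) * (\<integral>\<^sup>+\<sigma>. ennreal (exp (- (2 * real n * \<sigma>))) * indicator {0<..<T} \<sigma> \<partial>lborel))"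
    by (subst nn_integral_suminf) (auto simp: nn_integral_cmult)
  also have "\<dots> \<le> (\<Sum>n. ennreal (pi * (real n * (cmod (c n))\<^sup>2)))"
  proof (rule suminf_le)
    fix n
    show "ennreal (?q n) * (\<integral>\<^sup>+\<sigma>. ennreal (exp (- (2 * real n * \<sigma>))) * indicator {0<..<T} \<sigma> \<partial>lborel)
      \<le> ennreal (pi * (real n * (cmod (c n))\<^sup>2))"
    proof (cases "n = 0")
      case False
      then have "ennreal (?q n) * (\<integral>\<^sup>+\<sigma>. ennreal (exp (- (2 * real n * \<sigma>))) * indicator {0<..<T} \<sigma> \<partial>lborel)
          \<le> ennreal (?q n) * ennreal (1 / (2 * real n))"
        by (intro mult_left_mono nn_integral_exp_decay[where T=T]) auto
      also have "\<dots> = ennreal (pi * (real n * (cmod (c n))\<^sup>2))"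
        using False by (simp add: ennreal_mult[symmetric] power2_eq_square)
      finally show ?thesis .
    qed simp
  qed auto
  also have "\<dots> = ennreal (\<Sum>n. pi * (real n * (cmod (c n))\<^sup>2))"
    by (rule suminf_ennreal2) (auto intro: summable_mult s)
  also have "(\<Sum>n. pi * (real n * (cmod (c n))\<^sup>2)) = pi * (\<Sum>n. real n * (cmod (c n))\<^sup>2)"
    by (rule suminf_mult[OF s])
  finally show ?thesis .
qed

text \<open>The coefficient of the form p(z) dz in the coordinate w = log z.\<close>

definition log_poly :: "complex poly \<Rightarrow> complex \<Rightarrow> complex" where
  "log_poly p w = poly p (exp w) * exp w"

lemma log_poly_measurable [measurable]: "log_poly p \<in> borel_measurable borel"
  unfolding log_poly_def[abs_def] by measurable

text \<open>Cauchy-Schwarz over the rectangle in (\<sigma>, x). The squared modulus of the factor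
  \<open>exp w\<close> in \<open>log_poly\<close> is exactly the area element of polar coordinates,
  so the second norm is the Bergman norm itself.\<close>

lemma area_bound:
  assumes ab: "b - a \<le> 2 * pi" and B: "\<And>n. cmod (c n) \<le> B"
    and s: "summable (\<lambda>n. real n * (cmod (c n))\<^sup>2)"
  shows "(\<integral>\<^sup>+\<sigma>. (\<integral>\<^sup>+x. ennreal (cmod (dlog c (cart \<sigma> x) * log_poly p (cart \<sigma> x))) * indicator {a<..<b} x \<partial>lborel)
      * indicator {0<..<T} \<sigma> \<partial>lborel)
    \<le> ennreal (sqrt (pi * (\<Sum>n. real n * (cmod (c n))\<^sup>2)) * bergman_norm (Omega (open_arc a b) T) (poly p))"
proof -
  let ?P = "lborel \<Otimes>\<^sub>M lborel :: (real \<times> real) measure"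
  let ?R = "\<lambda>y::real \<times> real. indicator {a<..<b} (snd y) * indicator {0<..<T} (fst y) :: ennreal"
  let ?N = "bergman_norm (Omega (open_arc a b) T) (poly p)"
  let ?D = "pi * (\<Sum>n. real n * (cmod (c n))\<^sup>2)"
  have D: "0 \<le> ?D" using suminf_nonneg[OF s] by simp
  define f where "f y = ennreal (cmod (dlog c (cart (fst y) (snd y)))) * ?R y" for y
  define g where "g y = ennreal (cmod (log_poly p (cart (fst y) (snd y)))) * ?R y" for y
  have [measurable]: "f \<in> borel_measurable ?P" "g \<in> borel_measurable ?P"
    unfolding f_def g_def by measurable
  have fub: "(\<integral>\<^sup>+y. h (cart (fst y) (snd y)) * ?R y \<partial>?P)
      = (\<integral>\<^sup>+\<sigma>. (\<integral>\<^sup>+x. h (cart \<sigma> x) * indicator {a<..<b} x \<partial>lborel) * indicator {0<..<T} \<sigma> \<partial>lborel)"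
    if [measurable]: "h \<in> borel_measurable borel" for h :: "complex \<Rightarrow> ennreal"
  proof -
    have "(\<integral>\<^sup>+y. h (cart (fst y) (snd y)) * ?R y \<partial>?P)
        = (\<integral>\<^sup>+\<sigma>. \<integral>\<^sup>+x. h (cart (fst (\<sigma>, x)) (snd (\<sigma>, x))) * ?R (\<sigma>, x) \<partial>lborel \<partial>lborel)"
      by (rule lborel.nn_integral_fst[symmetric]) measurable
    also have "\<dots> = (\<integral>\<^sup>+\<sigma>. (\<integral>\<^sup>+x. h (cart \<sigma> x) * indicator {a<..<b} x \<partial>lborel) * indicator {0<..<T} \<sigma> \<partial>lborel)"
    proof (rule nn_integral_cong)
      fix \<sigma> :: real
      show "(\<integral>\<^sup>+x. h (cart (fst (\<sigma>, x)) (snd (\<sigma>, x))) * ?R (\<sigma>, x) \<partial>lborel)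
        = (\<integral>\<^sup>+x. h (cart \<sigma> x) * indicator {a<..<b} x \<partial>lborel) * indicator {0<..<T} \<sigma>"
        by (cases "\<sigma> \<in> {0<..<T}") auto
    qed
    finally show ?thesis .
  qed
  have R2: "?R y * ?R y = ?R y" for y by (simp add: indicator_def)
  have fg: "(\<integral>\<^sup>+\<sigma>. (\<integral>\<^sup>+x. ennreal (cmod (dlog c (cart \<sigma> x) * log_poly p (cart \<sigma> x))) * indicator {a<..<b} x \<partial>lborel)
      * indicator {0<..<T} \<sigma> \<partial>lborel) = (\<integral>\<^sup>+y. f y * g y \<partial>?P)" (is "?lhs = _")
  proof -
    have "f y * g y = ennreal (cmod (dlog c (cart (fst y) (snd y)) * log_poly p (cart (fst y) (snd y)))) * ?R y" for y
      unfolding f_def g_def by (auto simp: norm_mult ennreal_mult indicator_def)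
    then show ?thesis
      using fub[of "\<lambda>w. ennreal (cmod (dlog c w * log_poly p w))"] by simp
  qed
  have f2: "(\<integral>\<^sup>+y. f y ^ 2 \<partial>?P) \<le> ennreal ?D"
  proof -
    have "f y ^ 2 = ennreal ((cmod (dlog c (cart (fst y) (snd y))))\<^sup>2) * ?R y" for y
      unfolding f_def by (auto simp: indicator_def ennreal_power)
    then show ?thesis
      using fub[of "\<lambda>w. ennreal ((cmod (dlog c w))\<^sup>2)"] dlog_area[where c=c and T=T, OF ab B s] by simp
  qed
  have g2': "(\<integral>\<^sup>+y. g y ^ 2 \<partial>?P) = ennreal (?N\<^sup>2)"
  proof -
    have g2: "g y ^ 2 = ennreal ((cmod (log_poly p (cart (fst y) (snd y))))\<^sup>2) * ?R y" for y
      unfolding g_def by (auto simp: indicator_def ennreal_power)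
    have lp: "(cmod (log_poly p (cart \<sigma> x)))\<^sup>2 = exp (2 * \<sigma>) * (cmod (poly p (complex_of_real (exp \<sigma>) * cis x)))\<^sup>2" for \<sigma> x
      unfolding log_poly_def exp_cart by (simp add: norm_mult power_mult_distrib flip: exp_double)
    have "(\<integral>\<^sup>+y. g y ^ 2 \<partial>?P) = (\<integral>\<^sup>+\<sigma>. (\<integral>\<^sup>+x. ennreal (exp (2 * \<sigma>)) * ennreal ((cmod (poly p (complex_of_real (exp \<sigma>) * cis x)))\<^sup>2)
        * indicator {a<..<b} x \<partial>lborel) * indicator {0<..<T} \<sigma> \<partial>lborel)"
      unfolding g2 using fub[of "\<lambda>w. ennreal ((cmod (log_poly p w))\<^sup>2)"] by (simp add: lp ennreal_mult)
    also have "\<dots> = ennreal (?N\<^sup>2)"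
      unfolding bergman_norm_nn[OF open_arc_borel Omega_open_arc_borel]
      using nn_integral_polar_sector[OF ab, of "\<lambda>z. ennreal ((cmod (poly p z))\<^sup>2)" 0 T]
      by (simp add: Omega_eq_polar_sector)
    finally show ?thesis .
  qed
  have "(\<integral>\<^sup>+y. f y * g y \<partial>?P)\<^sup>2 \<le> (\<integral>\<^sup>+y. f y ^ 2 \<partial>?P) * (\<integral>\<^sup>+y. g y ^ 2 \<partial>?P)"
    by (rule Cauchy_Schwarz_nn_integral) measurable
  also have "\<dots> \<le> ennreal ?D * ennreal (?N\<^sup>2)"
    unfolding g2' by (rule mult_right_mono[OF f2]) simp
  also have "\<dots> = ennreal ((sqrt ?D * ?N)\<^sup>2)"
    using D by (simp add: power_mult_distrib ennreal_mult[symmetric])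
  finally have le: "(\<integral>\<^sup>+y. f y * g y \<partial>?P)\<^sup>2 \<le> ennreal ((sqrt ?D * ?N)\<^sup>2)" .
  show ?thesis
  proof (cases "\<integral>\<^sup>+y. f y * g y \<partial>?P")
    case (real r)
    have "0 \<le> sqrt ?D * ?N" using D by simp
    with le real have "r \<le> sqrt ?D * ?N"
      by (auto simp: ennreal_power intro: power2_le_imp_le)
    then show ?thesis unfolding fg real(2) by (rule ennreal_leI)
  next
    case top
    with le show ?thesis by (simp add: power2_eq_square top_unique ennreal_top_mult)
  qed
qed


section \<open>The boundary integral\<close>

text \<open>In the coordinate \<open>w = log z\<close>, with \<open>L s = Ln (1 + s d)\<close>, the segment from \<open>e\<^sup>i\<^sup>a\<close> becomes
  \<open>L + i a\<close> and the mirror segment from \<open>e\<^sup>i\<^sup>b\<close> becomes \<open>cnj L + i b\<close>. The segments joining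
  corresponding points of the two are vertical, that is, arcs of circles in the coordinate \<open>z\<close>.\<close>

locale arc_domain =
  fixes a b \<alpha> \<eta> T :: real
  assumes ab: "b - a < 2 * pi" and alpha: "0 < \<alpha>" "2 * \<alpha> < b - a" and eta: "0 < \<eta>" "\<eta> < T"
    and outward: "0 \<le> Re (complex_of_real (exp \<eta>) * cis \<alpha> - 1)"
begin

text \<open>Rotated so as to start at 1, the first segment ends at \<open>1 + d\<close> and the
  second at \<open>1 + cnj d\<close>. This mirror symmetry reflects the common centre of the two
  arcs.\<close>

definition d :: complex where "d = complex_of_real (exp \<eta>) * cis \<alpha> - 1"

definition L :: "real \<Rightarrow> complex" where "L s = Ln (1 + of_real s * d)"

definition L' :: "real \<Rightarrow> complex" where "L' s = d / (1 + of_real s * d)"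

abbreviation W1 :: "real \<Rightarrow> complex" where "W1 s \<equiv> L s + \<i> * of_real a"

abbreviation W2 :: "real \<Rightarrow> complex" where "W2 s \<equiv> cnj (L s) + \<i> * of_real b"

text \<open>The angle spanned by the crossing arc at parameter \<open>s\<close>.\<close>

abbreviation width :: "real \<Rightarrow> real" where "width s \<equiv> b - a - 2 * Im (L s)"

lemma alpha_pi: "\<alpha> < pi"
  using ab alpha by linarith

lemma d_pos: "0 \<le> Re d" "0 < Im d" "Im d \<noteq> 0"
  using outward alpha alpha_pi sin_gt_zero[of \<alpha>] by (auto simp: d_def)

text \<open>The real part is at least 1, so the principal logarithm is smooth along the
  segment.\<close>

lemma base_nonzero:
  assumes "0 \<le> s"
  shows "1 + of_real s * d \<notin> \<real>\<^sub>\<le>\<^sub>0" "1 + of_real s * d \<noteq> 0"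
proof -
  have "0 < Re (1 + of_real s * d)" using assms d_pos(1) by (simp add: add_pos_nonneg)
  then show "1 + of_real s * d \<notin> \<real>\<^sub>\<le>\<^sub>0" by (auto simp: complex_nonpos_Reals_iff)
  then show "1 + of_real s * d \<noteq> 0" by auto
qed

lemma exp_L: "0 \<le> s \<Longrightarrow> exp (L s) = 1 + of_real s * d"
  unfolding L_def using base_nonzero by simp

lemma L_derivative: "0 \<le> s \<Longrightarrow> (L has_vector_derivative L' s) (at s within X)"
  unfolding L_def[abs_def] L'_def
proof -
  assume s: "0 \<le> s"
  have "((\<lambda>s. 1 + of_real s * d) has_vector_derivative d) (at s within X)"
    by (auto intro!: derivative_eq_intros)
  from field_vector_diff_chain_within[OF this has_field_derivative_at_within[OF has_field_derivative_Ln[OF base_nonzero(1)[OF s]]]]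
  show "((\<lambda>s. Ln (1 + of_real s * d)) has_vector_derivative d / (1 + of_real s * d)) (at s within X)"
    by (simp add: o_def divide_inverse)
qed

lemma L_0 [simp]: "L 0 = 0" by (simp add: L_def)

lemma L_1: "L 1 = of_real \<eta> + \<i> * of_real \<alpha>"
proof -
  have "1 + of_real 1 * d = exp (of_real \<eta> + \<i> * of_real \<alpha>)" unfolding exp_cart by (simp add: d_def)
  then show ?thesis unfolding L_def using alpha(1) alpha_pi by simp
qed

lemma L_components_derivative:
  assumes "0 \<le> s"
  shows "((\<lambda>s. Re (L s)) has_real_derivative Re (L' s)) (at s)"
    "((\<lambda>s. Im (L s)) has_real_derivative Im (L' s)) (at s)"
  using bounded_linear.has_vector_derivative[OF bounded_linear_Re L_derivative[OF assms, of UNIV]]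
    bounded_linear.has_vector_derivative[OF bounded_linear_Im L_derivative[OF assms, of UNIV]]
  by (simp_all add: has_real_derivative_iff_has_vector_derivative)

text \<open>Multiplying by the conjugate denominator, \<open>L' s\<close> is d + s |d|^2 over a
  positive number, and both parts of \<open>d\<close> are nonnegative. So the crossing arcs move
  outwards and narrow as \<open>s\<close> grows, which the substitution in \<open>area_term\<close>
  relies on.\<close>

lemma L'_nonneg:
  assumes "0 \<le> s"
  shows "0 \<le> Re (L' s)" "0 \<le> Im (L' s)"
  using assms d_pos
  by (auto simp: L'_def Re_divide Im_divide algebra_simps intro!: divide_nonneg_nonneg add_nonneg_nonneg mult_nonneg_nonneg)

lemma L_mono:
  assumes "0 \<le> s" "s \<le> t"
  shows "Re (L s) \<le> Re (L t)" "Im (L s) \<le> Im (L t)"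
proof -
  have "0 \<le> x" if "s \<le> x" for x using that assms by simp
  then show "Re (L s) \<le> Re (L t)" "Im (L s) \<le> Im (L t)"
    using L_components_derivative L'_nonneg by (metis DERIV_nonneg_imp_nondecreasing[OF assms(2)])+
qed

lemma L_le: "0 \<le> s \<Longrightarrow> s \<le> 1 \<Longrightarrow> Re (L s) \<le> \<eta>" "0 \<le> s \<Longrightarrow> s \<le> 1 \<Longrightarrow> Im (L s) \<le> \<alpha>"
  using L_mono[of s 1] by (auto simp: L_1)

lemma L_pos:
  assumes "0 < s"
  shows "0 < Re (L s)" "0 < Im (L s)"
proof -
  have "1 < cmod (1 + of_real s * d)" by (rule segment_outside[OF d_pos(1,3) assms])
  then show "0 < Re (L s)" unfolding L_def using base_nonzero assms by simp
  have "0 < Im (1 + of_real s * d)" using assms d_pos by simp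
  then show "0 < Im (L s)" unfolding L_def using Im_Ln_pos_lt_imp by blast
qed

lemma L_continuous: "X \<subseteq> {0..} \<Longrightarrow> continuous_on X L"
  by (rule continuous_on_vector_derivative[OF L_derivative]) auto

lemma L'_continuous: "X \<subseteq> {0..} \<Longrightarrow> continuous_on X L'"
  unfolding L'_def[abs_def] using base_nonzero(2) by (intro continuous_intros) auto

lemma W_difference: "W2 s - W1 s = \<i> * of_real (width s)"
  by (simp add: complex_eq_iff)

lemma vertical_segment: "W1 s + of_real t * (W2 s - W1 s) = cart (Re (L s)) (a + Im (L s) + t * width s)"
  unfolding W_difference by (simp add: complex_eq_iff)

lemma width_pos: "0 \<le> s \<Longrightarrow> s \<le> 1 \<Longrightarrow> 0 < width s"
  using L_le(2)[of s] alpha by simp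

lemma vertical_segment_range:
  assumes "0 < s" "s \<le> 1" "0 \<le> t" "t \<le> 1"
  shows "a < a + Im (L s) + t * width s" "a + Im (L s) + t * width s < b"
proof -
  have w: "0 < width s" using width_pos assms by simp
  have "0 \<le> t * width s" "t * width s \<le> width s" using w assms by (auto simp: mult_left_le_one_le)
  then show "a < a + Im (L s) + t * width s" "a + Im (L s) + t * width s < b"
    using L_pos(2)[OF assms(1)] by linarith+
qed

lemma Gamma_path_1: "Gamma_path \<eta> a (a + \<alpha>) s = cis a * (1 + of_real s * d)"
  by (simp add: Gamma_path_def linepath_def d_def scaleR_conv_of_real cis_mult[symmetric] algebra_simps)

lemma Gamma_path_2: "Gamma_path \<eta> b (b - \<alpha>) s = cis b * (1 + of_real s * cnj d)"
proof -
  have "cis (b - \<alpha>) = cis b * cis (- \<alpha>)" by (simp add: cis_mult)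
  then show ?thesis
    by (simp add: Gamma_path_def linepath_def d_def scaleR_conv_of_real cis_cnj algebra_simps)
qed

lemma exp_W:
  assumes "0 \<le> s"
  shows "exp (W1 s) = Gamma_path \<eta> a (a + \<alpha>) s" "exp (W2 s) = Gamma_path \<eta> b (b - \<alpha>) s"
  using exp_L[OF assms]
  by (simp_all add: exp_add Gamma_path_1 Gamma_path_2 cis_conv_exp mult.commute exp_cnj[symmetric])

lemma Omega_vertical_segment:
  assumes "0 < s" "s \<le> 1" "0 \<le> t" "t \<le> 1"
  shows "exp (cart (Re (L s)) (a + Im (L s) + t * width s)) \<in> Omega (open_arc a b) T"
proof -
  have "0 < Re (L s)" "Re (L s) < T" using L_pos(1) L_le(1)[of s] eta assms by auto
  moreover have "cis (a + Im (L s) + t * width s) \<in> open_arc a b"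
    unfolding open_arc_def using vertical_segment_range[OF assms] by (intro imageI) auto
  ultimately show ?thesis unfolding exp_cart Omega_def by (simp add: norm_mult)
qed

end


section \<open>Green's formula on the domain cut off near the circle\<close>

context arc_domain
begin

abbreviation bergman :: "complex poly \<Rightarrow> real" where
  "bergman p \<equiv> bergman_norm (Omega (open_arc a b) T) (poly p)"

abbreviation vert :: "real \<Rightarrow> real \<Rightarrow> complex" where
  "vert s t \<equiv> cart (Re (L s)) (a + Im (L s) + t * width s)"

lemma vert_continuous: "X \<subseteq> {0..} \<times> UNIV \<Longrightarrow> continuous_on X (\<lambda>x. vert (fst x) (snd x))"
proof -
  assume "X \<subseteq> {0..} \<times> UNIV"
  then have "continuous_on X (\<lambda>x. L (fst x))"
    by (intro continuous_on_compose2[OF L_continuous[OF order_refl]] continuous_intros) auto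
  then show ?thesis by (intro continuous_intros)
qed

lemma log_poly_holomorphic: "log_poly p holomorphic_on X"
  unfolding log_poly_def[abs_def] by (intro holomorphic_intros)

lemma dlog_continuous:
  assumes B: "\<And>n. cmod (c n) \<le> B"
  shows "continuous_on {w. 0 < Re w} (dlog c)"
proof -
  have o: "open {w. 0 < Re w}" by (rule open_halfspace_Re_gt)
  have "deriv (\<lambda>w. pow_sum c (exp (- w))) holomorphic_on {w. 0 < Re w}"
    by (rule holomorphic_deriv[OF pow_sum_exp_holomorphic[where c=c, OF B] o])
  then have "continuous_on {w. 0 < Re w} (deriv (\<lambda>w. pow_sum c (exp (- w))))"
    by (rule holomorphic_on_imp_continuous_on)
  then show ?thesis
    by (rule continuous_on_eq) (simp add: deriv_pow_sum_exp[where c=c, OF B])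
qed

text \<open>\<open>width s * Re (L' s)\<close> is the Jacobian of \<open>vert\<close>, so the double
  integral is an area integral over the swept region. The substitution \<sigma> =
  \<open>Re (L s)\<close> leads to \<open>area_bound\<close>, and the resulting bound does not
  involve \<epsilon>.\<close>

lemma area_term:
  fixes c :: "nat \<Rightarrow> complex" and p :: "complex poly"
  assumes B: "\<And>n. cmod (c n) \<le> B" and s: "summable (\<lambda>n. real n * (cmod (c n))\<^sup>2)"
    and \<epsilon>: "0 < \<epsilon>" "\<epsilon> < 1"
  defines "E \<equiv> \<lambda>s. integral {0..1} (\<lambda>t. cnj (dlog c (vert s t)) * log_poly p (vert s t)
      * (2 * \<i> * of_real (width s) * of_real (Re (L' s))))"
  shows "continuous_on {\<epsilon>..1} E"
    and "cmod (integral {\<epsilon>..1} E) \<le> 2 * (sqrt (pi * (\<Sum>n. real n * (cmod (c n))\<^sup>2)) * bergman p)"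
proof -
  define k where "k s t = cnj (dlog c (vert s t)) * log_poly p (vert s t)
      * (2 * \<i> * of_real (width s) * of_real (Re (L' s)))" for s t
  have E: "E s = integral {0..1} (k s)" for s unfolding E_def k_def[abs_def] by (rule refl)
  define X where "X = {\<epsilon>..1} \<times> cbox (0::real) 1"
  have cw: "continuous_on X (\<lambda>x. vert (fst x) (snd x))"
    using \<epsilon> by (intro vert_continuous) (auto simp: X_def)
  have cd: "continuous_on X (\<lambda>x. dlog c (vert (fst x) (snd x)))"
    by (rule continuous_on_compose2[OF dlog_continuous[where c=c, OF B] cw])
      (use \<epsilon> L_pos(1) in \<open>auto simp: X_def\<close>)
  have cp: "continuous_on X (\<lambda>x. log_poly p (vert (fst x) (snd x)))"
    by (rule continuous_on_compose2[OF holomorphic_on_imp_continuous_on[OF log_poly_holomorphic[of p UNIV]] cw]) auto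
  have cL: "continuous_on X (\<lambda>x. L (fst x))" "continuous_on X (\<lambda>x. L' (fst x))"
    by (intro continuous_on_compose2[OF L_continuous[OF order_refl]] continuous_on_compose2[OF L'_continuous[OF order_refl]]
        continuous_intros; use \<epsilon> in \<open>auto simp: X_def\<close>)+
  have ck: "continuous_on X (\<lambda>(s, t). k s t)"
    unfolding k_def case_prod_beta by (intro continuous_intros cd cp cL)
  show cE: "continuous_on {\<epsilon>..1} E"
    using integral_continuous_on_param[OF ck[unfolded X_def]] by (simp add: E[abs_def])
  define \<psi> where "\<psi> \<sigma> = (\<integral>\<^sup>+x. ennreal (cmod (dlog c (cart \<sigma> x) * log_poly p (cart \<sigma> x))) * indicator {a<..<b} x \<partial>lborel)" for \<sigma>
  have [measurable]: "\<psi> \<in> borel_measurable borel" unfolding \<psi>_def by measurable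
  have slice: "ennreal (cmod (E s)) \<le> 2 * (\<psi> (Re (L s)) * ennreal (Re (L' s)))" if s: "s \<in> {\<epsilon>..1}" for s
  proof -
    have s0: "0 < s" "s \<le> 1" using s \<epsilon> by auto
    have w: "0 < width s" using width_pos s0 by simp
    have "continuous_on {0..1} (\<lambda>t. case (s, t) of (s, t) \<Rightarrow> k s t)"
      by (rule continuous_on_compose2[OF ck]) (use s in \<open>auto simp: X_def intro!: continuous_intros\<close>)
    then have ckt: "continuous_on {0..1} (k s)" by simp
    define f where "f x = ennreal (cmod (dlog c (cart (Re (L s)) x) * log_poly p (cart (Re (L s)) x)))" for x
    have [measurable]: "f \<in> borel_measurable borel" unfolding f_def by measurable
    have kf: "ennreal (cmod (k s t)) = ennreal (2 * Re (L' s)) * (ennreal (width s) * f (a + Im (L s) + t * width s))" for t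
    proof -
      have n: "cmod (cnj x * y * (2 * \<i> * of_real m * of_real r)) = cmod (x * y) * (2 * r * m)"
        and e: "ennreal (cmod (x * y) * (2 * r * m)) = ennreal (2 * r) * (ennreal m * ennreal (cmod (x * y)))"
        if "0 \<le> m" "0 \<le> r" for x y and m r :: real
        using that by (simp_all add: norm_mult ennreal_mult mult_ac)
      have "0 \<le> width s" "0 \<le> Re (L' s)" using L'_nonneg(1)[of s] s0 w by auto
      then show ?thesis unfolding k_def f_def n[OF \<open>0 \<le> width s\<close> \<open>0 \<le> Re (L' s)\<close>] by (rule e)
    qed
    have "ennreal (cmod (E s)) \<le> (\<integral>\<^sup>+t. ennreal (cmod (k s t)) * indicator {0..1} t \<partial>lborel)"
      unfolding E by (rule norm_integral_le_nn[OF ckt])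
    also have "\<dots> = ennreal (2 * Re (L' s)) * (ennreal (width s) * (\<integral>\<^sup>+t. f (a + Im (L s) + t * width s) * indicator {0..1} t \<partial>lborel))"
      unfolding kf mult.assoc by (simp add: nn_integral_cmult)
    \<comment> \<open>The crossing segment is widened to the whole angle (a, b), where \<psi> is
      defined.\<close>
    also have "\<dots> \<le> ennreal (2 * Re (L' s)) * (ennreal (width s) * (\<integral>\<^sup>+t. f (a + Im (L s) + width s * t) * indicator {a<..<b} (a + Im (L s) + width s * t) \<partial>lborel))"
    proof (intro mult_left_mono nn_integral_mono)
      fix t :: real
      show "f (a + Im (L s) + t * width s) * indicator {0..1} t
          \<le> f (a + Im (L s) + width s * t) * indicator {a<..<b} (a + Im (L s) + width s * t)"
        using vertical_segment_range[OF s0, of t] by (cases "t \<in> {0..1}") (auto simp: mult.commute)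
    qed auto
    also have "ennreal (width s) * (\<integral>\<^sup>+t. f (a + Im (L s) + width s * t) * indicator {a<..<b} (a + Im (L s) + width s * t) \<partial>lborel)
        = \<psi> (Re (L s))"
      using nn_integral_real_affine[of "\<lambda>x. f x * indicator {a<..<b} x" "width s" "a + Im (L s)"] w
      by (simp add: \<psi>_def f_def)
    also have "ennreal (2 * Re (L' s)) * \<psi> (Re (L s)) = 2 * (\<psi> (Re (L s)) * ennreal (Re (L' s)))"
      using L'_nonneg(1)[of s] s0 by (simp add: ennreal_mult mult_ac)
    finally show ?thesis .
  qed
  have "ennreal (cmod (integral {\<epsilon>..1} E)) \<le> (\<integral>\<^sup>+s. ennreal (cmod (E s)) * indicator {\<epsilon>..1} s \<partial>lborel)"
    by (rule norm_integral_le_nn[OF cE])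
  also have "\<dots> \<le> (\<integral>\<^sup>+s. 2 * (\<psi> (Re (L s)) * ennreal (Re (L' s)) * indicator {\<epsilon>..1} s) \<partial>lborel)"
  proof (rule nn_integral_mono)
    fix s :: real
    show "ennreal (cmod (E s)) * indicator {\<epsilon>..1} s \<le> 2 * (\<psi> (Re (L s)) * ennreal (Re (L' s)) * indicator {\<epsilon>..1} s)"
      using slice[of s] by (cases "s \<in> {\<epsilon>..1}") auto
  qed
  also have "\<dots> = 2 * (\<integral>\<^sup>+s. \<psi> (Re (L s)) * ennreal (Re (L' s)) * indicator {\<epsilon>..1} s \<partial>lborel)"
  proof (rule nn_integral_cmult)
    have [measurable]: "L \<in> borel_measurable borel" "L' \<in> borel_measurable borel"
      unfolding L_def[abs_def] L'_def[abs_def] by measurable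
    show "(\<lambda>s. \<psi> (Re (L s)) * ennreal (Re (L' s)) * indicator {\<epsilon>..1} s) \<in> borel_measurable lborel" by measurable
  qed
  also have "(\<integral>\<^sup>+s. \<psi> (Re (L s)) * ennreal (Re (L' s)) * indicator {\<epsilon>..1} s \<partial>lborel)
      = (\<integral>\<^sup>+\<sigma>. \<psi> \<sigma> * indicator {Re (L \<epsilon>)..Re (L 1)} \<sigma> \<partial>lborel)"
  \<comment> \<open>\<open>Re (L s)\<close> is nondecreasing, so the slices sweep the radii
    monotonically and no area is counted twice.\<close>
  proof (rule nn_integral_substitution_aux[where f=\<psi> and g="\<lambda>s. Re (L s)" and g'="\<lambda>s. Re (L' s)", symmetric])
    show "continuous_on {\<epsilon>..1} (\<lambda>s. Re (L' s))" using \<epsilon> by (intro continuous_on_Re L'_continuous) auto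
    show "((\<lambda>s. Re (L s)) has_real_derivative Re (L' s)) (at s)" "0 \<le> Re (L' s)" if "s \<in> {\<epsilon>..1}" for s
      using that \<epsilon> by (intro L_components_derivative(1) L'_nonneg(1); simp)+
  qed (use \<epsilon> in auto)
  also have "\<dots> \<le> (\<integral>\<^sup>+\<sigma>. \<psi> \<sigma> * indicator {0<..<T} \<sigma> \<partial>lborel)"
    using L_pos(1)[OF \<epsilon>(1)] eta by (intro nn_integral_mono) (auto simp: indicator_def L_1)
  also have "\<dots> \<le> ennreal (sqrt (pi * (\<Sum>n. real n * (cmod (c n))\<^sup>2)) * bergman p)"
    unfolding \<psi>_def using ab by (intro area_bound[where c=c, OF _ B s]) simp
  finally have "ennreal (cmod (integral {\<epsilon>..1} E))
      \<le> 2 * ennreal (sqrt (pi * (\<Sum>n. real n * (cmod (c n))\<^sup>2)) * bergman p)"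
    by (simp add: mult_left_mono)
  also have "\<dots> = ennreal (2 * (sqrt (pi * (\<Sum>n. real n * (cmod (c n))\<^sup>2)) * bergman p))"
    using suminf_nonneg[OF s] by (simp add: ennreal_mult)
  finally show "cmod (integral {\<epsilon>..1} E) \<le> 2 * (sqrt (pi * (\<Sum>n. real n * (cmod (c n))\<^sup>2)) * bergman p)"
    using suminf_nonneg[OF s] by (simp add: ennreal_le_iff)
qed

text \<open>The form cnj G p dz in the coordinate w = log z.\<close>

definition bdry :: "(complex \<Rightarrow> complex) \<Rightarrow> complex poly \<Rightarrow> complex \<Rightarrow> complex" where
  "bdry h p w = cnj (exterior_harmonic_ext h (exp w)) * log_poly p w"

text \<open>The integral of that form over the arc joining the two segments at parameter
  \<open>s\<close>.\<close>

definition cross :: "(complex \<Rightarrow> complex) \<Rightarrow> complex poly \<Rightarrow> real \<Rightarrow> complex" where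
  "cross h p s = integral {0..1} (\<lambda>t. bdry h p (vert s t) * (\<i> * of_real (width s)))"

lemma exterior_harmonic_ext_exp:
  assumes h: "h \<in> L2_space circle_measure" and w: "0 < Re w"
  shows "exterior_harmonic_ext h (exp w) = pow_sum (ext_hol h) (exp (- w)) + cnj (pow_sum (ext_anti h) (exp (- w)))"
  using exterior_harmonic_ext_eq[OF h, of "exp w"] w by (simp add: exp_minus inverse_eq_divide)

text \<open>Beyond parameter \<epsilon> the contour stays in the half plane of positive real part,
  where both parts of the extension are holomorphic. Only the inner crossing arc feels the limit
  \<epsilon> \<rightarrow> 0; it is kept on the left, and the right side does not depend on
  \<epsilon>.\<close>

lemma Green_bound:
  assumes h: "h \<in> L2_space circle_measure" and s: "summable (\<lambda>n. real n * (cmod (ext_hol h n))\<^sup>2)"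
    and \<epsilon>: "0 < \<epsilon>" "\<epsilon> < 1"
    and i1: "(\<lambda>s. bdry h p (W1 s) * L' s) integrable_on {\<epsilon>..1}"
    and i2: "(\<lambda>s. bdry h p (W2 s) * cnj (L' s)) integrable_on {\<epsilon>..1}"
  shows "cmod (integral {\<epsilon>..1} (\<lambda>s. bdry h p (W1 s) * L' s) - integral {\<epsilon>..1} (\<lambda>s. bdry h p (W2 s) * cnj (L' s)) - cross h p \<epsilon>)
    \<le> cmod (cross h p 1) + 2 * (sqrt (pi * (\<Sum>n. real n * (cmod (ext_hol h n))\<^sup>2)) * bergman p)"
proof -
  let ?S = "{w. 0 < Re w}"
  define A where "A w = pow_sum (ext_hol h) (exp (- w))" for w
  define H where "H w = pow_sum (ext_anti h) (exp (- w))" for w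
  have bnd: "bdry h p w = (cnj (A w) + H w) * log_poly p w" if "0 < Re w" for w
    using exterior_harmonic_ext_exp[OF h that] by (simp add: bdry_def A_def H_def)
  have dA: "deriv A w = dlog (ext_hol h) w" if "0 < Re w" for w
    unfolding A_def[abs_def] by (rule deriv_pow_sum_exp[OF ext_bounds(1)[OF h] that])
  define E where "E s = integral {0..1} (\<lambda>t. cnj (dlog (ext_hol h) (vert s t)) * log_poly p (vert s t)
      * (2 * \<i> * of_real (width s) * of_real (Re (L' s))))" for s
  note area = area_term[where c="ext_hol h", OF ext_bounds(1)[OF h] s \<epsilon>, of p, folded E_def[abs_def]]
  have iE: "E integrable_on {\<epsilon>..1}" by (rule integrable_continuous_real[OF area(1)])
  have pos: "0 < Re (L s)" if "s \<in> {\<epsilon>..1}" for s using that \<epsilon> L_pos(1) by auto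
  have vW: "Re (W1 s + of_real t * (W2 s - W1 s)) = Re (L s)" for s t by simp
  have dW1: "(W1 has_vector_derivative L' s) (at s within {\<epsilon>..1})"
    and dW2: "(W2 has_vector_derivative cnj (L' s)) (at s within {\<epsilon>..1})" if "s \<in> {\<epsilon>..1}" for s
    using that \<epsilon> L_derivative[of s "{\<epsilon>..1}"] has_vector_derivative_cnj[OF L_derivative[of s "{\<epsilon>..1}"]]
    by (auto simp: has_vector_derivative_add_const)
  have "((\<lambda>s. (cnj (A (W2 s)) + H (W2 s)) * log_poly p (W2 s) * cnj (L' s)
      - (cnj (A (W1 s)) + H (W1 s)) * log_poly p (W1 s) * L' s
      + integral {0..1} (\<lambda>t. cnj (deriv A (W1 s + of_real t * (W2 s - W1 s))) * log_poly p (W1 s + of_real t * (W2 s - W1 s))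
        * (cnj (L' s + of_real t * (cnj (L' s) - L' s)) * (W2 s - W1 s) - cnj (W2 s - W1 s) * (L' s + of_real t * (cnj (L' s) - L' s)))))
    has_integral
      integral {0..1} (\<lambda>t. (cnj (A (W1 1 + of_real t * (W2 1 - W1 1))) + H (W1 1 + of_real t * (W2 1 - W1 1)))
          * log_poly p (W1 1 + of_real t * (W2 1 - W1 1)) * (W2 1 - W1 1))
      - integral {0..1} (\<lambda>t. (cnj (A (W1 \<epsilon> + of_real t * (W2 \<epsilon> - W1 \<epsilon>))) + H (W1 \<epsilon> + of_real t * (W2 \<epsilon> - W1 \<epsilon>)))
          * log_poly p (W1 \<epsilon> + of_real t * (W2 \<epsilon> - W1 \<epsilon>)) * (W2 \<epsilon> - W1 \<epsilon>))) {\<epsilon>..1}"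
  proof (rule Green_homotopy[where S="?S"])
    show "open ?S" "convex ?S" by (rule open_halfspace_Re_gt convex_halfspace_Re_gt)+
    show "A holomorphic_on ?S" unfolding A_def[abs_def] by (rule pow_sum_exp_holomorphic[where c="ext_hol h", OF ext_bounds(1)[OF h]])
    show "H holomorphic_on ?S" unfolding H_def[abs_def] by (rule pow_sum_exp_holomorphic[where c="ext_anti h", OF ext_bounds(2)[OF h]])
    show "log_poly p holomorphic_on ?S" by (rule log_poly_holomorphic)
    show "continuous_on {\<epsilon>..1} L'" "continuous_on {\<epsilon>..1} (\<lambda>s. cnj (L' s))"
      using \<epsilon> by (intro continuous_intros L'_continuous; auto)+
  qed (use \<epsilon> pos dW1 dW2 in auto)
  note Gr = this
  \<comment> \<open>A vertical crossing makes \<open>W2 s - W1 s\<close> purely imaginary, so the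
    two products add up to twice a real part, and that real part is the same for all t.\<close>
  have kern: "cnj (L' s + of_real t * (cnj (L' s) - L' s)) * (W2 s - W1 s) - cnj (W2 s - W1 s) * (L' s + of_real t * (cnj (L' s) - L' s))
      = 2 * \<i> * of_real (width s) * of_real (Re (L' s))" for s t
    unfolding W_difference by (simp add: complex_eq_iff algebra_simps)
  have G0: "((\<lambda>s. (cnj (A (W2 s)) + H (W2 s)) * log_poly p (W2 s) * cnj (L' s)
      - (cnj (A (W1 s)) + H (W1 s)) * log_poly p (W1 s) * L' s
      + integral {0..1} (\<lambda>t. cnj (deriv A (vert s t)) * log_poly p (vert s t) * (2 * \<i> * of_real (width s) * of_real (Re (L' s)))))
    has_integral
      integral {0..1} (\<lambda>t. (cnj (A (vert 1 t)) + H (vert 1 t)) * log_poly p (vert 1 t) * (\<i> * of_real (width 1)))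
      - integral {0..1} (\<lambda>t. (cnj (A (vert \<epsilon> t)) + H (vert \<epsilon> t)) * log_poly p (vert \<epsilon> t) * (\<i> * of_real (width \<epsilon>)))) {\<epsilon>..1}"
    using Gr unfolding kern unfolding vertical_segment unfolding W_difference .
  have cr: "integral {0..1} (\<lambda>t. (cnj (A (vert s t)) + H (vert s t)) * log_poly p (vert s t) * (\<i> * of_real (width s))) = cross h p s"
    if "0 < Re (L s)" for s
  proof -
    have "0 < Re (vert s t)" for t using that by simp
    from bnd[OF this] show ?thesis by (simp only: cross_def)
  qed
  have p1: "0 < Re (L 1)" "0 < Re (L \<epsilon>)" using \<epsilon> by (auto intro: L_pos(1))
  have G: "((\<lambda>s. bdry h p (W2 s) * cnj (L' s) - bdry h p (W1 s) * L' s + E s)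
      has_integral (cross h p 1 - cross h p \<epsilon>)) {\<epsilon>..1}"
  proof (rule has_integral_eq[OF _ G0[unfolded cr[OF p1(1)] cr[OF p1(2)]]])
    fix s assume s: "s \<in> {\<epsilon>..1}"
    have "0 < Re (vert s t)" "0 < Re (W1 s)" "0 < Re (W2 s)" for t using pos[OF s] by simp_all
    note r = this
    show "(cnj (A (W2 s)) + H (W2 s)) * log_poly p (W2 s) * cnj (L' s)
        - (cnj (A (W1 s)) + H (W1 s)) * log_poly p (W1 s) * L' s
        + integral {0..1} (\<lambda>t. cnj (deriv A (vert s t)) * log_poly p (vert s t) * (2 * \<i> * of_real (width s) * of_real (Re (L' s))))
      = bdry h p (W2 s) * cnj (L' s) - bdry h p (W1 s) * L' s + E s"
      unfolding E_def bnd[OF r(2)] bnd[OF r(3)] dA[OF r(1)] ..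
  qed
  have "((\<lambda>s. bdry h p (W2 s) * cnj (L' s) - bdry h p (W1 s) * L' s + E s) has_integral
      integral {\<epsilon>..1} (\<lambda>s. bdry h p (W2 s) * cnj (L' s)) - integral {\<epsilon>..1} (\<lambda>s. bdry h p (W1 s) * L' s) + integral {\<epsilon>..1} E) {\<epsilon>..1}"
    by (intro has_integral_add has_integral_diff integrable_integral i1 i2 iE)
  note u = has_integral_unique[OF this G]
  have eq: "integral {\<epsilon>..1} (\<lambda>s. bdry h p (W1 s) * L' s) - integral {\<epsilon>..1} (\<lambda>s. bdry h p (W2 s) * cnj (L' s)) - cross h p \<epsilon>
      = integral {\<epsilon>..1} E - cross h p 1"
  proof -
    have "x - y - k = e - k1" if "y - x + e = k1 - k" for x y k e k1 :: complex
      using that by algebra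
    from this[OF u] show ?thesis .
  qed
  show ?thesis
    unfolding eq using norm_triangle_ineq4[of "integral {\<epsilon>..1} E" "cross h p 1"] area(2) by linarith
qed

text \<open>The outermost crossing arc is a compact subset of \<open>Omega\<close>, as \<eta> < T
  and its end points lie strictly inside the angle. There the extension is bounded and point
  evaluations are bounded by the Bergman norm.\<close>

lemma cross_1_bound:
  assumes h: "h \<in> L2_space circle_measure"
  shows "\<exists>C\<ge>0. \<forall>p. cmod (cross h p 1) \<le> C * bergman p"
proof -
  have cv: "continuous_on {0..1} (vert 1)" by (intro continuous_intros)
  have re: "0 < Re (vert 1 t)" for t using eta by (simp add: L_1)
  let ?K = "(\<lambda>t. exp (vert 1 t)) ` {0..1}"
  have "compact ?K" by (intro compact_continuous_image continuous_intros) simp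
  moreover have "?K \<subseteq> Omega (open_arc a b) T" using Omega_vertical_segment[of 1] by auto
  ultimately obtain C where C: "0 \<le> C" "\<And>p z. z \<in> ?K \<Longrightarrow> cmod (poly p z) \<le> C * bergman p"
    using bergman_point_estimate[of b a ?K T] ab by auto
  define G where "G t = cnj (pow_sum (ext_hol h) (exp (- vert 1 t))) + pow_sum (ext_anti h) (exp (- vert 1 t))" for t
  have cG: "continuous_on {0..1} G"
  proof -
    have c: "continuous_on {0..1} (\<lambda>t. pow_sum c (exp (- vert 1 t)))" if "\<And>n. cmod (c n) \<le> B" for c B
      by (rule continuous_on_compose2[OF holomorphic_on_imp_continuous_on[OF pow_sum_exp_holomorphic[where c=c, OF that]] cv])
        (use re in auto)
    show ?thesis unfolding G_def[abs_def] by (intro continuous_intros c[OF ext_bounds(1)[OF h]] c[OF ext_bounds(2)[OF h]])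
  qed
  have "compact (G ` {0..1})" by (rule compact_continuous_image[OF cG]) simp
  then obtain M where M: "0 < M" "\<And>t. t \<in> {0..1} \<Longrightarrow> cmod (G t) \<le> M"
    using compact_imp_bounded bounded_pos[of "G ` {0..1}"] by auto
  have bG: "bdry h p (vert 1 t) = G t * log_poly p (vert 1 t)" for p t
    using exterior_harmonic_ext_exp[OF h re[of t]] by (simp add: bdry_def G_def)
  have w: "0 < width 1" using width_pos[of 1] by simp
  have "cmod (cross h p 1) \<le> M * C * exp \<eta> * width 1 * bergman p" for p
  proof -
    let ?f = "\<lambda>t. bdry h p (vert 1 t) * (\<i> * of_real (width 1))"
    have "cmod (integral {0..1} ?f) \<le> (M * C * exp \<eta> * width 1 * bergman p) * (1 - 0)"
    proof (rule integral_bound)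
      show "continuous_on {0..1} ?f"
        unfolding bG log_poly_def by (intro continuous_intros cG)
      fix t :: real assume t: "t \<in> {0..1}"
      have "cmod (log_poly p (vert 1 t)) = cmod (poly p (exp (vert 1 t))) * exp \<eta>"
        by (simp add: log_poly_def norm_mult L_1)
      also have "\<dots> \<le> (C * bergman p) * exp \<eta>" using C(2)[of "exp (vert 1 t)" p] t by (intro mult_right_mono) auto
      finally have "cmod (G t) * cmod (log_poly p (vert 1 t)) \<le> M * ((C * bergman p) * exp \<eta>)"
        using M(2)[OF t] M(1) by (intro mult_mono) auto
      then have le: "cmod (G t) * cmod (log_poly p (vert 1 t)) * width 1 \<le> M * ((C * bergman p) * exp \<eta>) * width 1"
        using w by (intro mult_right_mono) auto
      show "cmod (?f t) \<le> M * C * exp \<eta> * width 1 * bergman p"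
      proof -
        have "cmod (\<i> * of_real m) = m" if "0 \<le> m" for m :: real using that by (simp add: norm_mult)
        from this[of "width 1"] w have "cmod (\<i> * of_real (width 1)) = width 1" by linarith
        then have "cmod (?f t) = cmod (G t) * cmod (log_poly p (vert 1 t)) * width 1"
          unfolding bG by (subst norm_mult) (simp only: norm_mult)
        then show ?thesis using le by (simp only: mult_ac)
      qed
    qed simp
    then show ?thesis by (simp add: cross_def)
  qed
  then show ?thesis using M(1) C(1) w by (intro exI[of _ "M * C * exp \<eta> * width 1"]) auto
qed

end


section \<open>The limit at the unit circle\<close>

context arc_domain
begin

text \<open>The factor p(z) z on the crossing arc at parameter \<open>s\<close>, as a function on
  the unit circle that vanishes off the arc. The second z comes from dz = \<i> z dx.\<close>

definition slice_poly :: "complex poly \<Rightarrow> real \<Rightarrow> complex \<Rightarrow> complex" where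
  "slice_poly p s \<zeta> = indicator (cis ` {a + Im (L s)..b - Im (L s)}) \<zeta>
    * (poly p (of_real (exp (Re (L s))) * \<zeta>) * (of_real (exp (Re (L s))) * \<zeta>))"

lemma cis_Icc_borel: "cis ` {u..v} \<in> sets borel"
  by (intro borel_compact compact_continuous_image continuous_intros) auto

lemma slice_poly_measurable [measurable]: "slice_poly p s \<in> borel_measurable borel"
proof -
  note cis_Icc_borel[measurable]
  show ?thesis unfolding slice_poly_def[abs_def] by measurable
qed

text \<open>All points of the crossing arc have the same modulus, so the extension there is a dilate
  of \<open>h\<close>. This is the reason for vertical crossings in the logarithmic
  coordinate.\<close>

lemma cross_eq_circle_integral:
  assumes h: "h \<in> L2_space circle_measure" and s: "0 < s" "s \<le> 1"
  shows "cross h p s = \<i> * (\<integral>\<zeta>. cnj (dilate h (Re (L s)) \<zeta>) * slice_poly p s \<zeta> \<partial>circle_measure)"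
proof -
  let ?l = "Re (L s)" and ?m = "Im (L s)"
  have l: "0 < ?l" "0 < ?m" using L_pos s by auto
  have w: "0 < width s" using width_pos s by simp
  define f where "f \<zeta> = cnj (dilate h ?l \<zeta>) * slice_poly p s \<zeta>" for \<zeta>
  have [measurable]: "dilate h ?l \<in> borel_measurable borel"
    using L2_measurable[OF dilate_L2[OF h l(1)]] by (simp cong: measurable_cong_sets)
  have [measurable]: "f \<in> borel_measurable borel" unfolding f_def by measurable
  have bd: "bdry h p (cart ?l x) = cnj (dilate h ?l (cis x)) * (poly p (of_real (exp ?l) * cis x) * (of_real (exp ?l) * cis x))" for x
    using exterior_harmonic_ext_dilate[OF h l(1), of "cis x"] by (simp add: bdry_def log_poly_def exp_cart)
  have fx: "indicator {a..<a + 2 * pi} x *\<^sub>R f (cis x) = indicator {a + ?m..b - ?m} x *\<^sub>R bdry h p (cart ?l x)" for x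
  proof (cases "x \<in> {a..<a + 2 * pi}")
    case True
    have "cis x \<in> cis ` {a + ?m..b - ?m} \<longleftrightarrow> x \<in> {a + ?m..b - ?m}"
    proof
      assume "cis x \<in> cis ` {a + ?m..b - ?m}"
      then obtain y where y: "y \<in> {a + ?m..b - ?m}" "cis x = cis y" by auto
      have "x = y" by (rule cis_eq_imp_eq[OF y(2)]) (use y True l ab in auto)
      then show "x \<in> {a + ?m..b - ?m}" using y by simp
    qed auto
    then show ?thesis using True by (simp add: f_def slice_poly_def bd indicator_def)
  next
    case False
    then show ?thesis using l ab by auto
  qed
  have "(\<integral>\<zeta>. f \<zeta> \<partial>circle_measure) = (\<integral>x. indicator {a + ?m..b - ?m} x *\<^sub>R bdry h p (cart ?l x) \<partial>lborel)"
    by (simp add: circle_integral[where c=a] set_lebesgue_integral_def fx)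
  also have "\<dots> = \<bar>width s\<bar> *\<^sub>R (\<integral>t. indicator {a + ?m..b - ?m} (a + ?m + width s * t) *\<^sub>R bdry h p (cart ?l (a + ?m + width s * t)) \<partial>lborel)"
    using w by (intro lborel_integral_real_affine) simp
  also have "(\<lambda>t. indicator {a + ?m..b - ?m} (a + ?m + width s * t) :: real) = indicator {0..1}"
  proof
    fix t
    have "a + ?m + width s * t \<le> b - ?m \<longleftrightarrow> width s * t \<le> width s * 1" by auto
    also have "\<dots> \<longleftrightarrow> t \<le> 1" using w by (simp only: mult_le_cancel_left_pos)
    finally show "indicator {a + ?m..b - ?m} (a + ?m + width s * t) = (indicator {0..1} t :: real)"
      using w zero_le_mult_iff[of "width s" t] by (auto simp: indicator_def)
  qed
  also have "(\<integral>t. indicator {0..1} t *\<^sub>R bdry h p (cart ?l (a + ?m + width s * t)) \<partial>lborel)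
      = integral {0..1} (\<lambda>t. bdry h p (vert s t))"
  proof -
    have c: "continuous_on {0..1} (\<lambda>t. pow_sum c (exp (- vert s t)))" if "\<And>n. cmod (c n) \<le> B" for c B
      by (rule continuous_on_compose2[OF holomorphic_on_imp_continuous_on[OF pow_sum_exp_holomorphic[where c=c, OF that]]])
        (use l in \<open>auto intro!: continuous_intros\<close>)
    have e: "bdry h p (vert s t) = cnj (pow_sum (ext_hol h) (exp (- vert s t)) + cnj (pow_sum (ext_anti h) (exp (- vert s t)))) * log_poly p (vert s t)" for t
      unfolding bdry_def using l by (subst exterior_harmonic_ext_exp[OF h]) auto
    have "continuous_on {0..1} (\<lambda>t. bdry h p (vert s t))"
      unfolding e log_poly_def by (intro continuous_intros c[OF ext_bounds(1)[OF h]] c[OF ext_bounds(2)[OF h]])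
    from set_borel_integral_eq_integral(2)[OF borel_integrable_atLeastAtMost'[OF this]]
    show ?thesis by (simp add: set_lebesgue_integral_def mult.commute)
  qed
  finally have "(\<integral>\<zeta>. f \<zeta> \<partial>circle_measure) = of_real (width s) * integral {0..1} (\<lambda>t. bdry h p (vert s t))"
    using w unfolding scaleR_conv_of_real by (simp only: abs_of_pos)
  moreover have "cross h p s = integral {0..1} (\<lambda>t. bdry h p (vert s t)) * (\<i> * of_real (width s))"
    unfolding cross_def by (rule integral_mult_left)
  ultimately show ?thesis unfolding f_def by (simp only: mult_ac)
qed

text \<open>The limit splits in two: dilates tend to \<open>h\<close> in L2 while paired with
  uniformly bounded functions, and these functions tend pointwise to the indicator of the arc times
  p(\<zeta>) \<zeta>.\<close>

lemma cross_tendsto: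
  assumes g: "g \<in> L2_space circle_measure" and van: "AE \<zeta> in circle_measure. \<zeta> \<notin> open_arc a b \<longrightarrow> g \<zeta> = 0"
    and s: "\<And>k. 0 < s k" "\<And>k. s k \<le> 1" "s \<longlonglongrightarrow> 0"
  shows "(\<lambda>k. cross (\<lambda>\<xi>. \<xi> * g \<xi>) p (s k)) \<longlonglongrightarrow> \<i> * (\<integral>\<zeta>. poly p \<zeta> * cnj (g \<zeta>) \<partial>circle_measure)"
proof -
  define h where "h = (\<lambda>\<xi>. \<xi> * g \<xi>)"
  have [measurable]: "g \<in> borel_measurable borel"
    using L2_measurable[OF g] by (simp cong: measurable_cong_sets)
  have h: "h \<in> L2_space circle_measure"
    unfolding h_def
    by (rule L2_bounded_mult(1)[where B=1, OF g]) (use AE_circle_norm in auto)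
  have [measurable]: "h \<in> borel_measurable borel"
    using L2_measurable[OF h] by (simp cong: measurable_cong_sets)
  define r where "r k = Re (L (s k))" for k
  define m where "m k = Im (L (s k))" for k
  have r: "0 < r k" "r k \<le> \<eta>" and m: "0 < m k" for k
    using s L_pos L_le(1)[of "s k"] by (auto simp: r_def m_def less_imp_le)
  have "continuous_on {0..} L" by (rule L_continuous) simp
  then have L0: "(\<lambda>k. L (s k)) \<longlonglongrightarrow> 0"
    using continuous_on_tendsto_compose[of "{0..}" L s 0 sequentially] s by (auto simp: less_imp_le)
  have r0: "r \<longlonglongrightarrow> 0" and m0: "m \<longlonglongrightarrow> 0"
    using tendsto_Re[OF L0] tendsto_Im[OF L0] by (simp_all add: r_def[abs_def] m_def[abs_def])
  define q where "q k = slice_poly p (s k)" for k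
  have q: "q k \<zeta> = indicator (cis ` {a + m k..b - m k}) \<zeta> * (poly p (of_real (exp (r k)) * \<zeta>) * (of_real (exp (r k)) * \<zeta>))" for k \<zeta>
    by (simp add: q_def slice_poly_def r_def m_def)
  have [measurable]: "q k \<in> borel_measurable borel" for k unfolding q_def by measurable
  obtain Q where Q: "0 \<le> Q" "\<And>k \<zeta>. cmod \<zeta> = 1 \<Longrightarrow> cmod (q k \<zeta>) \<le> Q"
  proof -
    have "compact ((\<lambda>z. poly p z * z) ` cball 0 (exp \<eta>))" by (intro compact_continuous_image continuous_intros) simp
    then obtain Q where Q: "0 < Q" "\<And>z. cmod z \<le> exp \<eta> \<Longrightarrow> cmod (poly p z * z) \<le> Q"
      using compact_imp_bounded bounded_pos[of "(\<lambda>z. poly p z * z) ` cball 0 (exp \<eta>)"] by auto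
    have "cmod (q k \<zeta>) \<le> Q" if "cmod \<zeta> = 1" for k \<zeta>
      using Q(2)[of "of_real (exp (r k)) * \<zeta>"] Q(1) r(2)[of k] that
      by (auto simp: q indicator_def norm_mult)
    then show ?thesis using that[of Q] Q(1) by simp
  qed
  have qL: "q k \<in> L2_space circle_measure" for k
    by (intro L2_spaceI integrable_circle_bounded[where B="Q\<^sup>2"])
      (use Q in \<open>auto intro!: power_mono\<close>)
  have nq: "normsq circle_measure (q k) \<le> 2 * pi * Q\<^sup>2" for k
  proof -
    have "normsq circle_measure (\<lambda>\<zeta>. q k \<zeta> * \<zeta> powi 0) \<le> Q\<^sup>2 * normsq circle_measure (\<lambda>\<zeta>. \<zeta> powi 0)"
      by (rule L2_bounded_mult(2)[OF powi_L2]) (use AE_circle_norm Q(2) in auto)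
    moreover have "normsq circle_measure (\<lambda>\<zeta>. \<zeta> powi 0) = 2 * pi"
      by (simp add: normsq_def measure_def emeasure_circle)
    ultimately show ?thesis by (simp add: mult.commute)
  qed
  have d1: "(\<lambda>k. (\<integral>\<zeta>. cnj (dilate h (r k) \<zeta>) * q k \<zeta> \<partial>circle_measure) - (\<integral>\<zeta>. cnj (h \<zeta>) * q k \<zeta> \<partial>circle_measure)) \<longlonglongrightarrow> 0"
  proof (rule Lim_null_comparison[OF always_eventually[OF allI]])
    fix k
    note i = L2_mult_integrable[OF L2_cnj[OF dilate_L2[OF h r(1)]] qL] L2_mult_integrable[OF L2_cnj[OF h] qL]
    have dL: "(\<lambda>\<zeta>. h \<zeta> - dilate h (r k) \<zeta>) \<in> L2_space circle_measure"
      by (rule L2_diff(1)[OF h dilate_L2[OF h r(1)]])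
    have "(\<integral>\<zeta>. cnj (dilate h (r k) \<zeta>) * q k \<zeta> \<partial>circle_measure) - (\<integral>\<zeta>. cnj (h \<zeta>) * q k \<zeta> \<partial>circle_measure)
        = - (\<integral>\<zeta>. cnj (h \<zeta> - dilate h (r k) \<zeta>) * q k \<zeta> \<partial>circle_measure)"
      using i by (simp add: ring_distribs)
    then have "cmod ((\<integral>\<zeta>. cnj (dilate h (r k) \<zeta>) * q k \<zeta> \<partial>circle_measure) - (\<integral>\<zeta>. cnj (h \<zeta>) * q k \<zeta> \<partial>circle_measure))
        \<le> sqrt (normsq circle_measure (\<lambda>\<zeta>. h \<zeta> - dilate h (r k) \<zeta>)) * sqrt (normsq circle_measure (q k))"
      using L2_Cauchy_Schwarz_sqrt[OF L2_cnj[OF dL] qL[of k]] by (simp only: norm_minus_cancel normsq_cnj)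
    also have "\<dots> \<le> sqrt (normsq circle_measure (\<lambda>\<zeta>. h \<zeta> - dilate h (r k) \<zeta>)) * sqrt (2 * pi * Q\<^sup>2)"
      by (intro mult_left_mono real_sqrt_le_mono nq) simp
    finally show "cmod ((\<integral>\<zeta>. cnj (dilate h (r k) \<zeta>) * q k \<zeta> \<partial>circle_measure) - (\<integral>\<zeta>. cnj (h \<zeta>) * q k \<zeta> \<partial>circle_measure))
        \<le> sqrt (normsq circle_measure (\<lambda>\<zeta>. h \<zeta> - dilate h (r k) \<zeta>)) * sqrt (2 * pi * Q\<^sup>2)" .
  next
    have "(\<lambda>k. sqrt (normsq circle_measure (\<lambda>\<zeta>. h \<zeta> - dilate h (r k) \<zeta>)) * sqrt (2 * pi * Q\<^sup>2)) \<longlonglongrightarrow> sqrt 0 * sqrt (2 * pi * Q\<^sup>2)"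
      by (intro tendsto_intros dilate_tendsto[OF h r(1) r0])
    then show "(\<lambda>k. sqrt (normsq circle_measure (\<lambda>\<zeta>. h \<zeta> - dilate h (r k) \<zeta>)) * sqrt (2 * pi * Q\<^sup>2)) \<longlonglongrightarrow> 0" by simp
  qed
  have d2: "(\<lambda>k. \<integral>\<zeta>. cnj (h \<zeta>) * q k \<zeta> \<partial>circle_measure)
      \<longlonglongrightarrow> (\<integral>\<zeta>. cnj (h \<zeta>) * (indicator (open_arc a b) \<zeta> * (poly p \<zeta> * \<zeta>)) \<partial>circle_measure)"
  proof (rule integral_dominated_convergence[where w="\<lambda>\<zeta>. cmod (h \<zeta>) * Q"])
    show "integrable circle_measure (\<lambda>\<zeta>. cmod (h \<zeta>) * Q)"
      using integrable_norm[OF L2_circle_integrable[OF h]] by simp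
    show "AE \<zeta> in circle_measure. (\<lambda>k. cnj (h \<zeta>) * q k \<zeta>) \<longlonglongrightarrow> cnj (h \<zeta>) * (indicator (open_arc a b) \<zeta> * (poly p \<zeta> * \<zeta>))"
    proof (rule AE_I2, rule tendsto_mult_left)
      fix \<zeta> :: complex
      have ind: "(\<lambda>k. indicator (cis ` {a + m k..b - m k}) \<zeta> :: complex) \<longlonglongrightarrow> indicator (open_arc a b) \<zeta>"
      proof (cases "\<zeta> \<in> open_arc a b")
        case True
        then obtain x where x: "\<zeta> = cis x" "a < x" "x < b" unfolding open_arc_def by auto
        have "\<forall>\<^sub>F k in sequentially. m k < min (x - a) (b - x)"
          using m0 x by (intro order_tendstoD(2)) auto
        then have "\<forall>\<^sub>F k in sequentially. indicator (open_arc a b) \<zeta> = (indicator (cis ` {a + m k..b - m k}) \<zeta> :: complex)"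
        proof eventually_elim
          case (elim k)
          then have "\<zeta> \<in> cis ` {a + m k..b - m k}" using x by auto
          then show ?case using True by simp
        qed
        then show ?thesis by (rule tendsto_cong[THEN iffD1]) (rule tendsto_const)
      next
        case False
        have "\<zeta> \<notin> cis ` {a + m k..b - m k}" for k
        proof
          assume "\<zeta> \<in> cis ` {a + m k..b - m k}"
          then have "\<zeta> \<in> open_arc a b" unfolding open_arc_def using m[of k] by (auto intro!: imageI)
          with False show False by simp
        qed
        then show ?thesis using False by simp
      qed
      have "(\<lambda>k. q k \<zeta>) \<longlonglongrightarrow> indicator (open_arc a b) \<zeta> * (poly p (of_real (exp 0) * \<zeta>) * (of_real (exp 0) * \<zeta>))"
        unfolding q by (intro tendsto_intros ind r0)
      then show "(\<lambda>k. q k \<zeta>) \<longlonglongrightarrow> indicator (open_arc a b) \<zeta> * (poly p \<zeta> * \<zeta>)" by simp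
    qed
    show "AE \<zeta> in circle_measure. norm (cnj (h \<zeta>) * q k \<zeta>) \<le> cmod (h \<zeta>) * Q" for k
      using AE_circle_norm by eventually_elim (auto simp: norm_mult intro!: mult_left_mono Q(2))
  qed measurable
  \<comment> \<open>The cnj \<zeta> from \<open>h\<close> cancels the \<zeta> from d\<zeta>, and the
    indicator is absorbed because \<open>g\<close> vanishes off the arc.\<close>
  have e: "(\<integral>\<zeta>. cnj (h \<zeta>) * (indicator (open_arc a b) \<zeta> * (poly p \<zeta> * \<zeta>)) \<partial>circle_measure) = (\<integral>\<zeta>. poly p \<zeta> * cnj (g \<zeta>) \<partial>circle_measure)"
  proof (rule integral_cong_AE)
    show "AE \<zeta> in circle_measure. cnj (h \<zeta>) * (indicator (open_arc a b) \<zeta> * (poly p \<zeta> * \<zeta>)) = poly p \<zeta> * cnj (g \<zeta>)"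
      using van AE_circle_norm
    proof eventually_elim
      case (elim \<zeta>)
      have "cnj \<zeta> * \<zeta> = 1" using elim(2) complex_norm_square[of \<zeta>] by (simp add: mult.commute)
      then show ?case using elim(1) by (auto simp: h_def indicator_def)
    qed
  qed measurable
  have "(\<lambda>k. \<i> * (\<integral>\<zeta>. cnj (dilate h (r k) \<zeta>) * q k \<zeta> \<partial>circle_measure)) \<longlonglongrightarrow> \<i> * (\<integral>\<zeta>. poly p \<zeta> * cnj (g \<zeta>) \<partial>circle_measure)"
    using tendsto_add[OF d1 d2] unfolding e by (intro tendsto_mult_left) simp
  moreover have "cross h p (s k) = \<i> * (\<integral>\<zeta>. cnj (dilate h (r k) \<zeta>) * q k \<zeta> \<partial>circle_measure)" for k
    unfolding r_def q_def by (rule cross_eq_circle_integral[OF h s(1,2)])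
  ultimately show ?thesis unfolding h_def by simp
qed

lemma Gamma_function_integrable:
  fixes \<Gamma> :: "real \<Rightarrow> complex"
  assumes h: "h \<in> L2_space circle_measure" and e: "0 \<le> Re e" "Im e \<noteq> 0"
    and \<Gamma>: "\<And>s. \<Gamma> s = cis \<theta> * (1 + of_real s * e)"
  shows "(\<lambda>s. cnj (exterior_harmonic_ext h (\<Gamma> s)) * poly p (\<Gamma> s) * v) integrable_on {0..1}"
proof -
  have i: "set_integrable lborel {0<..1} (\<lambda>s. exterior_harmonic_ext h (\<Gamma> s))"
    unfolding \<Gamma> by (rule exterior_harmonic_ext_segment_integrable[OF h e])
  have c: "continuous_on {0..1} (\<lambda>s. poly p (\<Gamma> s) * v)" unfolding \<Gamma> by (intro continuous_intros)
  then have "compact ((\<lambda>s. poly p (\<Gamma> s) * v) ` {0..1})" by (rule compact_continuous_image) simp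
  then obtain M where M: "\<And>s. s \<in> {0..1} \<Longrightarrow> cmod (poly p (\<Gamma> s) * v) \<le> M"
    using compact_imp_bounded bounded_pos[of "(\<lambda>s. poly p (\<Gamma> s) * v) ` {0..1}"] by (metis imageI)
  have [measurable]: "\<Gamma> \<in> borel_measurable borel" unfolding \<Gamma>[abs_def] by measurable
  have im: "(\<lambda>s. indicator {0<..1} s *\<^sub>R exterior_harmonic_ext h (\<Gamma> s)) \<in> borel_measurable lborel"
    using i unfolding set_integrable_def by (rule borel_measurable_integrable)
  have "set_integrable lborel {0<..1} (\<lambda>s. cnj (exterior_harmonic_ext h (\<Gamma> s)) * poly p (\<Gamma> s) * v)"
    unfolding set_integrable_def
  proof (rule Bochner_Integration.integrable_bound)
    show "integrable lborel (\<lambda>s. M *\<^sub>R (indicator {0<..1} s *\<^sub>R exterior_harmonic_ext h (\<Gamma> s)))"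
      using i unfolding set_integrable_def by (rule integrable_scaleR_right)
    have "(\<lambda>s. cnj (indicator {0<..1} s *\<^sub>R exterior_harmonic_ext h (\<Gamma> s)) * (poly p (\<Gamma> s) * v)) \<in> borel_measurable lborel"
      using im by measurable
    then show "(\<lambda>s. indicator {0<..1} s *\<^sub>R (cnj (exterior_harmonic_ext h (\<Gamma> s)) * poly p (\<Gamma> s) * v)) \<in> borel_measurable lborel"
      by (simp add: mult.assoc)
    have "cmod (exterior_harmonic_ext h (\<Gamma> s)) * cmod (poly p (\<Gamma> s) * v) \<le> \<bar>M\<bar> * cmod (exterior_harmonic_ext h (\<Gamma> s))"
      if "s \<in> {0<..1}" for s
      using M[of s] that by (subst mult.commute) (intro mult_right_mono, auto)
    then show "AE s in lborel. norm (indicator {0<..1} s *\<^sub>R (cnj (exterior_harmonic_ext h (\<Gamma> s)) * poly p (\<Gamma> s) * v))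
        \<le> norm (M *\<^sub>R (indicator {0<..1} s *\<^sub>R exterior_harmonic_ext h (\<Gamma> s)))"
      by (intro AE_I2) (auto simp: indicator_def norm_mult mult.assoc)
  qed
  then have "(\<lambda>s. cnj (exterior_harmonic_ext h (\<Gamma> s)) * poly p (\<Gamma> s) * v) integrable_on {0<..1}"
    by (rule set_borel_integral_eq_integral(1))
  \<comment> \<open>At s = 0 the path is on the circle, outside the domain of the extension; a
    single point is negligible.\<close>
  then show ?thesis by (rule integrable_spike_set) (auto intro: negligible_subset[of "{0}"])
qed

text \<open>Let \<epsilon> \<rightarrow> 0 in \<open>Green_bound\<close>. Integrability up to the
  circle makes the truncated segment integrals converge, and \<open>cross_tendsto\<close> identifies
  the limit of the inner crossing arc.\<close>

theorem Gamma_integral_pairing: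
  assumes g: "g \<in> L2_space circle_measure" and van: "AE \<zeta> in circle_measure. \<zeta> \<notin> open_arc a b \<longrightarrow> g \<zeta> = 0"
    and sm: "summable (\<lambda>n. real n * (cmod (ext_hol (\<lambda>\<xi>. \<xi> * g \<xi>) n))\<^sup>2)"
  shows "\<exists>C\<ge>0. \<forall>p. cmod (Gamma_integral \<eta> a (a + \<alpha>) b (b - \<alpha>) (\<lambda>\<zeta>. cnj (exterior_harmonic_ext (\<lambda>\<xi>. \<xi> * g \<xi>) \<zeta>) * poly p \<zeta>)
      - \<i> * (\<integral>\<zeta>. poly p \<zeta> * cnj (g \<zeta>) \<partial>circle_measure)) \<le> C * bergman p"
proof -
  define h where "h = (\<lambda>\<xi>. \<xi> * g \<xi>)"
  have [measurable]: "g \<in> borel_measurable borel"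
    using L2_measurable[OF g] by (simp cong: measurable_cong_sets)
  have h: "h \<in> L2_space circle_measure"
    unfolding h_def by (rule L2_bounded_mult(1)[where B=1, OF g]) (use AE_circle_norm in auto)
  obtain C where C: "0 \<le> C" "\<And>p. cmod (cross h p 1) \<le> C * bergman p"
    using cross_1_bound[OF h] by auto
  let ?D = "sqrt (pi * (\<Sum>n. real n * (cmod (ext_hol h n))\<^sup>2))"
  have "cmod (Gamma_integral \<eta> a (a + \<alpha>) b (b - \<alpha>) (\<lambda>\<zeta>. cnj (exterior_harmonic_ext h \<zeta>) * poly p \<zeta>)
      - \<i> * (\<integral>\<zeta>. poly p \<zeta> * cnj (g \<zeta>) \<partial>circle_measure)) \<le> (C + 2 * ?D) * bergman p" for p
  proof -
    let ?G1 = "Gamma_path \<eta> a (a + \<alpha>)" and ?G2 = "Gamma_path \<eta> b (b - \<alpha>)"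
    define q1 where "q1 s = cnj (exterior_harmonic_ext h (?G1 s)) * poly p (?G1 s) * (cis a * d)" for s
    define q2 where "q2 s = cnj (exterior_harmonic_ext h (?G2 s)) * poly p (?G2 s) * (cis b * cnj d)" for s
    have i1: "q1 integrable_on {0..1}" unfolding q1_def[abs_def]
      by (rule Gamma_function_integrable[OF h d_pos(1,3) Gamma_path_1])
    have i2: "q2 integrable_on {0..1}" unfolding q2_def[abs_def]
      by (rule Gamma_function_integrable[OF h _ _ Gamma_path_2]) (use d_pos in auto)
    have G: "Gamma_integral \<eta> a (a + \<alpha>) b (b - \<alpha>) (\<lambda>\<zeta>. cnj (exterior_harmonic_ext h \<zeta>) * poly p \<zeta>)
        = integral {0..1} q1 - integral {0..1} q2"
    proof -
      have v1: "vector_derivative ?G1 (at s) = cis a * d" for s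
        unfolding Gamma_path_1[abs_def] by (rule vector_derivative_at) (auto intro!: derivative_eq_intros)
      have v2: "vector_derivative ?G2 (at s) = cis b * cnj d" for s
        unfolding Gamma_path_2[abs_def] by (rule vector_derivative_at) (auto intro!: derivative_eq_intros)
      show ?thesis unfolding Gamma_integral_def contour_integral_integral v1 v2 q1_def q2_def ..
    qed
    have b1: "bdry h p (W1 s) * L' s = q1 s" and b2: "bdry h p (W2 s) * cnj (L' s) = q2 s" if "0 \<le> s" for s
    proof -
      note nz = base_nonzero(2)[OF that]
      have nz': "1 + of_real s * cnj d \<noteq> 0"
      proof
        assume "1 + of_real s * cnj d = 0"
        then have "cnj (1 + of_real s * d) = 0" by simp
        with nz show False by (simp only: complex_cnj_zero_iff)
      qed
      have "exp (W1 s) * L' s = cis a * d"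
        unfolding exp_W(1)[OF that] Gamma_path_1 L'_def using nz by simp
      then show "bdry h p (W1 s) * L' s = q1 s"
        unfolding bdry_def log_poly_def q1_def exp_W(1)[OF that, symmetric] by (simp only: mult.assoc)
      have "exp (W2 s) * cnj (L' s) = cis b * cnj d"
        unfolding exp_W(2)[OF that] Gamma_path_2 L'_def using nz' by simp
      then show "bdry h p (W2 s) * cnj (L' s) = q2 s"
        unfolding bdry_def log_poly_def q2_def exp_W(2)[OF that, symmetric] by (simp only: mult.assoc)
    qed
    \<comment> \<open>\<open>Suc (Suc k)\<close> keeps \<open>s k\<close> strictly below 1, as
      \<open>Green_bound\<close> requires.\<close>
    define s where "s k = inverse (real (Suc (Suc k)))" for k
    have s: "0 < s k" "s k < 1" for k by (auto simp: s_def inverse_less_1_iff)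
    have s0: "s \<longlonglongrightarrow> 0" unfolding s_def using LIMSEQ_Suc[OF LIMSEQ_inverse_real_of_nat] .
    have bd: "cmod (integral {s k..1} q1 - integral {s k..1} q2 - cross h p (s k)) \<le> (C + 2 * ?D) * bergman p" for k
    proof -
      have e: "integral {s k..1} (\<lambda>s. bdry h p (W1 s) * L' s) = integral {s k..1} q1"
        "integral {s k..1} (\<lambda>s. bdry h p (W2 s) * cnj (L' s)) = integral {s k..1} q2"
        using s[of k] by (auto intro!: integral_cong b1 b2)
      have "q1 integrable_on {s k..1}" "q2 integrable_on {s k..1}"
        using s[of k] by (auto intro: integrable_on_subinterval[OF i1] integrable_on_subinterval[OF i2])
      then have ii: "(\<lambda>s. bdry h p (W1 s) * L' s) integrable_on {s k..1}" "(\<lambda>s. bdry h p (W2 s) * cnj (L' s)) integrable_on {s k..1}"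
        using s[of k] by (auto simp: b1 intro: integrable_eq) (auto simp: b2 intro: integrable_eq)
      show ?thesis
        using Green_bound[OF h sm[folded h_def] s ii] C(2)[of p] unfolding e by (simp add: algebra_simps)
    qed
    have lim: "(\<lambda>k. integral {s k..1} q) \<longlonglongrightarrow> integral {0..1} q" if "q integrable_on {0..1}" for q :: "real \<Rightarrow> complex"
      using continuous_on_tendsto_compose[OF indefinite_integral_continuous_1'[OF that] s0] s by (auto simp: less_imp_le)
    have "(\<lambda>k. integral {s k..1} q1 - integral {s k..1} q2 - cross h p (s k))
        \<longlonglongrightarrow> integral {0..1} q1 - integral {0..1} q2 - \<i> * (\<integral>\<zeta>. poly p \<zeta> * cnj (g \<zeta>) \<partial>circle_measure)"
      using cross_tendsto[OF g van s(1) less_imp_le[OF s(2)] s0, of p, folded h_def]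
      by (intro tendsto_diff lim i1 i2)
    from tendsto_norm[OF this] show ?thesis
      unfolding G by (rule LIMSEQ_le_const2) (use bd in auto)
  qed
  moreover have "0 \<le> C + 2 * ?D" using C(1) suminf_nonneg[OF sm[folded h_def]] by simp
  ultimately show ?thesis unfolding h_def by blast
qed

end


section \<open>Necessity\<close>

text \<open>Bessel's inequality at almost every time, integrated over time; the bound is uniform in
  the finite set of frequencies.\<close>

lemma coeff_sections_L2:
  assumes v: "v \<in> L2_space (time_measure T \<Otimes>\<^sub>M circle_measure)"
  shows "(\<lambda>s. fourier_coeff (\<lambda>\<xi>. v (s, \<xi>)) n) \<in> L2_space (time_measure T)"
    and "finite A \<Longrightarrow> (\<Sum>n\<in>A. normsq (time_measure T) (\<lambda>s. fourier_coeff (\<lambda>\<xi>. v (s, \<xi>)) n))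
      \<le> normsq (time_measure T \<Otimes>\<^sub>M circle_measure) v / (2 * pi)"
proof -
  let ?N = "normsq (time_measure T \<Otimes>\<^sub>M circle_measure) v"
  let ?c = "\<lambda>n s. fourier_coeff (\<lambda>\<xi>. v (s, \<xi>)) n"
  have [measurable]: "v \<in> borel_measurable (time_measure T \<Otimes>\<^sub>M circle_measure)"
    using v by (rule L2_measurable)
  have B: "(\<integral>\<^sup>+s. (\<Sum>n\<in>A. ennreal ((cmod (?c n s))\<^sup>2)) \<partial>time_measure T) \<le> ennreal (?N / (2 * pi))"
    if A: "finite A" for A
  proof -
    have "(\<integral>\<^sup>+s. (\<Sum>n\<in>A. ennreal ((cmod (?c n s))\<^sup>2)) \<partial>time_measure T)
        \<le> (\<integral>\<^sup>+s. ennreal (1 / (2 * pi)) * ennreal (normsq circle_measure (\<lambda>\<xi>. v (s, \<xi>))) \<partial>time_measure T)"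
    proof (rule nn_integral_mono_AE)
      show "AE s in time_measure T. (\<Sum>n\<in>A. ennreal ((cmod (?c n s))\<^sup>2))
          \<le> ennreal (1 / (2 * pi)) * ennreal (normsq circle_measure (\<lambda>\<xi>. v (s, \<xi>)))"
        using L2_sections(1)[OF v]
      proof eventually_elim
        case (elim s)
        have "(\<Sum>n\<in>A. (cmod (?c n s))\<^sup>2) \<le> 1 / (2 * pi) * normsq circle_measure (\<lambda>\<xi>. v (s, \<xi>))"
          using Bessel[OF elim A] by (simp add: field_simps)
        then show ?case by (simp add: ennreal_mult[symmetric] ennreal_leI del: times_divide_eq_left)
      qed
    qed
    also have "\<dots> = ennreal (1 / (2 * pi)) * (\<integral>\<^sup>+s. ennreal (normsq circle_measure (\<lambda>\<xi>. v (s, \<xi>))) \<partial>time_measure T)"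
      unfolding normsq_def by (rule nn_integral_cmult) measurable
    also have "\<dots> = ennreal (?N / (2 * pi))"
      unfolding L2_sections(2)[OF v] by (simp add: ennreal_mult[symmetric])
    finally show ?thesis .
  qed
  show L: "?c n \<in> L2_space (time_measure T)" for n
  proof (rule L2_spaceI)
    show "integrable (time_measure T) (\<lambda>s. (cmod (?c n s))\<^sup>2)"
    proof (rule integrableI_bounded)
      have "(\<integral>\<^sup>+s. ennreal (norm ((cmod (?c n s))\<^sup>2)) \<partial>time_measure T) \<le> ennreal (?N / (2 * pi))"
        using B[of "{n}"] by simp
      also have "\<dots> < \<infinity>" by simp
      finally show "(\<integral>\<^sup>+s. ennreal (norm ((cmod (?c n s))\<^sup>2)) \<partial>time_measure T) < \<infinity>" .
    qed measurable
  qed measurable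
  show "(\<Sum>n\<in>A. normsq (time_measure T) (?c n)) \<le> ?N / (2 * pi)" if A: "finite A"
  proof -
    have "ennreal (\<Sum>n\<in>A. normsq (time_measure T) (?c n)) = (\<Sum>n\<in>A. ennreal (normsq (time_measure T) (?c n)))"
      by simp
    also have "\<dots> = (\<Sum>n\<in>A. \<integral>\<^sup>+s. ennreal ((cmod (?c n s))\<^sup>2) \<partial>time_measure T)"
      unfolding L2_nn_integral[OF L] ..
    also have "\<dots> = (\<integral>\<^sup>+s. (\<Sum>n\<in>A. ennreal ((cmod (?c n s))\<^sup>2)) \<partial>time_measure T)"
      by (rule nn_integral_sum[symmetric]) measurable
    also note B[OF A]
    finally show ?thesis by (simp add: ennreal_le_iff)
  qed
qed

text \<open>The k-th moment is 2 \<pi> times the time integral of exp (- k s) against the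
  coefficient of index -k. By Cauchy-Schwarz its square carries the squared norm of the exponential,
  at most 1 / (2 k), which pays for the weight k; \<open>coeff_sections_L2\<close> sums the
  rest.\<close>

lemma negative_moments_bound:
  assumes v: "v \<in> L2_space (time_measure T \<Otimes>\<^sub>M circle_measure)" and A: "finite A"
  shows "(\<Sum>k\<in>A. real k * (cmod (\<integral>x. v x * (complex_of_real (exp (- fst x)) * snd x) ^ k \<partial>(time_measure T \<Otimes>\<^sub>M circle_measure)))\<^sup>2)
    \<le> pi * normsq (time_measure T \<Otimes>\<^sub>M circle_measure) v"
proof -
  let ?M = "time_measure T \<Otimes>\<^sub>M circle_measure"
  let ?c = "\<lambda>n s. fourier_coeff (\<lambda>\<xi>. v (s, \<xi>)) n"
  let ?I = "\<lambda>k. \<integral>x. v x * (complex_of_real (exp (- fst x)) * snd x) ^ k \<partial>?M"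
  have [measurable]: "v \<in> borel_measurable ?M" using v by (rule L2_measurable)
  have vi: "integrable ?M v" by (rule L2_integrable[OF finite_time_circle v])
  have em [measurable]: "(\<lambda>x. complex_of_real (exp (- fst x)) * snd x) \<in> borel_measurable ?M"
  proof -
    have "(\<lambda>s. complex_of_real (exp (- s))) \<in> borel_measurable (time_measure T)"
      by (rule measurable_restrict_space1) measurable
    from measurable_compose[OF measurable_fst this]
    show ?thesis by (rule borel_measurable_times) measurable
  qed
  have term_bound: "real k * (cmod (?I k))\<^sup>2 \<le> 2 * pi\<^sup>2 * normsq (time_measure T) (?c (- int k))" for k
  proof (cases "k = 0")
    case False
    let ?e = "\<lambda>s. complex_of_real (exp (- (real k * s)))"
    have [measurable]: "?e \<in> borel_measurable (time_measure T)" by (rule measurable_restrict_space1) measurable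
    have ne: "(\<integral>\<^sup>+s. ennreal ((cmod (?e s))\<^sup>2) \<partial>time_measure T) \<le> ennreal (1 / (2 * real k))"
    proof -
      have "(\<integral>\<^sup>+s. ennreal ((cmod (?e s))\<^sup>2) \<partial>time_measure T)
          = (\<integral>\<^sup>+s. ennreal (exp (- (2 * real k * s))) * indicator {0..T} s \<partial>lborel)"
        by (subst nn_integral_restrict_space) (auto simp: mult.assoc simp flip: exp_double)
      also have "\<dots> \<le> ennreal (1 / (2 * real k))" using False by (intro nn_integral_exp_decay) auto
      finally show ?thesis .
    qed
    have eL: "?e \<in> L2_space (time_measure T)"
    proof (intro L2_spaceI integrableI_bounded)
      show "(\<integral>\<^sup>+s. ennreal (norm ((cmod (?e s))\<^sup>2)) \<partial>time_measure T) < \<infinity>"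
        using le_less_trans[OF ne ennreal_less_top] by simp
    qed measurable
    have en: "normsq (time_measure T) ?e \<le> 1 / (2 * real k)"
      using ne unfolding L2_nn_integral[OF eL] by (simp add: ennreal_le_iff)
    have i: "integrable ?M (\<lambda>x. v x * (complex_of_real (exp (- fst x)) * snd x) ^ k)"
    proof (rule Bochner_Integration.integrable_bound[OF vi])
      have "AE x in ?M. x \<in> space ?M" by (rule AE_space)
      with AE_time_circle_norm show "AE x in ?M. norm (v x * (complex_of_real (exp (- fst x)) * snd x) ^ k) \<le> norm (v x)"
      proof eventually_elim
        case (elim x)
        then have "cmod ((complex_of_real (exp (- fst x)) * snd x) ^ k) \<le> 1"
          by (auto simp: norm_mult norm_power intro!: power_le_one)
        then show ?case by (simp add: norm_mult mult_left_le)
      qed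
    qed measurable
    have "?I k = (\<integral>s. (\<integral>\<xi>. v (s, \<xi>) * (complex_of_real (exp (- fst (s, \<xi>))) * snd (s, \<xi>)) ^ k \<partial>circle_measure) \<partial>time_measure T)"
      by (rule tc.integral_fst'[OF i, symmetric])
    also have "\<dots> = (\<integral>s. complex_of_real (2 * pi) * (?e s * ?c (- int k) s) \<partial>time_measure T)"
    proof (rule Bochner_Integration.integral_cong[OF refl])
      fix s
      have "(\<integral>\<xi>. v (s, \<xi>) * (complex_of_real (exp (- fst (s, \<xi>))) * snd (s, \<xi>)) ^ k \<partial>circle_measure)
          = (\<integral>\<xi>. ?e s * (v (s, \<xi>) * \<xi> powi (- (- int k))) \<partial>circle_measure)"
        by (intro Bochner_Integration.integral_cong)
          (auto simp: power_mult_distrib mult_ac simp flip: exp_of_nat_mult of_real_power)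
      also have "\<dots> = complex_of_real (2 * pi) * (?e s * ?c (- int k) s)"
        by (simp add: fourier_coeff_def)
      finally show "(\<integral>\<xi>. v (s, \<xi>) * (complex_of_real (exp (- fst (s, \<xi>))) * snd (s, \<xi>)) ^ k \<partial>circle_measure)
          = complex_of_real (2 * pi) * (?e s * ?c (- int k) s)" .
    qed
    finally have I: "?I k = complex_of_real (2 * pi) * (\<integral>s. ?e s * ?c (- int k) s \<partial>time_measure T)" by simp
    have "(cmod (\<integral>s. ?e s * ?c (- int k) s \<partial>time_measure T))\<^sup>2
        \<le> normsq (time_measure T) ?e * normsq (time_measure T) (?c (- int k))"
      by (rule L2_Cauchy_Schwarz[OF eL coeff_sections_L2(1)[OF v]])
    also have "\<dots> \<le> 1 / (2 * real k) * normsq (time_measure T) (?c (- int k))"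
      by (rule mult_right_mono[OF en]) simp
    finally have J: "(cmod (\<integral>s. ?e s * ?c (- int k) s \<partial>time_measure T))\<^sup>2
        \<le> 1 / (2 * real k) * normsq (time_measure T) (?c (- int k))" .
    have "(cmod (?I k))\<^sup>2 = (2 * pi)\<^sup>2 * (cmod (\<integral>s. ?e s * ?c (- int k) s \<partial>time_measure T))\<^sup>2"
      unfolding I by (simp add: norm_mult power_mult_distrib)
    also have "\<dots> \<le> (2 * pi)\<^sup>2 * (1 / (2 * real k) * normsq (time_measure T) (?c (- int k)))"
      by (rule mult_left_mono[OF J]) simp
    finally have "(cmod (?I k))\<^sup>2 \<le> (2 * pi)\<^sup>2 * (1 / (2 * real k) * normsq (time_measure T) (?c (- int k)))" .
    then have "real k * (cmod (?I k))\<^sup>2 \<le> real k * ((2 * pi)\<^sup>2 * (1 / (2 * real k) * normsq (time_measure T) (?c (- int k))))"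
      by (intro mult_left_mono) auto
    also have "\<dots> = 2 * pi\<^sup>2 * normsq (time_measure T) (?c (- int k))"
      using False by (simp add: power2_eq_square field_simps)
    finally show ?thesis .
  qed simp
  have "(\<Sum>k\<in>A. real k * (cmod (?I k))\<^sup>2) \<le> (\<Sum>k\<in>A. 2 * pi\<^sup>2 * normsq (time_measure T) (?c (- int k)))"
    by (intro sum_mono term_bound)
  also have "\<dots> = 2 * pi\<^sup>2 * (\<Sum>n\<in>(\<lambda>k. - int k) ` A. normsq (time_measure T) (?c n))"
    by (subst sum.reindex) (auto simp: inj_on_def sum_distrib_left)
  also have "\<dots> \<le> 2 * pi\<^sup>2 * (normsq ?M v / (2 * pi))"
    using A by (intro mult_left_mono coeff_sections_L2(2)[OF v]) auto
  also have "\<dots> = pi * normsq ?M v" by (simp add: power2_eq_square)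
  finally show ?thesis .
qed

text \<open>Expansion of the Cauchy kernel under the integral; \<open>cmod z * Y < 1\<close> makes
  the geometric series converge uniformly in x. It is used both at 0 and, through the poles, at
  infinity.\<close>

lemma geometric_integral_sums:
  fixes u y :: "'a \<Rightarrow> complex"
  assumes u: "integrable M u" and [measurable]: "y \<in> borel_measurable M"
    and Y: "AE x in M. cmod (y x) \<le> Y" "0 \<le> Y" and z: "cmod z * Y < 1"
  shows "(\<lambda>n. (\<integral>x. u x * y x ^ n \<partial>M) * z ^ n) sums (\<integral>x. u x / (1 - z * y x) \<partial>M)"
proof -
  have [measurable]: "u \<in> borel_measurable M" using u by (rule borel_measurable_integrable)
  have ae: "AE x in M. \<forall>n. norm (u x * (z * y x) ^ n) \<le> cmod (u x) * (cmod z * Y) ^ n"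
    using Y(1) by eventually_elim (auto simp: norm_mult norm_power intro!: mult_left_mono power_mono)
  have geo: "AE x in M. cmod (z * y x) < 1"
    using Y(1)
  proof eventually_elim
    case (elim x)
    then have "cmod z * cmod (y x) \<le> cmod z * Y" by (intro mult_left_mono) auto
    then show ?case using z by (simp add: norm_mult)
  qed
  have i: "integrable M (\<lambda>x. u x * (z * y x) ^ n)" for n
  proof (rule Bochner_Integration.integrable_bound)
    show "integrable M (\<lambda>x. (cmod z * Y) ^ n *\<^sub>R u x)" using u by simp
    show "AE x in M. norm (u x * (z * y x) ^ n) \<le> norm ((cmod z * Y) ^ n *\<^sub>R u x)"
      using ae
    proof eventually_elim
      case (elim x)
      then have "norm (u x * (z * y x) ^ n) \<le> cmod (u x) * (cmod z * Y) ^ n" by blast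
      then show ?case using Y(2) by (simp add: mult.commute)
    qed
  qed measurable
  have "(\<lambda>n. \<integral>x. u x * (z * y x) ^ n \<partial>M) sums (\<integral>x. (\<Sum>n. u x * (z * y x) ^ n) \<partial>M)"
  proof (rule sums_integral[OF i])
    show "AE x in M. summable (\<lambda>n. norm (u x * (z * y x) ^ n))"
      using geo by eventually_elim (auto simp: norm_mult[of "u _"] norm_power intro!: summable_mult summable_geometric)
    show "summable (\<lambda>n. \<integral>x. norm (u x * (z * y x) ^ n) \<partial>M)"
    proof (rule summable_comparison_test'[where N=0])
      show "summable (\<lambda>n. (\<integral>x. cmod (u x) \<partial>M) * (cmod z * Y) ^ n)"
        using z Y(2) by (intro summable_mult summable_geometric) auto
      fix n
      have "(\<integral>x. norm (u x * (z * y x) ^ n) \<partial>M) \<le> (\<integral>x. cmod (u x) * (cmod z * Y) ^ n \<partial>M)"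
      proof (rule integral_mono_AE)
        show "AE x in M. norm (u x * (z * y x) ^ n) \<le> cmod (u x) * (cmod z * Y) ^ n"
          using ae by eventually_elim blast
      qed (use i u in \<open>auto intro: integrable_norm\<close>)
      then show "norm (\<integral>x. norm (u x * (z * y x) ^ n) \<partial>M) \<le> (\<integral>x. cmod (u x) \<partial>M) * (cmod z * Y) ^ n"
        by simp
    qed
  qed
  also have "(\<integral>x. (\<Sum>n. u x * (z * y x) ^ n) \<partial>M) = (\<integral>x. u x / (1 - z * y x) \<partial>M)"
  proof (rule integral_cong_AE)
    show "AE x in M. (\<Sum>n. u x * (z * y x) ^ n) = u x / (1 - z * y x)"
      using geo by eventually_elim (simp add: suminf_mult suminf_geometric summable_geometric)
  qed measurable
  finally have "(\<lambda>n. \<integral>x. u x * (z * y x) ^ n \<partial>M) sums (\<integral>x. u x / (1 - z * y x) \<partial>M)" .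
  moreover have "(\<integral>x. u x * (z * y x) ^ n \<partial>M) = (\<integral>x. u x * y x ^ n \<partial>M) * z ^ n" for n
  proof -
    have "u x * (z * y x) ^ n = (u x * y x ^ n) * z ^ n" for x by (simp add: power_mult_distrib)
    then show ?thesis by (simp only: integral_mult_left_zero)
  qed
  ultimately show ?thesis by simp
qed

text \<open>Direct differentiation: while the denominators stay at least \<rho>, the error of the
  difference quotient under the integral is at most |u| Y^2 / \<rho>^3 times |w - z|.\<close>

lemma Cauchy_transform_holomorphic:
  fixes u y :: "'a \<Rightarrow> complex"
  assumes u: "integrable M u" and [measurable]: "y \<in> borel_measurable M"
    and Y: "AE x in M. cmod (y x) \<le> Y" "0 \<le> Y"
    and away: "\<And>z. z \<in> S \<Longrightarrow> \<exists>\<rho>>0. AE x in M. \<forall>w\<in>ball z \<rho>. \<rho> \<le> cmod (1 - w * y x)"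
  shows "(\<lambda>z. \<integral>x. u x / (1 - z * y x) \<partial>M) holomorphic_on S"
proof (rule holomorphic_onI)
  fix z assume "z \<in> S"
  from away[OF this] obtain \<rho> where \<rho>: "0 < \<rho>" and ae: "AE x in M. \<forall>w\<in>ball z \<rho>. \<rho> \<le> cmod (1 - w * y x)"
    by blast
  have [measurable]: "u \<in> borel_measurable M" using u by (rule borel_measurable_integrable)
  let ?F = "\<lambda>z. \<integral>x. u x / (1 - z * y x) \<partial>M"
  let ?D = "\<integral>x. u x * y x / (1 - z * y x)\<^sup>2 \<partial>M"
  have i: "integrable M (\<lambda>x. u x * k x)" if [measurable]: "k \<in> borel_measurable M" and k: "AE x in M. cmod (k x) \<le> B" for k B
  proof (rule Bochner_Integration.integrable_bound)
    show "integrable M (\<lambda>x. B *\<^sub>R u x)" using u by simp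
    show "AE x in M. norm (u x * k x) \<le> norm (B *\<^sub>R u x)"
      using k
    proof eventually_elim
      case (elim x)
      then have "cmod (u x) * cmod (k x) \<le> cmod (u x) * \<bar>B\<bar>" by (intro mult_left_mono) auto
      then show ?case by (simp add: norm_mult mult.commute)
    qed
  qed measurable
  define C where "C = (\<integral>x. cmod (u x) \<partial>M) * (Y\<^sup>2 / \<rho> ^ 3)"
  have est: "cmod ((?F w - ?F z) / (w - z) - ?D) \<le> C * cmod (w - z)" if w: "w \<in> ball z \<rho>" "w \<noteq> z" for w
  proof -
    have z: "z \<in> ball z \<rho>" using \<rho> by simp
    have b: "AE x in M. cmod (1 / (1 - t * y x)) \<le> 1 / \<rho>" if "t \<in> ball z \<rho>" for t
      using ae
    proof eventually_elim
      case (elim x)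
        then have "\<rho> \<le> cmod (1 - t * y x)" using that by blast
        moreover from this have "0 < cmod (1 - t * y x)" using \<rho> by linarith
        ultimately show ?case using \<rho> by (simp add: norm_divide divide_left_mono)
    qed
    have i1: "integrable M (\<lambda>x. u x / (1 - t * y x))" if "t \<in> ball z \<rho>" for t
      using i[OF _ b[OF that]] by simp
    have i2: "integrable M (\<lambda>x. u x * y x / (1 - z * y x)\<^sup>2)"
    proof -
      have "AE x in M. cmod (y x / (1 - z * y x)\<^sup>2) \<le> Y * (1 / \<rho>)\<^sup>2"
        using b[OF z] Y(1)
      proof eventually_elim
        case (elim x)
        have "cmod (y x / (1 - z * y x)\<^sup>2) = cmod (y x) * (cmod (1 / (1 - z * y x)))\<^sup>2"
          by (simp add: norm_divide norm_power power_divide)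
        also have "\<dots> \<le> Y * (1 / \<rho>)\<^sup>2" using elim Y(2) by (intro mult_mono power_mono) auto
        finally show ?case .
      qed
      from i[OF _ this] show ?thesis by simp
    qed
    have eq: "(?F w - ?F z) / (w - z) - ?D
        = (\<integral>x. (u x / (1 - w * y x) - u x / (1 - z * y x)) / (w - z) - u x * y x / (1 - z * y x)\<^sup>2 \<partial>M)"
      using i1[OF w(1)] i1[OF z] i2 by simp
    have "cmod (\<integral>x. (u x / (1 - w * y x) - u x / (1 - z * y x)) / (w - z) - u x * y x / (1 - z * y x)\<^sup>2 \<partial>M)
        \<le> (\<integral>x. cmod (u x) * (Y\<^sup>2 / \<rho> ^ 3 * cmod (w - z)) \<partial>M)"
    proof (rule order_trans[OF integral_norm_bound integral_mono_AE])
      show "integrable M (\<lambda>x. norm ((u x / (1 - w * y x) - u x / (1 - z * y x)) / (w - z) - u x * y x / (1 - z * y x)\<^sup>2))"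
        using i1[OF w(1)] i1[OF z] i2 by (intro integrable_norm) simp
      show "integrable M (\<lambda>x. cmod (u x) * (Y\<^sup>2 / \<rho> ^ 3 * cmod (w - z)))" using integrable_norm[OF u] by simp
      show "AE x in M. cmod ((u x / (1 - w * y x) - u x / (1 - z * y x)) / (w - z) - u x * y x / (1 - z * y x)\<^sup>2)
          \<le> cmod (u x) * (Y\<^sup>2 / \<rho> ^ 3 * cmod (w - z))"
        using b[OF w(1)] b[OF z] ae Y(1)
      proof eventually_elim
        case (elim x)
        have nz: "1 - w * y x \<noteq> 0" "1 - z * y x \<noteq> 0" using bspec[OF elim(3) w(1)] bspec[OF elim(3) z] \<rho> by auto
        have wz: "w - z \<noteq> 0" using w(2) by simp
        \<comment> \<open>Exact remainder of the difference quotient of the Cauchy kernel, with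
          \<open>p\<close> and \<open>q\<close> the denominators at \<open>w\<close> and at
          \<open>z\<close>.\<close>
        have id: "(u0 / p - u0 / q) / e - u0 * y0 / q\<^sup>2 = u0 * (y0\<^sup>2 * (1 / p * (1 / q) * (1 / q)) * e)"
          if "p \<noteq> 0" "q \<noteq> 0" "e \<noteq> 0" "p = q - e * y0" for u0 p q e y0 :: complex
        proof -
          have "u0 / p - u0 / q = u0 * (q - p) / (p * q)" using that(1,2) by (simp add: field_simps)
          also have "q - p = e * y0" using that(4) by simp
          finally have "(u0 / p - u0 / q) / e = u0 * y0 / (p * q)" using that(3) by (simp add: mult_ac)
          then have "(u0 / p - u0 / q) / e - u0 * y0 / q\<^sup>2 = u0 * y0 / (p * q) - u0 * y0 / q\<^sup>2" by simp
          also have "\<dots> = u0 * y0 * (q - p) / (p * q\<^sup>2)" using that(1,2) by (simp add: field_simps power2_eq_square)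
          also have "\<dots> = u0 * (y0\<^sup>2 * (1 / p * (1 / q) * (1 / q)) * e)"
            unfolding \<open>q - p = e * y0\<close> by (simp add: power2_eq_square mult_ac)
          finally show ?thesis .
        qed
        have "cmod ((u x / (1 - w * y x) - u x / (1 - z * y x)) / (w - z) - u x * y x / (1 - z * y x)\<^sup>2)
            = cmod (u x) * ((cmod (y x))\<^sup>2 * (cmod (1 / (1 - w * y x)) * cmod (1 / (1 - z * y x)) * cmod (1 / (1 - z * y x))) * cmod (w - z))"
          by (subst id[OF nz wz]) (simp_all only: norm_mult norm_power, simp add: algebra_simps)
        also have "\<dots> \<le> cmod (u x) * (Y\<^sup>2 * (1 / \<rho> * (1 / \<rho>) * (1 / \<rho>)) * cmod (w - z))"
          using elim(1,2,4) \<rho> Y(2) by (intro mult_left_mono mult_right_mono mult_mono power_mono) auto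
        also have "Y\<^sup>2 * (1 / \<rho> * (1 / \<rho>) * (1 / \<rho>)) = Y\<^sup>2 / \<rho> ^ 3" by (simp add: power3_eq_cube)
        finally show ?case .
      qed
    qed
    also have "\<dots> = C * cmod (w - z)" unfolding C_def by (simp only: integral_mult_left_zero mult.assoc)
    finally show ?thesis unfolding eq .
  qed
  have "((\<lambda>w. (?F w - ?F z) / (w - z)) \<longlongrightarrow> ?D) (at z)"
  proof (rule LIM_zero_cancel, rule Lim_null_comparison)
    show "\<forall>\<^sub>F w in at z. norm ((?F w - ?F z) / (w - z) - ?D) \<le> C * cmod (w - z)"
      using est \<rho> by (auto simp: eventually_at dist_commute intro!: exI[of _ \<rho>])
    have "((\<lambda>w. C * cmod (w - z)) \<longlongrightarrow> C * cmod (z - z)) (at z)" by (intro tendsto_intros)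
    then show "((\<lambda>w. C * cmod (w - z)) \<longlongrightarrow> 0) (at z)" by simp
  qed
  then have "(?F has_field_derivative ?D) (at z)" by (simp add: has_field_derivative_iff)
  then show "?F field_differentiable at z within S"
    unfolding field_differentiable_def by (blast intro: has_field_derivative_at_within)
qed


lemma pow_sum_split:
  assumes "summable (\<lambda>n. c n * w ^ n)"
  shows "pow_sum c w = c 0 + w * (\<Sum>n. c (Suc n) * w ^ n)"
    and "pow_sum (\<lambda>n. if n = 0 then 0 else c n) w = pow_sum c w - c 0"
proof -
  have s: "summable (\<lambda>n. c (Suc n) * w ^ Suc n)" using summable_ignore_initial_segment[OF assms, of 1] by simp
  have "pow_sum c w = c 0 + (\<Sum>n. c (Suc n) * w ^ Suc n)"
    using suminf_split_head[OF assms] by (simp add: pow_sum_def)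
  moreover have "(\<Sum>n. c (Suc n) * w ^ Suc n) = w * (\<Sum>n. c (Suc n) * w ^ n)"
  proof (cases "w = 0")
    case False
    have "summable (\<lambda>n. c (Suc n) * w ^ n)"
      using summable_mult[OF s, of "inverse w"] False by (simp add: field_simps)
    from suminf_mult[OF this, of w] show ?thesis by (simp add: mult_ac)
  qed simp
  ultimately show 1: "pow_sum c w = c 0 + w * (\<Sum>n. c (Suc n) * w ^ n)" by simp
  have s2: "summable (\<lambda>n. (if n = 0 then 0 else c n) * w ^ n)"
    by (subst summable_Suc_iff[symmetric]) (use s in simp)
  show "pow_sum (\<lambda>n. if n = 0 then 0 else c n) w = pow_sum c w - c 0"
    using suminf_split_head[OF s2] suminf_split_head[OF assms] by (simp add: pow_sum_def)
qed

text \<open>The density \<open>g\<close> is the jump across the circle of the Cauchy transform of the control, carried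
  by the region \<open>e\<^sup>-\<^sup>s \<xi>\<close>, \<open>0 < s < T\<close>, \<open>\<xi> \<in> \<omega>\<close>. The transform is holomorphic across the rest of the
  circle, hence has no jump there.\<close>

theorem null_controllable_imp_density:
  assumes f: "f \<in> hardy_H2" and T: "0 < T" and \<omega>: "\<omega> \<in> sets borel" "\<omega> \<subseteq> sphere 0 1"
    and nc: "f \<in> null_controllable_H2 \<omega> T"
  shows "\<exists>g \<in> L2_space circle_measure.
    (\<forall>n\<ge>0. fourier_coeff g n = fourier_coeff f n) \<and>
    (AE \<zeta> in circle_measure. \<zeta> \<notin> closure \<omega> \<longrightarrow> g \<zeta> = 0) \<and>
    (\<lambda>n. \<bar>real_of_int n\<bar> * (cmod (fourier_coeff g n))\<^sup>2) summable_on {..<0}"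
proof -
  let ?M = "control_measure \<omega> T" and ?N = "time_measure T \<Otimes>\<^sub>M circle_measure"
  obtain u where u: "u \<in> L2_space ?M" and mom: "\<And>n. complex_of_real (2 * pi) * fourier_coeff f (int n) =
      - (\<integral>x. u x * cnj ((complex_of_real (exp (fst x)) * snd x) ^ n) \<partial>?M)"
    using nc unfolding null_controllable_iff_moments[OF f T \<omega>(1)] by blast
  have ui: "integrable ?M u" by (rule L2_integrable[OF finite_control_measure[OF \<omega>(1)] u])
  have [measurable]: "u \<in> borel_measurable ?M" using u by (rule L2_measurable)
  \<comment> \<open>The kernel 1 / (1 - z y) has its pole at z = \<open>q x\<close>, the reflection
    of \<open>exp_coord x\<close> in the unit circle.\<close>
  define y where "y x = cnj (exp_coord x)" for x
  define q where "q x = complex_of_real (exp (- fst x)) * snd x" for x :: "real \<times> complex"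
  have [measurable]: "y \<in> borel_measurable ?M"
    unfolding y_def by (rule borel_measurable_cnj[OF exp_coord_measurable[OF \<omega>(1)]])
  have [measurable]: "q \<in> borel_measurable ?M"
  proof -
    have 1: "(\<lambda>s. complex_of_real (exp (- s))) \<in> borel_measurable (time_measure T)"
      by (rule measurable_restrict_space1) measurable
    have 2: "(\<lambda>\<xi>. \<xi>) \<in> borel_measurable (restrict_space circle_measure \<omega>)"
      by (rule measurable_restrict_space1) measurable
    show ?thesis unfolding q_def[abs_def]
      by (rule borel_measurable_times[OF measurable_compose[OF measurable_fst 1] measurable_compose[OF measurable_snd 2]])
  qed
  have ae: "AE x in ?M. cmod (y x) \<le> exp T \<and> 1 \<le> cmod (y x) \<and> cmod (q x) \<le> 1 \<and> q x * y x = 1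
      \<and> exp (- fst x) \<in> {exp (- T)..1} \<and> snd x \<in> \<omega>"
    using AE_control[OF \<omega>(1), of T]
  proof eventually_elim
    case (elim x)
    have "snd x * cnj (snd x) = 1" using elim complex_norm_square[of "snd x"] by simp
    moreover have "q x * y x = complex_of_real (exp (- fst x) * exp (fst x)) * (snd x * cnj (snd x))"
      by (simp add: q_def y_def exp_coord_def)
    ultimately have "q x * y x = 1" by (simp flip: exp_add)
    then show ?case using elim by (simp add: y_def q_def exp_coord_def norm_mult)
  qed
  \<comment> \<open>Normalises the conjugated moment equations: with this constant, the expansion of
    \<open>F\<close> at 0 has exactly the Fourier coefficients of \<open>f\<close>.\<close>
  define \<kappa> where "\<kappa> = - complex_of_real (1 / (2 * pi))"
  define c where "c n = fourier_coeff f (int n)" for n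
  \<comment> \<open>Coefficients of the same transform at infinity; those with n > 0 become the
    negative coefficients of \<open>g\<close>.\<close>
  define e where "e n = \<kappa> * (\<integral>x. u x * q x ^ n \<partial>?M)" for n
  define F where "F z = \<kappa> * (\<integral>x. u x / (1 - z * y x) \<partial>?M)" for z
  have cy: "c n = \<kappa> * (\<integral>x. u x * y x ^ n \<partial>?M)" for n
    using mom[of n] by (simp add: c_def \<kappa>_def y_def exp_coord_def field_simps)
  have e0: "e 0 = c 0" by (simp add: cy e_def)
  have cB: "cmod (c n) \<le> sqrt (normsq circle_measure f)" for n
    unfolding c_def by (rule fourier_coeff_bound[OF hardy_coeff(1)[OF f]])
  \<comment> \<open>The expansion at 0 converges below exp (- T), the smallest possible modulus of a
    pole; \<open>Fc\<close> carries the identity further by continuation.\<close>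
  have F_in: "F z = pow_sum c z" if z: "cmod z < exp (- T)" for z
  proof -
    have "cmod z * exp T < exp (- T) * exp T" using z by (intro mult_strict_right_mono) auto
    then have "cmod z * exp T < 1" by (simp flip: exp_add)
    then have "(\<lambda>n. (\<integral>x. u x * y x ^ n \<partial>?M) * z ^ n) sums (\<integral>x. u x / (1 - z * y x) \<partial>?M)"
      using ae by (intro geometric_integral_sums[where Y="exp T"] ui) auto
    from sums_mult[OF this, of \<kappa>] show ?thesis
      by (simp add: F_def pow_sum_def cy sums_iff mult.assoc)
  qed
  have eB: "cmod (e n) \<le> cmod \<kappa> * (\<integral>x. cmod (u x) \<partial>?M)" for n
  proof -
    have qn: "AE x in ?M. cmod (u x * q x ^ n) \<le> cmod (u x)"
      using ae
    proof eventually_elim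
      case (elim x)
      then have "cmod (q x ^ n) \<le> 1" by (simp add: norm_power power_le_one)
      then show ?case by (simp add: norm_mult mult_left_le)
    qed
    have i: "integrable ?M (\<lambda>x. u x * q x ^ n)"
      by (rule Bochner_Integration.integrable_bound[OF ui _ qn]) measurable
    have "cmod (\<integral>x. u x * q x ^ n \<partial>?M) \<le> (\<integral>x. cmod (u x) \<partial>?M)"
      by (rule order_trans[OF integral_norm_bound integral_mono_AE[OF integrable_norm[OF i] integrable_norm[OF ui] qn]])
    then show ?thesis unfolding e_def norm_mult by (rule mult_left_mono) simp
  qed
  have F_out: "F z = e 0 - pow_sum e (1 / z)" if z: "1 < cmod z" for z
  proof -
    have z0: "z \<noteq> 0" using z by auto
    then have lt: "cmod (1 / z) * 1 < 1" using z by (simp add: norm_divide)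
    have "AE x in ?M. cmod (u x * q x) \<le> cmod (u x)"
      using ae by eventually_elim (simp add: norm_mult mult_left_le)
    then have i: "integrable ?M (\<lambda>x. u x * q x)"
      by (intro Bochner_Integration.integrable_bound[OF ui]) measurable
    have s: "(\<lambda>n. (\<integral>x. u x * q x * q x ^ n \<partial>?M) * (1 / z) ^ n) sums (\<integral>x. u x * q x / (1 - 1 / z * q x) \<partial>?M)"
      using ae lt by (intro geometric_integral_sums[where Y=1] i) auto
    \<comment> \<open>Since q y = 1, the kernel equals - (q / z) / (1 - q / z), which has a
      geometric expansion outside the unit disk.\<close>
    have "(\<integral>x. u x / (1 - z * y x) \<partial>?M) = (\<integral>x. - (1 / z) * (u x * q x / (1 - 1 / z * q x)) \<partial>?M)"
    proof (rule integral_cong_AE)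
      show "AE x in ?M. u x / (1 - z * y x) = - (1 / z) * (u x * q x / (1 - 1 / z * q x))"
        using ae
      proof eventually_elim
        case (elim x)
        then have qy: "q x * y x = 1" and y1: "1 \<le> cmod (y x)" and q1: "cmod (q x) \<le> 1" by auto
        have "cmod (q x) < cmod z" using q1 z by linarith
        then have n1: "z - q x \<noteq> 0" by auto
        have "z * y x \<noteq> 1"
        proof
          assume "z * y x = 1"
          then have "cmod z * cmod (y x) = 1" by (metis norm_mult norm_one)
          moreover have "cmod z * 1 \<le> cmod z * cmod (y x)" using y1 by (intro mult_left_mono) auto
          ultimately show False using z by linarith
        qed
        then have n2: "1 - z * y x \<noteq> 0" by simp
        have "- (1 / z) * (u x * q x / (1 - 1 / z * q x)) = - (u x * q x) / (z - q x)"
          using z0 n1 by (simp add: field_simps)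
        also have "\<dots> = u x / (1 - z * y x)"
        proof -
          have "- (u x * q x) * (1 - z * y x) = - (u x * q x) + u x * z * (q x * y x)" by (simp add: algebra_simps)
          also have "\<dots> = u x * (z - q x)" unfolding qy by (simp add: algebra_simps)
          finally show ?thesis using frac_eq_eq[OF n1 n2] by blast
        qed
        finally show ?case by simp
      qed
    qed measurable
    also have "\<dots> = - (1 / z) * (\<integral>x. u x * q x / (1 - 1 / z * q x) \<partial>?M)" by (rule integral_mult_right_zero)
    finally have "F z = - (1 / z) * (\<kappa> * (\<integral>x. u x * q x / (1 - 1 / z * q x) \<partial>?M))" by (simp add: F_def)
    also have "\<kappa> * (\<integral>x. u x * q x / (1 - 1 / z * q x) \<partial>?M) = (\<Sum>n. e (Suc n) * (1 / z) ^ n)"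
      using sums_mult[OF s, of \<kappa>] by (simp add: e_def sums_iff mult.assoc)
    also have "- (1 / z) * (\<Sum>n. e (Suc n) * (1 / z) ^ n) = e 0 - pow_sum e (1 / z)"
      using lt by (subst pow_sum_split(1)) (auto intro!: summable_norm_cancel[OF summable_pow_sum[where c=e, OF eB]])
    finally show ?thesis .
  qed
  define v where "v = zero_ext \<omega> u"
  have v: "v \<in> L2_space ?N" unfolding v_def by (rule zero_ext_L2[OF \<omega>(1) u])
  \<comment> \<open>The source of condition (iii). The zero extension brings the control to the
    whole circle, where \<open>negative_moments_bound\<close> applies.\<close>
  have eS: "(\<Sum>k\<in>A. real k * (cmod (e k))\<^sup>2) \<le> (cmod \<kappa>)\<^sup>2 * (pi * normsq ?N v)" if A: "finite A" for A
  proof -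
    have "(\<Sum>k\<in>A. real k * (cmod (e k))\<^sup>2)
        = (cmod \<kappa>)\<^sup>2 * (\<Sum>k\<in>A. real k * (cmod (\<integral>x. v x * (complex_of_real (exp (- fst x)) * snd x) ^ k \<partial>?N))\<^sup>2)"
      unfolding e_def v_def zero_ext_integral[OF \<omega>(1) u] q_def
      by (simp add: norm_mult power_mult_distrib sum_distrib_left mult_ac)
    also have "\<dots> \<le> (cmod \<kappa>)\<^sup>2 * (pi * normsq ?N v)"
      by (intro mult_left_mono negative_moments_bound[OF v A]) simp
    finally show ?thesis .
  qed
  \<comment> \<open>Coefficients of the jump of \<open>F\<close> from inside to outside: the
    expansion at 0 for n \<ge> 0, and for n < 0 the expansion at infinity, whose minus sign the
    subtraction removes.\<close>
  define \<gamma> where "\<gamma> n = (if 0 \<le> n then fourier_coeff f n else e (nat (- n)))" for n :: int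
  have sneg: "(\<lambda>n. \<bar>real_of_int n\<bar> * (cmod (\<gamma> n))\<^sup>2) summable_on {..<0}"
  proof (rule nonneg_bdd_above_summable_on)
    show "bdd_above (sum (\<lambda>n. \<bar>real_of_int n\<bar> * (cmod (\<gamma> n))\<^sup>2) ` {F. F \<subseteq> {..<0} \<and> finite F})"
    proof (rule bdd_aboveI2)
      fix F :: "int set" assume F: "F \<in> {F. F \<subseteq> {..<0} \<and> finite F}"
      have "(\<Sum>n\<in>F. \<bar>real_of_int n\<bar> * (cmod (\<gamma> n))\<^sup>2) = (\<Sum>k\<in>(\<lambda>n. nat (- n)) ` F. real k * (cmod (e k))\<^sup>2)"
        using F by (subst sum.reindex) (auto simp: inj_on_def \<gamma>_def intro!: sum.cong)
      also have "\<dots> \<le> (cmod \<kappa>)\<^sup>2 * (pi * normsq ?N v)" using F by (intro eS) auto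
      finally show "(\<Sum>n\<in>F. \<bar>real_of_int n\<bar> * (cmod (\<gamma> n))\<^sup>2) \<le> (cmod \<kappa>)\<^sup>2 * (pi * normsq ?N v)" .
    qed
  qed (rule mult_nonneg_nonneg; simp)
  have "(\<lambda>n. (cmod (\<gamma> n))\<^sup>2) summable_on UNIV"
  proof -
    have "(\<lambda>n. (cmod (\<gamma> n))\<^sup>2) summable_on {..<0}"
    proof (rule summable_on_comparison_test[OF sneg])
      fix n :: int assume "n \<in> {..<0}"
      then have "1 \<le> \<bar>real_of_int n\<bar>" by auto
      from mult_right_mono[OF this, of "(cmod (\<gamma> n))\<^sup>2"]
      show "(cmod (\<gamma> n))\<^sup>2 \<le> \<bar>real_of_int n\<bar> * (cmod (\<gamma> n))\<^sup>2" by simp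
    qed simp
    moreover have "(\<lambda>n. (cmod (\<gamma> n))\<^sup>2) summable_on {0..}"
    proof -
      have "(\<lambda>n. (cmod (fourier_coeff f n))\<^sup>2) summable_on {0..}"
        by (rule summable_on_subset_banach[OF fourier_coeff_sq_summable[OF hardy_coeff(1)[OF f]]]) simp
      then show ?thesis by (rule summable_on_cong[THEN iffD1, rotated]) (simp add: \<gamma>_def)
    qed
    ultimately have "(\<lambda>n. (cmod (\<gamma> n))\<^sup>2) summable_on ({..<0} \<union> {0..})" by (rule summable_on_Un_disjoint) auto
    moreover have "{..<0} \<union> {0..} = (UNIV :: int set)" by auto
    ultimately show ?thesis by simp
  qed
  then obtain g where g': "has_L2_fourier_series g \<gamma>" using Riesz_Fischer by blast
  then have g: "g \<in> L2_space circle_measure" by (simp add: has_L2_fourier_series_def)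
  have gc: "fourier_coeff g n = \<gamma> n" for n by (rule fourier_coeff_L2_series[OF g'])
  \<comment> \<open>A compact set containing almost all the poles \<open>q x\<close>;
    \<open>F\<close> is holomorphic off it.\<close>
  define Q where "Q = (\<lambda>(t, \<xi>). complex_of_real t * \<xi>) ` ({exp (- T)..1} \<times> closure \<omega>)"
  have cl: "closure \<omega> \<subseteq> sphere 0 1" using \<omega>(2) by (rule closure_minimal) simp
  then have "compact (closure \<omega>)" by (meson bounded_subset bounded_sphere closed_closure compact_eq_bounded_closed)
  then have "compact Q" unfolding Q_def case_prod_beta
    by (intro compact_continuous_image compact_Times continuous_intros) auto
  then have Qc: "closed Q" by (rule compact_imp_closed)
  have Q_norm: "exp (- T) \<le> cmod z \<and> cmod z \<le> 1 \<and> z / complex_of_real (cmod z) \<in> closure \<omega>" if zQ: "z \<in> Q" for z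
  proof -
    obtain t \<xi> where t: "exp (- T) \<le> t" "t \<le> 1" "\<xi> \<in> closure \<omega>" "z = complex_of_real t * \<xi>"
      using zQ unfolding Q_def by auto
    have "0 < t" using t(1) less_le_trans[OF exp_gt_zero[of "- T"]] by auto
    moreover have "cmod \<xi> = 1" using cl t(3) by auto
    ultimately show ?thesis using t by (simp add: norm_mult)
  qed
  have QI: "z \<in> Q" if "exp (- T) \<le> cmod z" "cmod z \<le> 1" "z / complex_of_real (cmod z) \<in> closure \<omega>" for z
    using that unfolding Q_def
    by (intro image_eqI[where x="(cmod z, z / complex_of_real (cmod z))"]) auto
  have Fh: "F holomorphic_on - Q"
    unfolding F_def[abs_def]
  proof (intro holomorphic_on_mult holomorphic_on_const Cauchy_transform_holomorphic[where Y="exp T"] ui)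
    fix z assume "z \<in> - Q"
    then obtain \<delta> where \<delta>: "0 < \<delta>" "ball z \<delta> \<subseteq> - Q"
      using Qc open_contains_ball[of "- Q"] by (auto simp: open_Compl)
    \<comment> \<open>From (w - q) y = - (1 - w y) and |y| \<ge> 1, the distance from
      \<open>w\<close> to the pole bounds the denominator from below. Half of \<delta> is spent on
      moving from \<open>z\<close> to \<open>w\<close>.\<close>
    show "\<exists>\<rho>>0. AE x in ?M. \<forall>w\<in>ball z \<rho>. \<rho> \<le> cmod (1 - w * y x)"
    proof (intro exI conjI)
      show "AE x in ?M. \<forall>w\<in>ball z (\<delta> / 2). \<delta> / 2 \<le> cmod (1 - w * y x)"
        using ae
      proof eventually_elim
        case * : (elim x)
        show ?case
        proof
          fix w assume w: "w \<in> ball z (\<delta> / 2)"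
          have "q x \<in> Q" unfolding Q_def q_def
            using * closure_subset[of \<omega>] by (intro image_eqI[where x="(exp (- fst x), snd x)"]) auto
          then have "q x \<notin> ball z \<delta>" using \<delta>(2) by auto
          then have "\<delta> \<le> cmod (z - q x)" by (simp add: dist_norm)
          also have "\<dots> \<le> cmod (z - w) + cmod (w - q x)" using norm_triangle_ineq[of "z - w" "w - q x"] by simp
          finally have "\<delta> / 2 \<le> cmod (w - q x)" using w by (simp add: dist_norm)
          also have "\<dots> \<le> cmod (w - q x) * cmod (y x)" using * mult_left_mono[of 1 "cmod (y x)" "cmod (w - q x)"] by simp
          also have "\<dots> = cmod (1 - w * y x)"
          proof -
            have "(w - q x) * y x = - (1 - w * y x)" using * by (simp add: left_diff_distrib)
            then show ?thesis by (metis norm_mult norm_minus_cancel)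
          qed
          finally show "\<delta> / 2 \<le> cmod (1 - w * y x)" .
        qed
      qed
    qed (use \<delta> in simp)
  qed (use ae in auto)
  \<comment> \<open>\<open>Q\<close> consists of radial segments reaching the unit circle, so the
    disk without \<open>Q\<close> is starlike about 0. The identity continues to it from the small
    disk of \<open>F_in\<close>.\<close>
  have Fc: "F z = pow_sum c z" if z: "z \<in> ball 0 1 - Q" for z
  proof -
    let ?S = "ball 0 1 - Q"
    have oS: "open ?S" using Qc by (intro open_Diff) auto
    have small: "w \<notin> Q" if "cmod w < exp (- T)" for w using Q_norm[of w] that by auto
    have "starlike ?S" unfolding starlike_def
    proof (intro bexI ballI)
      show 0: "0 \<in> ?S" using small[of 0] by simp
      fix w assume w: "w \<in> ?S"
      show "closed_segment 0 w \<subseteq> ?S"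
      proof
        fix t assume "t \<in> closed_segment 0 w"
        then obtain l where l: "0 \<le> l" "l \<le> 1" "t = complex_of_real l * w"
          by (auto simp: in_segment scaleR_conv_of_real)
        have nt: "cmod t = l * cmod w" using l by (simp add: norm_mult)
        have le: "l * cmod w \<le> cmod w" using l by (simp add: mult_left_le_one_le)
        have "t \<notin> Q"
        proof
          assume "t \<in> Q"
          then have t: "exp (- T) \<le> l * cmod w" "t / complex_of_real (cmod t) \<in> closure \<omega>"
            using Q_norm[of t] nt by auto
          have "0 < l * cmod w" using t(1) less_le_trans[OF exp_gt_zero[of "- T"]] by auto
          then have "l \<noteq> 0" by auto
          then have "t / complex_of_real (cmod t) = w / complex_of_real (cmod w)" unfolding nt using l by simp
          then have "w \<in> Q" using t le w by (intro QI) auto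
          with w show False by simp
        qed
        then show "t \<in> ?S" using nt le w by auto
      qed
    qed
    then have conn: "connected ?S" by (rule starlike_imp_connected)
    have "pow_sum c holomorphic_on ball 0 1" by (rule pow_sum_holomorphic[where c=c, OF cB])
    then have hol: "(\<lambda>z. F z - pow_sum c z) holomorphic_on ?S"
      using holomorphic_on_diff[OF holomorphic_on_subset[OF Fh, of ?S] holomorphic_on_subset[of "pow_sum c" "ball 0 1" ?S]] by auto
    have "F z - pow_sum c z = 0"
    proof (rule analytic_continuation[OF hol oS conn])
      show "ball 0 (exp (- T)) \<subseteq> ?S" using small T by (auto simp: less_trans)
      show "0 \<in> ?S" using small[of 0] by simp
      show "(0::complex) islimpt ball 0 (exp (- T))" by (simp add: islimpt_ball)
      show "F w - pow_sum c w = 0" if "w \<in> ball 0 (exp (- T))" for w using F_in[of w] that by simp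
    qed (rule z)
    then show ?thesis by simp
  qed
  \<comment> \<open>Off the closed arc, a dilate of \<open>g\<close> is the difference of
    \<open>F\<close> at two points reflected into each other by the unit circle. The constant term
    is counted once because \<open>e 0 = c 0\<close>.\<close>
  have jump: "dilate g r \<zeta> = F (complex_of_real (exp (- r)) * \<zeta>) - F (complex_of_real (exp r) * \<zeta>)"
    if r: "0 < r" and \<zeta>: "cmod \<zeta> = 1" "\<zeta> \<notin> closure \<omega>" for r \<zeta>
  proof -
    let ?z = "complex_of_real (exp r) * \<zeta>" and ?w = "complex_of_real (exp (- r)) * \<zeta>"
    have z: "1 < cmod ?z" using r \<zeta> by (simp add: norm_mult)
    have w: "cmod ?w < 1" using r \<zeta> by (simp add: norm_mult)
    have "?w \<notin> Q"
    proof
      assume "?w \<in> Q"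
      then have "?w / complex_of_real (cmod ?w) \<in> closure \<omega>" using Q_norm by blast
      moreover have "?w / complex_of_real (cmod ?w) = \<zeta>" using \<zeta>(1) by (simp add: norm_mult)
      ultimately show False using \<zeta>(2) by simp
    qed
    then have Fw: "F ?w = pow_sum c ?w" using w by (intro Fc) auto
    have ehol: "ext_hol g = e"
    proof
      fix k show "ext_hol g k = e k" using e0 by (cases "k = 0") (auto simp: ext_hol_def gc \<gamma>_def c_def)
    qed
    have eanti: "(\<lambda>k. cnj (ext_anti g k)) = (\<lambda>k. if k = 0 then 0 else c k)"
      by (auto simp: ext_anti_def gc \<gamma>_def c_def)
    have "cnj (1 / ?z) = ?w"
    proof -
      have "\<zeta> * cnj \<zeta> = 1" using \<zeta>(1) complex_norm_square[of \<zeta>] by simp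
      moreover have "\<zeta> \<noteq> 0" using \<zeta>(1) by auto
      ultimately have "1 / cnj \<zeta> = \<zeta>" by (simp add: field_simps)
      then have "cnj (1 / ?z) = complex_of_real (1 / exp r) * \<zeta>" by (simp add: field_simps)
      then show ?thesis by (simp add: exp_minus inverse_eq_divide)
    qed
    moreover have "0 < cmod ?z" using z by linarith
    then have "cmod (1 / ?z) < 1" using z by (simp only: norm_divide norm_one divide_less_eq_1_pos)
    then have "summable (\<lambda>n. ext_anti g n * (1 / ?z) ^ n)"
      by (intro summable_norm_cancel[OF summable_pow_sum[where c="ext_anti g", OF ext_bounds(2)[OF g]]])
    ultimately have "cnj (pow_sum (ext_anti g) (1 / ?z)) = pow_sum (\<lambda>k. if k = 0 then 0 else c k) ?w"
      using pow_sum_cnj[of "ext_anti g" "1 / ?z"] by (simp only: eanti)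
    also have "\<dots> = F ?w - c 0"
      unfolding Fw by (intro pow_sum_split(2) summable_norm_cancel[OF summable_pow_sum[where c=c, OF cB w]])
    finally have "exterior_harmonic_ext g ?z = F ?w - (e 0 - pow_sum e (1 / ?z))"
      unfolding exterior_harmonic_ext_eq[OF g z] ehol e0 by simp
    then show ?thesis
      unfolding exterior_harmonic_ext_dilate[OF g r \<zeta>(1)] F_out[OF z] .
  qed
  define r where "r k = inverse (real (Suc k))" for k
  have r: "0 < r k" for k by (simp add: r_def)
  have r0: "r \<longlonglongrightarrow> 0" unfolding r_def by (rule LIMSEQ_inverse_real_of_nat)
  define h where "h = (\<lambda>\<zeta>. indicator (- closure \<omega>) \<zeta> * g \<zeta>)"
  have [measurable]: "g \<in> borel_measurable borel"
    using L2_measurable[OF g] by (simp cong: measurable_cong_sets)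
  have [measurable]: "closure \<omega> \<in> sets borel" by simp
  \<comment> \<open>Dilates of \<open>g\<close> tend to \<open>g\<close> in L2, and off the closed
    arc to 0 pointwise, because \<open>F\<close> is continuous there. Fatou for the differences
    bounds the norm of \<open>h\<close> by every B > 0 without extracting a subsequence.\<close>
  have "normsq circle_measure h \<le> 0 + B" if B: "0 < B" for B
  proof -
    let ?w = "\<lambda>k \<zeta>. indicator (- closure \<omega>) \<zeta> * (g \<zeta> - dilate g (r k) \<zeta>)"
    have dL: "(\<lambda>\<zeta>. g \<zeta> - dilate g (r k) \<zeta>) \<in> L2_space circle_measure" for k
      by (rule L2_diff(1)[OF g dilate_L2[OF g r]])
    have [measurable]: "dilate g (r k) \<in> borel_measurable borel" for k
      using L2_measurable[OF dilate_L2[OF g r]] by (simp cong: measurable_cong_sets)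
    have wL: "?w k \<in> L2_space circle_measure"
      and wn: "normsq circle_measure (?w k) \<le> 1\<^sup>2 * normsq circle_measure (\<lambda>\<zeta>. g \<zeta> - dilate g (r k) \<zeta>)" for k
      by (rule L2_bounded_mult[where B=1, OF dL]; simp add: indicator_def)+
    have "AE \<zeta> in circle_measure. (\<lambda>k. ?w k \<zeta>) \<longlonglongrightarrow> h \<zeta>"
      using AE_circle_norm
    proof eventually_elim
      case (elim \<zeta>)
      show ?case
      proof (cases "\<zeta> \<in> closure \<omega>")
        case False
        have "\<zeta> \<notin> Q" using Q_norm[of \<zeta>] elim False by auto
        then have "isCont F \<zeta>"
          using holomorphic_on_imp_continuous_on[OF Fh] Qc by (simp add: continuous_on_eq_continuous_at open_Compl)
        then have lim: "(\<lambda>k. F (t k)) \<longlonglongrightarrow> F \<zeta>" if "t \<longlonglongrightarrow> \<zeta>" for t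
          using that by (rule isCont_tendsto_compose)
        have "(\<lambda>k. complex_of_real (exp (- r k)) * \<zeta>) \<longlonglongrightarrow> complex_of_real (exp (- 0)) * \<zeta>"
          "(\<lambda>k. complex_of_real (exp (r k)) * \<zeta>) \<longlonglongrightarrow> complex_of_real (exp 0) * \<zeta>"
          by (intro tendsto_intros r0)+
        then have "(\<lambda>k. F (complex_of_real (exp (- r k)) * \<zeta>) - F (complex_of_real (exp (r k)) * \<zeta>)) \<longlonglongrightarrow> F \<zeta> - F \<zeta>"
          by (intro tendsto_diff lim) simp_all
        then have "(\<lambda>k. dilate g (r k) \<zeta>) \<longlonglongrightarrow> 0" by (simp add: jump[OF r elim False])
        then have "(\<lambda>k. ?w k \<zeta>) \<longlonglongrightarrow> indicator (- closure \<omega>) \<zeta> * (g \<zeta> - 0)" by (intro tendsto_intros)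
        then show ?thesis by (simp add: h_def)
      qed (simp add: h_def)
    qed
    moreover have "\<forall>\<^sub>F k in sequentially. ?w k \<in> L2_space circle_measure \<and> normsq circle_measure (?w k) \<le> B"
      using order_tendstoD(2)[OF dilate_tendsto[OF g r r0] B]
    proof eventually_elim
      case (elim k)
      then show ?case using wL[of k] wn[of k] by simp
    qed
    ultimately show ?thesis
      using L2_Fatou(2)[of ?w circle_measure h B] B by (simp add: h_def)
  qed
  then have "normsq circle_measure h \<le> 0" by (rule field_le_epsilon)
  moreover have "h \<in> L2_space circle_measure"
    unfolding h_def by (rule L2_bounded_mult(1)[where B=1, OF g]) (auto simp: indicator_def)
  ultimately have "AE \<zeta> in circle_measure. h \<zeta> = 0" by (intro normsq_eq_0_AE) (auto intro: antisym)
  then have "AE \<zeta> in circle_measure. \<zeta> \<notin> closure \<omega> \<longrightarrow> g \<zeta> = 0"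
    by eventually_elim (auto simp: h_def indicator_def)
  then show ?thesis
    using g sneg by (intro bexI[OF _ g]) (simp add: gc \<gamma>_def)
qed


section \<open>Proof of the characterization\<close>

text \<open>The complement of the support is covered by possibly uncountably many open sets on which
  \<open>g\<close> vanishes almost everywhere; Lindelof reduces them to countably many.\<close>

lemma AE_zero_off_ess_support: "AE \<zeta> in circle_measure. \<zeta> \<notin> ess_support g \<longrightarrow> g \<zeta> = 0"
proof -
  define \<U> where "\<U> = {U. open U \<and> (AE \<xi> in circle_measure. \<xi> \<in> U \<longrightarrow> g \<xi> = 0)}"
  obtain \<V> where \<V>: "\<V> \<subseteq> \<U>" "countable \<V>" "\<Union>\<V> = \<Union>\<U>"
    by (rule Lindelof[of \<U>]) (auto simp: \<U>_def)
  have "AE \<xi> in circle_measure. \<forall>U\<in>\<V>. \<xi> \<in> U \<longrightarrow> g \<xi> = 0"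
    using \<V>(1,2) by (subst AE_ball_countable) (auto simp: \<U>_def)
  then show ?thesis
    using AE_circle_norm
  proof eventually_elim
    case (elim \<zeta>)
    show ?case
    proof
      assume "\<zeta> \<notin> ess_support g"
      then have "\<zeta> \<in> \<Union>\<U>" using elim(2) unfolding ess_support_def \<U>_def by auto
      then show "g \<zeta> = 0" using elim(1) \<V>(3) by auto
    qed
  qed
qed

lemma open_arc_subset_sphere: "open_arc a b \<subseteq> sphere 0 1"
  by (auto simp: open_arc_def)

text \<open>The closure adds at most the two end points, which are null.\<close>

lemma AE_zero_off_open_arc:
  assumes "AE \<zeta> in circle_measure. \<zeta> \<notin> closure (open_arc a b) \<longrightarrow> g \<zeta> = 0"
  shows "AE \<zeta> in circle_measure. \<zeta> \<notin> open_arc a b \<longrightarrow> g \<zeta> = 0"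
proof -
  have "closed (cis ` {a..b})" by (intro compact_imp_closed compact_continuous_image continuous_intros) auto
  then have cl: "closure (open_arc a b) \<subseteq> cis ` {a..b}"
    unfolding open_arc_def by (intro closure_minimal image_mono) auto
  show ?thesis
    using assms AE_circle_neq[of a] AE_circle_neq[of b]
  proof eventually_elim
    case (elim \<zeta>)
    have "\<zeta> \<in> open_arc a b" if im: "\<zeta> \<in> cis ` {a..b}"
    proof -
      obtain x where x: "\<zeta> = cis x" "a \<le> x" "x \<le> b" using im by auto
      then have "x \<noteq> a" "x \<noteq> b" using elim(2,3) by auto
      with x show ?thesis by (auto simp: open_arc_def)
    qed
    then show ?case using elim(1) cl by blast
  qed
qed

text \<open>Multiplication by \<xi> shifts indices by one: \<open>ext_hol\<close> at n is the
  coefficient of \<open>g\<close> at -n-1, and the weight n is at most |-n-1|.\<close>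

lemma ext_hol_shift_summable:
  assumes g: "g \<in> L2_space circle_measure"
    and s: "(\<lambda>n. \<bar>real_of_int n\<bar> * (cmod (fourier_coeff g n))\<^sup>2) summable_on {..<0}"
  shows "summable (\<lambda>n. real n * (cmod (ext_hol (\<lambda>\<xi>. \<xi> * g \<xi>) n))\<^sup>2)"
proof -
  have bij: "bij_betw (\<lambda>n. - int n - 1) UNIV {..<0}"
    by (rule bij_betwI[where g="\<lambda>m. nat (- m - 1)"]) auto
  have "(\<lambda>n. \<bar>real_of_int (- int n - 1)\<bar> * (cmod (fourier_coeff g (- int n - 1)))\<^sup>2) summable_on UNIV"
    using s summable_on_reindex_bij_betw[OF bij, of "\<lambda>n. \<bar>real_of_int n\<bar> * (cmod (fourier_coeff g n))\<^sup>2"] by blast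
  then have s': "summable (\<lambda>n. \<bar>real_of_int (- int n - 1)\<bar> * (cmod (fourier_coeff g (- int n - 1)))\<^sup>2)"
    by (rule summable_on_imp_summable)
  have eq: "ext_hol (\<lambda>\<xi>. \<xi> * g \<xi>) n = fourier_coeff g (- int n - 1)" for n
    using fourier_coeff_shift[OF L2_measurable[OF g], of 1 "- int n"] by (simp add: ext_hol_def mult.commute)
  show ?thesis
    by (rule summable_comparison_test'[OF s', where N=0]) (auto simp: eq intro!: mult_right_mono)
qed

text \<open>The squared modulus of 1 + s d is 1 + s (2 Re d + s |d|^2), so a direction with negative
  real part would enter the disk for small s.\<close>

lemma outward_direction:
  assumes d: "d \<noteq> 0" and out: "\<And>s. 0 < s \<Longrightarrow> s \<le> 1 \<Longrightarrow> 1 < cmod (1 + of_real s * d)"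
  shows "0 \<le> Re d"
proof (rule ccontr)
  assume neg: "\<not> 0 \<le> Re d"
  \<comment> \<open>Half of the positive root of 2 Re d + s |d|^2, capped at 1; the bracket is then
    at most Re d, which is negative.\<close>
  define s where "s = min 1 (- Re d / (cmod d)\<^sup>2)"
  have d2: "0 < (cmod d)\<^sup>2" using d by simp
  have s: "0 < s" "s \<le> 1" "s \<le> - Re d / (cmod d)\<^sup>2" using neg d2 by (auto simp: s_def divide_neg_pos)
  have "s * (cmod d)\<^sup>2 \<le> - Re d" using s(3) unfolding pos_le_divide_eq[OF d2] .
  then have "s * (2 * Re d + s * (cmod d)\<^sup>2) \<le> s * Re d" using s(1) by (intro mult_left_mono) auto
  moreover have "s * Re d < 0" using s(1) neg by (simp add: mult_pos_neg)
  moreover have "(cmod (1 + of_real s * d))\<^sup>2 = 1 + s * (2 * Re d + s * (cmod d)\<^sup>2)"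
    unfolding cmod_power2 by (simp add: power2_eq_square algebra_simps)
  ultimately have "(cmod (1 + of_real s * d))\<^sup>2 < 1\<^sup>2" by simp
  then have "cmod (1 + of_real s * d) < 1" by (rule power2_less_imp_less) simp
  with out[OF s(1,2)] show False by simp
qed

text \<open>By \<open>Gamma_integral_pairing\<close> the segment integral and \<i> times the pairing
  with \<open>f\<close> differ by at most a multiple of the Bergman norm, and
  \<open>bergman_norm_control\<close> makes this norm equivalent to the one in
  \<open>null_controllable_iff_bounded\<close>. So both functionals are bounded or neither
  is.\<close>

lemma (in arc_domain) pseudo_carleson_iff_null_controllable:
  assumes f: "f \<in> hardy_H2" and g: "g \<in> L2_space circle_measure"
    and fg: "\<And>n. 0 \<le> n \<Longrightarrow> fourier_coeff g n = fourier_coeff f n"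
    and van: "AE \<zeta> in circle_measure. \<zeta> \<notin> open_arc a b \<longrightarrow> g \<zeta> = 0"
    and sm: "(\<lambda>n. \<bar>real_of_int n\<bar> * (cmod (fourier_coeff g n))\<^sup>2) summable_on {..<0}"
  shows "pseudo_carleson (Omega (open_arc a b) T)
      (\<lambda>q. Gamma_integral \<eta> a (a + \<alpha>) b (b - \<alpha>) (\<lambda>\<zeta>. cnj (exterior_harmonic_ext (\<lambda>\<xi>. \<xi> * g \<xi>) \<zeta>) * q \<zeta>))
    \<longleftrightarrow> f \<in> null_controllable_H2 (open_arc a b) T"
proof -
  have T: "0 < T" using eta by simp
  define I where "I p = Gamma_integral \<eta> a (a + \<alpha>) b (b - \<alpha>) (\<lambda>\<zeta>. cnj (exterior_harmonic_ext (\<lambda>\<xi>. \<xi> * g \<xi>) \<zeta>) * poly p \<zeta>)" for p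
  define J where "J p = (\<integral>\<zeta>. poly p \<zeta> * cnj (f \<zeta>) \<partial>circle_measure)" for p
  define N where "N p = sqrt (normsq (control_measure (open_arc a b) T) (\<lambda>x. poly p (exp_coord x)))" for p
  have Jg: "(\<integral>\<zeta>. poly p \<zeta> * cnj (g \<zeta>) \<partial>circle_measure) = J p" for p
    unfolding J_def integral_poly_cnj[OF g] integral_poly_cnj[OF hardy_coeff(1)[OF f]] by (simp add: fg)
  obtain C where C: "0 \<le> C" "\<And>p. cmod (I p - \<i> * J p) \<le> C * bergman p"
    using Gamma_integral_pairing[OF g van ext_hol_shift_summable[OF g sm]] unfolding Jg I_def by auto
  have N1: "N p \<le> bergman p" for p
    unfolding N_def using bergman_norm_control(1)[OF ab, of T p] by (intro real_le_lsqrt) auto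
  have N2: "bergman p \<le> exp T * N p" for p
  proof -
    have "(bergman p)\<^sup>2 \<le> (exp T * N p)\<^sup>2"
      using bergman_norm_control(2)[OF ab, of T p] by (simp add: N_def power_mult_distrib flip: exp_double)
    then show ?thesis by (rule power2_le_imp_le) (simp add: N_def)
  qed
  have tri: "cmod (I p) \<le> cmod (J p) + C * bergman p" "cmod (J p) \<le> cmod (I p) + C * bergman p" for p
    using C(2)[of p] norm_triangle_ineq2[of "I p" "\<i> * J p"] norm_triangle_ineq3[of "I p" "\<i> * J p"]
    by (auto simp: norm_mult)
  have "pseudo_carleson (Omega (open_arc a b) T)
      (\<lambda>q. Gamma_integral \<eta> a (a + \<alpha>) b (b - \<alpha>) (\<lambda>\<zeta>. cnj (exterior_harmonic_ext (\<lambda>\<xi>. \<xi> * g \<xi>) \<zeta>) * q \<zeta>))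
    \<longleftrightarrow> (\<exists>D>0. \<forall>p. cmod (I p) \<le> D * bergman p)"
    unfolding pseudo_carleson_def I_def ..
  also have "\<dots> \<longleftrightarrow> (\<exists>D. \<forall>p. cmod (J p) \<le> D * N p)"
  proof
    assume "\<exists>D>0. \<forall>p. cmod (I p) \<le> D * bergman p"
    then obtain D where D: "0 < D" "\<And>p. cmod (I p) \<le> D * bergman p" by auto
    have "cmod (J p) \<le> ((D + C) * exp T) * N p" for p
    proof -
      have "cmod (J p) \<le> (D + C) * bergman p" using tri(2)[of p] D(2)[of p] by (simp add: distrib_right)
      also have "\<dots> \<le> (D + C) * (exp T * N p)" using C(1) D(1) N2 by (intro mult_left_mono) auto
      finally show ?thesis by (simp add: mult.assoc)
    qed
    then show "\<exists>D. \<forall>p. cmod (J p) \<le> D * N p" by blast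
  next
    assume "\<exists>D. \<forall>p. cmod (J p) \<le> D * N p"
    then obtain D where D: "\<And>p. cmod (J p) \<le> D * N p" by auto
    have "cmod (I p) \<le> (\<bar>D\<bar> + C + 1) * bergman p" for p
    proof -
      have "D * N p \<le> \<bar>D\<bar> * N p" by (rule mult_right_mono) (auto simp: N_def)
      also have "\<dots> \<le> \<bar>D\<bar> * bergman p" using N1 by (intro mult_left_mono) auto
      finally have "D * N p \<le> \<bar>D\<bar> * bergman p" .
      moreover have "0 \<le> bergman p" by simp
      ultimately show ?thesis using tri(1)[of p] D[of p] by (simp only: distrib_right)
    qed
    then show "\<exists>D>0. \<forall>p. cmod (I p) \<le> D * bergman p" using C(1) by (intro exI[of _ "\<bar>D\<bar> + C + 1"]) auto
  qed
  also have "\<dots> \<longleftrightarrow> f \<in> null_controllable_H2 (open_arc a b) T"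
    unfolding J_def N_def by (rule null_controllable_iff_bounded[OF f T open_arc_borel, symmetric])
  finally show ?thesis .
qed

theorem theorem2p5:
  fixes a b a' b' \<eta>0 T :: real and \<omega> :: "complex set" and f0 :: "complex \<Rightarrow> complex"
  assumes "0 < b - a" and "b - a < 2 * pi" and "\<omega> = open_arc a b"
    and "0 < T" and "0 < \<eta>0" and "\<eta>0 < T"
    and "a < a'" and "a' < b'" and "b' < b" and "(a' + b') / 2 = (a + b) / 2"
    and "\<eta>0 * pi / 8 \<le> cmod (cis a' - cis a)" and "cmod (cis a' - cis a) \<le> \<eta>0 * pi / 4"
    and "\<eta>0 * pi / 8 \<le> cmod (cis b' - cis b)" and "cmod (cis b' - cis b) \<le> \<eta>0 * pi / 4"
    and "path_image (Gamma_path \<eta>0 a a') - {cis a} \<subseteq> Omega \<omega> T"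
    and "path_image (Gamma_path \<eta>0 b b') - {cis b} \<subseteq> Omega \<omega> T"
    and "f0 \<in> hardy_H2"
  shows "f0 \<in> null_controllable_H2 \<omega> T \<longleftrightarrow>
    (\<exists>g \<in> L2_space circle_measure.
      (AE \<zeta> in circle_measure. f0 \<zeta> = riesz_proj g \<zeta>) \<and>
      ess_support g \<subseteq> closure \<omega> \<and>
      (\<lambda>n::int. \<bar>real_of_int n\<bar> * (cmod (fourier_coeff g n))\<^sup>2) summable_on {..<0} \<and>
      pseudo_carleson (Omega \<omega> T)
        (\<lambda>q. Gamma_integral \<eta>0 a a' b b'
           (\<lambda>\<zeta>. cnj (exterior_harmonic_ext (\<lambda>\<xi>. \<xi> * g \<xi>) \<zeta>) * q \<zeta>)))"
proof -
  have fL: "f0 \<in> L2_space circle_measure" using assms(17) by (rule hardy_coeff(1))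
  \<comment> \<open>The common centre makes the gaps at both ends equal, so a single angle describes
    both segments.\<close>
  define \<alpha> where "\<alpha> = a' - a"
  have a': "a' = a + \<alpha>" and b': "b' = b - \<alpha>" using assms(10) by (auto simp: \<alpha>_def)
  have \<alpha>: "0 < \<alpha>" "2 * \<alpha> < b - a" using assms(7,8) a' b' by linarith+
  define d where "d = complex_of_real (exp \<eta>0) * cis \<alpha> - 1"
  have "Im d \<noteq> 0" using \<alpha> assms(2) sin_gt_zero[of \<alpha>] by (simp add: d_def)
  then have d0: "d \<noteq> 0" by auto
  \<comment> \<open>The position of the first segment inside \<open>Omega\<close> is used in this
    form: its points, rotated back, lie outside the closed disk. Through
    \<open>outward_direction\<close> this yields the sign of \<open>Re d\<close> that the locale
    asks for.\<close>
  have "1 < cmod (1 + of_real s * d)" if s: "0 < s" "s \<le> 1" for s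
  proof -
    have G: "Gamma_path \<eta>0 a a' s = cis a * (1 + of_real s * d)"
      by (simp add: Gamma_path_def linepath_def d_def a' scaleR_conv_of_real cis_mult[symmetric] algebra_simps)
    have "Gamma_path \<eta>0 a a' s \<noteq> cis a" using s d0 unfolding G by simp
    moreover have "Gamma_path \<eta>0 a a' s \<in> path_image (Gamma_path \<eta>0 a a')"
      unfolding path_image_def using s by (intro imageI) auto
    ultimately have "Gamma_path \<eta>0 a a' s \<in> Omega \<omega> T" using assms(15) by blast
    then show ?thesis unfolding G Omega_def by (simp add: norm_mult)
  qed
  then have "0 \<le> Re d" by (rule outward_direction[OF d0])
  then interpret arc_domain a b \<alpha> \<eta>0 T
    using \<alpha> assms by unfold_locales (auto simp: d_def)
  note iff = pseudo_carleson_iff_null_controllable[OF assms(17), folded a' b' assms(3)]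
  show ?thesis
  proof
    assume nc: "f0 \<in> null_controllable_H2 \<omega> T"
    have "\<omega> \<in> sets borel" "\<omega> \<subseteq> sphere 0 1"
      unfolding assms(3) by (rule open_arc_borel, rule open_arc_subset_sphere)
    from null_controllable_imp_density[OF assms(17,4) this nc]
    obtain g where g: "g \<in> L2_space circle_measure" "\<And>n. 0 \<le> n \<Longrightarrow> fourier_coeff g n = fourier_coeff f0 n"
      "AE \<zeta> in circle_measure. \<zeta> \<notin> closure \<omega> \<longrightarrow> g \<zeta> = 0"
      "(\<lambda>n. \<bar>real_of_int n\<bar> * (cmod (fourier_coeff g n))\<^sup>2) summable_on {..<0}"
      by blast
    have "AE \<zeta> in circle_measure. f0 \<zeta> - riesz_proj g \<zeta> = 0"
    proof (rule fourier_coeff_unique)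
      show "integrable circle_measure (\<lambda>\<zeta>. f0 \<zeta> - riesz_proj g \<zeta>)"
        by (rule L2_circle_integrable[OF L2_diff(1)[OF fL riesz_proj(1)[OF g(1)]]])
      show "fourier_coeff (\<lambda>\<zeta>. f0 \<zeta> - riesz_proj g \<zeta>) n = 0" for n
        using fourier_coeff_diff[OF L2_circle_integrable[OF fL] L2_circle_integrable[OF riesz_proj(1)[OF g(1)]]]
        by (simp add: riesz_proj(2)[OF g(1)] g(2) hardy_coeff(2)[OF assms(17)])
    qed
    then have "AE \<zeta> in circle_measure. f0 \<zeta> = riesz_proj g \<zeta>" by simp
    moreover have "ess_support g \<subseteq> closure \<omega>"
    proof
      fix \<zeta> assume \<zeta>: "\<zeta> \<in> ess_support g"
      show "\<zeta> \<in> closure \<omega>"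
      proof (rule ccontr)
        assume "\<zeta> \<notin> closure \<omega>"
        moreover have "open (- closure \<omega>)" by (simp add: open_Compl)
        ultimately show False using \<zeta> g(3) unfolding ess_support_def by auto
      qed
    qed
    moreover have "AE \<zeta> in circle_measure. \<zeta> \<notin> \<omega> \<longrightarrow> g \<zeta> = 0"
      using AE_zero_off_open_arc g(3) unfolding assms(3) by blast
    note iff[OF g(1,2) this g(4), THEN iffD2, OF _ nc]
    ultimately show "\<exists>g \<in> L2_space circle_measure.
      (AE \<zeta> in circle_measure. f0 \<zeta> = riesz_proj g \<zeta>) \<and>
      ess_support g \<subseteq> closure \<omega> \<and>
      (\<lambda>n::int. \<bar>real_of_int n\<bar> * (cmod (fourier_coeff g n))\<^sup>2) summable_on {..<0} \<and>
      pseudo_carleson (Omega \<omega> T)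
        (\<lambda>q. Gamma_integral \<eta>0 a a' b b'
           (\<lambda>\<zeta>. cnj (exterior_harmonic_ext (\<lambda>\<xi>. \<xi> * g \<xi>) \<zeta>) * q \<zeta>))"
      using g(1,4) by blast
  next
    assume "\<exists>g \<in> L2_space circle_measure.
      (AE \<zeta> in circle_measure. f0 \<zeta> = riesz_proj g \<zeta>) \<and>
      ess_support g \<subseteq> closure \<omega> \<and>
      (\<lambda>n::int. \<bar>real_of_int n\<bar> * (cmod (fourier_coeff g n))\<^sup>2) summable_on {..<0} \<and>
      pseudo_carleson (Omega \<omega> T)
        (\<lambda>q. Gamma_integral \<eta>0 a a' b b'
           (\<lambda>\<zeta>. cnj (exterior_harmonic_ext (\<lambda>\<xi>. \<xi> * g \<xi>) \<zeta>) * q \<zeta>))"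
    then obtain g where g: "g \<in> L2_space circle_measure"
      and fg: "AE \<zeta> in circle_measure. f0 \<zeta> = riesz_proj g \<zeta>"
      and supp: "ess_support g \<subseteq> closure \<omega>"
      and sm: "(\<lambda>n::int. \<bar>real_of_int n\<bar> * (cmod (fourier_coeff g n))\<^sup>2) summable_on {..<0}"
      and pc: "pseudo_carleson (Omega \<omega> T)
        (\<lambda>q. Gamma_integral \<eta>0 a a' b b'
           (\<lambda>\<zeta>. cnj (exterior_harmonic_ext (\<lambda>\<xi>. \<xi> * g \<xi>) \<zeta>) * q \<zeta>))"
      by blast
    have c: "fourier_coeff g n = fourier_coeff f0 n" if "0 \<le> n" for n
      using fourier_coeff_cong_AE[OF L2_measurable[OF fL] L2_measurable[OF riesz_proj(1)[OF g]] fg, of n] that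
      by (simp add: riesz_proj(2)[OF g])
    have "AE \<zeta> in circle_measure. \<zeta> \<notin> closure \<omega> \<longrightarrow> g \<zeta> = 0"
      using AE_zero_off_ess_support[of g] by eventually_elim (use supp in blast)
    then have "AE \<zeta> in circle_measure. \<zeta> \<notin> \<omega> \<longrightarrow> g \<zeta> = 0"
      unfolding assms(3) by (rule AE_zero_off_open_arc)
    from iff[OF g c this sm] pc show "f0 \<in> null_controllable_H2 \<omega> T" by blast
  qed
qed

end
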